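(* Let $p,q\ge 1$, $n=p+q$, $G=\mathrm{GL}(n,\mathbb{C})$, $\lambda\in\mathbb{R}$ and $k\in\mathbb{Z}$. Upon restriction to the symmetric subgroup $H_1=\mathrm{GL}(p,\mathbb{C})\times\mathrm{GL}(q,\mathbb{C})$ (block diagonal matrices) the unitary principal series representation $\pi_{i\lambda,k}^G$ of $G$ decomposes as $$\pi_{i\lambda,k}^G|_{H_1}\;\cong\;\bigoplus_{k'\in\mathbb{Z}}\int_{\mathbb{R}}^{\oplus}\pi_{i\lambda',k'}^{\mathrm{GL}(p,\mathbb{C})}\otimes\pi_{i(\lambda-\lambda'),k-k'}^{\mathrm{GL}(q,\mathbb{C})}\,d\lambda',$$ as a Hilbert space direct sum of direct integrals with respect to Lebesgue measure.
   Context: For $N\ge 1$ let $P_N=(\mathrm{GL}(1,\mathbb{C})\times\mathrm{GL}(N-1,\mathbb{C}))\ltimes\mathbb{C}^{N-1}$ be the standard (block upper triangular) maximal parabolic subgroup of $\mathrm{GL}(N,\mathbb{C})$ for the partition $(1,N-1)$, i.e. the stabilizer of the line $\mathbb{C}e_1$. For $t\in\mathbb{C}$, $k\in\mathbb{Z}$ let $\chi_{t,k}$ be the character of $P_N$ given by $\chi_{t,k}(\mathrm{diag}(w,g))=|w|^t(w/|w|)^k$ for $w\in\mathrm{GL}(1,\mathbb{C})$, $g\in\mathrm{GL}(N-1,\mathbb{C})$, and trivial on the nilpotent radical. Then $\pi_{t,k}^{\mathrm{GL}(N,\mathbb{C})}=\mathrm{Ind}_{P_N}^{\mathrm{GL}(N,\mathbb{C})}(\chi_{t,k})$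 is the normalized parabolically induced representation: the group acts by left translation on functions $f$ with $f(gp)=\delta(p)^{-1/2}\chi_{t,k}(p)^{-1}f(g)$ for $p\in P_N$, where $\delta(p)=|\det\mathrm{Ad}(p)|_{\mathfrak{n}}|$ ($\mathfrak n$ the Lie algebra of the nilradical, as a real vector space). For $t\in i\mathbb{R}$ it is unitary on the natural $L^2$-completion. For $N=1$ one has $P_1=\mathrm{GL}(1,\mathbb{C})$ and $\pi_{t,k}^{\mathrm{GL}(1,\mathbb{C})}$ is the character $w\mapsto|w|^t(w/|w|)^k$. $\pi\otimes\pi'$ denotes the outer tensor product representation of the product group. *)

theory Defs
  imports "HOL-Analysis.Analysis" "HOL-Library.Poly_Mapping"
begin

section \<open>Hilbert spaces with explicit carrier\<close>

text \<open>
  Hilbert spaces are represented as setoids: a complex vector space \<open>vecs H\<close> with explicit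
  operations and a positive semidefinite Hermitian form \<open>vinner H\<close>, conjugate linear in the first
  argument. Vectors at distance 0 are identified (\<open>veq\<close>), exactly as square-integrable functions
  are identified when they agree almost everywhere. The Hilbert space proper is the quotient of
  \<open>vecs H\<close> by \<open>veq H\<close>.
\<close>

record 'v ip_space =
  vecs :: "'v set"
  vzero :: 'v
  vadd :: "'v \<Rightarrow> 'v \<Rightarrow> 'v"
  vscale :: "complex \<Rightarrow> 'v \<Rightarrow> 'v"
  vinner :: "'v \<Rightarrow> 'v \<Rightarrow> complex"

definition vnorm :: "'v ip_space \<Rightarrow> 'v \<Rightarrow> real" where
  "vnorm H x = sqrt (Re (vinner H x x))"

definition vdist :: "'v ip_space \<Rightarrow> 'v \<Rightarrow> 'v \<Rightarrow> real" where
  "vdist H x y = vnorm H (vadd H x (vscale H (-1) y))"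

definition veq :: "'v ip_space \<Rightarrow> 'v \<Rightarrow> 'v \<Rightarrow> bool" where
  "veq H x y \<longleftrightarrow> vdist H x y = 0"

inductive_set vspan :: "'v ip_space \<Rightarrow> 'v set \<Rightarrow> 'v set"
  for H :: "'v ip_space" and S :: "'v set" where
  zero: "vzero H \<in> vspan H S"
| step: "x \<in> S \<Longrightarrow> y \<in> vspan H S \<Longrightarrow> vadd H (vscale H c x) y \<in> vspan H S"

definition vtotal :: "'v ip_space \<Rightarrow> 'v set \<Rightarrow> bool" where
  "vtotal H S \<longleftrightarrow> S \<subseteq> vecs H \<and> (\<forall>x\<in>vecs H. \<forall>\<epsilon>>0. \<exists>y\<in>vspan H S. vdist H x y < \<epsilon>)"

text \<open>Hilbert space completion, realised by Cauchy sequences.\<close>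

definition completion :: "'v ip_space \<Rightarrow> (nat \<Rightarrow> 'v) ip_space" where
  "completion H = \<lparr>
     vecs = {x. (\<forall>n. x n \<in> vecs H) \<and>
                (\<forall>\<epsilon>>0. \<exists>N. \<forall>m\<ge>N. \<forall>n\<ge>N. vdist H (x m) (x n) < \<epsilon>)},
     vzero = (\<lambda>_. vzero H),
     vadd = (\<lambda>x y n. vadd H (x n) (y n)),
     vscale = (\<lambda>c x n. vscale H c (x n)),
     vinner = (\<lambda>x y. lim (\<lambda>n. vinner H (x n) (y n))) \<rparr>"

text \<open>
  The algebraic tensor product, as the space of formal linear combinations of pairs \<open>(a, b)\<close>, which
  stand for the pure tensors, with the form
  \<open>\<langle>a \<otimes> b, c \<otimes> d\<rangle> = \<langle>a, c\<rangle> \<langle>b, d\<rangle>\<close>. The bilinearity relations between pure tensors lie in the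
  kernel of this form, so that they hold modulo \<open>veq\<close>.
\<close>

definition algebraic_tensor ::
  "'v ip_space \<Rightarrow> 'w ip_space \<Rightarrow> (('v \<times> 'w) \<Rightarrow>\<^sub>0 complex) ip_space" where
  "algebraic_tensor H K = \<lparr>
     vecs = {\<phi>. Poly_Mapping.keys \<phi> \<subseteq> vecs H \<times> vecs K},
     vzero = 0,
     vadd = (+),
     vscale = (\<lambda>c. Poly_Mapping.map ((*) c)),
     vinner = (\<lambda>\<phi> \<psi>. \<Sum>x\<in>Poly_Mapping.keys \<phi>. \<Sum>y\<in>Poly_Mapping.keys \<psi>.
       cnj (Poly_Mapping.lookup \<phi> x) * Poly_Mapping.lookup \<psi> y *
         (vinner H (fst x) (fst y) * vinner K (snd x) (snd y))) \<rparr>"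

definition hilbert_tensor ::
  "'v ip_space \<Rightarrow> 'w ip_space \<Rightarrow> (nat \<Rightarrow> (('v \<times> 'w) \<Rightarrow>\<^sub>0 complex)) ip_space" where
  "hilbert_tensor H K = completion (algebraic_tensor H K)"

definition pure_tensor :: "'v \<Rightarrow> 'w \<Rightarrow> (nat \<Rightarrow> (('v \<times> 'w) \<Rightarrow>\<^sub>0 complex))" where
  "pure_tensor a b = (\<lambda>_. Poly_Mapping.single (a, b) 1)"

definition hilbert_sum :: "'k set \<Rightarrow> ('k \<Rightarrow> 'v ip_space) \<Rightarrow> ('k \<Rightarrow> 'v) ip_space" where
  "hilbert_sum I H = \<lparr>
     vecs = {x. (\<forall>k\<in>I. x k \<in> vecs (H k)) \<and> (\<lambda>k. (vnorm (H k) (x k))\<^sup>2) summable_on I},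
     vzero = (\<lambda>k. vzero (H k)),
     vadd = (\<lambda>x y k. vadd (H k) (x k) (y k)),
     vscale = (\<lambda>c x k. vscale (H k) c (x k)),
     vinner = (\<lambda>x y. \<Sum>\<^sub>\<infinity>k\<in>I. vinner (H k) (x k) (y k)) \<rparr>"

text \<open>
  A measurable field of Hilbert spaces over \<open>M\<close>: a family \<open>H\<close> of Hilbert spaces with a set \<open>E\<close> of
  sections that have measurable mutual inner products and contain a fundamental (countable and
  fibrewise total) family. The measurable sections are those whose inner products with all members
  of \<open>E\<close> are measurable; the direct integral consists of the square-integrable ones.
\<close>

definition measurable_field ::
  "'z measure \<Rightarrow> ('z \<Rightarrow> 'v ip_space) \<Rightarrow> ('z \<Rightarrow> 'v) set \<Rightarrow> bool" where
  "measurable_field M H E \<longleftrightarrow>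
     (\<forall>e\<in>E. \<forall>z\<in>space M. e z \<in> vecs (H z)) \<and>
     (\<forall>d\<in>E. \<forall>e\<in>E. (\<lambda>z. vinner (H z) (d z) (e z)) \<in> borel_measurable M) \<and>
     (\<exists>D\<subseteq>E. countable D \<and> (\<forall>z\<in>space M. vtotal (H z) ((\<lambda>e. e z) ` D)))"

definition direct_integral ::
  "'z measure \<Rightarrow> ('z \<Rightarrow> 'v ip_space) \<Rightarrow> ('z \<Rightarrow> 'v) set \<Rightarrow> ('z \<Rightarrow> 'v) ip_space" where
  "direct_integral M H E = \<lparr>
     vecs = {s. (\<forall>z\<in>space M. s z \<in> vecs (H z)) \<and>
                (\<forall>e\<in>E. (\<lambda>z. vinner (H z) (e z) (s z)) \<in> borel_measurable M) \<and>
                integrable M (\<lambda>z. (vnorm (H z) (s z))\<^sup>2)},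
     vzero = (\<lambda>z. vzero (H z)),
     vadd = (\<lambda>s t z. vadd (H z) (s z) (t z)),
     vscale = (\<lambda>c s z. vscale (H z) c (s z)),
     vinner = (\<lambda>s t. \<integral>z. vinner (H z) (s z) (t z) \<partial>M) \<rparr>"

section \<open>Unitary representations\<close>

record ('g, 'v) rep =
  hspace :: "'v ip_space"
  act :: "'g \<Rightarrow> 'v \<Rightarrow> 'v"

definition restrict_rep :: "('h \<Rightarrow> 'g) \<Rightarrow> ('g, 'v) rep \<Rightarrow> ('h, 'v) rep" where
  "restrict_rep \<iota> R = \<lparr> hspace = hspace R, act = (\<lambda>h. act R (\<iota> h)) \<rparr>"

definition outer_tensor ::
  "('g, 'v) rep \<Rightarrow> ('h, 'w) rep \<Rightarrow> ('g \<times> 'h, nat \<Rightarrow> (('v \<times> 'w) \<Rightarrow>\<^sub>0 complex)) rep" where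
  "outer_tensor R S = \<lparr>
     hspace = hilbert_tensor (hspace R) (hspace S),
     act = (\<lambda>(g, h) x n. \<Sum>ab\<in>Poly_Mapping.keys (x n).
       Poly_Mapping.single (act R g (fst ab), act S h (snd ab)) (Poly_Mapping.lookup (x n) ab)) \<rparr>"

definition sum_rep :: "'k set \<Rightarrow> ('k \<Rightarrow> ('g, 'v) rep) \<Rightarrow> ('g, 'k \<Rightarrow> 'v) rep" where
  "sum_rep I R = \<lparr>
     hspace = hilbert_sum I (\<lambda>k. hspace (R k)),
     act = (\<lambda>g x k. act (R k) g (x k)) \<rparr>"

definition integral_rep ::
  "'z measure \<Rightarrow> ('z \<Rightarrow> ('g, 'v) rep) \<Rightarrow> ('z \<Rightarrow> 'v) set \<Rightarrow> ('g, 'z \<Rightarrow> 'v) rep" where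
  "integral_rep M R E = \<lparr>
     hspace = direct_integral M (\<lambda>z. hspace (R z)) E,
     act = (\<lambda>g s z. act (R z) g (s z)) \<rparr>"

text \<open>
  Equivalence through a unitary intertwining operator. All conditions are modulo \<open>veq\<close>; a linear
  isometry \<open>T\<close> respects \<open>veq\<close> and hence descends to the Hilbert spaces.
\<close>

definition unitarily_equivalent :: "'g set \<Rightarrow> ('g, 'v) rep \<Rightarrow> ('g, 'w) rep \<Rightarrow> bool" where
  "unitarily_equivalent G R S \<longleftrightarrow> (\<exists>T.
     (\<forall>x\<in>vecs (hspace R). T x \<in> vecs (hspace S)) \<and>
     (\<forall>x\<in>vecs (hspace R). \<forall>y\<in>vecs (hspace R).
        veq (hspace S) (T (vadd (hspace R) x y)) (vadd (hspace S) (T x) (T y))) \<and>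
     (\<forall>c. \<forall>x\<in>vecs (hspace R).
        veq (hspace S) (T (vscale (hspace R) c x)) (vscale (hspace S) c (T x))) \<and>
     (\<forall>x\<in>vecs (hspace R). \<forall>y\<in>vecs (hspace R).
        vinner (hspace S) (T x) (T y) = vinner (hspace R) x y) \<and>
     (\<forall>y\<in>vecs (hspace S). \<exists>x\<in>vecs (hspace R). veq (hspace S) (T x) y) \<and>
     (\<forall>g\<in>G. \<forall>x\<in>vecs (hspace R). veq (hspace S) (T (act R g x)) (act S g (T x))))"

section \<open>Principal series of the complex general linear group\<close>

text \<open>
  The coordinates of the \<open>N\<close>-dimensional space are indexed by a type \<open>'n\<close> with \<open>CARD('n) = N\<close>, and
  \<open>i :: 'n\<close> is the index of the first coordinate.
\<close>

definition GL :: "(complex^'n^'n) set" where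
  "GL = {A. invertible A}"

definition parabolic :: "'n \<Rightarrow> (complex^'n^'n) set" where
  "parabolic i = {A \<in> GL. \<forall>a. a \<noteq> i \<longrightarrow> A $ a $ i = 0}"

definition para_char :: "'n \<Rightarrow> complex \<Rightarrow> int \<Rightarrow> complex^'n^'n \<Rightarrow> complex" where
  "para_char i t k A =
     of_real (cmod (A $ i $ i)) powr t * (A $ i $ i / of_real (cmod (A $ i $ i))) powi k"

definition unit_mat :: "'n \<Rightarrow> 'n \<Rightarrow> complex^'n^'n" where
  "unit_mat r c = (\<chi> a b. if a = r \<and> b = c then 1 else 0)"

text \<open>
  The Lie algebra of the nilradical has the complex basis \<open>unit_mat i b\<close>, \<open>b \<noteq> i\<close>. The matrix below
  is that of \<open>Ad A\<close> in this basis, extended by the identity in position \<open>(i, i)\<close>. The absolute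
  value of the determinant over the reals is the squared modulus of the one over the complex
  numbers.
\<close>

definition para_delta :: "'n::finite \<Rightarrow> complex^'n^'n \<Rightarrow> real" where
  "para_delta i A = (cmod (det (\<chi> a b.
     if a = i \<or> b = i then (if a = b then 1 else 0)
     else (A ** unit_mat i b ** matrix_inv A) $ i $ a)))\<^sup>2"

definition opp_unipotent :: "'n \<Rightarrow> ('n \<Rightarrow> complex) \<Rightarrow> complex^'n^'n" where
  "opp_unipotent i y = (\<chi> a b. if a = b then 1 else if b = i then y a else 0)"

definition opp_measure :: "'n \<Rightarrow> ('n \<Rightarrow> complex) measure" where
  "opp_measure i = PiM (UNIV - {i}) (\<lambda>_. lborel)"

text \<open>
  The space of the normalized induced representation. For unitary \<open>para_char i t k\<close> the functions
  \<open>cnj f * f'\<close> are densities on the quotient by the parabolic subgroup, and the invariant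
  inner product integrates them over the open dense cell given by the opposite unipotent radical,
  with its Haar (Lebesgue) measure. Values of functions off \<open>GL\<close> are irrelevant.
\<close>

definition ps_space ::
  "'n::finite \<Rightarrow> complex \<Rightarrow> int \<Rightarrow> (complex^'n^'n \<Rightarrow> complex) ip_space" where
  "ps_space i t k = \<lparr>
     vecs = {f. f \<in> borel_measurable (restrict_space borel GL) \<and>
                (\<forall>g\<in>GL. \<forall>p\<in>parabolic i. f (g ** p) =
                   of_real (para_delta i p powr (-1/2)) * inverse (para_char i t k p) * f g) \<and>
                integrable (opp_measure i) (\<lambda>y. (cmod (f (opp_unipotent i y)))\<^sup>2)},
     vzero = (\<lambda>_. 0),
     vadd = (\<lambda>f f' g. f g + f' g),
     vscale = (\<lambda>c f g. c * f g),
     vinner = (\<lambda>f f'. \<integral>y. cnj (f (opp_unipotent i y)) * f' (opp_unipotent i y) \<partial>opp_measure i) \<rparr>"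

definition principal_series ::
  "'n::finite \<Rightarrow> complex \<Rightarrow> int \<Rightarrow> (complex^'n^'n, complex^'n^'n \<Rightarrow> complex) rep" where
  "principal_series i t k = \<lparr>
     hspace = ps_space i t k,
     act = (\<lambda>h f g. f (matrix_inv h ** g)) \<rparr>"

text \<open>
  Measurable structures on the fields \<open>z \<mapsto> principal_series i (t z) k\<close> (jointly measurable
  functions on parameter space times group) and on outer tensor products (pure tensors of such).
\<close>

definition ps_sections ::
  "'n::finite \<Rightarrow> (real \<Rightarrow> complex) \<Rightarrow> int \<Rightarrow> (real \<Rightarrow> complex^'n^'n \<Rightarrow> complex) set" where
  "ps_sections i t k = {e. (\<forall>z. e z \<in> vecs (ps_space i (t z) k)) \<and>
     (\<lambda>(z, g). e z g) \<in> borel_measurable (lborel \<Otimes>\<^sub>M restrict_space borel GL)}"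

definition tensor_sections ::
  "('z \<Rightarrow> 'v) set \<Rightarrow> ('z \<Rightarrow> 'w) set \<Rightarrow> ('z \<Rightarrow> (nat \<Rightarrow> (('v \<times> 'w) \<Rightarrow>\<^sub>0 complex))) set" where
  "tensor_sections E F = {\<lambda>z. pure_tensor (d z) (e z) | d e. d \<in> E \<and> e \<in> F}"

definition block_diag :: "(complex^'p^'p) \<times> (complex^'q^'q) \<Rightarrow> complex^('p + 'q)^('p + 'q)" where
  "block_diag AB = (\<chi> r c. case (r, c) of
       (Inl a, Inl b) \<Rightarrow> fst AB $ a $ b
     | (Inr a, Inr b) \<Rightarrow> snd AB $ a $ b
     | _ \<Rightarrow> 0)"

end

theory Submission imports Defs "HOL-Probability.Probability" begin

text \<open>
  Both sides carry a family of explicit vectors with the same index set, the same inner products and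
  the same behaviour under the group, and both families are total. Such families determine a unitary
  intertwining operator (\<open>unitarily_equivalentI_families\<close>).

  For a function \<open>\<Phi>\<close> on the nonzero vectors of the \<open>N\<close>-dimensional coordinate space, let
  \<open>psf i v k \<Phi> g\<close> be \<open>|det g|\<close> times the integral of \<open>\<Phi> (s x) |s|^N |s|^(\<i>v) (s/|s|)^k\<close> over the
  multiplicative group with its Haar measure, where \<open>x\<close> is the column \<open>i\<close> of \<open>g\<close>. This lies in the principal
  series with parameters \<open>v, k\<close>, and translation by \<open>h\<close> turns \<open>\<Phi>\<close> into \<open>|det h|^(-1) \<Phi> \<circ> h^(-1)\<close>
  for all parameters alike. Unfolding the integral over the open cell shows that the inner product
  of two such vectors is the Mellin transform at \<open>(k, v)\<close> of their correlation, a function on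
  the multiplicative group that does not depend on the parameters (\<open>psf_inner_psf\<close>).

  The big group receives the vectors of the products \<open>\<Phi> \<otimes> \<Psi>\<close>, and the direct integral receives the
  sections \<open>(k', v) \<mapsto> psf i v k' \<Phi> \<otimes> psf j (\<nu> - v) (k - k') \<Psi>\<close>. The correlation of products is
  the product of the correlations, and the Parseval formula on the multiplicative group
  (\<open>mellin_parseval\<close>), whose dual is the product of the integers and the line, equates the two inner
  products up to the constant \<open>4 * pi^2\<close>. Totality on the left is the
  density of product functions (\<open>psf_tbump_separate\<close>). On the right, dilating \<open>\<Phi>\<close> multiplies the
  section by the characters of the dual, and uniqueness of Fourier transforms (\<open>dual_unique\<close>)
  separates the fibres (\<open>bv_orth_total\<close>).
\<close>

abbreviation (input) tends_to (infix "-->>" 60) where "X -->> L == X \<longlonglongrightarrow> L"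

abbreviation "bmeas == borel_measurable"
abbreviation "plookup == Poly_Mapping.lookup"
abbreviation "pkeys == Poly_Mapping.keys"
abbreviation "psingle == Poly_Mapping.single"
abbreviation "gauss == std_normal_density"
abbreviation "borelGL == restrict_space borel GL"

lemmas b_integrable_add = Bochner_Integration.integrable_add
lemmas b_integrable_bound = Bochner_Integration.integrable_bound
lemmas b_integrable_cong = Bochner_Integration.integrable_cong
lemmas b_integral_add = Bochner_Integration.integral_add
lemmas b_integral_cnj = Bochner_Integration.integral_cnj
lemmas b_integral_cong = Bochner_Integration.integral_cong
lemmas b_integral_diff = Bochner_Integration.integral_diff
lemmas b_integral_norm_bound_integral = Bochner_Integration.integral_norm_bound_integral

section \<open>Pre-Hilbert spaces with explicit carrier\<close>

locale pre_hilbert =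
 fixes H :: "'v ip_space"
 assumes zero_mem [simp, intro]: "vzero H : vecs H"
  and add_mem [simp, intro]: "x : vecs H ==> y : vecs H ==> vadd H x y : vecs H"
  and scale_mem [simp, intro]: "x : vecs H ==> vscale H c x : vecs H"
  and inner_zero [simp]: "z : vecs H ==> vinner H z (vzero H) = 0"
  and inner_add [simp]: "z : vecs H ==> x : vecs H ==> y : vecs H ==>
   vinner H z (vadd H x y) = vinner H z x + vinner H z y"
  and inner_scale [simp]: "z : vecs H ==> x : vecs H ==>
   vinner H z (vscale H c x) = c * vinner H z x"
  and inner_commute: "x : vecs H ==> y : vecs H ==> vinner H y x = cnj (vinner H x y)"
  and inner_nonneg: "x : vecs H ==> 0 <= Re (vinner H x x)"
begin

abbreviation vsub where "vsub x y \<equiv> vadd H x (vscale H (-1) y)"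

lemma inner_zero_left [simp]: "z : vecs H ==> vinner H (vzero H) z = 0"
 by (subst inner_commute) auto

lemma inner_add_left [simp]: "z : vecs H ==> x : vecs H ==> y : vecs H ==>
  vinner H (vadd H x y) z = vinner H x z + vinner H y z"
 using inner_commute[of z "vadd H x y"] inner_commute[of z x] inner_commute[of z y] by simp

lemma inner_scale_left [simp]: "z : vecs H ==> x : vecs H ==>
  vinner H (vscale H c x) z = cnj c * vinner H x z"
 using inner_commute[of z "vscale H c x"] inner_commute[of z x] by simp

lemma Im_inner_self [simp]: "x : vecs H ==> Im (vinner H x x) = 0"
 using inner_commute[of x x] by (simp add: complex_eq_iff)

lemma norm_nonneg [simp]: "0 <= vnorm H x" if "x : vecs H"
 using inner_nonneg[OF that] by (simp add: vnorm_def)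

lemma norm_power2: "(vnorm H x)^2 = Re (vinner H x x)" if "x : vecs H"
 using inner_nonneg[OF that] by (simp add: vnorm_def)

lemma inner_self: "vinner H x x = of_real ((vnorm H x)^2)" if "x : vecs H"
 using that by (simp add: norm_power2 complex_eq_iff)

lemma cauchy_schwarz: "cmod (vinner H x y) <= vnorm H x * vnorm H y"
 if xy: "x : vecs H" "y : vecs H"
proof -
 define a b C where "a = Re (vinner H x x)" and "b = Re (vinner H y y)"
  and "C = (cmod (vinner H x y))^2"
 have ab: "0 <= a" "0 <= b" "0 <= C" using xy inner_nonneg by (auto simp: a_def b_def C_def)
 have ax: "vinner H x x = of_real a" "vinner H y y = of_real b"
  using xy by (auto simp: a_def b_def complex_eq_iff)
 \<comment> \<open>Positivity on the real line through x in the direction that decreases the norm fastest.\<close>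
 have quad: "0 <= a - 2 * t * C + t^2 * C * b" for t :: real
 proof -
  let ?l = "- (of_real t * cnj (vinner H x y))"
  have C: "vinner H x y * cnj (vinner H x y) = of_real C"
   by (simp add: C_def complex_norm_square[symmetric])
  have "vinner H (vadd H x (vscale H ?l y)) (vadd H x (vscale H ?l y))
   = of_real a - 2 * of_real t * (vinner H x y * cnj (vinner H x y))
   + (of_real t)^2 * (vinner H x y * cnj (vinner H x y)) * of_real b"
   using xy by (simp add: ax inner_commute[of x y] algebra_simps power2_eq_square)
  also have "... = of_real (a - 2 * t * C + t^2 * C * b)"
   unfolding C by simp
  finally show ?thesis
   using inner_nonneg[of "vadd H x (vscale H ?l y)"] xy by simp
 qed
 have "C <= a * b"
 proof (cases "C = 0")
  case False
  hence C: "C > 0" using ab by simp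
  have "b ~= 0"
  proof
   assume "b = 0"
   with quad[of "(a + 1) / (2 * C)"] C show False by (simp add: field_simps)
  qed
  with ab have b: "b > 0" by simp
  from quad[of "1 / b"] b have "0 <= a - C / b"
   by (simp add: field_simps power2_eq_square)
  with b show ?thesis by (simp add: field_simps)
 qed (use ab in auto)
 hence "sqrt C <= sqrt a * sqrt b" by (simp add: real_sqrt_mult[symmetric])
 thus ?thesis by (simp add: C_def a_def b_def vnorm_def)
qed

lemma norm_triangle: "vnorm H (vadd H x y) <= vnorm H x + vnorm H y"
 if xy: "x : vecs H" "y : vecs H"
proof -
 have "(vnorm H (vadd H x y))^2 = (vnorm H x)^2 + 2 * Re (vinner H x y) + (vnorm H y)^2"
  using xy by (simp add: norm_power2 inner_commute[of x y])
 also have "... <= (vnorm H x)^2 + 2 * (vnorm H x * vnorm H y) + (vnorm H y)^2"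
  using cauchy_schwarz[OF xy] complex_Re_le_cmod[of "vinner H x y"] by linarith
 also have "... = (vnorm H x + vnorm H y)^2" by (simp add: power2_sum)
 finally show ?thesis using xy by (meson add_nonneg_nonneg norm_nonneg power2_le_imp_le)
qed

lemma norm_cong_inner: "vnorm H x = vnorm H y"
 if xy: "x : vecs H" "y : vecs H" and eq: "!!w. w : vecs H ==> vinner H w x = vinner H w y"
proof -
 have "vinner H x x = cnj (vinner H y x)" using eq[OF xy(1)] inner_commute[of y x] xy by simp
 also have "... = vinner H y y" using eq[OF xy(2)] xy by (simp add: complex_eq_iff)
 finally show ?thesis by (simp add: vnorm_def)
qed

lemma norm_zero [simp]: "vnorm H (vzero H) = 0" by (simp add: vnorm_def)

lemma norm_scale: "vnorm H (vscale H c x) = cmod c * vnorm H x" if "x : vecs H"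
proof -
 have "vinner H (vscale H c x) (vscale H c x) = of_real ((cmod c)^2 * (vnorm H x)^2)"
 proof -
  have "vinner H (vscale H c x) (vscale H c x) = c * cnj c * vinner H x x"
   using that by simp
  thus ?thesis using inner_self[OF that] complex_norm_square[of c] by simp
 qed
 hence "(vnorm H (vscale H c x))^2 = (cmod c * vnorm H x)^2"
  unfolding norm_power2[OF scale_mem[OF that]] power_mult_distrib by (metis Re_complex_of_real)
 thus ?thesis using that by (simp add: power2_eq_iff_nonneg)
qed

lemma dist_nonneg [simp]: "0 <= vdist H x y" if "x : vecs H" "y : vecs H"
 using that by (simp add: vdist_def)

lemma dist_self [simp]: "vdist H x x = 0" if "x : vecs H"
 using that by (simp add: vdist_def vnorm_def)

lemma dist_power2: "(vdist H x y)^2 = (vnorm H x)^2 + (vnorm H y)^2 - 2 * Re (vinner H x y)"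
 if "x : vecs H" "y : vecs H"
 using that by (simp add: vdist_def norm_power2 inner_commute[of x y])

lemma dist_commute: "vdist H x y = vdist H y x" if "x : vecs H" "y : vecs H"
proof -
 have "(vdist H x y)^2 = (vdist H y x)^2"
  using that by (simp add: dist_power2 inner_commute[of x y])
 thus ?thesis using that by (simp add: power2_eq_iff_nonneg)
qed

lemma dist_triangle: "vdist H x z <= vdist H x y + vdist H y z"
 if "x : vecs H" "y : vecs H" "z : vecs H"
proof -
 have "vdist H x z = vnorm H (vadd H (vsub x y) (vsub y z))"
  unfolding vdist_def by (rule norm_cong_inner) (use that in auto)
 thus ?thesis using norm_triangle[of "vsub x y" "vsub y z"] that by (simp add: vdist_def)
qed

lemma dist_zero: "vdist H x (vzero H) = vnorm H x" if "x : vecs H"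
 unfolding vdist_def by (rule norm_cong_inner) (use that in auto)

lemma norm_le_dist: "vnorm H x <= vnorm H y + vdist H x y" if "x : vecs H" "y : vecs H"
 using dist_triangle[of x y "vzero H"] that by (simp add: dist_zero)

lemma dist_add: "vdist H (vadd H x y) (vadd H x' y') <= vdist H x x' + vdist H y y'"
 if "x : vecs H" "y : vecs H" "x' : vecs H" "y' : vecs H"
proof -
 have "vdist H (vadd H x y) (vadd H x' y') = vnorm H (vadd H (vsub x x') (vsub y y'))"
  unfolding vdist_def by (rule norm_cong_inner) (use that in "auto simp: algebra_simps")
 thus ?thesis using norm_triangle[of "vsub x x'" "vsub y y'"] that by (simp add: vdist_def)
qed

lemma dist_scale: "vdist H (vscale H c x) (vscale H c y) = cmod c * vdist H x y"
 if "x : vecs H" "y : vecs H"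
proof -
 have "vdist H (vscale H c x) (vscale H c y) = vnorm H (vscale H c (vsub x y))"
  unfolding vdist_def by (rule norm_cong_inner) (use that in "auto simp: algebra_simps")
 thus ?thesis using norm_scale[of "vsub x y"] that by (simp add: vdist_def)
qed

lemma dist_scale2: "vdist H (vscale H c x) (vscale H d x) = cmod (c - d) * vnorm H x"
 if "x : vecs H"
proof -
 have "vdist H (vscale H c x) (vscale H d x) = vnorm H (vscale H (c - d) x)"
  unfolding vdist_def by (rule norm_cong_inner) (use that in "auto simp: algebra_simps")
 thus ?thesis using norm_scale that by simp
qed

lemma inner_diff_le: "cmod (vinner H z x - vinner H z y) <= vnorm H z * vdist H x y"
 if "x : vecs H" "y : vecs H" "z : vecs H"
 using cauchy_schwarz[of z "vsub x y"] that by (simp add: vdist_def)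

lemma tendsto_inner:
 assumes "!!n. X n : vecs H" "!!n. Y n : vecs H" "x : vecs H" "y : vecs H"
  and X: "(%n::nat. vdist H (X n) x) -->> 0" and Y: "(%n. vdist H (Y n) y) -->> 0"
 shows "(%n. vinner H (X n) (Y n)) -->> vinner H x y"
proof -
 have "cmod (vinner H (X n) (Y n) - vinner H x y)
   <= (vnorm H x + vdist H (X n) x) * vdist H (Y n) y + vnorm H y * vdist H (X n) x" for n
 proof -
  have 1: "cmod (vinner H (X n) (Y n) - vinner H (X n) y) <= vnorm H (X n) * vdist H (Y n) y"
   using inner_diff_le assms by simp
  have 2: "cmod (vinner H (X n) y - vinner H x y) <= vnorm H y * vdist H (X n) x"
  proof -
   have "vinner H (X n) y - vinner H x y = cnj (vinner H y (X n) - vinner H y x)"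
   using assms by (simp add: inner_commute[of y])
   thus ?thesis using inner_diff_le[of "X n" x y] assms by (simp del: complex_cnj_diff)
  qed
  have 3: "vnorm H (X n) * vdist H (Y n) y <= (vnorm H x + vdist H (X n) x) * vdist H (Y n) y"
   using norm_le_dist[of "X n" x] assms by (intro mult_right_mono) auto
  have "cmod (vinner H (X n) (Y n) - vinner H x y)
   <= cmod (vinner H (X n) (Y n) - vinner H (X n) y) + cmod (vinner H (X n) y - vinner H x y)"
   using norm_triangle_ineq[of "vinner H (X n) (Y n) - vinner H (X n) y"
   "vinner H (X n) y - vinner H x y"] by simp
  with 1 2 3 show ?thesis by linarith
 qed
 moreover have "(%n. (vnorm H x + vdist H (X n) x) * vdist H (Y n) y + vnorm H y * vdist H (X n) x)
   -->> (vnorm H x + 0) * 0 + vnorm H y * 0"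
  by (intro tendsto_intros X Y)
 ultimately show ?thesis
  by (subst Lim_null, subst tendsto_norm_zero_iff[symmetric])
   (rule tendsto_sandwich[OF always_eventually always_eventually tendsto_const],
   auto)
qed

lemma tendsto_norm_power2:
 assumes "!!n. X n : vecs H" "x : vecs H" "(%n::nat. vdist H (X n) x) -->> 0"
 shows "(%n. (vnorm H (X n))^2) -->> (vnorm H x)^2"
 using tendsto_Re[OF tendsto_inner[OF assms(1) assms(1) assms(2) assms(2) assms(3) assms(3)]] assms
 by (simp add: norm_power2)

lemma inner_veq: "vinner H w x = vinner H w y"
 if "veq H x y" "x : vecs H" "y : vecs H" "w : vecs H"
 using inner_diff_le[of x y w] that by (simp add: veq_def)

lemma vspan_mem: "x : vspan H S ==> S \<subseteq> vecs H ==> x : vecs H"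
 by (induction rule: vspan.induct) auto

text \<open>A bounded conjugate linear functional is determined by its values on a total set.\<close>

lemma functional_zero_on_total:
 assumes tot: "vtotal H S" and x: "x : vecs H"
  and f0: "f (vzero H) = 0"
  and lin: "!!s y c. s : S ==> y : vecs H ==> f (vadd H (vscale H c s) y) = cnj c * f s + f y"
  and bd: "!!x y. x : vecs H ==> y : vecs H ==> cmod (f x - f y) <= B * vdist H x y"
  and fS: "!!s. s : S ==> f s = (0::complex)"
 shows "f x = 0"
proof (rule ccontr)
 assume ne: "f x ~= 0"
 have S: "S \<subseteq> vecs H" using tot by (simp add: vtotal_def)
 have span: "f y = 0 & y : vecs H" if "y : vspan H S" for y
  using that by induction (use f0 lin fS S in auto)
 define \<epsilon> where "\<epsilon> = cmod (f x) / (\<bar>B\<bar> + 1)"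
 have "\<epsilon> > 0" using ne by (auto simp: \<epsilon>_def intro!: divide_pos_pos)
 then obtain y where y: "y : vspan H S" "vdist H x y < \<epsilon>"
  using tot x unfolding vtotal_def by blast
 have "cmod (f x) <= B * vdist H x y" using bd[OF x, of y] span[OF y(1)] by simp
 also have "... <= (\<bar>B\<bar> + 1) * vdist H x y"
  using dist_nonneg[of x y] span[OF y(1)] x by (intro mult_right_mono) auto
 also have "... < (\<bar>B\<bar> + 1) * \<epsilon>" using y(2) by (intro mult_strict_left_mono) auto
 also have "... = cmod (f x)" by (simp add: \<epsilon>_def)
 finally show False by simp
qed

end


definition hcauchy :: "'v ip_space => (nat => 'v) => bool" where
 "hcauchy H X \<longleftrightarrow> (ALL n. X n : vecs H) &
   (\<forall>\<epsilon>>0. EX N. \<forall>m\<ge>N. \<forall>n\<ge>N. vdist H (X m) (X n) < \<epsilon>)"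

locale hilbert = pre_hilbert +
 assumes complete: "hcauchy H X ==> EX x:vecs H. (%n. vdist H (X n) x) -->> 0"

definition orth_total :: "'v ip_space => 'v set => bool" where
 "orth_total H S \<longleftrightarrow> S \<subseteq> vecs H &
   (ALL x:vecs H. (ALL s:S. vinner H s x = 0) --> vnorm H x = 0)"

context pre_hilbert
begin

lemma hcauchyI_tendsto:
 assumes "!!n. X n : vecs H" "x : vecs H" "(%n. vdist H (X n) x) -->> 0"
 shows "hcauchy H X"
 unfolding hcauchy_def
proof (intro conjI allI impI)
 fix \<epsilon> :: real assume "\<epsilon> > 0"
 hence "eventually (%n. vdist H (X n) x < \<epsilon> / 2) sequentially"
  using order_tendstoD(2)[OF assms(3), of "\<epsilon> / 2"] by simp
 then obtain N where N: "!!n. n >= N ==> vdist H (X n) x < \<epsilon> / 2"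
  by (auto simp: eventually_sequentially)
 have "vdist H (X m) (X n) < \<epsilon>" if "m >= N" "n >= N" for m n
  using dist_triangle[of "X m" x "X n"] dist_commute[of x "X n"] N[OF that(1)] N[OF that(2)] assms
  by simp
 thus "EX N. \<forall>m\<ge>N. \<forall>n\<ge>N. vdist H (X m) (X n) < \<epsilon>" by blast
qed (use assms in auto)


lemma vspan_add: "x : vspan H S ==> y : vspan H S ==> S \<subseteq> vecs H ==>
  EX z:vspan H S. ALL w:vecs H. vinner H w z = vinner H w x + vinner H w y"
proof (induction rule: vspan.induct)
 case zero thus ?case by auto
next
 case (step s x c)
 then obtain z where z: "z : vspan H S" "ALL w:vecs H. vinner H w z = vinner H w x + vinner H w y"
  by blast
 have "vadd H (vscale H c s) z : vspan H S" using step z by (intro vspan.step)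
 moreover have "ALL w:vecs H. vinner H w (vadd H (vscale H c s) z)
   = vinner H w (vadd H (vscale H c s) x) + vinner H w y"
  using step.hyps step.prems z vspan_mem[OF z(1)] vspan_mem[OF step.hyps(2)] by auto
 ultimately show ?case by blast
qed

lemma vspan_scale: "x : vspan H S ==> S \<subseteq> vecs H ==>
  EX z:vspan H S. ALL w:vecs H. vinner H w z = c * vinner H w x"
proof (induction rule: vspan.induct)
 case zero show ?case by (rule bexI[of _ "vzero H"]) (auto intro: vspan.zero)
next
 case (step s x d)
 then obtain z where z: "z : vspan H S" "ALL w:vecs H. vinner H w z = c * vinner H w x"
  by blast
 have "vadd H (vscale H (c * d) s) z : vspan H S" using step z by (intro vspan.step)
 moreover have "ALL w:vecs H. vinner H w (vadd H (vscale H (c * d) s) z)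
   = c * vinner H w (vadd H (vscale H d s) x)"
  using step.hyps step.prems z vspan_mem[OF z(1)] vspan_mem[OF step.hyps(2)]
  by (auto simp: algebra_simps)
 ultimately show ?case by blast
qed

lemma parallelogram:
 assumes m: "x : vecs H" "u : vecs H" "v : vecs H" "z : vecs H"
  and z: "!!w. w : vecs H ==> vinner H w z = (vinner H w u + vinner H w v) / 2"
 shows "(vdist H u v)^2 = 2 * (vdist H x u)^2 + 2 * (vdist H x v)^2 - 4 * (vdist H x z)^2"
proof -
 have self: "cnj (vinner H w w) = vinner H w w" if "w : vecs H" for w
  using inner_commute[OF that that] by simp
 have zu: "vinner H z u = (vinner H u u + vinner H v u) / 2"
 proof -
  have "vinner H z u = cnj ((vinner H u u + vinner H u v) / 2)"
   using z[of u] inner_commute[of u z] assms by simp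
  also have "... = (vinner H u u + vinner H v u) / 2"
   using self[of u] inner_commute[of u v] assms by simp
  finally show ?thesis .
 qed
 have zv: "vinner H z v = (vinner H u v + vinner H v v) / 2"
 proof -
  have "vinner H z v = cnj ((vinner H v u + vinner H v v) / 2)"
   using z[of v] inner_commute[of v z] assms by simp
  also have "... = (vinner H u v + vinner H v v) / 2"
   using self[of v] inner_commute[of v u] assms by simp
  finally show ?thesis .
 qed
 have "vinner H z z = (vinner H u u + vinner H v v + vinner H u v + vinner H v u) / 4"
  unfolding z[OF \<open>z : vecs H\<close>] zu zv by (simp add: add_divide_distrib)
 hence "Re (vinner H z z) = (Re (vinner H u u) + Re (vinner H v v) + 2 * Re (vinner H u v)) / 4"
  by (simp only: inner_commute[OF \<open>u : vecs H\<close> \<open>v : vecs H\<close>]) simp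
 moreover have "Re (vinner H x z) = (Re (vinner H x u) + Re (vinner H x v)) / 2"
  unfolding z[OF \<open>x : vecs H\<close>] by simp
 ultimately show ?thesis
  unfolding dist_power2[OF m(2,3)] dist_power2[OF m(1,2)] dist_power2[OF m(1,3)] dist_power2[OF m(1,4)]
   norm_power2[OF m(1)] norm_power2[OF m(2)] norm_power2[OF m(3)] norm_power2[OF m(4)]
  by (simp add: field_simps)
qed

end

text \<open>The projection theorem: minimizing the distance to the span produces the orthogonal
  component, which has to vanish.\<close>

lemma (in hilbert) vtotal_of_orth_total:
 assumes tot: "orth_total H S"
 shows "vtotal H S"
 unfolding vtotal_def
proof (intro conjI ballI allI impI)
 have S: "S \<subseteq> vecs H" using tot by (simp add: orth_total_def)
 show "S \<subseteq> vecs H" by fact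
 fix x \<epsilon> assume x: "x : vecs H" and "\<epsilon> > (0::real)"
 define d where "d = (INF y\<in>vspan H S. (vdist H x y)^2)"
 have ne: "vspan H S ~= {}" using vspan.zero by auto
 have bdd: "bdd_below ((%y. (vdist H x y)^2) ` vspan H S)" by (rule bdd_belowI[of _ 0]) auto
 have d_le: "d <= (vdist H x y)^2" if "y : vspan H S" for y
  unfolding d_def using that bdd by (intro cINF_lower)
 have "EX y:vspan H S. (vdist H x y)^2 < d + 1 / Suc n" for n
  using cINF_less_iff[OF ne bdd, of "d + 1 / Suc n"] by (simp add: d_def)
 then obtain Y where Y: "!!n. Y n : vspan H S" "!!n. (vdist H x (Y n))^2 < d + 1 / Suc n"
  by metis
 have Ym: "Y n : vecs H" for n using Y vspan_mem S by blast
 have close: "(vdist H (Y m) (Y n))^2 <= 2 / Suc m + 2 / Suc n" for m n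
 proof -
  obtain z0 where z0: "z0 : vspan H S" "ALL w:vecs H. vinner H w z0 = vinner H w (Y m) + vinner H w (Y n)"
   using vspan_add[OF Y(1) Y(1) S] by blast
  obtain z where z: "z : vspan H S" "ALL w:vecs H. vinner H w z = (1/2) * vinner H w z0"
   using vspan_scale[OF z0(1) S] by blast
  have "(vdist H (Y m) (Y n))^2 = 2 * (vdist H x (Y m))^2 + 2 * (vdist H x (Y n))^2 - 4 * (vdist H x z)^2"
   using z z0 vspan_mem[OF z(1) S] x Ym by (intro parallelogram) auto
  thus ?thesis using d_le[OF z(1)] Y(2)[of m] Y(2)[of n] by simp
 qed
 have "hcauchy H Y"
  unfolding hcauchy_def
 proof (intro conjI allI impI Ym)
  fix e :: real assume e: "e > 0"
  obtain N where N: "1 / real (Suc N) < e^2 / 4"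
   using nat_approx_posE[of "e^2 / 4"] e by auto
  have "vdist H (Y m) (Y n) < e" if "m >= N" "n >= N" for m n
  proof -
   have "1 / real (Suc m) <= 1 / real (Suc N)" "1 / real (Suc n) <= 1 / real (Suc N)"
   using that by (auto intro!: divide_left_mono)
   hence "(vdist H (Y m) (Y n))^2 < e^2" using close[of m n] N by simp
   thus ?thesis using e by (auto intro: power2_less_imp_less)
  qed
  thus "EX N. \<forall>m\<ge>N. \<forall>n\<ge>N. vdist H (Y m) (Y n) < e" by blast
 qed
 then obtain y where y: "y : vecs H" "(%n. vdist H (Y n) y) -->> 0" using complete by blast
 have lim: "(%n. (vdist H x (Y n))^2) -->> (vdist H x y)^2"
 proof -
  have "vdist H (vsub x (Y n)) (vsub x y) = vdist H (Y n) y" for n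
  proof -
   have "vdist H (vsub x (Y n)) (vsub x y) = vnorm H (vsub y (Y n))"
   unfolding vdist_def by (rule norm_cong_inner) (use x y Ym in auto)
   thus ?thesis using dist_commute[of y "Y n"] y Ym by (simp add: vdist_def)
  qed
  thus ?thesis
   using tendsto_norm_power2[of "%n. vsub x (Y n)" "vsub x y"] x y Ym by (simp add: vdist_def)
 qed
 have dlim: "(vdist H x y)^2 <= d"
 proof (rule LIMSEQ_le[OF lim])
  show "(%n. d + 1 / Suc n) -->> d"
   using tendsto_add[OF tendsto_const[of d] LIMSEQ_Suc[OF lim_1_over_n[where 'a=real]]] by simp
  show "EX N. \<forall>n\<ge>N. (vdist H x (Y n))^2 <= d + 1 / Suc n" using Y(2) less_imp_le by blast
 qed
 have orth: "vinner H s (vsub x y) = 0" if s: "s : S" for s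
 proof (rule ccontr)
  have sH: "s : vecs H" using s S by auto
  define a where "a = vinner H s (vsub x y)"
  assume "vinner H s (vsub x y) ~= 0"
  hence a: "a ~= 0" by (simp add: a_def)
  have ge: "d <= (vdist H x (vadd H (vscale H c s) y))^2" for c
  proof -
   have "(%n. (vdist H x (vadd H (vscale H c s) (Y n)))^2) -->> (vdist H x (vadd H (vscale H c s) y))^2"
   proof -
   have "vdist H (vsub x (vadd H (vscale H c s) (Y n))) (vsub x (vadd H (vscale H c s) y)) = vdist H (Y n) y" for n
   proof -
   have "vdist H (vsub x (vadd H (vscale H c s) (Y n))) (vsub x (vadd H (vscale H c s) y)) = vnorm H (vsub y (Y n))"
   unfolding vdist_def by (rule norm_cong_inner) (use x y Ym sH in "auto simp: algebra_simps")
   thus ?thesis using dist_commute[of y "Y n"] y Ym by (simp add: vdist_def)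
   qed
   thus ?thesis
   using tendsto_norm_power2[of "%n. vsub x (vadd H (vscale H c s) (Y n))" "vsub x (vadd H (vscale H c s) y)"]
   x y Ym sH by (simp add: vdist_def)
   qed
   moreover have "d <= (vdist H x (vadd H (vscale H c s) (Y n)))^2" for n
   using d_le[OF vspan.step[OF s Y(1)]] .
   ultimately show ?thesis by (meson LIMSEQ_le_const)
  qed
  define b where "b = (vnorm H s)^2"
  have b: "b >= 0" by (simp add: b_def)
  have ex: "(vdist H x (vadd H (vscale H (of_real t * a) s) y))^2
   = (vdist H x y)^2 - 2 * t * (cmod a)^2 + t^2 * (cmod a)^2 * b" for t
  proof -
   let ?u = "vsub x y" let ?v = "vscale H (of_real t * a) s"
   have "vdist H x (vadd H ?v y) = vdist H ?u ?v"
   unfolding vdist_def by (rule norm_cong_inner) (use x y sH in "auto simp: algebra_simps")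
   hence "(vdist H x (vadd H ?v y))^2 = (vnorm H ?u)^2 + (vnorm H ?v)^2 - 2 * Re (vinner H ?u ?v)"
   using dist_power2[of ?u ?v] x y sH by simp
   also have "vinner H ?u ?v = of_real t * a * cnj a"
   using inner_commute[of s ?u] x y sH by (simp add: a_def)
   also have "Re (of_real t * a * cnj a) = t * (cmod a)^2"
   by (simp add: cmod_power2) (simp add: power2_eq_square algebra_simps)
   also have "(vnorm H ?v)^2 = t^2 * (cmod a)^2 * b"
   using sH by (simp add: norm_scale b_def norm_mult power_mult_distrib)
   finally show ?thesis by (simp add: vdist_def)
  qed
  have "0 <= - 2 * t * (cmod a)^2 + t^2 * (cmod a)^2 * b" for t
   using ge[of "of_real t * a"] ex[of t] dlim by simp
  from this[of "1 / (b + 1)"] have "0 <= (cmod a)\<^sup>2 * (- 2 / (b + 1) + b / (b + 1)\<^sup>2)"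
   by (simp add: power_divide algebra_simps)
  moreover have "- 2 / (b + 1) + b / (b + 1)^2 < 0"
   using b by (simp add: divide_simps power2_eq_square)
  ultimately show False using a by (simp add: zero_le_mult_iff)
 qed
 hence "vnorm H (vsub x y) = 0" using tot x y unfolding orth_total_def by auto
 hence "(%n. (vdist H x (Y n))^2) -->> 0" using lim by (simp add: vdist_def)
 hence "eventually (%n. (vdist H x (Y n))^2 < \<epsilon>^2) sequentially"
  using order_tendstoD(2)[of _ 0 sequentially "\<epsilon>^2"] \<open>\<epsilon> > 0\<close> by simp
 then obtain n where "(vdist H x (Y n))^2 < \<epsilon>^2" using eventually_happens by fastforce
 hence "vdist H x (Y n) < \<epsilon>" using \<open>\<epsilon> > 0\<close> by (auto intro: power2_less_imp_less)
 thus "EX y:vspan H S. vdist H x y < \<epsilon>" using Y by blast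
qed

section \<open>Unitary operators from total families\<close>

text \<open>Finite linear combinations of two families, formed with the same coefficients.\<close>

inductive_set pair_span :: "'v ip_space => 'w ip_space => 'i set => ('i => 'v) => ('i => 'w) => ('v \<times> 'w) set"
 for H K I a b where
 pzero: "(vzero H, vzero K) : pair_span H K I a b"
| pstep: "i : I ==> (x, y) : pair_span H K I a b ==>
   (vadd H (vscale H c (a i)) x, vadd K (vscale K c (b i)) y) : pair_span H K I a b"

lemma vspan_pair_span_left: "x : vspan H (a ` I) ==> EX y. (x, y) : pair_span H K I a b"
 by (induction rule: vspan.induct) (blast intro: pair_span.intros)+

text \<open>The graph of the isometry that extends \<open>a i \<mapsto> b i\<close>.\<close>

definition graph_closure ::
 "'v ip_space => 'w ip_space => 'i set => ('i => 'v) => ('i => 'w) => 'v => 'w => bool" where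
 "graph_closure H K I a b x y \<longleftrightarrow> x : vecs H & y : vecs K &
   (EX X Y. (ALL n. (X n, Y n) : pair_span H K I a b) &
   (%n. vdist H (X n) x) -->> 0 & (%n. vdist K (Y n) y) -->> 0)"

locale matched_families = H: pre_hilbert H + K: pre_hilbert K
 for H :: "'v ip_space" and K :: "'w ip_space" +
 fixes I :: "'i set" and a :: "'i => 'v" and b :: "'i => 'w"
 assumes a_mem: "i : I ==> a i : vecs H" and b_mem: "i : I ==> b i : vecs K"
  and same_inner: "i : I ==> j : I ==> vinner H (a i) (a j) = vinner K (b i) (b j)"
begin

lemma pair_span_mem: "p : pair_span H K I a b ==> fst p : vecs H & snd p : vecs K"
proof (cases p)
 fix x y assume "p : pair_span H K I a b" "p = (x, y)"
 hence "(x, y) : pair_span H K I a b" by simp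
 hence "x : vecs H & y : vecs K"
  by (induction rule: pair_span.induct) (use a_mem b_mem in auto)
 thus ?thesis using \<open>p = (x, y)\<close> by simp
qed

lemma pair_span_inner:
 assumes p: "p : pair_span H K I a b" and q: "q : pair_span H K I a b"
 shows "vinner H (fst p) (fst q) = vinner K (snd p) (snd q)"
proof -
 obtain x y x' y' where pq: "p = (x, y)" "q = (x', y')" by (metis surj_pair)
 note m = pair_span_mem[OF q, unfolded pq, simplified]
 have 1: "vinner H (a i) x' = vinner K (b i) y'" if "i : I" for i
  using q[unfolded pq] by (induction rule: pair_span.induct)
   (use a_mem b_mem same_inner that pair_span_mem in fastforce)+
 have "vinner H x x' = vinner K y y'" using p[unfolded pq]
  by (induction rule: pair_span.induct) (use a_mem b_mem 1 m pair_span_mem in fastforce)+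
 thus ?thesis by (simp add: pq)
qed

lemma pair_span_dist:
 assumes p: "p : pair_span H K I a b" and q: "q : pair_span H K I a b"
 shows "vdist H (fst p) (fst q) = vdist K (snd p) (snd q)"
proof -
 have "(vdist H (fst p) (fst q))^2 = (vdist K (snd p) (snd q))^2"
  using pair_span_mem[OF p] pair_span_mem[OF q] pair_span_inner p q
  by (simp add: H.dist_power2 K.dist_power2 H.norm_power2 K.norm_power2)
 thus ?thesis using pair_span_mem[OF p] pair_span_mem[OF q] by (simp add: power2_eq_iff_nonneg)
qed

lemma graph_inner:
 assumes "graph_closure H K I a b x y" "graph_closure H K I a b x' y'"
 shows "vinner H x x' = vinner K y y'"
proof -
 obtain X Y X' Y' where XY: "!!n. (X n, Y n) : pair_span H K I a b" "(%n. vdist H (X n) x) -->> 0"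
   "(%n. vdist K (Y n) y) -->> 0"
  and XY': "!!n. (X' n, Y' n) : pair_span H K I a b" "(%n. vdist H (X' n) x') -->> 0"
   "(%n. vdist K (Y' n) y') -->> 0"
  using assms unfolding graph_closure_def by metis
 have "(%n. vinner H (X n) (X' n)) -->> vinner H x x'"
  using XY XY' pair_span_mem[OF XY(1)] pair_span_mem[OF XY'(1)] assms
  by (intro H.tendsto_inner) (auto simp: graph_closure_def)
 moreover have "(%n. vinner K (Y n) (Y' n)) -->> vinner K y y'"
  using XY XY' pair_span_mem[OF XY(1)] pair_span_mem[OF XY'(1)] assms
  by (intro K.tendsto_inner) (auto simp: graph_closure_def)
 moreover have "vinner H (X n) (X' n) = vinner K (Y n) (Y' n)" for n
  using pair_span_inner[OF XY(1) XY'(1)] by simp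
 ultimately show ?thesis by (simp add: LIMSEQ_unique)
qed

lemma graph_base: "i : I ==> graph_closure H K I a b (a i) (b i)"
proof -
 assume i: "i : I"
 let ?x = "vadd H (vscale H 1 (a i)) (vzero H)" let ?y = "vadd K (vscale K 1 (b i)) (vzero K)"
 have "vdist H ?x (a i) = 0"
  using H.norm_cong_inner[of "H.vsub ?x (a i)" "vzero H"] a_mem[OF i] by (simp add: vdist_def)
 moreover have "vdist K ?y (b i) = 0"
  using K.norm_cong_inner[of "K.vsub ?y (b i)" "vzero K"] b_mem[OF i] by (simp add: vdist_def)
 moreover have "(?x, ?y) : pair_span H K I a b" using i by (intro pair_span.intros)
 ultimately show ?thesis unfolding graph_closure_def using a_mem b_mem i
  by (intro conjI exI[of _ "%_. ?x"] exI[of _ "%_. ?y"]) auto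
qed

lemma graph_total:
 assumes "hilbert K" "vtotal H (a ` I)" "x : vecs H"
 shows "EX y. graph_closure H K I a b x y"
proof -
 interpret hilbert K by fact
 have "EX u. u : vspan H (a ` I) & vdist H x u < 1 / Suc n" for n
  using assms(2,3) unfolding vtotal_def by (metis of_nat_0_less_iff zero_less_Suc zero_less_divide_1_iff)
 then obtain X where X: "!!n. X n : vspan H (a ` I)" "!!n. vdist H x (X n) < 1 / Suc n" by metis
 have "EX y. (X n, y) : pair_span H K I a b" for n using vspan_pair_span_left[OF X(1)] .
 then obtain Y where Y: "!!n. (X n, Y n) : pair_span H K I a b" by metis
 note m = pair_span_mem[OF Y, simplified]
 have lim: "(%n. vdist H (X n) x) -->> 0"
 proof (rule tendsto_sandwich[OF _ _ tendsto_const])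
  show "(%n. 1 / real (Suc n)) -->> 0" using LIMSEQ_Suc[OF lim_1_over_n[where 'a=real]] by simp
  show "eventually (%n. vdist H (X n) x <= 1 / real (Suc n)) sequentially"
  proof (rule always_eventually, rule allI)
   fix n show "vdist H (X n) x <= 1 / real (Suc n)"
   using X(2)[of n] H.dist_commute[of x "X n"] assms(3) m[of n] by simp
  qed
 qed (use m assms(3) in auto)
 have "hcauchy H X" using m lim assms by (intro H.hcauchyI_tendsto) auto
 hence "hcauchy K Y" using pair_span_dist[OF Y Y] m by (simp add: hcauchy_def)
 then obtain y where "y : vecs K" "(%n. vdist K (Y n) y) -->> 0" using complete by blast
 thus ?thesis using lim Y assms(3) unfolding graph_closure_def by blast
qed

end

definition isometry_on :: "'v ip_space => ('v => 'v) => bool" where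
 "isometry_on H U \<longleftrightarrow> (ALL x:vecs H. U x : vecs H) &
   (ALL x:vecs H. ALL y:vecs H. vinner H (U x) (U y) = vinner H x y)"

text \<open>Both families are total, so a vector of the target is determined by its inner products with
  the \<open>b i\<close>. The isometry that extends \<open>a i \<mapsto> b i\<close> preserves these, which gives its linearity,
  and it intertwines the actions because every \<open>a j\<close> and \<open>b j\<close> is the image of a matching pair.\<close>

theorem unitarily_equivalentI_families:
 assumes R: "hilbert (hspace R)" and S: "hilbert (hspace S)"
  and a: "!!i. i : I ==> a i : vecs (hspace R)" and b: "!!i. i : I ==> b i : vecs (hspace S)"
  and same: "!!i j. i : I ==> j : I ==>
   vinner (hspace R) (a i) (a j) = vinner (hspace S) (b i) (b j)"
  and ta: "orth_total (hspace R) (a ` I)" and tb: "orth_total (hspace S) (b ` I)"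
  and isoR: "!!g. g : G ==> isometry_on (hspace R) (act R g)"
  and isoS: "!!g. g : G ==> isometry_on (hspace S) (act S g)"
  and match: "!!g j. g : G ==> j : I ==> EX i:I. act R g (a i) = a j & act S g (b i) = b j"
 shows "unitarily_equivalent G R S"
proof -
 let ?H = "hspace R" and ?K = "hspace S"
 interpret H: hilbert ?H by fact
 interpret K: hilbert ?K by fact
 interpret F: matched_families ?H ?K I a b by unfold_locales (use a b same in auto)
 interpret F': matched_families ?K ?H I b a by unfold_locales (use a b same in auto)
 have tota: "vtotal ?H (a ` I)" and totb: "vtotal ?K (b ` I)"
  using ta tb H.vtotal_of_orth_total K.vtotal_of_orth_total by auto
 define T where "T x = (SOME y. graph_closure ?H ?K I a b x y)" for x
 have T: "graph_closure ?H ?K I a b x (T x)" if "x : vecs ?H" for x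
  unfolding T_def using F.graph_total[OF S tota that] by (rule someI_ex)
 have Tm: "T x : vecs ?K" if "x : vecs ?H" for x using T[OF that] by (simp add: graph_closure_def)
 have Ti: "vinner ?K (T x) (T y) = vinner ?H x y" if "x : vecs ?H" "y : vecs ?H" for x y
  using F.graph_inner[OF T T] that by simp
 have base: "vinner ?K (b j) y = vinner ?H (a j) x" if "graph_closure ?H ?K I a b x y" "j : I" for x y j
  using F.graph_inner[OF F.graph_base[OF that(2)] that(1)] by simp
 note baseT = base[OF T]
 have eqI: "veq ?K u v" if m: "u : vecs ?K" "v : vecs ?K" and uv: "!!j. j : I ==> vinner ?K (b j) u = vinner ?K (b j) v" for u v
 proof -
  have "ALL s:b ` I. vinner ?K s (K.vsub u v) = 0" using m uv b by simp
  thus ?thesis using tb m unfolding orth_total_def veq_def vdist_def by simp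
 qed
 have onto: "EX x:vecs ?H. veq ?K (T x) y" if y: "y : vecs ?K" for y
 proof -
  obtain x where x: "graph_closure ?K ?H I b a y x" using F'.graph_total[OF R totb y] by blast
  then obtain X Y where XY: "!!n. (Y n, X n) : pair_span ?K ?H I b a"
   "(%n. vdist ?K (Y n) y) -->> 0" "(%n. vdist ?H (X n) x) -->> 0"
   unfolding graph_closure_def by metis
  have "(x, y) : pair_span ?H ?K I a b" if "(y, x) : pair_span ?K ?H I b a" for x y
   using that by induction (auto intro: pair_span.intros)
  hence g: "graph_closure ?H ?K I a b x y"
   using x XY unfolding graph_closure_def by blast
  hence xH: "x : vecs ?H" by (simp add: graph_closure_def)
  have "veq ?K (T x) y" by (rule eqI[OF Tm[OF xH] y]) (simp add: base[OF g] baseT[OF xH])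
  thus ?thesis using xH by blast
 qed
 have intertwine: "veq ?K (T (act R g x)) (act S g (T x))" if g: "g : G" and x: "x : vecs ?H" for g x
 proof (rule eqI)
  have gx: "act R g x : vecs ?H" using isoR[OF g] x by (simp add: isometry_on_def)
  show "T (act R g x) : vecs ?K" "act S g (T x) : vecs ?K"
   using Tm[OF gx] Tm[OF x] isoS[OF g] by (auto simp: isometry_on_def)
  fix j assume "j : I"
  then obtain i where i: "i : I" "act R g (a i) = a j" "act S g (b i) = b j" using match[OF g] by blast
  have "vinner ?K (b j) (T (act R g x)) = vinner ?H (act R g (a i)) (act R g x)"
   using baseT[OF gx \<open>j : I\<close>] i by simp
  also have "... = vinner ?K (b i) (T x)"
   using isoR[OF g] a[OF i(1)] x baseT[OF x i(1)] by (simp add: isometry_on_def)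
  also have "... = vinner ?K (act S g (b i)) (act S g (T x))"
   using isoS[OF g] b[OF i(1)] Tm[OF x] by (simp add: isometry_on_def)
  also have "... = vinner ?K (b j) (act S g (T x))" by (simp only: i(3))
  finally show "vinner ?K (b j) (T (act R g x)) = vinner ?K (b j) (act S g (T x))" .
 qed
 show ?thesis
  unfolding unitarily_equivalent_def
 proof (intro exI[of _ T] conjI ballI allI)
  fix x y assume x: "x : vecs ?H" and y: "y : vecs ?H"
  show "veq ?K (T (vadd ?H x y)) (vadd ?K (T x) (T y))"
   by (rule eqI) (use x y Tm a b baseT in auto)
  show "vinner ?K (T x) (T y) = vinner ?H x y" using Ti x y by simp
 next
  fix c x assume x: "x : vecs ?H"
  show "veq ?K (T (vscale ?H c x)) (vscale ?K c (T x))"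
   by (rule eqI) (use x Tm a b baseT in auto)
 qed (use Tm onto intertwine in auto)
qed


section \<open>Completions\<close>

lemma completion_simps:
 "vecs (completion H) = Collect (hcauchy H)"
 "vzero (completion H) = (%_. vzero H)"
 "vadd (completion H) = (%x y n. vadd H (x n) (y n))"
 "vscale (completion H) = (%c x n. vscale H c (x n))"
 by (auto simp: completion_def hcauchy_def)

context pre_hilbert
begin

lemma hcauchy_bounded:
 assumes "hcauchy H X"
 shows "EX B. ALL n. vnorm H (X n) <= B"
proof -
 have X: "X n : vecs H" for n using assms by (simp add: hcauchy_def)
 obtain N where N: "!!m n. m >= N ==> n >= N ==> vdist H (X m) (X n) < 1"
  using assms unfolding hcauchy_def by (metis zero_less_one)
 define B where "B = Max ((%n. vnorm H (X n)) ` {..N}) + 1"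
 have le: "vnorm H (X n) <= B - 1" if "n <= N" for n using that by (simp add: B_def)
 have "vnorm H (X n) <= B" for n
 proof (cases "n <= N")
  case False
  thus ?thesis using norm_le_dist[of "X n" "X N"] N[of n N] X le[of N] by (auto simp: less_imp_le)
 qed (use le in force)
 thus ?thesis by blast
qed

lemma inner_hcauchy_convergent:
 assumes XY: "hcauchy H X" "hcauchy H Y"
 shows "convergent (%n. vinner H (X n) (Y n))"
proof -
 have m: "X n : vecs H" "Y n : vecs H" for n using XY by (auto simp: hcauchy_def)
 obtain B1 B2 where B1: "!!n. vnorm H (X n) <= B1" and B2: "!!n. vnorm H (Y n) <= B2"
  using hcauchy_bounded XY by metis
 define B where "B = \<bar>B1\<bar> + \<bar>B2\<bar> + 1"
 have B: "vnorm H (X n) <= B" "vnorm H (Y n) <= B" "B > 0" for n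
  using B1[of n] B2[of n] by (auto simp: B_def)
 have "Cauchy (%n. vinner H (X n) (Y n))"
  unfolding Cauchy_def
 proof (intro allI impI)
  fix e :: real assume "e > 0"
  hence e: "e / (2 * B) > 0" using B by simp
  obtain N1 where N1: "!!m n. m >= N1 ==> n >= N1 ==> vdist H (X m) (X n) < e / (2 * B)"
   using XY(1) e unfolding hcauchy_def by metis
  obtain N2 where N2: "!!m n. m >= N2 ==> n >= N2 ==> vdist H (Y m) (Y n) < e / (2 * B)"
   using XY(2) e unfolding hcauchy_def by metis
  have "dist (vinner H (X m) (Y m)) (vinner H (X n) (Y n)) < e"
   if mn: "m >= max N1 N2" "n >= max N1 N2" for m n
  proof -
   have 1: "cmod (vinner H (X m) (Y m) - vinner H (X m) (Y n)) <= B * vdist H (Y m) (Y n)"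
   using inner_diff_le[of "Y m" "Y n" "X m"] m B
   by (meson dist_nonneg mult_right_mono order_trans)
   have 2: "cmod (vinner H (X m) (Y n) - vinner H (X n) (Y n)) <= B * vdist H (X m) (X n)"
   proof -
   have "vinner H (X m) (Y n) - vinner H (X n) (Y n)
   = cnj (vinner H (Y n) (X m) - vinner H (Y n) (X n))"
   using m inner_commute[of "Y n"] by simp
   hence "cmod (vinner H (X m) (Y n) - vinner H (X n) (Y n))
   = cmod (vinner H (Y n) (X m) - vinner H (Y n) (X n))" by (simp only: complex_mod_cnj)
   thus ?thesis using inner_diff_le[of "X m" "X n" "Y n"] m B
   by (metis (no_types, lifting) dist_nonneg mult_right_mono order_trans)
   qed
   have "B * vdist H (Y m) (Y n) < B * (e / (2 * B))" "B * vdist H (X m) (X n) < B * (e / (2 * B))"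
   using mult_strict_left_mono[OF N2[of m n] B(3)] mult_strict_left_mono[OF N1[of m n] B(3)] mn by auto
   moreover have "B * (e / (2 * B)) = e / 2" using B(3) by simp
   ultimately show ?thesis
   using 1 2 norm_triangle_ineq[of "vinner H (X m) (Y m) - vinner H (X m) (Y n)"
   "vinner H (X m) (Y n) - vinner H (X n) (Y n)"] by (simp add: dist_norm)
  qed
  thus "EX M. \<forall>m\<ge>M. \<forall>n\<ge>M. dist (vinner H (X m) (Y m)) (vinner H (X n) (Y n)) < e" by blast
 qed
 thus ?thesis by (simp add: Cauchy_convergent_iff)
qed

lemma completion_inner_tendsto:
 assumes "hcauchy H X" "hcauchy H Y"
 shows "(%n. vinner H (X n) (Y n)) -->> vinner (completion H) X Y"
 using inner_hcauchy_convergent[OF assms] by (simp add: completion_def convergent_LIMSEQ_iff)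

lemma hcauchy_const: "x : vecs H ==> hcauchy H (%_. x)"
 by (auto simp: hcauchy_def)

lemma hcauchy_add:
 assumes "hcauchy H X" "hcauchy H Y"
 shows "hcauchy H (%n. vadd H (X n) (Y n))"
 unfolding hcauchy_def
proof (intro conjI allI impI)
 have m: "X n : vecs H" "Y n : vecs H" for n using assms by (auto simp: hcauchy_def)
 show "vadd H (X n) (Y n) : vecs H" for n using m by simp
 fix e :: real assume e: "e > 0"
 obtain N1 where N1: "!!m n. m >= N1 ==> n >= N1 ==> vdist H (X m) (X n) < e / 2"
  using assms(1) e unfolding hcauchy_def by (metis half_gt_zero)
 obtain N2 where N2: "!!m n. m >= N2 ==> n >= N2 ==> vdist H (Y m) (Y n) < e / 2"
  using assms(2) e unfolding hcauchy_def by (metis half_gt_zero)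
 have "vdist H (vadd H (X k) (Y k)) (vadd H (X n) (Y n)) < e" if "k >= max N1 N2" "n >= max N1 N2" for k n
  using dist_add[of "X k" "Y k" "X n" "Y n"] m N1[of k n] N2[of k n] that by fastforce
 thus "EX N. \<forall>k\<ge>N. \<forall>n\<ge>N. vdist H (vadd H (X k) (Y k)) (vadd H (X n) (Y n)) < e" by blast
qed

lemma hcauchy_scale:
 assumes "hcauchy H X"
 shows "hcauchy H (%n. vscale H c (X n))"
 unfolding hcauchy_def
proof (intro conjI allI impI)
 have m: "X n : vecs H" for n using assms by (auto simp: hcauchy_def)
 show "vscale H c (X n) : vecs H" for n using m by simp
 fix e :: real assume e: "e > 0"
 hence e': "e / (cmod c + 1) > 0" by (simp add: add_nonneg_pos)
 obtain N where N: "!!m n. m >= N ==> n >= N ==> vdist H (X m) (X n) < e / (cmod c + 1)"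
  using assms e' unfolding hcauchy_def by metis
 have "vdist H (vscale H c (X k)) (vscale H c (X n)) < e" if "k >= N" "n >= N" for k n
 proof -
  have "cmod c * vdist H (X k) (X n) <= (cmod c + 1) * vdist H (X k) (X n)"
   using m by (intro mult_right_mono) auto
  also have "... < (cmod c + 1) * (e / (cmod c + 1))"
   using N[OF that] by (intro mult_strict_left_mono) (auto simp: add_nonneg_pos)
  also have "... = e" using add_nonneg_pos[OF norm_ge_zero zero_less_one, of c] by simp
  finally show ?thesis using dist_scale m by simp
 qed
 thus "EX N. \<forall>k\<ge>N. \<forall>n\<ge>N. vdist H (vscale H c (X k)) (vscale H c (X n)) < e" by blast
qed

lemma pre_hilbert_completion: "pre_hilbert (completion H)"
proof (unfold_locales, unfold completion_simps)
 show "(%_. vzero H) : Collect (hcauchy H)" using hcauchy_const by simp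
next
 fix X Y assume "X : Collect (hcauchy H)" "Y : Collect (hcauchy H)"
 thus "(%n. vadd H (X n) (Y n)) : Collect (hcauchy H)" using hcauchy_add by simp
next
 fix X c assume "X : Collect (hcauchy H)"
 thus "(%n. vscale H c (X n)) : Collect (hcauchy H)" using hcauchy_scale by simp
next
 fix Z assume Z: "Z : Collect (hcauchy H)"
 thus "vinner (completion H) Z (%_. vzero H) = 0"
  using completion_inner_tendsto[of Z "%_. vzero H"] hcauchy_const
  by (intro LIMSEQ_unique) (auto simp: hcauchy_def)
next
 fix Z X Y assume "Z : Collect (hcauchy H)" "X : Collect (hcauchy H)" "Y : Collect (hcauchy H)"
 hence c: "hcauchy H Z" "hcauchy H X" "hcauchy H Y" by auto
 hence m: "Z n : vecs H" "X n : vecs H" "Y n : vecs H" for n by (auto simp: hcauchy_def)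
 show "vinner (completion H) Z (%n. vadd H (X n) (Y n))
   = vinner (completion H) Z X + vinner (completion H) Z Y"
  using completion_inner_tendsto[OF c(1) hcauchy_add[OF c(2,3)]]
   tendsto_add[OF completion_inner_tendsto[OF c(1,2)] completion_inner_tendsto[OF c(1,3)]] m
  by (simp add: LIMSEQ_unique)
next
 fix Z X c assume "Z : Collect (hcauchy H)" "X : Collect (hcauchy H)"
 hence h: "hcauchy H Z" "hcauchy H X" by auto
 hence m: "Z n : vecs H" "X n : vecs H" for n by (auto simp: hcauchy_def)
 show "vinner (completion H) Z (%n. vscale H c (X n)) = c * vinner (completion H) Z X"
  using completion_inner_tendsto[OF h(1) hcauchy_scale[OF h(2)], of c]
   tendsto_mult_left[OF completion_inner_tendsto[OF h], of c] m
  by (simp add: LIMSEQ_unique)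
next
 fix X Y assume "X : Collect (hcauchy H)" "Y : Collect (hcauchy H)"
 hence h: "hcauchy H X" "hcauchy H Y" by auto
 hence m: "X n : vecs H" "Y n : vecs H" for n by (auto simp: hcauchy_def)
 have "(%n. cnj (vinner H (X n) (Y n))) -->> cnj (vinner (completion H) X Y)"
  by (rule tendsto_cnj[OF completion_inner_tendsto[OF h]])
 hence "(%n. vinner H (Y n) (X n)) -->> cnj (vinner (completion H) X Y)"
  using inner_commute[OF m(1) m(2)] by simp
 thus "vinner (completion H) Y X = cnj (vinner (completion H) X Y)"
  using completion_inner_tendsto[OF h(2,1)] LIMSEQ_unique by blast
next
 fix X assume "X : Collect (hcauchy H)"
 hence h: "hcauchy H X" by auto
 hence m: "X n : vecs H" for n by (auto simp: hcauchy_def)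
 show "0 <= Re (vinner (completion H) X X)"
  using tendsto_Re[OF completion_inner_tendsto[OF h h]] inner_nonneg[OF m]
  by (intro LIMSEQ_le_const) auto
qed

lemma completion_dist_tendsto:
 assumes h: "hcauchy H X" "hcauchy H Y"
 shows "(%n. vdist H (X n) (Y n)) -->> vdist (completion H) X Y"
proof -
 have d: "hcauchy H (%n. vsub (X n) (Y n))"
  using hcauchy_add[OF h(1) hcauchy_scale[OF h(2)]] .
 show ?thesis
  unfolding vdist_def vnorm_def completion_simps
  by (intro tendsto_real_sqrt tendsto_Re completion_inner_tendsto d)
qed

lemma completion_const_dist:
 "x : vecs H ==> y : vecs H ==> vdist (completion H) (%_. x) (%_. y) = vdist H x y"
 using completion_dist_tendsto[OF hcauchy_const hcauchy_const, of x y] LIMSEQ_unique tendsto_const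
 by blast

lemma completion_const_inner:
 "x : vecs H ==> y : vecs H ==> vinner (completion H) (%_. x) (%_. y) = vinner H x y"
 using completion_inner_tendsto[OF hcauchy_const hcauchy_const, of x y] LIMSEQ_unique tendsto_const
 by blast

lemma completion_const_tendsto:
 assumes h: "hcauchy H X"
 shows "(%n. vdist (completion H) (%_. X n) X) -->> 0"
proof (rule LIMSEQ_I)
 have m: "X n : vecs H" for n using h by (auto simp: hcauchy_def)
 interpret C: pre_hilbert "completion H" by (rule pre_hilbert_completion)
 fix r :: real assume r: "r > 0"
 then obtain N where N: "!!m n. m >= N ==> n >= N ==> vdist H (X m) (X n) < r / 2"
  using h unfolding hcauchy_def by (metis half_gt_zero)
 have "norm (vdist (completion H) (%_. X n) X - 0) < r" if "n >= N" for n
 proof -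
  have "vdist (completion H) (%_. X n) X <= r / 2"
   by (rule LIMSEQ_le_const2[OF completion_dist_tendsto[OF hcauchy_const[OF m] h]])
   (use N[OF that] less_imp_le in blast)
  moreover have "0 <= vdist (completion H) (%_. X n) X"
   using h m by (intro C.dist_nonneg) (auto simp: completion_simps hcauchy_const)
  ultimately show ?thesis using r by simp
 qed
 thus "EX no. \<forall>n\<ge>no. norm (vdist (completion H) (%_. X n) X - 0) < r" by blast
qed

text \<open>A diagonal sequence of approximating constants represents the limit.\<close>

lemma hilbert_completion: "hilbert (completion H)"
proof -
 interpret C: pre_hilbert "completion H" by (rule pre_hilbert_completion)
 show ?thesis
 proof
  fix \<X> assume X: "hcauchy (completion H) \<X>"
  have XC: "\<X> n : vecs (completion H)" for n using X by (simp add: hcauchy_def)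
  hence Xh: "hcauchy H (\<X> n)" for n by (simp add: completion_simps)
  hence Xm: "\<X> n k : vecs H" for n k by (simp add: hcauchy_def)
  have cm: "(%_. \<X> n k) : vecs (completion H)" for n k
   using hcauchy_const[OF Xm] by (simp add: completion_simps)
  have "EX k. vdist (completion H) (%_. \<X> n k) (\<X> n) < 1 / Suc n" for n
   using order_tendstoD(2)[OF completion_const_tendsto[OF Xh[of n]], of "1 / Suc n"]
   by (auto simp: eventually_sequentially)
  then obtain k where k: "!!n. vdist (completion H) (%_. \<X> n (k n)) (\<X> n) < 1 / Suc n" by metis
  define y where "y n = \<X> n (k n)" for n
  have ym: "y n : vecs H" for n by (simp add: y_def Xm)
  have ycm: "(%_. y n) : vecs (completion H)" for n by (simp add: y_def cm)
  have yd: "vdist (completion H) (%_. y n) (\<X> n) < 1 / Suc n" for n using k by (simp add: y_def)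
  have "hcauchy H y"
   unfolding hcauchy_def
  proof (intro conjI allI impI ym)
   fix e :: real assume e: "e > 0"
   obtain N1 where N1: "!!m n. m >= N1 ==> n >= N1 ==> vdist (completion H) (\<X> m) (\<X> n) < e / 3"
   using X e unfolding hcauchy_def by (metis divide_pos_pos zero_less_numeral)
   obtain N2 where N2: "1 / real (Suc N2) < e / 3"
   using nat_approx_posE[of "e / 3"] e by auto
   have "vdist H (y m) (y n) < e" if "m >= max N1 N2" "n >= max N1 N2" for m n
   proof -
   have "1 / real (Suc m) <= 1 / real (Suc N2)" "1 / real (Suc n) <= 1 / real (Suc N2)"
   using that by (auto intro!: divide_left_mono)
   moreover have "vdist (completion H) (%_. y m) (%_. y n)
   <= vdist (completion H) (%_. y m) (\<X> m) + (vdist (completion H) (\<X> m) (\<X> n)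
   + vdist (completion H) (\<X> n) (%_. y n))"
   using C.dist_triangle[OF ycm[of m] XC[of m] ycm[of n]] C.dist_triangle[OF XC[of m] XC[of n] ycm[of n]] by linarith
   moreover have "vdist (completion H) (\<X> n) (%_. y n) = vdist (completion H) (%_. y n) (\<X> n)"
   by (rule C.dist_commute[OF XC ycm])
   moreover have "vdist (completion H) (\<X> m) (\<X> n) < e / 3" using N1 that by simp
   ultimately show ?thesis
   using yd[of m] yd[of n] N2 completion_const_dist[OF ym[of m] ym[of n]] by linarith
   qed
   thus "EX N. \<forall>m\<ge>N. \<forall>n\<ge>N. vdist H (y m) (y n) < e" by blast
  qed
  hence yC: "y : vecs (completion H)" and yh: "hcauchy H y" by (auto simp: completion_simps)
  have "(%n. vdist (completion H) (\<X> n) y) -->> 0"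
  proof (rule tendsto_sandwich[OF _ _ tendsto_const])
   show "\<forall>\<^sub>F n in sequentially. 0 <= vdist (completion H) (\<X> n) y"
   using C.dist_nonneg[OF XC yC] by simp
   show "\<forall>\<^sub>F n in sequentially. vdist (completion H) (\<X> n) y
   <= 1 / Suc n + vdist (completion H) (%_. y n) y"
   proof (rule always_eventually, rule allI)
   fix n
   show "vdist (completion H) (\<X> n) y <= 1 / Suc n + vdist (completion H) (%_. y n) y"
   using C.dist_triangle[OF XC[of n] ycm[of n] yC] C.dist_commute[OF XC[of n] ycm[of n]] yd[of n]
   by linarith
   qed
   show "(%n. 1 / real (Suc n) + vdist (completion H) (%_. y n) y) -->> 0"
   using tendsto_add[OF LIMSEQ_Suc[OF lim_1_over_n[where 'a=real]] completion_const_tendsto[OF yh]] by simp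
  qed
  thus "EX x:vecs (completion H). (%n. vdist (completion H) (\<X> n) x) -->> 0" using yC by blast
 qed
qed

lemma completion_orth_total:
 assumes X: "X : vecs (completion H)"
  and 0: "!!x. x : vecs H ==> vinner (completion H) (%_. x) X = 0"
 shows "vnorm (completion H) X = 0"
proof -
 interpret C: pre_hilbert "completion H" by (rule pre_hilbert_completion)
 have h: "hcauchy H X" using X by (simp add: completion_simps)
 have m: "X n : vecs H" for n using h by (auto simp: hcauchy_def)
 have cm: "(%_. X n) : vecs (completion H)" for n
  using hcauchy_const[OF m] by (simp add: completion_simps)
 have "(%n. vinner (completion H) (%_. X n) X) -->> vinner (completion H) X X"
  using completion_const_tendsto[OF h] X cm by (intro C.tendsto_inner) auto
 hence "vinner (completion H) X X = 0" using 0[OF m] by (simp add: LIMSEQ_const_iff)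
 thus ?thesis by (simp add: vnorm_def)
qed

end

section \<open>Tensor products\<close>

text \<open>Schur's product theorem for a Gram matrix: splitting off the component along one vector
  reduces the number of vectors.\<close>

lemma (in pre_hilbert) schur_product:
 assumes "finite I" "!!i. i : I ==> a i : vecs H"
  and "!!c. 0 <= Re (\<Sum>i\<in>I. \<Sum>j\<in>I. cnj (c i) * c j * Q i j)"
 shows "0 <= Re (\<Sum>i\<in>I. \<Sum>j\<in>I. vinner H (a i) (a j) * Q i j)"
 using assms
proof (induction I arbitrary: a rule: finite_induct)
 case (insert n J)
 have am: "a i : vecs H" if "i : insert n J" for i using insert.prems(1) that by simp
 define r where "r = (vnorm H (a n))^2"
 define \<beta> where "\<beta> i = (if i = n then 1 else vinner H (a n) (a i) / of_real r)" for i
 define a' where "a' i = vadd H (a i) (vscale H (- \<beta> i) (a n))" for i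
 have r0: "vinner H (a n) (a n) = of_real r" using am by (simp add: r_def inner_self)
 have ani: "vinner H (a n) (a i) = \<beta> i * of_real r" if i: "i : insert n J" for i
 proof (cases "r = 0")
  case True
  hence "vnorm H (a n) = 0" by (simp add: r_def)
  thus ?thesis using cauchy_schwarz[of "a n" "a i"] am i True by simp
 qed (auto simp: \<beta>_def r0)
 have dec: "vinner H (a i) (a j) = vinner H (a' i) (a' j) + of_real r * (cnj (\<beta> i) * \<beta> j)"
  if i: "i : insert n J" and j: "j : insert n J" for i j
 proof -
  have "vinner H (a i) (a n) = cnj (\<beta> i) * of_real r"
   using ani[OF i] inner_commute[of "a n" "a i"] am[OF i] am by simp
  thus ?thesis using am i j ani[OF j] r0 by (simp add: a'_def algebra_simps)
 qed
 have a'n: "vinner H (a' n) (a' j) = 0" "vinner H (a' j) (a' n) = 0" if j: "j : insert n J" for j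
 proof -
  show "vinner H (a' n) (a' j) = 0" using am j ani[OF j] r0 by (simp add: a'_def \<beta>_def)
  moreover have "a' j : vecs H" "a' n : vecs H" using am j by (auto simp: a'_def)
  ultimately show "vinner H (a' j) (a' n) = 0" using inner_commute[of "a' n" "a' j"] by simp
 qed
 have "(\<Sum>i\<in>insert n J. \<Sum>j\<in>insert n J. vinner H (a i) (a j) * Q i j)
   = (\<Sum>i\<in>insert n J. \<Sum>j\<in>insert n J. vinner H (a' i) (a' j) * Q i j)
   + of_real r * (\<Sum>i\<in>insert n J. \<Sum>j\<in>insert n J. cnj (\<beta> i) * \<beta> j * Q i j)"
  unfolding sum_distrib_left sum.distrib[symmetric]
  by (intro sum.cong refl) (simp add: dec algebra_simps)
 also have "(\<Sum>i\<in>insert n J. \<Sum>j\<in>insert n J. vinner H (a' i) (a' j) * Q i j)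
   = (\<Sum>i\<in>J. \<Sum>j\<in>J. vinner H (a' i) (a' j) * Q i j)"
  using insert.hyps a'n by (simp add: sum.neutral)
 finally have eq: "Re (\<Sum>i\<in>insert n J. \<Sum>j\<in>insert n J. vinner H (a i) (a j) * Q i j)
   = Re (\<Sum>i\<in>J. \<Sum>j\<in>J. vinner H (a' i) (a' j) * Q i j)
   + r * Re (\<Sum>i\<in>insert n J. \<Sum>j\<in>insert n J. cnj (\<beta> i) * \<beta> j * Q i j)"
  by simp
 have "0 <= Re (\<Sum>i\<in>J. \<Sum>j\<in>J. vinner H (a' i) (a' j) * Q i j)"
 proof (rule insert.IH)
  show "a' i : vecs H" if "i : J" for i using am that by (auto simp: a'_def)
  fix c
  have "(\<Sum>i\<in>insert n J. \<Sum>j\<in>insert n J. cnj ((c(n := 0)) i) * (c(n := 0)) j * Q i j)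
   = (\<Sum>i\<in>J. \<Sum>j\<in>J. cnj ((c(n := 0)) i) * (c(n := 0)) j * Q i j)"
   using insert.hyps by simp
  also have "... = (\<Sum>i\<in>J. \<Sum>j\<in>J. cnj (c i) * c j * Q i j)"
   using insert.hyps by (intro sum.cong) auto
  finally show "0 <= Re (\<Sum>i\<in>J. \<Sum>j\<in>J. cnj (c i) * c j * Q i j)"
   using insert.prems(2)[of "c(n := 0)"] by simp
 qed
 moreover have "0 <= r * Re (\<Sum>i\<in>insert n J. \<Sum>j\<in>insert n J. cnj (\<beta> i) * \<beta> j * Q i j)"
  using insert.prems(2)[of \<beta>] by (intro mult_nonneg_nonneg) (auto simp: r_def)
 ultimately show ?case unfolding eq by simp
qed simp

lemma lookup_map_times:
 "plookup (Poly_Mapping.map ((*) (c::complex)) \<phi>) x = c * plookup \<phi> x"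
 by (simp add: Poly_Mapping.map.rep_eq when_def)

lemma keys_map_times: "pkeys (Poly_Mapping.map ((*) (c::complex)) \<phi>) \<subseteq> pkeys \<phi>"
 by (auto simp: in_keys_iff lookup_map_times)

lemma algebraic_tensor_simps:
 "vecs (algebraic_tensor H K) = {\<phi>. pkeys \<phi> \<subseteq> vecs H \<times> vecs K}"
 "vzero (algebraic_tensor H K) = 0"
 "vadd (algebraic_tensor H K) = (+)"
 "vscale (algebraic_tensor H K) = (%c. Poly_Mapping.map ((*) c))"
 by (simp_all add: algebraic_tensor_def)

lemma algebraic_tensor_inner:
 assumes "finite S" "finite T" "pkeys \<phi> \<subseteq> S" "pkeys \<psi> \<subseteq> T"
 shows "vinner (algebraic_tensor H K) \<phi> \<psi> = (\<Sum>x\<in>S. \<Sum>y\<in>T.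
  cnj (plookup \<phi> x) * plookup \<psi> y *
   (vinner H (fst x) (fst y) * vinner K (snd x) (snd y)))"
proof -
 have "vinner (algebraic_tensor H K) \<phi> \<psi> = (\<Sum>x\<in>pkeys \<phi>. \<Sum>y\<in>T.
  cnj (plookup \<phi> x) * plookup \<psi> y *
   (vinner H (fst x) (fst y) * vinner K (snd x) (snd y)))"
  unfolding algebraic_tensor_def ip_space.simps using assms
  by (intro sum.cong[OF refl] sum.mono_neutral_left) (auto simp: in_keys_iff)
 also have "... = (\<Sum>x\<in>S. \<Sum>y\<in>T.
  cnj (plookup \<phi> x) * plookup \<psi> y *
   (vinner H (fst x) (fst y) * vinner K (snd x) (snd y)))"
  using assms by (intro sum.mono_neutral_left) (auto simp: in_keys_iff)
 finally show ?thesis .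
qed

lemma pre_hilbert_algebraic_tensor:
 assumes "pre_hilbert H" "pre_hilbert K"
 shows "pre_hilbert (algebraic_tensor H K)"
proof -
 interpret H: pre_hilbert H by fact
 interpret K: pre_hilbert K by fact
 let ?A = "algebraic_tensor H K"
 show ?thesis
 proof (unfold_locales, goal_cases)
  case 1 show ?case by (simp add: algebraic_tensor_simps)
 next
  case (2 x y) thus ?case using Poly_Mapping.keys_add[of x y] by (auto simp: algebraic_tensor_simps)
 next
  case (3 x c) thus ?case using keys_map_times[of c x] by (auto simp: algebraic_tensor_simps)
 next
  case (4 z) show ?case by (simp add: algebraic_tensor_def)
 next
  case (5 z x y)
  let ?S = "pkeys z" let ?T = "pkeys x \<union> pkeys y"
  show ?case
   unfolding algebraic_tensor_simps
   by (subst (1 2 3) algebraic_tensor_inner[of ?S ?T])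
   (use Poly_Mapping.keys_add[of x y] in
   \<open>auto simp: lookup_add sum.distrib[symmetric] algebra_simps\<close>)
 next
  case (6 z x c)
  let ?S = "pkeys z" let ?T = "pkeys x"
  show ?case
   unfolding algebraic_tensor_simps
   by (subst (1 2) algebraic_tensor_inner[of ?S ?T])
   (use keys_map_times[of c x] in "auto simp: lookup_map_times sum_distrib_left mult_ac")
 next
  case (7 x y)
  hence k: "pkeys x \<subseteq> vecs H \<times> vecs K" "pkeys y \<subseteq> vecs H \<times> vecs K"
   by (auto simp: algebraic_tensor_simps)
  have "vinner ?A y x = (\<Sum>b\<in>pkeys y. \<Sum>a\<in>pkeys x.
   cnj (cnj (plookup x a) * plookup y b *
   (vinner H (fst a) (fst b) * vinner K (snd a) (snd b))))"
   unfolding algebraic_tensor_def using k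
   by (auto intro!: sum.cong simp: H.inner_commute[of "fst (_, _)"] mult_ac)
   (metis H.inner_commute K.inner_commute SigmaE fst_conv mem_Sigma_iff snd_conv subset_eq)
  also have "... = cnj (vinner ?A x y)"
   by (subst sum.swap) (simp add: algebraic_tensor_def cnj_sum)
  finally show ?case .
 next
  case (8 x)
  hence k: "pkeys x \<subseteq> vecs H \<times> vecs K" by (auto simp: algebraic_tensor_simps)
  let ?I = "pkeys x" let ?l = "plookup x"
  define Q where "Q a b = cnj (?l a) * ?l b * vinner K (snd a) (snd b)" for a b
  have "0 <= Re (\<Sum>a\<in>?I. \<Sum>b\<in>?I. vinner H (fst a) (fst b) * Q a b)"
  proof (rule H.schur_product)
   show "fst i : vecs H" if "i : ?I" for i using k that by auto
   fix c
   have "0 <= Re (\<Sum>a\<in>?I. \<Sum>b\<in>?I. vinner K (snd a) (snd b) * (cnj (c a * ?l a) * (c b * ?l b)))"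
   proof (rule K.schur_product)
   show "snd i : vecs K" if "i : ?I" for i using k that by auto
   fix d
   have "(\<Sum>i\<in>?I. \<Sum>j\<in>?I. cnj (d i) * d j * (cnj (c i * ?l i) * (c j * ?l j)))
   = cnj (\<Sum>i\<in>?I. d i * (c i * ?l i)) * (\<Sum>j\<in>?I. d j * (c j * ?l j))"
   unfolding cnj_sum sum_product by (intro sum.cong refl) (simp add: mult_ac)
   moreover have "0 <= Re (cnj z * z)" for z by simp
   ultimately show "0 <= Re (\<Sum>i\<in>?I. \<Sum>j\<in>?I. cnj (d i) * d j * (cnj (c i * ?l i) * (c j * ?l j)))"
   by (simp only:)
   qed simp
   thus "0 <= Re (\<Sum>i\<in>?I. \<Sum>j\<in>?I. cnj (c i) * c j * Q i j)" by (simp add: Q_def mult_ac)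
  qed simp
  thus ?case by (simp add: algebraic_tensor_def Q_def mult_ac)
 qed
qed


lemma algebraic_tensor_single_inner:
 "vinner (algebraic_tensor H K) (psingle x c) (psingle y d)
   = cnj c * d * (vinner H (fst x) (fst y) * vinner K (snd x) (snd y))"
 by (subst algebraic_tensor_inner[of "{x}" "{y}"]) (auto simp: lookup_single)

lemma algebraic_tensor_expand_left:
 "vinner (algebraic_tensor H K) \<phi> \<psi> = (\<Sum>x\<in>pkeys \<phi>.
   cnj (plookup \<phi> x) * vinner (algebraic_tensor H K) (psingle x 1) \<psi>)"
proof -
 have "vinner (algebraic_tensor H K) (psingle x 1) \<psi> = (\<Sum>y\<in>pkeys \<psi>.
   plookup \<psi> y * (vinner H (fst x) (fst y) * vinner K (snd x) (snd y)))" for x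
  by (subst algebraic_tensor_inner[of "{x}" "pkeys \<psi>"]) (auto simp: lookup_single)
 thus ?thesis
  by (subst algebraic_tensor_inner[of "pkeys \<phi>" "pkeys \<psi>"])
   (auto simp: sum_distrib_left mult_ac)
qed

lemma algebraic_tensor_sum:
 assumes "pre_hilbert H" "pre_hilbert K" "finite S"
  and "!!s. s : S ==> F s : vecs (algebraic_tensor H K)"
 shows "sum F S : vecs (algebraic_tensor H K) & (\<forall>\<psi>\<in>vecs (algebraic_tensor H K).
  vinner (algebraic_tensor H K) \<psi> (sum F S) = (\<Sum>s\<in>S. vinner (algebraic_tensor H K) \<psi> (F s)))"
proof -
 interpret A: pre_hilbert "algebraic_tensor H K" by (rule pre_hilbert_algebraic_tensor) fact+
 show ?thesis using assms(3,4)
 proof (induction S rule: finite_induct)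
  case empty
  show ?case using A.zero_mem A.inner_zero by (simp add: algebraic_tensor_simps)
 next
  case (insert s S)
  thus ?case using A.add_mem[of "F s" "sum F S"] A.inner_add[of _ "F s" "sum F S"]
   by (simp add: algebraic_tensor_simps)
 qed
qed

definition tensor_map :: "('v => 'v) => ('w => 'w) => (('v \<times> 'w) \<Rightarrow>\<^sub>0 complex) => (('v \<times> 'w) \<Rightarrow>\<^sub>0 complex)"
 where "tensor_map U V \<phi> = (\<Sum>ab\<in>pkeys \<phi>.
  psingle (U (fst ab), V (snd ab)) (plookup \<phi> ab))"

lemma (in pre_hilbert) isometry_on_dist:
 assumes U: "isometry_on H U" and "x : vecs H" "y : vecs H"
 shows "vdist H (U x) (U y) = vdist H x y"
proof -
 have "(vdist H (U x) (U y))^2 = (vdist H x y)^2"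
  using assms by (simp add: isometry_on_def dist_power2 norm_power2)
 thus ?thesis using assms by (simp add: isometry_on_def power2_eq_iff_nonneg)
qed

lemma tensor_map_isometry:
 assumes H: "pre_hilbert H" and K: "pre_hilbert K" and U: "isometry_on H U" and V: "isometry_on K V"
 shows "isometry_on (algebraic_tensor H K) (tensor_map U V)"
proof -
 let ?A = "algebraic_tensor H K"
 interpret A: pre_hilbert ?A by (rule pre_hilbert_algebraic_tensor) fact+
 have s: "psingle (U (fst ab), V (snd ab)) (plookup \<phi> ab) : vecs ?A"
  if "\<phi> : vecs ?A" "ab : pkeys \<phi>" for \<phi> ab
  using that U V by (auto simp: algebraic_tensor_simps isometry_on_def)
 have ms: "tensor_map U V \<phi> : vecs ?A & (\<forall>\<psi>\<in>vecs ?A. vinner ?A \<psi> (tensor_map U V \<phi>)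
   = (\<Sum>ab\<in>pkeys \<phi>. vinner ?A \<psi>
   (psingle (U (fst ab), V (snd ab)) (plookup \<phi> ab))))"
  if "\<phi> : vecs ?A" for \<phi>
  unfolding tensor_map_def by (rule algebraic_tensor_sum[OF H K finite_keys]) (rule s[OF that])
 have m: "tensor_map U V \<phi> : vecs ?A" if "\<phi> : vecs ?A" for \<phi> using ms[OF that] by simp
 have r: "vinner ?A \<psi> (tensor_map U V \<phi>) = (\<Sum>ab\<in>pkeys \<phi>. vinner ?A \<psi>
   (psingle (U (fst ab), V (snd ab)) (plookup \<phi> ab)))"
  if "\<phi> : vecs ?A" "\<psi> : vecs ?A" for \<phi> \<psi>
  using ms[OF that(1)] that(2) by (rule conjunct2[THEN bspec])
 show ?thesis
  unfolding isometry_on_def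
 proof (intro conjI ballI m)
  fix \<phi> \<psi> assume p: "\<phi> : vecs ?A" "\<psi> : vecs ?A"
  have "vinner ?A (tensor_map U V \<phi>) (tensor_map U V \<psi>) = (\<Sum>b\<in>pkeys \<psi>.
   cnj (vinner ?A (psingle (U (fst b), V (snd b)) (plookup \<psi> b)) (tensor_map U V \<phi>)))"
   unfolding r[OF p(2) m[OF p(1)]]
   by (rule sum.cong[OF refl]) (rule A.inner_commute[OF s[OF p(2)] m[OF p(1)]])
  also have "... = (\<Sum>b\<in>pkeys \<psi>. \<Sum>a\<in>pkeys \<phi>.
   cnj (vinner ?A (psingle (U (fst b), V (snd b)) (plookup \<psi> b))
   (psingle (U (fst a), V (snd a)) (plookup \<phi> a))))"
   by (rule sum.cong[OF refl]) (simp only: r[OF p(1) s[OF p(2)]] cnj_sum)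
  also have "... = (\<Sum>b\<in>pkeys \<psi>. \<Sum>a\<in>pkeys \<phi>.
   vinner ?A (psingle (U (fst a), V (snd a)) (plookup \<phi> a))
   (psingle (U (fst b), V (snd b)) (plookup \<psi> b)))"
   by (rule sum.cong[OF refl], rule sum.cong[OF refl])
   (rule A.inner_commute[OF s[OF p(2)] s[OF p(1)], symmetric])
  also have "... = (\<Sum>b\<in>pkeys \<psi>. \<Sum>a\<in>pkeys \<phi>.
   cnj (plookup \<phi> a) * plookup \<psi> b *
   (vinner H (fst a) (fst b) * vinner K (snd a) (snd b)))"
  proof (intro sum.cong refl)
   fix a b assume ab: "b : pkeys \<psi>" "a : pkeys \<phi>"
   hence "fst a : vecs H" "snd a : vecs K" "fst b : vecs H" "snd b : vecs K"
   using p by (auto simp: algebraic_tensor_simps)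
   thus "vinner ?A (psingle (U (fst a), V (snd a)) (plookup \<phi> a))
   (psingle (U (fst b), V (snd b)) (plookup \<psi> b))
   = cnj (plookup \<phi> a) * plookup \<psi> b *
   (vinner H (fst a) (fst b) * vinner K (snd a) (snd b))"
   using U V by (simp add: algebraic_tensor_single_inner isometry_on_def)
  qed
  also have "... = vinner ?A \<phi> \<psi>"
   by (subst sum.swap) (simp add: algebraic_tensor_def)
  finally show "vinner ?A (tensor_map U V \<phi>) (tensor_map U V \<psi>) = vinner ?A \<phi> \<psi>" .
 qed
qed

lemma (in pre_hilbert) completion_isometry:
 assumes U: "isometry_on H U"
 shows "isometry_on (completion H) (%X n. U (X n))"
proof -
 have h: "hcauchy H (%n. U (X n))" if "hcauchy H X" for X
  using that U isometry_on_dist[OF U] by (auto simp: hcauchy_def isometry_on_def)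
 show ?thesis
  unfolding isometry_on_def completion_simps
 proof (intro conjI ballI)
  fix X Y assume "X : Collect (hcauchy H)" "Y : Collect (hcauchy H)"
  hence c: "hcauchy H X" "hcauchy H Y" by auto
  hence "(%n. vinner H (U (X n)) (U (Y n))) = (%n. vinner H (X n) (Y n))"
   using U by (auto simp: isometry_on_def hcauchy_def)
  thus "vinner (completion H) (%n. U (X n)) (%n. U (Y n)) = vinner (completion H) X Y"
   using completion_inner_tendsto[OF c] completion_inner_tendsto[OF h h, OF c] LIMSEQ_unique by simp
 qed (use h in auto)
qed

lemma hilbert_hilbert_tensor: "pre_hilbert H ==> pre_hilbert K ==> hilbert (hilbert_tensor H K)"
 unfolding hilbert_tensor_def
 by (rule pre_hilbert.hilbert_completion) (rule pre_hilbert_algebraic_tensor)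

lemma pure_tensor_mem:
 "pre_hilbert H ==> pre_hilbert K ==> a : vecs H ==> b : vecs K ==>
   pure_tensor a b : vecs (hilbert_tensor H K)"
 unfolding hilbert_tensor_def pure_tensor_def completion_simps
 by (auto intro!: pre_hilbert.hcauchy_const[OF pre_hilbert_algebraic_tensor]
   simp: algebraic_tensor_simps)

lemma pure_tensor_inner:
 assumes "pre_hilbert H" "pre_hilbert K" "a : vecs H" "b : vecs K" "c : vecs H" "d : vecs K"
 shows "vinner (hilbert_tensor H K) (pure_tensor a b) (pure_tensor c d) = vinner H a c * vinner K b d"
proof -
 interpret A: pre_hilbert "algebraic_tensor H K" by (rule pre_hilbert_algebraic_tensor) fact+
 show ?thesis
  unfolding hilbert_tensor_def pure_tensor_def
  by (subst A.completion_const_inner)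
   (use assms in "auto simp: algebraic_tensor_simps algebraic_tensor_single_inner")
qed

lemma outer_tensor_act: "act (outer_tensor R S) (g, h) X = (%n. tensor_map (act R g) (act S h) (X n))"
 by (simp add: outer_tensor_def tensor_map_def)

lemma outer_tensor_isometry:
 assumes "pre_hilbert (hspace R)" "pre_hilbert (hspace S)"
  and "isometry_on (hspace R) (act R g)" "isometry_on (hspace S) (act S h)"
 shows "isometry_on (hspace (outer_tensor R S)) (act (outer_tensor R S) (g, h))"
 unfolding outer_tensor_act
 by (simp add: outer_tensor_def hilbert_tensor_def)
   (intro pre_hilbert.completion_isometry pre_hilbert_algebraic_tensor tensor_map_isometry assms)

lemma outer_tensor_act_pure:
 "act (outer_tensor R S) (g, h) (pure_tensor a b) = pure_tensor (act R g a) (act S h b)"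
 by (simp add: outer_tensor_act pure_tensor_def tensor_map_def lookup_single)

text \<open>A map that multiplies inner products by a constant is linear up to vectors of norm zero.\<close>

lemma scaled_isometry_linear:
 assumes "pre_hilbert H" "pre_hilbert T" and p: "!!u. u : vecs H ==> p u : vecs T"
  and inn: "!!u v. u : vecs H ==> v : vecs H ==> vinner T (p u) (p v) = of_real q * vinner H u v"
  and m: "s : vecs H" "y : vecs H" "X : vecs T"
 shows "vinner T (p (vadd H (vscale H c s) y)) X = cnj c * vinner T (p s) X + vinner T (p y) X"
proof -
 interpret H: pre_hilbert H by fact
 interpret T: pre_hilbert T by fact
 let ?u = "vadd H (vscale H c s) y" and ?w = "vadd T (vscale T c (p s)) (p y)"
 have mm: "?u : vecs H" "p ?u : vecs T" "?w : vecs T" using m p by auto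
 have uw: "vinner T (p ?u) ?w = of_real q * vinner H ?u ?u" using m mm p by (simp add: inn algebra_simps)
 have ww: "vinner T ?w ?w = of_real q * vinner H ?u ?u" using m mm p by (simp add: inn algebra_simps)
 have "(vdist T (p ?u) ?w)^2 = 0"
  unfolding T.dist_power2[OF mm(2,3)] T.norm_power2[OF mm(2)] T.norm_power2[OF mm(3)] uw ww inn[OF mm(1,1)] by simp
 hence "vinner T X (p ?u) = vinner T X ?w" by (intro T.inner_veq mm m) (simp add: veq_def)
 hence "vinner T (p ?u) X = vinner T ?w X"
  unfolding T.inner_commute[OF m(3) mm(2)] T.inner_commute[OF m(3) mm(3)] by (rule arg_cong)
 thus ?thesis using m p by simp
qed

lemma scaled_isometry_zero:
 assumes H: "pre_hilbert H" and T: "pre_hilbert T" and p: "!!u. u : vecs H ==> p u : vecs T"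
  and inn: "!!u v. u : vecs H ==> v : vecs H ==> vinner T (p u) (p v) = of_real q * vinner H u v"
  and S: "vtotal H S" and X: "X : vecs T" and 0: "!!s. s : S ==> vinner T (p s) X = 0" and x: "x : vecs H"
 shows "vinner T (p x) X = 0"
proof -
 interpret H: pre_hilbert H by fact
 interpret T: pre_hilbert T by fact
 have SH: "S \<subseteq> vecs H" using S by (simp add: vtotal_def)
 show ?thesis
 proof (rule H.functional_zero_on_total[OF S x, of "%x. vinner T (p x) X" "vnorm T X * sqrt q"])
  have "vnorm T (p (vzero H)) = 0" using inn[of "vzero H" "vzero H"] by (simp add: vnorm_def)
  thus "vinner T (p (vzero H)) X = 0" using T.cauchy_schwarz[OF p[OF H.zero_mem] X] by simp
  show "vinner T (p (vadd H (vscale H c s) y)) X = cnj c * vinner T (p s) X + vinner T (p y) X"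
   if "s : S" "y : vecs H" for s y c
   by (rule scaled_isometry_linear[OF H T p inn _ that(2) X]) (use that SH in auto)
  fix u v assume uv: "u : vecs H" "v : vecs H"
  note m = p[OF uv(1)] p[OF uv(2)]
  have "(vdist T (p u) (p v))^2 = q * (vdist H u v)^2"
   unfolding T.dist_power2[OF m] H.dist_power2[OF uv] T.norm_power2[OF m(1)] T.norm_power2[OF m(2)]
   H.norm_power2[OF uv(1)] H.norm_power2[OF uv(2)] using uv by (simp add: inn algebra_simps)
  hence "sqrt ((vdist T (p u) (p v))^2) = sqrt (q * (vdist H u v)^2)" by (rule arg_cong)
  hence d: "vdist T (p u) (p v) = sqrt q * vdist H u v"
   using T.dist_nonneg[OF m] H.dist_nonneg[OF uv] by (simp add: real_sqrt_mult)
  have "vinner T (p u) X - vinner T (p v) X = cnj (vinner T X (p u) - vinner T X (p v))"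
   unfolding T.inner_commute[OF X m(1)] T.inner_commute[OF X m(2)] by simp
  thus "cmod (vinner T (p u) X - vinner T (p v) X) <= vnorm T X * sqrt q * vdist H u v"
   using T.inner_diff_le[OF m X] unfolding d by (simp only: complex_mod_cnj mult.assoc)
 qed (rule 0)
qed

text \<open>Bilinearity and continuity of the pure tensors extend orthogonality from the products of two
  total sets first to all pure tensors and then to the whole space.\<close>

lemma pure_tensors_orth_total:
 assumes H: "pre_hilbert H" and K: "pre_hilbert K" and A: "vtotal H A" and B: "vtotal K B"
 shows "orth_total (hilbert_tensor H K) {pure_tensor a b | a b. a : A & b : B}"
proof -
 interpret H: pre_hilbert H by fact
 interpret K: pre_hilbert K by fact
 let ?A = "algebraic_tensor H K" and ?T = "hilbert_tensor H K"
 interpret AA: pre_hilbert ?A by (rule pre_hilbert_algebraic_tensor) fact+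
 interpret T: hilbert ?T by (rule hilbert_hilbert_tensor) fact+
 note mem = pure_tensor_mem[OF H K] and inn = pure_tensor_inner[OF H K]
 have AH: "A \<subseteq> vecs H" and BK: "B \<subseteq> vecs K" using A B by (auto simp: vtotal_def)
 show ?thesis
  unfolding orth_total_def
 proof (intro conjI ballI impI)
  show "{pure_tensor a b | a b. a : A & b : B} \<subseteq> vecs ?T" using mem AH BK by auto
  fix X assume X: "X : vecs ?T"
   and 0: "ALL s:{pure_tensor a b | a b. a : A & b : B}. vinner ?T s X = 0"
  have Xh: "hcauchy ?A X" using X by (simp add: hilbert_tensor_def completion_simps)
  have Xm: "X n : vecs ?A" for n using Xh by (simp add: hcauchy_def)
  have sm: "psingle (a, b) 1 : vecs ?A" if "a : vecs H" "b : vecs K" for a b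
   using that by (simp add: algebraic_tensor_simps)
  have lim: "(%n. vinner ?A (psingle (a, b) 1) (X n)) -->> vinner ?T (pure_tensor a b) X"
   if "a : vecs H" "b : vecs K" for a b
   using AA.completion_inner_tendsto[OF AA.hcauchy_const[OF sm[OF that]] Xh]
   by (simp add: pure_tensor_def hilbert_tensor_def)
  have z1: "vinner ?T (pure_tensor a b) X = 0" if a: "a : vecs H" and b: "b : B" for a b
  proof (rule scaled_isometry_zero[OF H T.pre_hilbert_axioms, where p = "%a. pure_tensor a b" and q = "(vnorm K b)^2", OF _ _ A X _ a])
   have bK: "b : vecs K" using b BK by auto
   show "pure_tensor u b : vecs ?T" if "u : vecs H" for u using mem[OF that bK] .
   show "vinner ?T (pure_tensor u b) (pure_tensor v b) = of_real ((vnorm K b)^2) * vinner H u v"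
   if "u : vecs H" "v : vecs H" for u v
   unfolding inn[OF that(1) bK that(2) bK] K.inner_self[OF bK] by simp
  qed (use 0 b in auto)
  have z2: "vinner ?T (pure_tensor a b) X = 0" if a: "a : vecs H" and b: "b : vecs K" for a b
  proof (rule scaled_isometry_zero[OF K T.pre_hilbert_axioms, where p = "pure_tensor a" and q = "(vnorm H a)^2", OF _ _ B X _ b])
   show "pure_tensor a u : vecs ?T" if "u : vecs K" for u using mem[OF a that] .
   show "vinner ?T (pure_tensor a u) (pure_tensor a v) = of_real ((vnorm H a)^2) * vinner K u v"
   if "u : vecs K" "v : vecs K" for u v
   unfolding inn[OF a that(1) a that(2)] H.inner_self[OF a] by simp
  qed (use z1[OF a] in auto)
  show "vnorm ?T X = 0"
   unfolding hilbert_tensor_def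
  proof (rule AA.completion_orth_total)
   show "X : vecs (completion ?A)" using X by (simp add: hilbert_tensor_def)
   fix \<phi> assume \<phi>: "\<phi> : vecs ?A"
   have "(%n. vinner ?A \<phi> (X n)) -->> (\<Sum>x\<in>pkeys \<phi>. cnj (plookup \<phi> x) * 0)"
   unfolding algebraic_tensor_expand_left[of H K \<phi>]
   proof (intro tendsto_sum tendsto_mult tendsto_const)
   fix x assume "x : pkeys \<phi>"
   then obtain a b where x: "x = (a, b)" "a : vecs H" "b : vecs K"
   using \<phi> by (auto simp: algebraic_tensor_simps)
   show "(%n. vinner ?A (psingle x 1) (X n)) -->> 0"
   using lim[OF x(2,3)] z2[OF x(2,3)] x(1) by simp
   qed
   thus "vinner (completion ?A) (%_. \<phi>) X = 0"
   using AA.completion_inner_tendsto[OF AA.hcauchy_const[OF \<phi>] Xh] LIMSEQ_unique by fastforce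
  qed
 qed
qed


section \<open>Square-integrable sections\<close>

lemma (in pre_hilbert) hcauchyI_geometric:
 assumes Y: "!!n. Y n : vecs H" and le: "!!n. vdist H (Y (Suc n)) (Y n) <= c * (1/2) ^ n"
 shows "hcauchy H Y"
 unfolding hcauchy_def
proof (intro conjI allI impI Y)
 have c: "c >= 0" using le[of 0] dist_nonneg[OF Y Y, of 1 0] by simp
 have step: "vdist H (Y (n + k)) (Y n) <= 2 * c * (1/2) ^ n * (1 - (1/2) ^ k)" for n k
 proof (induction k)
  case 0 show ?case using Y by simp
 next
  case (Suc k)
  have "vdist H (Y (n + Suc k)) (Y n) <= c * (1/2) ^ (n + k) + 2 * c * (1/2) ^ n * (1 - (1/2) ^ k)"
   using dist_triangle[OF Y[of "Suc (n + k)"] Y[of "n + k"] Y[of n]] le[of "n + k"] Suc by simp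
  also have "... = 2 * c * (1/2) ^ n * (1 - (1/2) ^ Suc k)"
   by (simp add: power_add field_simps)
  finally show ?case .
 qed
 have tail: "vdist H (Y (n + k)) (Y n) <= 2 * c * (1/2) ^ n" for n k
 proof -
  have "2 * c * (1/2) ^ n * (1 - (1/2) ^ k) <= 2 * c * (1/2) ^ n * 1"
   using c by (intro mult_left_mono) auto
  with step[of n k] show ?thesis by linarith
 qed
 fix e :: real assume e: "e > 0"
 have "(%n. 4 * c * (1/2) ^ n) -->> 4 * c * 0"
  by (intro tendsto_intros LIMSEQ_power_zero) simp
 hence "eventually (%n. 4 * c * (1/2) ^ n < e) sequentially"
  using e by (intro order_tendstoD(2)[of _ 0]) auto
 then obtain N where N: "4 * c * (1/2) ^ N < e" using eventually_happens by fastforce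
 have "vdist H (Y m) (Y n) < e" if "m >= N" "n >= N" for m n
 proof -
  have "vdist H (Y m) (Y n) <= vdist H (Y m) (Y N) + vdist H (Y n) (Y N)"
   using dist_triangle[OF Y[of m] Y[of N] Y[of n]] dist_commute[OF Y[of N] Y[of n]] by simp
  also have "... <= 2 * c * (1/2) ^ N + 2 * c * (1/2) ^ N"
   using tail[of N "m - N"] tail[of N "n - N"] that by simp
  finally show ?thesis using N by simp
 qed
 thus "EX N. \<forall>m\<ge>N. \<forall>n\<ge>N. vdist H (Y m) (Y n) < e" by blast
qed

text \<open>The Riesz--Fischer argument, fibre by fibre: a rapidly converging subsequence is a Cauchy
  sequence in almost every fibre. Where it is not, the limit is filled up with the first member of
  the sequence, which keeps it measurable.\<close>

lemma square_integrable_field_limit: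
 fixes H :: "'z => 'v ip_space" and X :: "nat => 'z => 'v"
 assumes H: "!!z. z : space M ==> hilbert (H z)"
  and X: "!!n z. z : space M ==> X n z : vecs (H z)"
  and int: "!!m n. integrable M (%z. (vdist (H z) (X m z) (X n z))^2)"
  and cau: "!!\<epsilon>. \<epsilon> > 0 ==> EX N. \<forall>m\<ge>N. \<forall>n\<ge>N. (LINT z|M. (vdist (H z) (X m z) (X n z))^2) < \<epsilon>"
 obtains x r Z where "Z : sets M" "AE z in M. z : Z" "!!z. z : space M ==> x z : vecs (H z)"
  "!!z. z : Z ==> (%n. vdist (H z) (X (r n) z) (x z)) -->> 0"
  "!!z. z : space M - Z ==> x z = X 0 z"
  "!!m. integrable M (%z. (vdist (H z) (X m z) (x z))^2)"
  "(%m. LINT z|M. (vdist (H z) (X m z) (x z))^2) -->> 0"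
proof -
 have P: "pre_hilbert (H z)" if "z : space M" for z using H[OF that] by (simp add: hilbert_def)
 note [measurable] = borel_measurable_integrable[OF int]
 define N where "N k = (SOME N. \<forall>m\<ge>N. \<forall>n\<ge>N. (LINT z|M. (vdist (H z) (X m z) (X n z))^2) < (1/8) ^ k)" for k :: nat
 have N: "(LINT z|M. (vdist (H z) (X m z) (X n z))^2) < (1/8) ^ k" if "m >= N k" "n >= N k" for m n k
  using someI_ex[OF cau[of "(1/8) ^ k"]] that by (simp add: N_def)
 define r where "r k = (\<Sum>i\<le>k. N i) + k" for k
 have rN: "r k >= N k" "r (Suc k) >= N k" "r k >= k" for k
  using member_le_sum[of k "{..k}" N] by (auto simp: r_def)
 define h where "h k z = (vdist (H z) (X (r (Suc k)) z) (X (r k) z))^2" for k z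
 have hm [measurable]: "h k : bmeas M" for k unfolding h_def by measurable
 define S where "S z = suminf (%k. ennreal (4 ^ k * h k z))" for z
 have Sm [measurable]: "S : bmeas M" unfolding S_def by measurable
 have "(nn_integral M (%z. S z)) = suminf (%k. nn_integral M (%z. ennreal (4 ^ k * h k z)))"
  unfolding S_def by (rule nn_integral_suminf) measurable
 also have "... <= suminf (%k. ennreal ((1/2) ^ k))"
 proof (rule suminf_le)
  fix k
  have "(nn_integral M (%z. ennreal (4 ^ k * h k z))) = ennreal (LINT z|M. 4 ^ k * h k z)"
   by (rule nn_integral_eq_integral) (auto simp: h_def int)
  also have "(LINT z|M. 4 ^ k * h k z) = 4 ^ k * (LINT z|M. h k z)" by simp
  also have "... <= 4 ^ k * (1/8) ^ k"
   using N[OF rN(2) rN(1), of k] by (intro mult_left_mono) (auto simp: h_def)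
  also have "(4::real) ^ k * (1/8) ^ k = (1/2) ^ k" by (simp add: power_mult_distrib[symmetric])
  finally show "(nn_integral M (%z. ennreal (4 ^ k * h k z))) <= ennreal ((1/2) ^ k)" by (simp add: ennreal_leI)
 qed auto
 also have "... = ennreal (suminf (%k. (1/2) ^ k))"
  by (rule suminf_ennreal2) (auto simp: summable_geometric)
 also have "... < \<infinity>" by simp
 finally have fin: "(nn_integral M (%z. S z)) ~= \<infinity>" by simp
 define Z where "Z = {z : space M. S z ~= \<infinity>}"
 have Zs [measurable]: "Z : sets M" unfolding Z_def by measurable
 have AEZ: "AE z in M. z : Z"
  using nn_integral_PInf_AE[OF Sm fin] by (auto simp: Z_def)
 have Zc: "hcauchy (H z) (%n. X (r n) z)" if z: "z : Z" for z
 proof -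
  have zM: "z : space M" using z by (simp add: Z_def)
  interpret pre_hilbert "H z" using P zM .
  obtain C where C: "S z = ennreal C" "C >= 0" using z by (cases "S z") (auto simp: Z_def)
  have hC: "4 ^ k * h k z <= C" for k
  proof -
   have "ennreal (4 ^ k * h k z) <= S z" unfolding S_def
   using sum_le_suminf[of "%k. ennreal (4 ^ k * h k z)" "{k}"] by simp
   thus ?thesis using C by simp
  qed
  have "(2 ^ k * vdist (H z) (X (r (Suc k)) z) (X (r k) z))^2 <= (sqrt C)^2" for k
  proof -
   have "((2::real) ^ k)^2 = 4 ^ k"
   by (subst power_mult[symmetric], subst mult.commute, subst power_mult) simp
   thus ?thesis using hC[of k] C(2) by (simp add: h_def power_mult_distrib)
  qed
  hence "2 ^ k * vdist (H z) (X (r (Suc k)) z) (X (r k) z) <= sqrt C" for k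
   using C(2) power2_le_imp_le[of _ "sqrt C"] by (meson real_sqrt_ge_zero)
  hence "vdist (H z) (X (r (Suc k)) z) (X (r k) z) <= sqrt C * (1/2) ^ k" for k
   by (simp add: power_one_over field_simps)
  thus ?thesis using X[OF zM] by (intro hcauchyI_geometric) auto
 qed
 define x where "x z = (if z : Z then (SOME x. x : vecs (H z) & (%n. vdist (H z) (X (r n) z) x) -->> 0)
  else X 0 z)" for z
 have x_out: "x z = X 0 z" if "z \<notin> Z" for z using that by (simp add: x_def)
 have xZ: "x z : vecs (H z) & (%n. vdist (H z) (X (r n) z) (x z)) -->> 0" if z: "z : Z" for z
 proof -
  have "EX x. x : vecs (H z) & (%n. vdist (H z) (X (r n) z) x) -->> 0"
   using hilbert.complete[OF H Zc[OF z]] z unfolding Z_def by blast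
  from someI_ex[OF this] show ?thesis unfolding x_def if_P[OF z] .
 qed
 have xm: "x z : vecs (H z)" if "z : space M" for z
  using xZ[of z] X[OF that] x_out[of z] by (cases "z : Z") auto
 have dlim: "(%n. (vdist (H z) (X m z) (X (r n) z))^2) -->> (vdist (H z) (X m z) (x z))^2" if z: "z : Z" for z m
 proof -
  have zM: "z : space M" using z by (simp add: Z_def)
  interpret pre_hilbert "H z" using P zM .
  note mm = X[OF zM] xm[OF zM]
  have "\<bar>vdist (H z) (X m z) (X (r n) z) - vdist (H z) (X m z) (x z)\<bar> <= vdist (H z) (X (r n) z) (x z)" for n
   using dist_triangle[OF mm(1)[of m] mm(1)[of "r n"] mm(2)] dist_triangle[OF mm(1)[of m] mm(2) mm(1)[of "r n"]]
   dist_commute[OF mm(1)[of "r n"] mm(2)] by linarith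
  hence "(%n. vdist (H z) (X m z) (X (r n) z) - vdist (H z) (X m z) (x z)) -->> 0"
   by (intro Lim_null_comparison[OF _ conjunct2[OF xZ[OF z]]] always_eventually) simp
  hence "(%n. vdist (H z) (X m z) (X (r n) z)) -->> vdist (H z) (X m z) (x z)"
   by (simp add: LIM_zero_iff)
  thus ?thesis by (rule tendsto_power)
 qed
 have dm [measurable]: "(%z. (vdist (H z) (X m z) (x z))^2) : bmeas M" for m
 proof (rule borel_measurable_LIMSEQ_real)
  show "(%z. if z : Z then (vdist (H z) (X m z) (X (r n) z))^2 else (vdist (H z) (X m z) (X 0 z))^2)
   : bmeas M" for n by measurable
  show "(%n. if z : Z then (vdist (H z) (X m z) (X (r n) z))^2 else (vdist (H z) (X m z) (X 0 z))^2)
   -->> (vdist (H z) (X m z) (x z))^2" if "z : space M" for z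
   using dlim[of z m] x_out[of z] by (cases "z : Z") auto
 qed
 have fatou: "(nn_integral M (%z. ennreal ((vdist (H z) (X m z) (x z))^2))) <= ennreal e"
  if e: "!!n. n >= K ==> (LINT z|M. (vdist (H z) (X m z) (X n z))^2) <= e" for m K e
 proof -
  have "(nn_integral M (%z. ennreal ((vdist (H z) (X m z) (x z))^2)))
   = (nn_integral M (%z. liminf (%n. ennreal ((vdist (H z) (X m z) (X (r n) z))^2))))"
  proof (rule nn_integral_cong_AE, use AEZ in eventually_elim)
   fix z assume "z : Z"
   from tendsto_ennrealI[OF dlim[OF this, of m]]
   show "ennreal ((vdist (H z) (X m z) (x z))^2) = liminf (%n. ennreal ((vdist (H z) (X m z) (X (r n) z))^2))"
   by (intro lim_imp_Liminf[symmetric]) auto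
  qed
  also have "... <= liminf (%n. nn_integral M (%z. ennreal ((vdist (H z) (X m z) (X (r n) z))^2)))"
   by (rule nn_integral_liminf) measurable
  also have "... <= ennreal e"
  proof (rule Liminf_le)
   show "\<forall>\<^sub>F n in sequentially. (nn_integral M (%z. ennreal ((vdist (H z) (X m z) (X (r n) z))^2))) <= ennreal e"
   unfolding eventually_sequentially
   proof (intro exI[of _ K] allI impI)
   fix n assume "n >= K"
   hence "r n >= K" using rN(3)[of n] by simp
   have "(nn_integral M (%z. ennreal ((vdist (H z) (X m z) (X (r n) z))^2)))
   = ennreal (LINT z|M. (vdist (H z) (X m z) (X (r n) z))^2)"
   by (rule nn_integral_eq_integral) (auto simp: int)
   thus "(nn_integral M (%z. ennreal ((vdist (H z) (X m z) (X (r n) z))^2))) <= ennreal e"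
   using e[OF \<open>r n >= K\<close>] by (simp add: ennreal_leI)
   qed
  qed simp
  finally show ?thesis .
 qed
 have bnd: "integrable M (%z. (vdist (H z) (X m z) (x z))^2) & (LINT z|M. (vdist (H z) (X m z) (x z))^2) <= e"
  if e: "!!n. n >= K ==> (LINT z|M. (vdist (H z) (X m z) (X n z))^2) <= e" "e >= 0" for m K e
 proof -
  have i: "integrable M (%z. (vdist (H z) (X m z) (x z))^2)"
   using fatou[OF e(1)] by (intro integrableI_bounded) (auto simp: less_top[symmetric] top_unique)
  moreover have "ennreal (LINT z|M. (vdist (H z) (X m z) (x z))^2) <= ennreal e"
   using fatou[OF e(1)] nn_integral_eq_integral[OF i] by simp
  ultimately show ?thesis using e(2) by simp
 qed
 obtain K1 where K1: "!!m n. m >= K1 ==> n >= K1 ==> (LINT z|M. (vdist (H z) (X m z) (X n z))^2) < 1"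
  using cau[of 1] by auto
 have i1: "integrable M (%z. (vdist (H z) (X K1 z) (x z))^2)"
  using bnd[of K1 K1 1] K1[of K1] less_imp_le by fastforce
 have i2: "integrable M (%z. (vdist (H z) (X m z) (x z))^2)" for m
 proof (rule b_integrable_bound)
  show "integrable M (%z. 2 * (vdist (H z) (X m z) (X K1 z))^2 + 2 * (vdist (H z) (X K1 z) (x z))^2)"
   using int i1 by simp
  show "AE z in M. norm ((vdist (H z) (X m z) (x z))^2)
   <= norm (2 * (vdist (H z) (X m z) (X K1 z))^2 + 2 * (vdist (H z) (X K1 z) (x z))^2)"
  proof (rule AE_I2)
   fix z assume zM: "z : space M"
   interpret pre_hilbert "H z" using P zM .
   have "(vdist (H z) (X m z) (x z))^2 <= (vdist (H z) (X m z) (X K1 z) + vdist (H z) (X K1 z) (x z))^2"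
   using dist_triangle[OF X[OF zM] X[OF zM] xm[OF zM]] X[OF zM] xm[OF zM] by (intro power_mono) auto
   also have "... <= 2 * (vdist (H z) (X m z) (X K1 z))^2 + 2 * (vdist (H z) (X K1 z) (x z))^2"
   using sum_squares_bound[of "vdist (H z) (X m z) (X K1 z)" "vdist (H z) (X K1 z) (x z)"]
   by (simp add: power2_sum)
   finally show "norm ((vdist (H z) (X m z) (x z))^2)
   <= norm (2 * (vdist (H z) (X m z) (X K1 z))^2 + 2 * (vdist (H z) (X K1 z) (x z))^2)" by simp
  qed
 qed measurable
 have l2: "(%m. LINT z|M. (vdist (H z) (X m z) (x z))^2) -->> 0"
 proof (rule LIMSEQ_I)
  fix e :: real assume e: "e > 0"
  obtain K where K: "!!m n. m >= K ==> n >= K ==> (LINT z|M. (vdist (H z) (X m z) (X n z))^2) < e / 2"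
   using cau[of "e / 2"] e by auto
  have "norm ((LINT z|M. (vdist (H z) (X m z) (x z))^2) - 0) < e" if "m >= K" for m
  proof -
   have "(LINT z|M. (vdist (H z) (X m z) (x z))^2) <= e / 2"
   using bnd[of K m "e / 2"] K[OF that] e by (auto simp: less_imp_le)
   moreover have "0 <= (LINT z|M. (vdist (H z) (X m z) (x z))^2)" by simp
   ultimately show ?thesis using e by (simp add: abs_of_nonneg)
  qed
  thus "EX no. \<forall>m\<ge>no. norm ((LINT z|M. (vdist (H z) (X m z) (x z))^2) - 0) < e" by blast
 qed
 show thesis
  by (rule that[where x = x and r = r and Z = Z, OF Zs AEZ xm conjunct2[OF xZ] x_out i2 l2]) auto
qed

lemma summable_on_iff_integrable_count_space_real:
 fixes f :: "'k => real"
 shows "f summable_on I \<longleftrightarrow> integrable (count_space I) f"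
 using Infinite_Set_Sum.abs_summable_equivalent[of f I] summable_on_iff_abs_summable_on_real[of f I]
 unfolding Infinite_Set_Sum.abs_summable_on_def by simp


lemma infsum_eq_integral_count_space:
 fixes f :: "'k => complex"
 assumes "integrable (count_space I) f"
 shows "infsum f I = (LINT k|count_space I. f k)"
 using infsetsum_infsum[of f I] assms
 by (simp add: infsetsum_def Infinite_Set_Sum.abs_summable_on_def)

lemma infsum_eq_integral_count_space_real:
 fixes f :: "'k => real"
 assumes "integrable (count_space I) f"
 shows "infsum f I = (LINT k|count_space I. f k)"
 using infsetsum_infsum[of f I] assms
 by (simp add: infsetsum_def Infinite_Set_Sum.abs_summable_on_def)

lemma hilbert_sum_simps:
 "vecs (hilbert_sum I H) = {x. (ALL k:I. x k : vecs (H k)) & integrable (count_space I) (%k. (vnorm (H k) (x k))^2)}"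
 "vzero (hilbert_sum I H) = (%k. vzero (H k))"
 "vadd (hilbert_sum I H) = (%x y k. vadd (H k) (x k) (y k))"
 "vscale (hilbert_sum I H) = (%c x k. vscale (H k) c (x k))"
 by (simp_all add: hilbert_sum_def summable_on_iff_integrable_count_space_real)

lemma hilbert_sum_inner: "vinner (hilbert_sum I H) x y = infsum (%k. vinner (H k) (x k) (y k)) I"
 by (simp add: hilbert_sum_def)

lemma (in pre_hilbert) norm_add_power2_le:
 "x : vecs H ==> y : vecs H ==> (vnorm H (vadd H x y))^2 <= 2 * (vnorm H x)^2 + 2 * (vnorm H y)^2"
 using power_mono[OF norm_triangle norm_nonneg, of x y 2] sum_squares_bound[of "vnorm H x" "vnorm H y"]
 by (simp add: power2_sum)

lemma (in pre_hilbert) inner_le_power2: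
 "x : vecs H ==> y : vecs H ==> cmod (vinner H x y) <= (vnorm H x)^2 + (vnorm H y)^2"
 using cauchy_schwarz[of x y] sum_squares_bound[of "vnorm H x" "vnorm H y"]
  zero_le_power2[of "vnorm H x"] zero_le_power2[of "vnorm H y"] by linarith

text \<open>Hilbert sums and direct integrals are both spaces of square-integrable sections, which differ
  only in the measure and in the measurability condition. The common part is derived here for any
  class of sections that is closed under the operations and under pointwise limits of
  subsequences.\<close>

locale section_space =
 fixes M :: "'z measure" and H :: "'z => 'v ip_space" and \<M> :: "('z => 'v) set"
  and L :: "('z => 'v) ip_space"
 assumes H: "!!z. z : space M ==> hilbert (H z)"
  and sections_mem: "!!s z. s : \<M> ==> z : space M ==> s z : vecs (H z)"
  and sections_zero: "(%z. vzero (H z)) : \<M>"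
  and sections_add: "!!s t. s : \<M> ==> t : \<M> ==> (%z. vadd (H z) (s z) (t z)) : \<M>"
  and sections_scale: "!!s c. s : \<M> ==> (%z. vscale (H z) c (s z)) : \<M>"
  and sections_inner: "!!s t. s : \<M> ==> t : \<M> ==> (%z. vinner (H z) (s z) (t z)) : bmeas M"
  and sections_lim: "!!X Z x. (!!n. X n : \<M>) ==> Z : sets M ==> (!!z. z : space M ==> x z : vecs (H z)) ==>
   (!!z. z : Z ==> (%n. vdist (H z) (X n z) (x z)) -->> 0) ==>
   (!!z. z : space M - Z ==> x z = X 0 z) ==> x : \<M>"
  and L_vecs: "vecs L = {s : \<M>. integrable M (%z. (vnorm (H z) (s z))^2)}"
  and L_ops: "vzero L = (%z. vzero (H z))" "vadd L = (%s t z. vadd (H z) (s z) (t z))"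
   "vscale L = (%c s z. vscale (H z) c (s z))"
  and L_inner: "!!s t. s : vecs L ==> t : vecs L ==> integrable M (%z. vinner (H z) (s z) (t z)) ==>
   vinner L s t = (LINT z|M. vinner (H z) (s z) (t z))"
begin

lemma P: "z : space M ==> pre_hilbert (H z)"
 using H by (simp add: hilbert_def)

lemma norm2_measurable:
 assumes "s : \<M>"
 shows "(%z. (vnorm (H z) (s z))^2) : bmeas M"
proof -
 have "(%z. Re (vinner (H z) (s z) (s z))) : bmeas M"
  using sections_inner[OF assms assms] by (rule borel_measurable_Re[THEN measurable_compose_rev])
 thus ?thesis
  by (rule measurable_cong[THEN iffD1, rotated])
   (simp add: pre_hilbert.norm_power2[OF P] sections_mem[OF assms])
qed

lemma inner_integrable:
 assumes "s : vecs L" "t : vecs L"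
 shows "integrable M (%z. vinner (H z) (s z) (t z))"
proof (rule b_integrable_bound)
 have st: "s : \<M>" "t : \<M>" using assms by (auto simp: L_vecs)
 show "integrable M (%z. (vnorm (H z) (s z))^2 + (vnorm (H z) (t z))^2)"
  using assms by (simp add: L_vecs)
 show "(%z. vinner (H z) (s z) (t z)) : bmeas M" using sections_inner[OF st] .
 show "AE z in M. norm (vinner (H z) (s z) (t z)) <= norm ((vnorm (H z) (s z))^2 + (vnorm (H z) (t z))^2)"
  using pre_hilbert.inner_le_power2[OF P] sections_mem[OF st(1)] sections_mem[OF st(2)]
  by (intro AE_I2) simp
qed

lemma L_add: "s : vecs L ==> t : vecs L ==> vadd L s t : vecs L"
proof -
 assume st: "s : vecs L" "t : vecs L"
 hence m: "s : \<M>" "t : \<M>" by (auto simp: L_vecs)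
 have "integrable M (%z. (vnorm (H z) (vadd (H z) (s z) (t z)))^2)"
 proof (rule b_integrable_bound)
  show "integrable M (%z. 2 * (vnorm (H z) (s z))^2 + 2 * (vnorm (H z) (t z))^2)"
   using st by (simp add: L_vecs)
  show "(%z. (vnorm (H z) (vadd (H z) (s z) (t z)))^2) : bmeas M"
   using norm2_measurable[OF sections_add[OF m]] .
  show "AE z in M. norm ((vnorm (H z) (vadd (H z) (s z) (t z)))^2)
   <= norm (2 * (vnorm (H z) (s z))^2 + 2 * (vnorm (H z) (t z))^2)"
   using pre_hilbert.norm_add_power2_le[OF P] sections_mem[OF m(1)] sections_mem[OF m(2)]
   by (intro AE_I2) simp
 qed
 thus ?thesis using sections_add[OF m] by (simp add: L_vecs L_ops)
qed

lemma L_scale: "s : vecs L ==> vscale L c s : vecs L"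
proof -
 assume s: "s : vecs L"
 hence m: "s : \<M>" by (auto simp: L_vecs)
 have "integrable M (%z. (vnorm (H z) (vscale (H z) c (s z)))^2)
   \<longleftrightarrow> integrable M (%z. (cmod c)^2 * (vnorm (H z) (s z))^2)"
  using sections_mem[OF m]
  by (intro b_integrable_cong refl)
   (simp add: pre_hilbert.norm_scale[OF P] power_mult_distrib)
 thus ?thesis using s sections_scale[OF m] by (simp add: L_vecs L_ops)
qed

lemma L_zero: "vzero L : vecs L"
proof -
 have "integrable M (%z. (vnorm (H z) (vzero (H z)))^2) \<longleftrightarrow> integrable M (%z. 0 :: real)"
  by (intro b_integrable_cong refl) (simp add: pre_hilbert.norm_zero[OF P])
 thus ?thesis using sections_zero by (simp add: L_vecs L_ops)
qed

lemma pre_hilbert_L: "pre_hilbert L"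
proof
 show "vzero L : vecs L" by (rule L_zero)
 show "vadd L x y : vecs L" if "x : vecs L" "y : vecs L" for x y using L_add that .
 show "vscale L c x : vecs L" if "x : vecs L" for c x using L_scale that .
 note mm = sections_mem
 have sm: "s : \<M>" if "s : vecs L" for s using that by (simp add: L_vecs)
 have li: "vinner L s t = (LINT z|M. vinner (H z) (s z) (t z))" if "s : vecs L" "t : vecs L" for s t
  using L_inner[OF that inner_integrable[OF that]] .
 show "vinner L z (vzero L) = 0" if "z : vecs L" for z
  unfolding li[OF that L_zero] unfolding L_ops
  using mm[OF sm[OF that]] by (intro integral_eq_zero_AE AE_I2) (simp add: pre_hilbert.inner_zero[OF P])
 show "vinner L z (vadd L x y) = vinner L z x + vinner L z y"
  if "z : vecs L" "x : vecs L" "y : vecs L" for x y z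
 proof -
  have "vinner L z (vadd L x y) = (LINT w|M. vinner (H w) (z w) (x w) + vinner (H w) (z w) (y w))"
   unfolding li[OF that(1) L_add[OF that(2,3)]] unfolding L_ops
   using mm[OF sm[OF that(1)]] mm[OF sm[OF that(2)]] mm[OF sm[OF that(3)]]
   by (intro b_integral_cong refl) (simp add: pre_hilbert.inner_add[OF P])
  thus ?thesis using inner_integrable that by (simp add: li)
 qed
 show "vinner L z (vscale L c x) = c * vinner L z x" if "z : vecs L" "x : vecs L" for x z c
 proof -
  have "vinner L z (vscale L c x) = (LINT w|M. c * vinner (H w) (z w) (x w))"
   unfolding li[OF that(1) L_scale[OF that(2)]] unfolding L_ops
   using mm[OF sm[OF that(1)]] mm[OF sm[OF that(2)]]
   by (intro b_integral_cong refl) (simp add: pre_hilbert.inner_scale[OF P])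
  thus ?thesis using that by (simp add: li)
 qed
 show "vinner L y x = cnj (vinner L x y)" if "x : vecs L" "y : vecs L" for x y
 proof -
  have "vinner L y x = (LINT w|M. cnj (vinner (H w) (x w) (y w)))"
   unfolding li[OF that(2,1)]
   using mm[OF sm[OF that(1)]] mm[OF sm[OF that(2)]]
   by (intro b_integral_cong refl) (rule pre_hilbert.inner_commute[OF P], auto)
  thus ?thesis using that by (simp add: li)
 qed
 show "0 <= Re (vinner L x x)" if "x : vecs L" for x
 proof -
  have "Re (vinner L x x) = (LINT w|M. Re (vinner (H w) (x w) (x w)))"
   unfolding li[OF that that] using integral_Re[OF inner_integrable[OF that that]] by simp
  also have "... >= 0"
   using mm[OF sm[OF that]] by (intro integral_nonneg_AE AE_I2) (simp add: pre_hilbert.inner_nonneg[OF P])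
  finally show ?thesis .
 qed
qed

lemma L_norm: "s : vecs L ==> (vnorm L s)^2 = (LINT z|M. (vnorm (H z) (s z))^2)"
proof -
 assume s: "s : vecs L"
 have sm: "s : \<M>" using s by (simp add: L_vecs)
 have "(vnorm L s)^2 = (LINT w|M. Re (vinner (H w) (s w) (s w)))"
  unfolding pre_hilbert.norm_power2[OF pre_hilbert_L s] L_inner[OF s s inner_integrable[OF s s]]
  using integral_Re[OF inner_integrable[OF s s]] by simp
 also have "... = (LINT z|M. (vnorm (H z) (s z))^2)"
  using sections_mem[OF sm]
  by (intro b_integral_cong refl) (simp add: pre_hilbert.norm_power2[OF P])
 finally show ?thesis .
qed

lemma L_dist:
 assumes "s : vecs L" "t : vecs L"
 shows "(vdist L s t)^2 = (LINT z|M. (vdist (H z) (s z) (t z))^2)"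
  and "integrable M (%z. (vdist (H z) (s z) (t z))^2)"
proof -
 have d: "vadd L s (vscale L (-1) t) : vecs L" using L_add[OF assms(1) L_scale[OF assms(2)]] .
 show "(vdist L s t)^2 = (LINT z|M. (vdist (H z) (s z) (t z))^2)"
  using L_norm[OF d] by (simp add: vdist_def L_ops)
 show "integrable M (%z. (vdist (H z) (s z) (t z))^2)"
  using d by (simp add: L_vecs L_ops vdist_def)
qed

theorem hilbert_L: "hilbert L"
proof -
 interpret L: pre_hilbert L by (rule pre_hilbert_L)
 show ?thesis
 proof
  fix X assume X: "hcauchy L X"
  hence XL: "X n : vecs L" for n by (simp add: hcauchy_def)
  hence XM: "X n : \<M>" for n by (simp add: L_vecs)
  have cau: "EX N. \<forall>m\<ge>N. \<forall>n\<ge>N. (LINT z|M. (vdist (H z) (X m z) (X n z))^2) < \<epsilon>" if "\<epsilon> > 0" for \<epsilon>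
  proof -
   obtain N where N: "!!m n. m >= N ==> n >= N ==> vdist L (X m) (X n) < sqrt \<epsilon>"
   using X real_sqrt_gt_zero[OF \<open>\<epsilon> > 0\<close>] unfolding hcauchy_def by blast
   have "(LINT z|M. (vdist (H z) (X m z) (X n z))^2) < \<epsilon>" if "m >= N" "n >= N" for m n
   proof -
   have "(vdist L (X m) (X n))^2 < (sqrt \<epsilon>)^2"
   using N[OF that] L.dist_nonneg[OF XL XL] by (intro power_strict_mono) auto
   thus ?thesis using L_dist(1)[OF XL XL] \<open>\<epsilon> > 0\<close> by simp
   qed
   thus ?thesis by blast
  qed
  show "EX x:vecs L. (%n. vdist L (X n) x) -->> 0"
  proof (rule square_integrable_field_limit[OF H sections_mem[OF XM] L_dist(2)[OF XL XL] cau])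
  fix x r Z assume Z: "Z : sets M" "AE z in M. z : Z"
   "!!z. z : space M ==> x z : vecs (H z)"
   "!!z. z : Z ==> (%n. vdist (H z) (X (r n) z) (x z)) -->> 0"
   "!!z. z : space M - Z ==> x z = X 0 z"
   "!!m. integrable M (%z. (vdist (H z) (X m z) (x z))^2)"
   "(%m. LINT z|M. (vdist (H z) (X m z) (x z))^2) -->> 0"
  have xM: "x : \<M>"
  proof (rule sections_lim)
   show "(case n of 0 => X 0 | Suc n => X (r n)) : \<M>" for n using XM by (cases n) auto
   show "(%n. vdist (H z) ((case n of 0 => X 0 | Suc n => X (r n)) z) (x z)) -->> 0" if "z : Z" for z
   using Z(4)[OF that] by (subst filterlim_sequentially_Suc[symmetric]) simp
  qed (use Z in auto)
  have "integrable M (%z. (vnorm (H z) (x z))^2)"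
  proof (rule b_integrable_bound)
   show "integrable M (%z. 2 * (vdist (H z) (X 0 z) (x z))^2 + 2 * (vnorm (H z) (X 0 z))^2)"
   using Z(6)[of 0] XL[of 0] by (simp add: L_vecs)
   show "(%z. (vnorm (H z) (x z))^2) : bmeas M" using norm2_measurable[OF xM] .
   show "AE z in M. norm ((vnorm (H z) (x z))^2)
   <= norm (2 * (vdist (H z) (X 0 z) (x z))^2 + 2 * (vnorm (H z) (X 0 z))^2)"
   proof (rule AE_I2)
   fix z assume z: "z : space M"
   interpret pre_hilbert "H z" using P z .
   have X0: "X 0 z : vecs (H z)" using sections_mem[OF XM z] .
   have "vnorm (H z) (x z) <= vnorm (H z) (X 0 z) + vdist (H z) (X 0 z) (x z)"
   using norm_le_dist[OF Z(3)[OF z] X0] dist_commute[OF Z(3)[OF z] X0] by simp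
   hence "(vnorm (H z) (x z))^2 <= (vnorm (H z) (X 0 z) + vdist (H z) (X 0 z) (x z))^2"
   using Z(3)[OF z] by (intro power_mono) auto
   thus "norm ((vnorm (H z) (x z))^2)
   <= norm (2 * (vdist (H z) (X 0 z) (x z))^2 + 2 * (vnorm (H z) (X 0 z))^2)"
   using sum_squares_bound[of "vnorm (H z) (X 0 z)" "vdist (H z) (X 0 z) (x z)"]
   by (simp add: power2_sum)
   qed
  qed
  hence xL: "x : vecs L" using xM by (simp add: L_vecs)
  have "(%n. sqrt ((vdist L (X n) x)^2)) -->> sqrt 0"
   using Z(7) by (intro tendsto_real_sqrt) (simp add: L_dist(1)[OF XL xL])
  hence "(%n. vdist L (X n) x) -->> 0" using L.dist_nonneg[OF XL xL] by simp
  thus "EX x:vecs L. (%n. vdist L (X n) x) -->> 0" using xL by blast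
  qed
 qed
qed

end

section \<open>Hilbert sums\<close>

lemma section_space_hilbert_sum:
 assumes H: "!!k. k : I ==> hilbert (H k)"
 shows "section_space (count_space I) H {x. ALL k:I. x k : vecs (H k)} (hilbert_sum I H)"
proof -
 have P: "pre_hilbert (H k)" if "k : I" for k using H[OF that] by (simp add: hilbert_def)
 show ?thesis
  by (rule section_space.intro)
   (auto simp: H hilbert_sum_simps pre_hilbert.zero_mem[OF P] pre_hilbert.add_mem[OF P]
   pre_hilbert.scale_mem[OF P] hilbert_sum_inner infsum_eq_integral_count_space)
qed

section \<open>Direct integrals\<close>

lemma complex_rational_approx:
 fixes c :: complex assumes "e > 0"
 shows "EX q:(%(a, b). Complex a b) ` (\<rat> \<times> \<rat>). cmod (c - q) < e"
proof -
 obtain a where a: "a : \<rat>" "Re c - e / 2 < a" "a < Re c"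
  using Rats_dense_in_real[of "Re c - e / 2" "Re c"] assms by auto
 obtain b where b: "b : \<rat>" "Im c - e / 2 < b" "b < Im c"
  using Rats_dense_in_real[of "Im c - e / 2" "Im c"] assms by auto
 have "cmod (c - Complex a b) <= \<bar>Re (c - Complex a b)\<bar> + \<bar>Im (c - Complex a b)\<bar>" by (rule cmod_le)
 also have "... < e" using a b by simp
 finally show ?thesis using a b by (intro bexI[of _ "Complex a b"]) auto
qed

definition lincomb :: "('z => 'v ip_space) => (complex \<times> ('z => 'v)) list => 'z => 'v" where
 "lincomb H l z = foldr (%(c, d) y. vadd (H z) (vscale (H z) c (d z)) y) l (vzero (H z))"

lemma lincomb_simps [simp]:
 "lincomb H [] z = vzero (H z)"
 "lincomb H ((c, d) # l) z = vadd (H z) (vscale (H z) c (d z)) (lincomb H l z)"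
 by (simp_all add: lincomb_def)

locale hilbert_field =
 fixes M :: "'z measure" and H :: "'z => 'v ip_space" and E :: "('z => 'v) set"
 assumes mf: "measurable_field M H E"
  and H: "!!z. z : space M ==> hilbert (H z)"
begin

definition msections :: "('z => 'v) set" where
 "msections = {s. (ALL z:space M. s z : vecs (H z)) &
   (ALL e:E. (%z. vinner (H z) (e z) (s z)) : bmeas M)}"

lemma P: "z : space M ==> pre_hilbert (H z)"
 using H by (simp add: hilbert_def)

lemma E_mem: "e : E ==> z : space M ==> e z : vecs (H z)"
 using mf by (simp add: measurable_field_def)

lemma msections_mem: "s : msections ==> z : space M ==> s z : vecs (H z)"
 by (simp add: msections_def)

lemma lincomb_mem: "set l \<subseteq> UNIV \<times> E ==> z : space M ==> lincomb H l z : vecs (H z)"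
proof (induction l)
 case (Cons a l)
 obtain c d where a: "a = (c, d)" by (cases a)
 interpret pre_hilbert "H z" using P Cons by blast
 show ?case using Cons E_mem[of d z] a by simp
qed (auto intro: pre_hilbert.zero_mem[OF P])

lemma lincomb_inner_measurable:
 "set l \<subseteq> UNIV \<times> E ==> s : msections ==>
   (%z. vinner (H z) (lincomb H l z) (s z)) : bmeas M"
proof (induction l)
 case Nil
 have "(%z. vinner (H z) (lincomb H [] z) (s z)) : bmeas M \<longleftrightarrow> (%z. 0::complex) : bmeas M"
  using Nil by (intro measurable_cong) (simp add: pre_hilbert.inner_zero_left[OF P] msections_mem)
 thus ?case by simp
next
 case (Cons a l)
 obtain c d where a: "a = (c, d)" by (cases a)
 have dE: "d : E" using Cons.prems a by auto
 have [measurable]: "(%z. vinner (H z) (lincomb H l z) (s z)) : bmeas M"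
  "(%z. vinner (H z) (d z) (s z)) : bmeas M"
  using Cons dE by (auto simp: msections_def)
 have "(%z. vinner (H z) (lincomb H (a # l) z) (s z)) : bmeas M \<longleftrightarrow>
  (%z. cnj c * vinner (H z) (d z) (s z) + vinner (H z) (lincomb H l z) (s z)) : bmeas M"
 proof (rule measurable_cong)
  fix z assume z: "z : space M"
  interpret pre_hilbert "H z" using P z .
  show "vinner (H z) (lincomb H (a # l) z) (s z)
   = cnj c * vinner (H z) (d z) (s z) + vinner (H z) (lincomb H l z) (s z)"
   using lincomb_mem[OF _ z, of l] E_mem[OF dE z] msections_mem[OF Cons.prems(2) z] Cons.prems(1) a by simp
 qed
 thus ?case by simp
qed

lemma lincomb_msections: "set l \<subseteq> UNIV \<times> E ==> lincomb H l : msections"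
proof -
 assume l: "set l \<subseteq> UNIV \<times> E"
 have "(%z. vinner (H z) (e z) (lincomb H l z)) : bmeas M" if e: "e : E" for e
 proof -
  have eM: "e : msections" using e mf by (auto simp: msections_def measurable_field_def)
  have "(%z. vinner (H z) (e z) (lincomb H l z)) : bmeas M \<longleftrightarrow>
   (%z. cnj (vinner (H z) (lincomb H l z) (e z))) : bmeas M"
   using lincomb_mem[OF l] E_mem[OF e]
   by (intro measurable_cong) (rule pre_hilbert.inner_commute[OF P], auto)
  moreover have "(%z. cnj (vinner (H z) (lincomb H l z) (e z))) : bmeas M"
   using lincomb_inner_measurable[OF l eM]
   by (rule measurable_compose) (simp add: borel_measurable_continuous_onI continuous_on_cnj)
  ultimately show ?thesis by simp
 qed
 thus ?thesis using lincomb_mem[OF l] by (auto simp: msections_def)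
qed

text \<open>Rational linear combinations of a fundamental family form a countable family of measurable
  sections which is dense in every fibre.\<close>

lemma countable_dense_sections:
 obtains Q where "countable Q" "Q ~= {}" "!!l. l : Q ==> set l \<subseteq> UNIV \<times> E"
  "!!z x \<epsilon>. z : space M ==> x : vecs (H z) ==> \<epsilon> > 0 ==> EX l:Q. vdist (H z) x (lincomb H l z) < \<epsilon>"
proof -
 obtain D where D: "D \<subseteq> E" "countable D" "!!z. z : space M ==> vtotal (H z) ((%e. e z) ` D)"
  using mf unfolding measurable_field_def by blast
 define C where "C = (%(a, b). Complex a b) ` (\<rat> \<times> \<rat>)"
 have C: "countable C" unfolding C_def using countable_rat by (intro countable_image countable_SIGMA) auto
 define Q where "Q = lists (C \<times> D)"
 have QE: "set l \<subseteq> UNIV \<times> E" if "l : Q" for l using that D(1) by (auto simp: Q_def)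
 have span: "EX l:Q. vdist (H z) y (lincomb H l z) < \<epsilon>"
  if z: "z : space M" and "y : vspan (H z) ((%e. e z) ` D)" "\<epsilon> > 0" for z y \<epsilon>
  using that(2,3)
 proof (induction arbitrary: \<epsilon> rule: vspan.induct)
  case zero
  interpret pre_hilbert "H z" using P z .
  show ?case using zero by (intro bexI[of _ "[]"]) (auto simp: Q_def)
 next
  case (step x y c)
  interpret pre_hilbert "H z" using P z .
  obtain d where d: "d : D" "x = d z" using step.hyps(1) by auto
  have xm: "x : vecs (H z)" using d E_mem D(1) z by auto
  have ym: "y : vecs (H z)" using vspan_mem[OF step.hyps(2)] D(1) E_mem z by auto
  obtain l where l: "l : Q" "vdist (H z) y (lincomb H l z) < \<epsilon> / 2"
   using step.IH[of "\<epsilon> / 2"] step.prems by auto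
  have lm: "lincomb H l z : vecs (H z)" using lincomb_mem[OF QE[OF l(1)] z] .
  have pos: "\<epsilon> / (2 * (vnorm (H z) x + 1)) > 0"
   using step.prems norm_nonneg[OF xm] by (simp add: add_nonneg_pos)
  obtain q where q: "q : C" "cmod (c - q) < \<epsilon> / (2 * (vnorm (H z) x + 1))"
   using complex_rational_approx[OF pos, of c] by (auto simp: C_def)
  have "cmod (c - q) * vnorm (H z) x <= \<epsilon> / (2 * (vnorm (H z) x + 1)) * (vnorm (H z) x + 1)"
   using norm_nonneg[OF xm] by (intro mult_mono less_imp_le[OF q(2)] less_imp_le[OF pos]) auto
  also have "... = \<epsilon> / 2" using norm_nonneg[OF xm] by (simp add: field_simps add_nonneg_eq_0_iff)
  finally have "vdist (H z) (vscale (H z) c x) (vscale (H z) q x) <= \<epsilon> / 2"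
   using dist_scale2[OF xm] by simp
  hence "vdist (H z) (vadd (H z) (vscale (H z) c x) y) (lincomb H ((q, d) # l) z) < \<epsilon>"
   using dist_add[of "vscale (H z) c x" y "vscale (H z) q x" "lincomb H l z"] xm ym lm l(2) d(2) by simp
  moreover have "(q, d) # l : Q" using l q d by (simp add: Q_def)
  ultimately show ?case by blast
 qed
 have "EX l:Q. vdist (H z) x (lincomb H l z) < \<epsilon>"
  if z: "z : space M" and x: "x : vecs (H z)" and e: "\<epsilon> > 0" for z x \<epsilon>
 proof -
  interpret pre_hilbert "H z" using P z .
  obtain y where y: "y : vspan (H z) ((%e. e z) ` D)" "vdist (H z) x y < \<epsilon> / 2"
   using D(3)[OF z] x e unfolding vtotal_def by (metis half_gt_zero)
  obtain l where l: "l : Q" "vdist (H z) y (lincomb H l z) < \<epsilon> / 2"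
   using span[OF z y(1), of "\<epsilon> / 2"] e by auto
  have "y : vecs (H z)" using vspan_mem[OF y(1)] D(1) E_mem z by auto
  hence "vdist (H z) x (lincomb H l z) < \<epsilon>"
   using dist_triangle[OF x _ lincomb_mem[OF QE[OF l(1)] z], of y] y l by simp
  thus ?thesis using l(1) by blast
 qed
 moreover have "countable Q" unfolding Q_def using C D(2) by (intro countable_lists countable_SIGMA) auto
 moreover have "Q ~= {}" by (auto simp: Q_def)
 ultimately show thesis using that QE by blast
qed

text \<open>The squared norm is the supremum of \<open>2 Re \<langle>d, s\<rangle> - \<langle>d, d\<rangle> = \<langle>s, s\<rangle> - \<langle>s - d, s - d\<rangle>\<close> over a
  dense family of sections \<open>d\<close>.\<close>

lemma msections_norm_measurable:
 assumes s: "s : msections"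
 shows "(%z. (vnorm (H z) (s z))^2) : bmeas M"
proof -
 obtain Q where Q: "countable Q" "Q ~= {}" "!!l. l : Q ==> set l \<subseteq> UNIV \<times> E"
  "!!z x \<epsilon>. z : space M ==> x : vecs (H z) ==> \<epsilon> > 0 ==> EX l:Q. vdist (H z) x (lincomb H l z) < \<epsilon>"
  using countable_dense_sections by blast
 define g where "g l z = 2 * Re (vinner (H z) (lincomb H l z) (s z)) - Re (vinner (H z) (lincomb H l z) (lincomb H l z))" for l z
 have g: "g l z = (vnorm (H z) (s z))^2 - (vdist (H z) (s z) (lincomb H l z))^2" if "l : Q" "z : space M" for l z
 proof -
  interpret pre_hilbert "H z" using P that by blast
  note m = lincomb_mem[OF Q(3)[OF that(1)] that(2)] msections_mem[OF s that(2)]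
  show ?thesis using inner_commute[OF m(2,1)] m by (simp add: g_def dist_power2 norm_power2)
 qed
 have gm: "g l : bmeas M" if "l : Q" for l
 proof -
  have [measurable]: "(%z. vinner (H z) (lincomb H l z) (s z)) : bmeas M"
   "(%z. vinner (H z) (lincomb H l z) (lincomb H l z)) : bmeas M"
   using lincomb_inner_measurable[OF Q(3)[OF that]] s lincomb_msections[OF Q(3)[OF that]] by auto
  show ?thesis unfolding g_def by measurable
 qed
 have bdd: "bdd_above ((%l. g l z) ` Q)" if "z : space M" for z
  by (rule bdd_aboveI[of _ "(vnorm (H z) (s z))^2"]) (use g that in auto)
 have "(%z. SUP l\<in>Q. g l z) : bmeas M"
  using Q(1) gm bdd by (intro borel_measurable_cSUP) auto
 moreover have "(SUP l\<in>Q. g l z) = (vnorm (H z) (s z))^2" if z: "z : space M" for z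
 proof (rule antisym)
  show "(SUP l\<in>Q. g l z) <= (vnorm (H z) (s z))^2"
   using Q(2) g z by (intro cSUP_least) auto
  show "(vnorm (H z) (s z))^2 <= (SUP l\<in>Q. g l z)"
  proof (rule field_le_epsilon)
   fix e :: real assume e: "e > 0"
   interpret pre_hilbert "H z" using P z .
   obtain l where l: "l : Q" "vdist (H z) (s z) (lincomb H l z) < sqrt e"
   using Q(4)[OF z msections_mem[OF s z], of "sqrt e"] e by auto
   have "(vdist (H z) (s z) (lincomb H l z))^2 <= (sqrt e)^2"
   using l(2) lincomb_mem[OF Q(3)[OF l(1)] z] msections_mem[OF s z] by (intro power_mono) auto
   hence "(vnorm (H z) (s z))^2 <= g l z + e" using g[OF l(1) z] e by simp
   also have "g l z <= (SUP l\<in>Q. g l z)" using l(1) bdd[OF z] by (intro cSUP_upper) auto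
   finally show "(vnorm (H z) (s z))^2 <= (SUP l\<in>Q. g l z) + e" by simp
  qed
 qed
 ultimately show ?thesis by (subst measurable_cong[symmetric]) auto
qed

lemma msections_add: "s : msections ==> t : msections ==> (%z. vadd (H z) (s z) (t z)) : msections"
proof -
 assume st: "s : msections" "t : msections"
 have "(%z. vinner (H z) (e z) (vadd (H z) (s z) (t z))) : bmeas M" if e: "e : E" for e
 proof -
  have [measurable]: "(%z. vinner (H z) (e z) (s z)) : bmeas M"
   "(%z. vinner (H z) (e z) (t z)) : bmeas M" using st e by (auto simp: msections_def)
  have "(%z. vinner (H z) (e z) (vadd (H z) (s z) (t z))) : bmeas M \<longleftrightarrow>
   (%z. vinner (H z) (e z) (s z) + vinner (H z) (e z) (t z)) : bmeas M"
   using E_mem[OF e] msections_mem[OF st(1)] msections_mem[OF st(2)]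
   by (intro measurable_cong) (simp add: pre_hilbert.inner_add[OF P])
  thus ?thesis by simp
 qed
 thus ?thesis using st pre_hilbert.add_mem[OF P] by (auto simp: msections_def)
qed

lemma msections_scale: "s : msections ==> (%z. vscale (H z) c (s z)) : msections"
proof -
 assume s: "s : msections"
 have "(%z. vinner (H z) (e z) (vscale (H z) c (s z))) : bmeas M" if e: "e : E" for e
 proof -
  have [measurable]: "(%z. vinner (H z) (e z) (s z)) : bmeas M"
   using s e by (auto simp: msections_def)
  have "(%z. vinner (H z) (e z) (vscale (H z) c (s z))) : bmeas M \<longleftrightarrow>
   (%z. c * vinner (H z) (e z) (s z)) : bmeas M"
   using E_mem[OF e] msections_mem[OF s]
   by (intro measurable_cong) (simp add: pre_hilbert.inner_scale[OF P])
  thus ?thesis by simp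
 qed
 thus ?thesis using s pre_hilbert.scale_mem[OF P] by (auto simp: msections_def)
qed

lemma msections_inner_measurable:
 assumes st: "s : msections" "t : msections"
 shows "(%z. vinner (H z) (s z) (t z)) : bmeas M"
proof -
 define N where "N c z = (vnorm (H z) (vadd (H z) (s z) (vscale (H z) c (t z))))^2" for c z
 have [measurable]: "N c : bmeas M" for c
  unfolding N_def by (rule msections_norm_measurable[OF msections_add[OF st(1) msections_scale[OF st(2)]]])
 have "(%z. vinner (H z) (s z) (t z)) : bmeas M \<longleftrightarrow>
  (%z. Complex ((N 1 z - N (-1) z) / 4) ((N (-\<i>) z - N \<i> z) / 4)) : bmeas M"
 proof (rule measurable_cong)
  fix z assume z: "z : space M"
  interpret pre_hilbert "H z" using P z .
  note m = msections_mem[OF st(1) z] msections_mem[OF st(2) z]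
  show "vinner (H z) (s z) (t z) = Complex ((N 1 z - N (-1) z) / 4) ((N (-\<i>) z - N \<i> z) / 4)"
   using m inner_commute[OF m] by (simp add: N_def norm_power2 complex_eq_iff)
 qed
 also have "..." unfolding Complex_eq by measurable
 finally show ?thesis .
qed

lemma section_space_direct_integral: "section_space M H msections (direct_integral M H E)"
proof (rule section_space.intro)
 show "(%z. vzero (H z)) : msections"
  using lincomb_msections[of "[]"] by (simp add: lincomb_def[abs_def])
 show "x : msections"
  if X: "!!n. X n : msections" and Z: "Z : sets M" and x: "!!z. z : space M ==> x z : vecs (H z)"
   and lim: "!!z. z : Z ==> (%n. vdist (H z) (X n z) (x z)) -->> 0"
   and off: "!!z. z : space M - Z ==> x z = X 0 z" for X Z x
 proof -
  note [measurable] = Z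
  have "(%z. vinner (H z) (e z) (x z)) : bmeas M" if e: "e : E" for e
  proof (rule borel_measurable_LIMSEQ_metric)
   have [measurable]: "(%z. vinner (H z) (e z) (X n z)) : bmeas M" for n
   using X e by (auto simp: msections_def)
   show "(%z. if z : Z then vinner (H z) (e z) (X n z) else vinner (H z) (e z) (X 0 z)) : bmeas M" for n
   by measurable
   fix z assume z: "z : space M"
   interpret pre_hilbert "H z" using P z .
   show "(%n. if z : Z then vinner (H z) (e z) (X n z) else vinner (H z) (e z) (X 0 z))
   -->> vinner (H z) (e z) (x z)"
   proof (cases "z : Z")
   case True
   have "(%n. vinner (H z) (e z) (X n z)) -->> vinner (H z) (e z) (x z)"
   using E_mem[OF e z] msections_mem[OF X z] x[OF z] lim[OF True] by (intro tendsto_inner) auto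
   thus ?thesis using True by simp
   qed (use off z in auto)
  qed
  thus ?thesis using x by (auto simp: msections_def)
 qed
qed (auto simp: H msections_mem msections_add msections_scale msections_inner_measurable
  direct_integral_def msections_def[symmetric], auto simp: msections_def)

end

sublocale hilbert_field \<subseteq> D: section_space M H msections "direct_integral M H E"
 by (rule section_space_direct_integral)

lemma (in hilbert_field) direct_integral_isometry:
 assumes U: "!!z. z : space M ==> isometry_on (H z) (U z)"
  and inv: "!!e. e : E ==> EX e':E. ALL z:space M. e z = U z (e' z)"
 shows "isometry_on (direct_integral M H E) (%s z. U z (s z))"
proof -
 have m: "(%z. U z (s z)) : msections" if s: "s : msections" for s
 proof -
  have "(%z. vinner (H z) (e z) (U z (s z))) : bmeas M" if e: "e : E" for e
  proof -
   obtain e' where e': "e' : E" "ALL z:space M. e z = U z (e' z)" using inv[OF e] by blast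
   have "(%z. vinner (H z) (e z) (U z (s z))) : bmeas M \<longleftrightarrow>
   (%z. vinner (H z) (e' z) (s z)) : bmeas M"
   using U e' E_mem[OF e'(1)] msections_mem[OF s]
   by (intro measurable_cong) (auto simp: isometry_on_def)
   thus ?thesis using s e'(1) by (simp add: msections_def)
  qed
  thus ?thesis using s U by (auto simp: msections_def isometry_on_def)
 qed
 have n: "vnorm (H z) (U z (s z)) = vnorm (H z) (s z)" if "s : msections" "z : space M" for s z
  using U[OF that(2)] msections_mem[OF that] by (simp add: isometry_on_def vnorm_def)
 have v: "(%z. U z (s z)) : vecs (direct_integral M H E)" if s: "s : vecs (direct_integral M H E)" for s
 proof -
  have sm: "s : msections" using s by (simp add: D.L_vecs)
  have "integrable M (%z. (vnorm (H z) (U z (s z)))^2) \<longleftrightarrow> integrable M (%z. (vnorm (H z) (s z))^2)"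
   using n[OF sm] by (intro b_integrable_cong) auto
  thus ?thesis using s m[OF sm] by (simp add: D.L_vecs)
 qed
 show ?thesis
  unfolding isometry_on_def
 proof (intro conjI ballI v)
  fix s t assume st: "s : vecs (direct_integral M H E)" "t : vecs (direct_integral M H E)"
  hence sm: "s : msections" "t : msections" by (auto simp: D.L_vecs)
  show "vinner (direct_integral M H E) (%z. U z (s z)) (%z. U z (t z)) = vinner (direct_integral M H E) s t"
   unfolding direct_integral_def ip_space.simps
   using U msections_mem[OF sm(1)] msections_mem[OF sm(2)]
   by (intro b_integral_cong) (auto simp: isometry_on_def)
 qed
qed

lemma hilbert_sum_isometry:
 assumes U: "!!k. k : I ==> isometry_on (H k) (U k)"
 shows "isometry_on (hilbert_sum I H) (%x k. U k (x k))"
proof -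
 have n: "vnorm (H k) (U k y) = vnorm (H k) y" if "k : I" "y : vecs (H k)" for k y
  using U[OF that(1)] that by (simp add: isometry_on_def vnorm_def)
 show ?thesis
  unfolding isometry_on_def
 proof (intro conjI ballI)
  fix x assume x: "x : vecs (hilbert_sum I H)"
  have "integrable (count_space I) (%k. (vnorm (H k) (U k (x k)))^2)
   \<longleftrightarrow> integrable (count_space I) (%k. (vnorm (H k) (x k))^2)"
   using x n by (intro b_integrable_cong) (auto simp: hilbert_sum_simps)
  thus "(%k. U k (x k)) : vecs (hilbert_sum I H)"
   using x U by (auto simp: hilbert_sum_simps isometry_on_def)
  fix y assume y: "y : vecs (hilbert_sum I H)"
  show "vinner (hilbert_sum I H) (%k. U k (x k)) (%k. U k (y k)) = vinner (hilbert_sum I H) x y"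
   unfolding hilbert_sum_def ip_space.simps
   using x y U by (intro infsum_cong) (auto simp: hilbert_sum_simps isometry_on_def)
 qed
qed


section \<open>Plancherel's formula on the line\<close>

lemma integrable_pair_bound:
 fixes h :: "'a \<times> 'b => 'c::{banach, second_countable_topology}"
  and f :: "'a => real" and g :: "'b => real"
 assumes "sigma_finite_measure M1" "sigma_finite_measure M2"
  and f: "integrable M1 f" and g: "integrable M2 g"
  and h: "h : bmeas (M1 \<Otimes>\<^sub>M M2)"
  and le: "!!x y. x : space M1 ==> y : space M2 ==> norm (h (x, y)) <= f x * g y"
 shows "integrable (M1 \<Otimes>\<^sub>M M2) h"
proof -
 interpret M1: sigma_finite_measure M1 by fact
 interpret M2: sigma_finite_measure M2 by fact
 interpret pair_sigma_finite M1 M2 ..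
 note [measurable] = borel_measurable_integrable[OF f] borel_measurable_integrable[OF g]
 have "integrable (M1 \<Otimes>\<^sub>M M2) (%(x, y). f x * g y)"
  by (rule Fubini_integrable) (use f g in "auto simp: abs_mult")
 thus ?thesis
  by (rule b_integrable_bound)
   (use h le in "auto intro!: AE_I2 order.trans[OF _ abs_ge_self] simp: space_pair_measure")
qed

lemma cis_measurable [measurable]: "cis : bmeas borel"
 by (intro borel_measurable_continuous_onI) (simp add: cis_conv_exp[abs_def] continuous_intros)

definition fourier :: "(real => complex) => real => complex" where
 "fourier f t = (LINT x|lborel. f x * cis (t * x))"

lemma fourier_gauss:
 assumes m: "m > (0::real)"
 shows "(LINT t|lborel. of_real (exp (- (t / m)\<^sup>2 / 2)) * cis (t * u))
  = of_real (m * sqrt (2 * pi) * exp (- (m * u)\<^sup>2 / 2))"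
proof -
 have base: "(LINT x|lborel. of_real (exp (- x\<^sup>2 / 2)) * cis (v * x)) = of_real (sqrt (2 * pi) * exp (- v\<^sup>2 / 2))" for v :: real
 proof -
  have "char std_normal_distribution v = (LINT x|lborel. gauss x *\<^sub>R iexp (v * x))"
   unfolding char_def by (rule integral_density) auto
  also have "... = (LINT x|lborel. of_real (1 / sqrt (2 * pi)) * (of_real (exp (- x\<^sup>2 / 2)) * cis (v * x)))"
   by (rule b_integral_cong[OF refl])
   (simp only: std_normal_density_def scaleR_conv_of_real cis_conv_exp of_real_mult mult.assoc)
  also have "... = of_real (1 / sqrt (2 * pi)) * (LINT x|lborel. of_real (exp (- x\<^sup>2 / 2)) * cis (v * x))"
   by (rule integral_mult_right_zero)
  finally have *: "of_real (1 / sqrt (2 * pi)) * (LINT x|lborel. of_real (exp (- x\<^sup>2 / 2)) * cis (v * x))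
   = complex_of_real (exp (- v\<^sup>2 / 2))"
   by (simp only: char_std_normal_distribution)
  have "of_real (sqrt (2 * pi)) * (of_real (1 / sqrt (2 * pi)) * I) = I" for I :: complex
   by (simp add: mult.assoc[symmetric] of_real_mult[symmetric] del: of_real_mult)
  from this[of "LINT x|lborel. of_real (exp (- x\<^sup>2 / 2)) * cis (v * x)"] show ?thesis
   unfolding * by (simp only: of_real_mult)
 qed
 have "(LINT t|lborel. of_real (exp (- (t / m)\<^sup>2 / 2)) * cis (t * u))
   = \<bar>m\<bar> *\<^sub>R (LINT x|lborel. of_real (exp (- ((0 + m * x) / m)\<^sup>2 / 2)) * cis ((0 + m * x) * u))"
  using m by (intro lborel_integral_real_affine) simp
 also have "... = m *\<^sub>R (LINT x|lborel. of_real (exp (- x\<^sup>2 / 2)) * cis ((m * u) * x))"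
  using m by (simp add: mult_ac)
 also have "... = of_real (m * sqrt (2 * pi) * exp (- (m * u)\<^sup>2 / 2))"
  unfolding base by (simp add: scaleR_conv_of_real)
 finally show ?thesis .
qed

lemma integrable_exp_square: "m > 0 ==> integrable lborel (%t::real. exp (- (t / m)\<^sup>2 / 2))"
proof -
 assume m: "m > (0::real)"
 have "integrable lborel (%t. sqrt (2 * pi * m^2) * normal_density 0 m t)"
  using m by simp
 moreover have "sqrt (2 * pi * m\<^sup>2) * normal_density 0 m t = exp (- (t / m)\<^sup>2 / 2)" for t
  using m by (simp add: normal_density_def power_divide)
 ultimately show ?thesis by simp
qed

locale bump_line =
 fixes f :: "real => complex" and R :: real
 assumes cont: "continuous_on UNIV f" and supp: "!!x. R < \<bar>x\<bar> ==> f x = 0"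
begin

lemma meas [measurable]: "f : bmeas borel"
 using cont by (rule borel_measurable_continuous_onI)

lemma cnj_meas [measurable]: "(%x. cnj (f x)) : bmeas borel"
 by (intro borel_measurable_continuous_onI continuous_on_cnj cont)

lemma bounded_ex: "\<exists>B>0. ALL x. cmod (f x) <= B"
proof -
 have "compact (f ` {-R..R})" by (intro compact_continuous_image continuous_on_subset[OF cont]) auto
 then obtain B where B: "!!x. x : {-R..R} ==> cmod (f x) <= B"
  by (meson bounded_iff compact_imp_bounded imageI)
 have "cmod (f x) <= \<bar>B\<bar> + 1" for x
 proof (cases "R < \<bar>x\<bar>")
  case False
  hence "x : {-R..R}" by auto
  from B[OF this] show ?thesis by linarith
 qed (simp add: supp)
 thus ?thesis by (intro exI[of _ "\<bar>B\<bar> + 1"]) auto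
qed

lemma integrable_bump: "integrable lborel f"
proof -
 obtain B where B: "B > 0" "!!x. cmod (f x) <= B" using bounded_ex by blast
 show ?thesis
 proof (rule b_integrable_bound)
  show "integrable lborel (%x. B * indicator {-R..R} x)"
   by (intro integrable_mult_right integrable_real_indicator) (auto simp: emeasure_lborel_Icc_eq)
  show "AE x in lborel. norm (f x) <= norm (B * indicator {- R..R} x)"
   using B supp by (intro AE_I2) (auto simp: indicator_def abs_le_iff not_le)
 qed simp
qed

lemma bump_power2: "integrable lborel (%x. (cmod (f x))^2)"
proof -
 obtain B where B: "B > 0" "!!x. cmod (f x) <= B" using bounded_ex by blast
 show ?thesis
 proof (rule b_integrable_bound)
  show "integrable lborel (%x. B * cmod (f x))" using integrable_bump by simp
  show "AE x in lborel. norm ((cmod (f x))^2) <= norm (B * cmod (f x))"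
   using B by (intro AE_I2) (simp add: power2_eq_square mult_right_mono)
 qed simp
qed

lemma fourier_measurable [measurable]: "fourier f : bmeas borel"
 unfolding fourier_def[abs_def] cis_conv_exp by measurable

lemma fourier_bounded: "cmod (fourier f t) <= (LINT x|lborel. cmod (f x))"
 unfolding fourier_def
 by (rule order.trans[OF integral_norm_bound]) (simp add: norm_mult)

text \<open>Damping with a Gaussian makes the double integral for the squared transform absolutely
  convergent; the Gaussian turns into the averages of \<open>f\<close> against narrow Gaussians.\<close>

lemma damped_plancherel:
 assumes m: "m > 0"
 shows "(LINT t|lborel. of_real (exp (- (t / m)\<^sup>2 / 2)) * (fourier f t * cnj (fourier f t)))
  = of_real (2 * pi) * (LINT x|lborel. (LINT z|lborel. cnj (f x) * f (x + z / m) * of_real (gauss z)))"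
proof -
 let ?g = "%t. exp (- (t / m)\<^sup>2 / 2)"
 note g = integrable_exp_square[OF m]
 have 1: "(LINT t|lborel. of_real (?g t) * (fourier f t * cis (- (t * x))))
   = of_real (2 * pi) * (LINT z|lborel. f (x + z / m) * of_real (gauss z))" for x
 proof -
  have i: "integrable (lborel \<Otimes>\<^sub>M lborel) (%(t, y). of_real (?g t) * (f y * cis (t * y)) * cis (- (t * x)))"
   by (rule integrable_pair_bound[of _ _ ?g "%y. cmod (f y)"])
   (use g integrable_bump in "auto simp: norm_mult cis_conv_exp intro!: lborel.sigma_finite_measure_axioms")
  have "(LINT t|lborel. of_real (?g t) * (fourier f t * cis (- (t * x))))
   = (LINT t|lborel. (LINT y|lborel. of_real (?g t) * (f y * cis (t * y)) * cis (- (t * x))))"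
   unfolding fourier_def
   by (rule b_integral_cong[OF refl],
   subst integral_mult_left_zero, subst integral_mult_right_zero, rule mult.assoc[symmetric])
  also have "... = (LINT y|lborel. (LINT t|lborel. of_real (?g t) * (f y * cis (t * y)) * cis (- (t * x))))"
   using lborel_pair.Fubini_integral[of "%t y. of_real (?g t) * (f y * cis (t * y)) * cis (- (t * x))"] i by simp
  also have "... = (LINT y|lborel. f y * (LINT t|lborel. of_real (?g t) * cis (t * (y - x))))"
  proof (rule b_integral_cong[OF refl])
   fix y
   have "of_real (?g t) * (f y * cis (t * y)) * cis (- (t * x)) = f y * (of_real (?g t) * cis (t * (y - x)))" for t
   proof -
   have "cis (t * y) * cis (- (t * x)) = cis (t * (y - x))" by (simp add: cis_mult right_diff_distrib)
   thus ?thesis by (simp only: mult.assoc mult.left_commute[of "f y"])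
   qed
   thus "(LINT t|lborel. of_real (?g t) * (f y * cis (t * y)) * cis (- (t * x)))
   = f y * (LINT t|lborel. of_real (?g t) * cis (t * (y - x)))"
   by (simp only: integral_mult_right_zero)
  qed
  also have "... = (LINT y|lborel. f y * of_real (m * sqrt (2 * pi) * exp (- (m * (y - x))\<^sup>2 / 2)))"
   unfolding fourier_gauss[OF m] ..
  also have "... = \<bar>1 / m\<bar> *\<^sub>R (LINT z|lborel. f (x + (1 / m) * z) * of_real (m * sqrt (2 * pi) * exp (- (m * ((x + (1 / m) * z) - x))\<^sup>2 / 2)))"
   using m by (intro lborel_integral_real_affine) simp
  also have "... = (LINT z|lborel. of_real (2 * pi) * (f (x + z / m) * of_real (gauss z)))"
  proof -
   have "(1 / m) *\<^sub>R (f (x + z / m) * of_real (m * sqrt (2 * pi) * exp (- z\<^sup>2 / 2)))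
   = of_real (2 * pi) * (f (x + z / m) * of_real (gauss z))" for z
   proof -
   have "(1 / m) * (m * sqrt (2 * pi) * exp (- z\<^sup>2 / 2)) = 2 * pi * gauss z"
   proof -
   have "2 * pi * (1 / sqrt (2 * pi)) = sqrt (2 * pi)" using real_div_sqrt[of "2 * pi"] by simp
   hence "2 * pi * gauss z = sqrt (2 * pi) * exp (- z\<^sup>2 / 2)"
   by (simp only: std_normal_density_def mult.assoc[symmetric])
   thus ?thesis using m by simp
   qed
   hence "f (x + z / m) * of_real ((1 / m) * (m * sqrt (2 * pi) * exp (- z\<^sup>2 / 2)))
   = f (x + z / m) * of_real (2 * pi * gauss z)" by (simp only:)
   moreover have "(1 / m) *\<^sub>R (f (x + z / m) * of_real (m * sqrt (2 * pi) * exp (- z\<^sup>2 / 2)))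
   = f (x + z / m) * of_real ((1 / m) * (m * sqrt (2 * pi) * exp (- z\<^sup>2 / 2)))"
   by (simp only: scaleR_conv_of_real of_real_mult mult_ac)
   moreover have "f (x + z / m) * of_real (2 * pi * gauss z)
   = of_real (2 * pi) * (f (x + z / m) * of_real (gauss z))"
   by (simp only: of_real_mult mult_ac)
   ultimately show ?thesis by (simp only:)
   qed
   thus ?thesis using m by (simp add: integral_scaleR_right[symmetric] del: integral_scaleR_right)
  qed
  finally show ?thesis by simp
 qed
 have c: "cnj (fourier f t) = (LINT x|lborel. cnj (f x) * cis (- (t * x)))" for t
  unfolding fourier_def
  by (rule trans[OF b_integral_cnj[symmetric]]) (simp only: complex_cnj_mult cis_cnj)
 have i2: "integrable (lborel \<Otimes>\<^sub>M lborel)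
   (%(t, x). of_real (?g t) * fourier f t * (cnj (f x) * cis (- (t * x))))"
 proof (rule integrable_pair_bound[of _ _ "%t. ?g t * (LINT x|lborel. cmod (f x))" "%x. cmod (f x)"])
  fix t x :: real
  show "norm (case (t, x) of (t, x) => of_real (?g t) * fourier f t * (cnj (f x) * cis (- (t * x))))
   <= ?g t * (LINT x|lborel. cmod (f x)) * cmod (f x)"
   using fourier_bounded[of t] by (simp add: norm_mult mult_right_mono mult_left_mono)
  show "(%(t, x). of_real (?g t) * fourier f t * (cnj (f x) * cis (- (t * x))))
   : bmeas (lborel \<Otimes>\<^sub>M lborel)" by measurable
 qed (use g integrable_bump in "auto intro!: lborel.sigma_finite_measure_axioms")
 have "(LINT t|lborel. of_real (?g t) * (fourier f t * cnj (fourier f t)))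
   = (LINT t|lborel. (LINT x|lborel. of_real (?g t) * fourier f t * (cnj (f x) * cis (- (t * x)))))"
  unfolding c by (simp add: mult.assoc)
 also have "... = (LINT x|lborel. (LINT t|lborel. of_real (?g t) * fourier f t * (cnj (f x) * cis (- (t * x)))))"
  using lborel_pair.Fubini_integral[of "%t x. of_real (?g t) * fourier f t * (cnj (f x) * cis (- (t * x)))"] i2 by simp
 also have "... = (LINT x|lborel. cnj (f x) * (of_real (2 * pi) * (LINT z|lborel. f (x + z / m) * of_real (gauss z))))"
 proof (rule b_integral_cong[OF refl])
  fix x
  have "of_real (?g t) * fourier f t * (cnj (f x) * cis (- (t * x)))
   = cnj (f x) * (of_real (?g t) * (fourier f t * cis (- (t * x))))" for t by (simp add: mult_ac)
  thus "(LINT t|lborel. of_real (?g t) * fourier f t * (cnj (f x) * cis (- (t * x))))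
   = cnj (f x) * (of_real (2 * pi) * (LINT z|lborel. f (x + z / m) * of_real (gauss z)))"
   by (simp only: integral_mult_right_zero 1)
 qed
 also have "... = (LINT x|lborel. of_real (2 * pi) * (LINT z|lborel. cnj (f x) * f (x + z / m) * of_real (gauss z)))"
  by (rule b_integral_cong[OF refl],
   subst mult.left_commute, subst integral_mult_right_zero[symmetric], simp only: mult.assoc)
 also have "... = of_real (2 * pi) * (LINT x|lborel. (LINT z|lborel. cnj (f x) * f (x + z / m) * of_real (gauss z)))"
  by (rule integral_mult_right_zero)
 finally show ?thesis .
qed

lemma damped_limit:
 "(%n. LINT x|lborel. (LINT z|lborel. cnj (f x) * f (x + z / real (Suc n)) * of_real (gauss z)))
  -->> of_real (LINT x|lborel. (cmod (f x))^2)"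
proof -
 obtain B where B: "B > 0" "!!x. cmod (f x) <= B" using bounded_ex by blast
 have fc: "isCont f x" for x using cont by (simp add: continuous_on_eq_continuous_at)
 have bd: "norm (cnj (f x) * f (x + z / real (Suc n)) * of_real (gauss z))
   <= cmod (f x) * B * gauss z" for x z n
  using B(2)[of "x + z / real (Suc n)"] B(1)
  by (simp add: norm_mult mult_right_mono mult_left_mono)
 have inner: "(%n. LINT z|lborel. cnj (f x) * f (x + z / real (Suc n)) * of_real (gauss z))
   -->> (LINT z|lborel. cnj (f x) * f x * of_real (gauss z))" for x
 proof (rule integral_dominated_convergence[where w = "%z. cmod (f x) * B * gauss z"])
  show "AE z in lborel. (%n. cnj (f x) * f (x + z / real (Suc n)) * of_real (gauss z))
   -->> cnj (f x) * f x * of_real (gauss z)"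
  proof (intro AE_I2 tendsto_intros)
   fix z :: real
   have "(%n. x + z * (1 / real (Suc n))) -->> x + z * 0"
   using LIMSEQ_Suc[OF lim_1_over_n[where 'a=real]] by (intro tendsto_intros) simp
   hence "(%n. x + z / real (Suc n)) -->> x" by simp
   thus "(%n. f (x + z / real (Suc n))) -->> f x" by (rule isCont_tendsto_compose[OF fc])
  qed
  show "AE z in lborel. norm (cnj (f x) * f (x + z / real (Suc n)) * of_real (gauss z))
   <= cmod (f x) * B * gauss z" for n using bd by (intro AE_I2)
 qed simp_all
 have "(LINT z|lborel. cnj (f x) * f x * of_real (gauss z)) = cnj (f x) * f x" for x
  using integral_normal_density[of 1 0] by (simp del: integral_normal_density)
 hence in2: "(%n. LINT z|lborel. cnj (f x) * f (x + z / real (Suc n)) * of_real (gauss z))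
   -->> of_real ((cmod (f x))^2)" for x
  using inner[of x] unfolding complex_norm_square by (simp only: mult.commute)
 have "(%n. LINT x|lborel. (LINT z|lborel. cnj (f x) * f (x + z / real (Suc n)) * of_real (gauss z)))
   -->> (LINT x|lborel. complex_of_real ((cmod (f x))^2))"
 proof (rule integral_dominated_convergence[where w = "%x. cmod (f x) * B"])
  show "AE x in lborel. norm (LINT z|lborel. cnj (f x) * f (x + z / real (Suc n)) * of_real (gauss z))
   <= cmod (f x) * B" for n
  proof (rule AE_I2)
   fix x
   have "norm (LINT z|lborel. cnj (f x) * f (x + z / real (Suc n)) * of_real (gauss z))
   <= (LINT z|lborel. cmod (f x) * B * gauss z)"
   proof (rule b_integral_norm_bound_integral[OF _ _ bd])
   show iw: "integrable lborel (%z. cmod (f x) * B * gauss z)" by simp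
   show "integrable lborel (%z. cnj (f x) * f (x + z / real (Suc n)) * of_real (gauss z))"
   by (rule b_integrable_bound[OF iw])
   (auto intro!: AE_I2 order.trans[OF bd abs_ge_self] simp del: of_nat_Suc)
   qed
   thus "norm (LINT z|lborel. cnj (f x) * f (x + z / real (Suc n)) * of_real (gauss z)) <= cmod (f x) * B"
   by simp
  qed
  show "(%x. LINT z|lborel. cnj (f x) * f (x + z / real (Suc n)) * of_real (gauss z))
   : bmeas lborel" for n
  proof (rule lborel.borel_measurable_lebesgue_integral)
   show "(%(x, z). cnj (f x) * f (x + z / real (Suc n)) * of_real (gauss z))
   : bmeas (lborel \<Otimes>\<^sub>M lborel)" by measurable
  qed
  show "integrable lborel (%x. cmod (f x) * B)" using integrable_bump by simp
  show "(%x. complex_of_real ((cmod (f x))^2)) : bmeas lborel" by measurable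
  show "AE x in lborel. (%n. LINT z|lborel. cnj (f x) * f (x + z / real (Suc n)) * of_real (gauss z))
   -->> complex_of_real ((cmod (f x))^2)" using in2 by (intro AE_I2)
 qed
 thus ?thesis by (simp only: integral_complex_of_real)
qed

theorem plancherel_line:
 "(nn_integral lborel (%t. ennreal ((cmod (fourier f t))^2))) = ennreal (2 * pi * (LINT x|lborel. (cmod (f x))^2))"
proof -
 define g where "g n t = exp (- (t / real (Suc n))\<^sup>2 / 2)" for n t
 have g1: "g n t <= 1" for n t by (simp add: g_def)
 have gi: "integrable lborel (%t. g n t * (cmod (fourier f t))^2)" for n
 proof (rule b_integrable_bound)
  show "integrable lborel (%t. g n t * (LINT x|lborel. cmod (f x))^2)"
   unfolding g_def by (intro integrable_mult_left integrable_exp_square) simp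
  show "AE t in lborel. norm (g n t * (cmod (fourier f t))^2) <= norm (g n t * (LINT x|lborel. cmod (f x))^2)"
   using fourier_bounded by (intro AE_I2) (simp add: g_def abs_mult mult_left_mono power_mono)
 qed (simp add: g_def)
 have val: "complex_of_real (LINT t|lborel. g n t * (cmod (fourier f t))^2)
   = of_real (2 * pi) * (LINT x|lborel. (LINT z|lborel. cnj (f x) * f (x + z / real (Suc n)) * of_real (gauss z)))" for n
 proof -
  have "complex_of_real (LINT t|lborel. g n t * (cmod (fourier f t))^2)
   = (LINT t|lborel. of_real (g n t) * (fourier f t * cnj (fourier f t)))"
   unfolding integral_complex_of_real[symmetric]
   by (rule b_integral_cong[OF refl]) (simp only: of_real_mult complex_norm_square)
  thus ?thesis using damped_plancherel[of "real (Suc n)"] by (simp add: g_def)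
 qed
 have "(%n. complex_of_real (LINT t|lborel. g n t * (cmod (fourier f t))^2))
   -->> of_real (2 * pi) * of_real (LINT x|lborel. (cmod (f x))^2)"
  unfolding val by (intro tendsto_mult tendsto_const damped_limit)
 hence "(%n. complex_of_real (LINT t|lborel. g n t * (cmod (fourier f t))^2))
   -->> of_real (2 * pi * (LINT x|lborel. (cmod (f x))^2))"
  unfolding of_real_mult .
 hence lim: "(%n. LINT t|lborel. g n t * (cmod (fourier f t))^2) -->> 2 * pi * (LINT x|lborel. (cmod (f x))^2)"
  by (simp only: tendsto_of_real_iff)
 have inc: "mono (%n. ennreal (g n t * (cmod (fourier f t))^2))" for t
 proof (rule monoI)
  fix m n :: nat assume "m <= n"
  hence "(t / real (Suc n))^2 <= (t / real (Suc m))^2"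
   unfolding power_divide by (intro divide_left_mono power_mono) auto
  thus "ennreal (g m t * (cmod (fourier f t))^2) <= ennreal (g n t * (cmod (fourier f t))^2)"
   by (intro ennreal_leI mult_right_mono) (auto simp: g_def)
 qed
 have pw: "(SUP n. ennreal (g n t * (cmod (fourier f t))^2)) = ennreal ((cmod (fourier f t))^2)" for t
 proof (rule LIMSEQ_unique[OF LIMSEQ_SUP[OF inc]])
  have "(%n. exp (- (t * (1 / real (Suc n)))\<^sup>2 / 2)) -->> exp (- (t * 0)\<^sup>2 / 2)"
   using LIMSEQ_Suc[OF lim_1_over_n[where 'a=real]] by (intro tendsto_intros) simp_all
  hence "(%n. g n t) -->> 1" by (simp add: g_def)
  hence "(%n. g n t * (cmod (fourier f t))^2) -->> 1 * (cmod (fourier f t))^2" by (intro tendsto_intros)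
  thus "(%n. ennreal (g n t * (cmod (fourier f t))^2)) -->> ennreal ((cmod (fourier f t))^2)"
   by (intro tendsto_ennrealI) simp
 qed
 have "(nn_integral lborel (%t. ennreal ((cmod (fourier f t))^2))) = (SUP n. nn_integral lborel (%t. ennreal (g n t * (cmod (fourier f t))^2)))"
  unfolding pw[symmetric]
 proof (rule nn_integral_monotone_convergence_SUP)
  show "incseq (%n t. ennreal (g n t * (cmod (fourier f t))^2))"
   using inc by (auto simp: mono_def le_fun_def)
 qed (simp add: g_def)
 also have "... = (SUP n. ennreal (LINT t|lborel. g n t * (cmod (fourier f t))^2))"
  by (intro SUP_cong refl nn_integral_eq_integral gi) (simp add: g_def)
 also have "... = ennreal (2 * pi * (LINT x|lborel. (cmod (f x))^2))"
 proof (rule LIMSEQ_unique[OF LIMSEQ_SUP])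
  show "mono (%n. ennreal (LINT t|lborel. g n t * (cmod (fourier f t))^2))"
  proof (rule monoI)
   fix m n :: nat assume mn: "m <= n"
   show "ennreal (LINT t|lborel. g m t * (cmod (fourier f t))^2) <= ennreal (LINT t|lborel. g n t * (cmod (fourier f t))^2)"
   proof (intro ennreal_leI integral_mono gi)
   fix t show "g m t * (cmod (fourier f t))^2 <= g n t * (cmod (fourier f t))^2"
   using monoD[OF inc mn, of t] by (simp add: g_def)
   qed
  qed
 qed (intro tendsto_ennrealI lim)
 finally show ?thesis .
qed

end


section \<open>Parseval's formula on the circle\<close>

lemma (in pre_hilbert) finite_combination_ex:
 assumes "finite S" "!!k. k : S ==> e k : vecs H"
 shows "EX z:vecs H. ALL w:vecs H. vinner H w z = (\<Sum>k\<in>S. c k * vinner H w (e k))"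
 using assms
proof (induction S rule: finite_induct)
 case empty show ?case by (intro bexI[of _ "vzero H"]) auto
next
 case (insert k S)
 then obtain z where z: "z : vecs H" "ALL w:vecs H. vinner H w z = (\<Sum>k\<in>S. c k * vinner H w (e k))" by auto
 show ?case using insert z by (intro bexI[of _ "vadd H (vscale H (c k) (e k)) z"]) auto
qed

lemma (in pre_hilbert) vspan_range_combination:
 assumes "z : vspan H (range e)" "range e \<subseteq> vecs H"
 shows "EX S c. finite S & (ALL w:vecs H. vinner H w z = (\<Sum>k\<in>S. c k * vinner H w (e k)))"
 using assms
proof (induction rule: vspan.induct)
 case zero show ?case by (intro exI[of _ "{}"]) auto
next
 case (step x y d)
 obtain k where k: "x = e k" using step.hyps(1) by auto
 obtain S c where S: "finite S" "ALL w:vecs H. vinner H w y = (\<Sum>k\<in>S. c k * vinner H w (e k))"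
  using step by blast
 define c' where "c' j = (if j : S then c j else 0) + (if j = k then d else 0)" for j
 have "vinner H w (vadd H (vscale H d x) y) = (\<Sum>j\<in>insert k S. c' j * vinner H w (e j))" if w: "w : vecs H" for w
 proof -
  have "(\<Sum>j\<in>insert k S. c' j * vinner H w (e j)) = (\<Sum>j\<in>insert k S. (if j : S then c j * vinner H w (e j) else 0))
   + (\<Sum>j\<in>insert k S. (if j = k then d * vinner H w (e j) else 0))"
   unfolding sum.distrib[symmetric] by (intro sum.cong refl) (simp add: c'_def distrib_right)
  also have "(\<Sum>j\<in>insert k S. (if j = k then d * vinner H w (e j) else 0)) = d * vinner H w x"
   using S(1) k by simp
  also have "(\<Sum>j\<in>insert k S. (if j : S then c j * vinner H w (e j) else 0)) = (\<Sum>j\<in>S. c j * vinner H w (e j))"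
   using S(1) by (intro sum.mono_neutral_cong_right) auto
  also have "... = vinner H w y" using S w by simp
  finally show ?thesis
   using w vspan_mem[OF step.hyps(2) step.prems] subsetD[OF step.prems rangeI[of e k]] k by simp
 qed
 thus ?case using S(1) by (intro exI[of _ "insert k S"] exI[of _ c']) auto
qed

theorem (in pre_hilbert) parseval:
 fixes e :: "'k => 'v"
 assumes e: "!!k. e k : vecs H" and on: "!!j k. vinner H (e j) (e k) = (if j = k then 1 else 0)"
  and tot: "vtotal H (range e)" and x: "x : vecs H"
 shows "((%k. (cmod (vinner H (e k) x))^2) has_sum (vnorm H x)^2) UNIV"
proof -
 define a where "a k = vinner H (e k) x" for k
 have quad: "(vdist H x z)^2 = (vnorm H x)^2 - (\<Sum>k\<in>S. (cmod (a k))^2) + (\<Sum>k\<in>S. (cmod (c k - a k))^2)"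
  if S: "finite S" and z: "z : vecs H" "ALL w:vecs H. vinner H w z = (\<Sum>k\<in>S. c k * vinner H w (e k))" for S z c
 proof -
  have xe: "vinner H x (e k) = cnj (a k)" for k unfolding a_def by (rule inner_commute[OF e x])
  have ez: "vinner H (e k) z = c k" if "k : S" for k
  proof -
   have "vinner H (e k) z = (\<Sum>j\<in>S. c j * (if k = j then 1 else 0))"
   using z(2) e by (simp add: on)
   also have "... = (\<Sum>j\<in>S. if k = j then c j else 0)" by (intro sum.cong refl) auto
   also have "... = c k" using S that by simp
   finally show ?thesis .
  qed
  have ze: "vinner H z (e k) = cnj (c k)" if "k : S" for k
   using inner_commute[OF e z(1), of k] ez[OF that] by simp
  have "vinner H z z = (\<Sum>k\<in>S. c k * cnj (c k))"
   using z ze by (simp cong: sum.cong)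
  hence zz: "(vnorm H z)^2 = (\<Sum>k\<in>S. (cmod (c k))^2)"
   unfolding norm_power2[OF z(1)] by (simp add: complex_norm_square[symmetric] del: complex_mult_cnj)
  have "Re (vinner H x z) = (\<Sum>k\<in>S. Re (c k * cnj (a k)))"
   using z(2) x by (simp add: xe)
  moreover have "(cmod (c k - a k))^2 = (cmod (c k))^2 + (cmod (a k))^2 - 2 * Re (c k * cnj (a k))" for k
   unfolding cmod_power2 by (simp add: power2_eq_square algebra_simps)
  ultimately show ?thesis
   unfolding dist_power2[OF x z(1)] zz by (simp add: sum.distrib sum_subtractf sum_distrib_left)
 qed
 have bessel: "(\<Sum>k\<in>S. (cmod (a k))^2) <= (vnorm H x)^2" if S: "finite S" for S
 proof -
  obtain z where z: "z : vecs H" "ALL w:vecs H. vinner H w z = (\<Sum>k\<in>S. a k * vinner H w (e k))"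
   using finite_combination_ex[where e = e and c = a, OF S e] by auto
  show ?thesis using quad[OF S z] zero_le_power2[of "vdist H x z"] by simp
 qed
 have "EX X. finite X & (ALL Y. finite Y & X \<subseteq> Y --> dist (\<Sum>k\<in>Y. (cmod (a k))^2) ((vnorm H x)^2) < \<epsilon>)"
  if eps: "\<epsilon> > 0" for \<epsilon>
 proof -
  obtain z where z: "z : vspan H (range e)" "vdist H x z < sqrt \<epsilon>"
   using tot x real_sqrt_gt_zero[OF eps] unfolding vtotal_def by blast
  have re: "range e \<subseteq> vecs H" using e by auto
  have zm: "z : vecs H" using vspan_mem[OF z(1) re] .
  obtain S c where S: "finite S" "ALL w:vecs H. vinner H w z = (\<Sum>k\<in>S. c k * vinner H w (e k))"
   using vspan_range_combination[OF z(1) re] by (elim exE conjE)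
  have "(vdist H x z)^2 < (sqrt \<epsilon>)^2"
   using z(2) dist_nonneg[OF x zm] by (intro power_strict_mono) auto
  hence lt: "(vnorm H x)^2 - (\<Sum>k\<in>S. (cmod (a k))^2) < \<epsilon>"
   using quad[OF S(1) zm S(2)] sum_nonneg[of S "%k. (cmod (c k - a k))^2"] eps by simp
  have "dist (\<Sum>k\<in>Y. (cmod (a k))^2) ((vnorm H x)^2) < \<epsilon>" if Y: "finite Y" "S \<subseteq> Y" for Y
   using sum_mono2[OF Y, of "%k. (cmod (a k))^2"] bessel[OF Y(1)] lt by (simp add: dist_real_def)
  thus ?thesis using S(1) by blast
 qed
 thus ?thesis
  unfolding has_sum_def tendsto_iff eventually_finite_subsets_at_top a_def[symmetric] by simp
qed

text \<open>An interval of length \<open>2 * pi\<close> that starts at \<open>-pi / 2\<close>, so that its two halves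
  correspond to the right and the left half-plane.\<close>

definition ang :: "real measure" where
 "ang = restrict_space lborel {-(pi/2)..3*pi/2}"

lemma space_ang: "space ang = {-(pi/2)..3*pi/2}"
 by (simp add: ang_def space_restrict_space)

lemma emeasure_ang: "emeasure ang (space ang) = ennreal (2 * pi)"
 unfolding space_ang unfolding ang_def
 by (subst emeasure_restrict_space) (auto simp: emeasure_lborel_Icc_eq)

lemma finite_measure_ang: "finite_measure ang"
 by (intro finite_measureI) (simp add: emeasure_ang)

interpretation ang: finite_measure ang by (rule finite_measure_ang)

lemma measurable_ang: "f : bmeas borel ==> f : bmeas ang"
 unfolding ang_def by (intro measurable_restrict_space1) simp

lemma sets_ang: "sets ang = sets (restrict_space borel {-(pi/2)..3*pi/2})"
 by (simp add: ang_def sets_restrict_space)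

lemma integrable_ang_bounded:
 fixes f :: "real => complex"
 assumes "f : bmeas ang" "!!x. cmod (f x) <= B"
 shows "integrable ang f"
 by (rule ang.integrable_const_bound[of _ B, OF AE_I2[OF assms(2)] assms(1)])

lemma integral_ang_cis: "(LINT t|ang. cis (of_int k * t)) = (if k = 0 then of_real (2 * pi) else 0)"
proof (cases "k = 0")
 case True
 have "measure ang (space ang) = 2 * pi" using emeasure_ang by (simp add: measure_def)
 thus ?thesis using True by (simp add: scaleR_conv_of_real)
next
 case False
 define F where "F t = cis (of_int k * t) / (\<i> * of_int k)" for t
 have eq: "(LINT t|ang. cis (of_int k * t)) = (LINT t|lborel. indicator {-(pi/2)..3*pi/2} t *\<^sub>R cis (of_int k * t))"
  unfolding ang_def by (subst integral_restrict_space) auto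
 have "(LINT t|lborel. indicator {-(pi/2)..3*pi/2} t *\<^sub>R cis (of_int k * t)) = F (3*pi/2) - F (-(pi/2))"
 proof (rule integral_FTC_Icc)
  show "-(pi/2) <= 3*pi/2" using pi_gt_zero by linarith
  show "continuous_on {-(pi/2)..3*pi/2} (%t. cis (of_int k * t))"
   unfolding cis_conv_exp by (intro continuous_intros)
  fix t
  have "((%z. exp (\<i> * (of_int k * z)) / (\<i> * of_int k)) has_field_derivative exp (\<i> * (of_int k * of_real t))) (at (of_real t))"
   using False by (auto intro!: derivative_eq_intros simp: mult_ac)
  from has_vector_derivative_real_field[OF this]
  show "(F has_vector_derivative cis (of_int k * t)) (at t within {-(pi/2)..3*pi/2})"
   by (simp add: F_def[abs_def] cis_conv_exp)
 qed
 also have "... = 0"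
 proof -
  have "cis (of_int k * (3*pi/2)) = cis (of_int k * (-(pi/2)) + 2 * pi * of_int k)" by (simp add: field_simps)
  also have "... = cis (of_int k * (-(pi/2))) * cis (2 * pi * of_int k)" by (rule cis_mult[symmetric])
  also have "... = cis (of_int k * (-(pi/2)))" by (simp only: cis_multiple_2pi Ints_of_int mult_1_right)
  finally show ?thesis by (simp add: F_def)
 qed
 finally show ?thesis using eq False by simp
qed

definition circle_space :: "(complex => complex) ip_space" where
 "circle_space = \<lparr>
   vecs = {F. continuous_on (sphere 0 1) F},
   vzero = (%_. 0),
   vadd = (%F G z. F z + G z),
   vscale = (%c F z. c * F z),
   vinner = (%F G. (LINT t|ang. cnj (F (cis t)) * G (cis t)) / of_real (2 * pi)) \<rparr>"

lemma continuous_on_circle: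
 assumes "continuous_on (sphere 0 1) F"
 shows "continuous_on UNIV (%t. F (cis t))" "EX B. ALL t. cmod (F (cis t)) <= B"
proof -
 show "continuous_on UNIV (%t. F (cis t))"
  unfolding cis_conv_exp
  by (rule continuous_on_compose2[OF assms]) (auto intro!: continuous_intros)
 have "compact (F ` sphere 0 1)" by (intro compact_continuous_image assms) simp
 then obtain B where "!!z. z : sphere 0 1 ==> cmod (F z) <= B"
  by (meson bounded_iff compact_imp_bounded imageI)
 hence "ALL t. cmod (F (cis t)) <= B" by simp
 thus "EX B. ALL t. cmod (F (cis t)) <= B" by blast
qed

lemma circle_integrable:
 assumes F: "continuous_on (sphere 0 1) F" and G: "continuous_on (sphere 0 1) G"
 shows "integrable ang (%t. cnj (F (cis t)) * G (cis t))"
proof -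
 obtain B C where B: "!!t. cmod (F (cis t)) <= B" and C: "!!t. cmod (G (cis t)) <= C"
  using continuous_on_circle[OF F] continuous_on_circle[OF G] by blast
 show ?thesis
 proof (rule integrable_ang_bounded)
  show "(%t. cnj (F (cis t)) * G (cis t)) : bmeas ang"
   by (intro measurable_ang borel_measurable_continuous_onI continuous_intros continuous_on_circle F G)
  show "cmod (cnj (F (cis t)) * G (cis t)) <= \<bar>B\<bar> * \<bar>C\<bar>" for t
   using B[of t] C[of t] by (simp add: norm_mult) (intro mult_mono, auto)
 qed
qed

lemma pre_hilbert_circle: "pre_hilbert circle_space"
proof (unfold_locales, goal_cases)
 case (5 z x y) thus ?case
  using circle_integrable[of z x] circle_integrable[of z y]
  by (simp add: circle_space_def distrib_left add_divide_distrib)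
next
 case (6 z x c)
 have "(LINT t|ang. cnj (z (cis t)) * (c * x (cis t))) = c * (LINT t|ang. cnj (z (cis t)) * x (cis t))"
  by (subst integral_mult_right_zero[symmetric]) (simp only: mult.left_commute)
 thus ?case by (simp add: circle_space_def)
next
 case (7 x y)
 have "(LINT t|ang. cnj (y (cis t)) * x (cis t)) = cnj (LINT t|ang. cnj (x (cis t)) * y (cis t))"
  by (subst b_integral_cnj[symmetric]) (simp add: mult.commute)
 thus ?case by (simp add: circle_space_def)
next
 case (8 x)
 have "(LINT t|ang. cnj (x (cis t)) * x (cis t)) = of_real (LINT t|ang. (cmod (x (cis t)))^2)"
  unfolding integral_complex_of_real[symmetric] complex_norm_square by (simp only: mult.commute)
 thus ?case by (simp add: circle_space_def)
qed (auto simp: circle_space_def intro!: continuous_intros)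

interpretation circle: pre_hilbert circle_space by (rule pre_hilbert_circle)

text \<open>The characters of the circle. The value off the circle is irrelevant; with \<open>0\<close> they multiply
  like characters everywhere.\<close>

definition circ_char :: "int => complex => complex" where
 "circ_char k z = (if cmod z = 1 then z powi k else 0)"

lemma circ_char_cis: "circ_char k (cis t) = cis (of_int k * t)"
 by (simp add: circ_char_def cis_power_int)

lemma circ_char_mem: "circ_char k : vecs circle_space"
proof -
 have "continuous_on (sphere 0 1) (%z::complex. z powi k)"
  by (intro continuous_on_power_int continuous_on_id) auto
 hence "continuous_on (sphere 0 1) (circ_char k)"
  by (rule continuous_on_eq) (auto simp: circ_char_def)
 thus ?thesis by (simp add: circle_space_def)
qed

lemma circ_char_orthonormal: "vinner circle_space (circ_char j) (circ_char k) = (if j = k then 1 else 0)"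
proof -
 have "cnj (circ_char j (cis t)) * circ_char k (cis t) = cis (of_int (k - j) * t)" for t
  by (simp add: circ_char_cis cis_cnj cis_mult left_diff_distrib)
 hence "vinner circle_space (circ_char j) (circ_char k)
   = (if k - j = 0 then of_real (2 * pi) else 0) / of_real (2 * pi)"
  unfolding circle_space_def ip_space.simps by (simp only: integral_ang_cis)
 thus ?thesis by simp
qed

abbreviation trig_span where "trig_span \<equiv> vspan circle_space (range circ_char)"

lemma trig_add: "F : trig_span ==> G : trig_span ==> (%z. F z + G z) : trig_span"
proof (induction rule: vspan.induct)
 case (step x y c)
 hence "vadd circle_space (vscale circle_space c x) (%z. y z + G z) : trig_span" by (intro vspan.step)
 thus ?case by (simp add: circle_space_def add.assoc)
qed (simp add: circle_space_def)

lemma trig_scale: "F : trig_span ==> (%z. d * F z) : trig_span"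
proof (induction rule: vspan.induct)
 case zero show ?case using vspan.zero[of circle_space "range circ_char"] by (simp add: circle_space_def)
next
 case (step x y c)
 hence "vadd circle_space (vscale circle_space (d * c) x) (%z. d * y z) : trig_span" by (intro vspan.step)
 thus ?case by (simp add: circle_space_def algebra_simps)
qed

lemma trig_char: "circ_char k : trig_span"
 using vspan.step[of "circ_char k" "range circ_char" "vzero circle_space" circle_space 1] vspan.zero[of circle_space "range circ_char"]
 by (simp add: circle_space_def)

lemma trig_mult_char: "F : trig_span ==> (%z. circ_char l z * F z) : trig_span"
proof (induction rule: vspan.induct)
 case zero show ?case using vspan.zero[of circle_space "range circ_char"] by (simp add: circle_space_def)
next
 case (step x y c)
 then obtain k where k: "x = circ_char k" by auto
 have "circ_char l z * circ_char k z = circ_char (l + k) z" for z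
  by (cases "z = 0") (auto simp: circ_char_def power_int_add)
 moreover have "vadd circle_space (vscale circle_space c (circ_char (l + k))) (%z. circ_char l z * y z) : trig_span"
  using step.IH by (intro vspan.step) auto
 ultimately show ?case by (simp add: circle_space_def algebra_simps k)
qed

lemma trig_mult: "F : trig_span ==> G : trig_span ==> (%z. F z * G z) : trig_span"
proof (induction rule: vspan.induct)
 case zero show ?case using vspan.zero[of circle_space "range circ_char"] by (simp add: circle_space_def)
next
 case (step x y c)
 then obtain k where k: "x = circ_char k" by auto
 have "(%z. c * (circ_char k z * G z) + y z * G z) : trig_span"
  using step by (intro trig_add trig_scale trig_mult_char)
 thus ?case by (simp add: circle_space_def k algebra_simps)
qed

lemma trig_real_polynomial:
 assumes "real_polynomial_function g"
 shows "(%z. if cmod z = 1 then of_real (g z) else 0) : trig_span"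
 using assms
proof (induction rule: real_polynomial_function.induct)
 case (linear h)
 interpret bounded_linear h by fact
 have "h z = Re z * h 1 + Im z * h \<i>" for z
 proof -
  have "h z = h (Re z *\<^sub>R 1 + Im z *\<^sub>R \<i>)"
   by (rule arg_cong[of _ _ h]) (simp add: complex_eq_iff)
  thus ?thesis by (simp add: add scale)
 qed
 note hz = this
 have "of_real (h z) = of_real (h 1) * ((1/2) * (circ_char 1 z + circ_char (-1) z))
   + of_real (h \<i>) * ((1 / (2 * \<i>)) * (circ_char 1 z + (-1) * circ_char (-1) z))" if z: "cmod z = 1" for z
 proof -
  have "z * cnj z = 1" using complex_norm_square[of z] z by simp
  hence "inverse z = cnj z" by (rule inverse_unique)
  hence c: "circ_char 1 z = z" "circ_char (-1) z = cnj z"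
   using z by (auto simp: circ_char_def power_int_minus)
  have "(1/2) * (circ_char 1 z + circ_char (-1) z) = of_real (Re z)"
   unfolding c by (simp add: complex_add_cnj)
  moreover have "(1 / (2 * \<i>)) * (circ_char 1 z + (-1) * circ_char (-1) z) = of_real (Im z)"
   using complex_diff_cnj[of z] unfolding c by (simp add: field_simps)
  ultimately show ?thesis unfolding hz[of z] by (simp only: of_real_add of_real_mult mult.commute)
 qed
 note on = this
 have off: "circ_char k z = 0" if "cmod z ~= 1" for k z using that by (simp add: circ_char_def)
 have "(%z. if cmod z = 1 then of_real (h z) else 0) = (%z. of_real (h 1) * ((1/2) * (circ_char 1 z + circ_char (-1) z))
   + of_real (h \<i>) * ((1 / (2 * \<i>)) * (circ_char 1 z + (-1) * circ_char (-1) z)))"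
 proof (rule ext)
  fix z show "(if cmod z = 1 then of_real (h z) else 0) = of_real (h 1) * ((1/2) * (circ_char 1 z + circ_char (-1) z))
   + of_real (h \<i>) * ((1 / (2 * \<i>)) * (circ_char 1 z + (-1) * circ_char (-1) z))"
  proof (cases "cmod z = 1")
   case True show ?thesis unfolding if_P[OF True] by (rule on[OF True])
  next
   case False show ?thesis unfolding if_not_P[OF False] off[OF False] by simp
  qed
 qed
 moreover have "... : trig_span" by (intro trig_add trig_scale trig_char)
 ultimately show ?case by (simp only:)
next
 case (const c)
 have "(%z. of_real c * circ_char 0 z) : trig_span" by (intro trig_scale trig_char)
 moreover have "(%z. of_real c * circ_char 0 z) = (%z. if cmod z = 1 then of_real c else 0)"
  by (auto simp: circ_char_def)
 ultimately show ?case by simp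
next
 case (add f g)
 from trig_add[OF add.IH] show ?case by (rule back_subst[of "%x. x : trig_span"]) auto
next
 case (mult f g)
 from trig_mult[OF mult.IH] show ?case by (rule back_subst[of "%x. x : trig_span"]) auto
qed

lemma trig_total: "vtotal circle_space (range circ_char)"
 unfolding vtotal_def
proof (intro conjI ballI allI impI)
 show "range circ_char \<subseteq> vecs circle_space" using circ_char_mem by auto
 fix F \<epsilon> assume F: "F : vecs circle_space" and eps: "\<epsilon> > (0::real)"
 have c: "continuous_on (sphere 0 1) F" using F by (simp add: circle_space_def)
 have c2: "continuous_on (sphere 0 1) (%z. Re (F z))" "continuous_on (sphere 0 1) (%z. Im (F z))"
  using c by (auto intro!: continuous_intros)
 obtain g1 where g1: "real_polynomial_function g1" "!!z. z : sphere 0 1 ==> \<bar>Re (F z) - g1 z\<bar> < \<epsilon> / 3"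
  using Stone_Weierstrass_real_polynomial_function[OF _ c2(1), of "\<epsilon> / 3"] eps by auto
 obtain g2 where g2: "real_polynomial_function g2" "!!z. z : sphere 0 1 ==> \<bar>Im (F z) - g2 z\<bar> < \<epsilon> / 3"
  using Stone_Weierstrass_real_polynomial_function[OF _ c2(2), of "\<epsilon> / 3"] eps by auto
 define G where "G z = (if cmod z = 1 then of_real (g1 z) else 0) + \<i> * (if cmod z = 1 then of_real (g2 z) else 0)" for z
 have G: "G : trig_span" unfolding G_def[abs_def]
  by (intro trig_add trig_scale trig_real_polynomial g1 g2)
 have GH: "G : vecs circle_space" using circle.vspan_mem[OF G] circ_char_mem by auto
 have near: "cmod (F (cis t) - G (cis t)) <= 2 * \<epsilon> / 3" for t
 proof -
  have "cmod (F (cis t) - G (cis t)) <= \<bar>Re (F (cis t) - G (cis t))\<bar> + \<bar>Im (F (cis t) - G (cis t))\<bar>"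
   by (rule cmod_le)
  thus ?thesis using g1(2)[of "cis t"] g2(2)[of "cis t"] by (simp add: G_def)
 qed
 define D where "D = vadd circle_space F (vscale circle_space (-1) G)"
 have DH: "D : vecs circle_space" unfolding D_def using F GH by simp
 have D: "D z = F z - G z" for z by (simp add: D_def circle_space_def)
 have "(vdist circle_space F G)^2 = (LINT t|ang. (cmod (D (cis t)))^2) / (2 * pi)"
 proof -
  have "(LINT t|ang. cnj (D (cis t)) * D (cis t)) = of_real (LINT t|ang. (cmod (D (cis t)))^2)"
   unfolding integral_complex_of_real[symmetric] complex_norm_square by (simp only: mult.commute)
  hence "vinner circle_space D D = of_real ((LINT t|ang. (cmod (D (cis t)))^2) / (2 * pi))"
   by (simp add: circle_space_def)
  thus ?thesis unfolding vdist_def D_def[symmetric] circle.norm_power2[OF DH] by (simp only: Re_complex_of_real)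
 qed
 also have "... <= ((2 * \<epsilon> / 3)^2 * (2 * pi)) / (2 * pi)"
 proof (rule divide_right_mono)
  have "(LINT t|ang. (cmod (D (cis t)))^2) <= (LINT t|ang. (2 * \<epsilon> / 3)^2)"
  proof (rule integral_mono)
   have Dc: "continuous_on UNIV (%t. D (cis t))"
   using continuous_on_circle(1) DH by (simp add: circle_space_def)
   show "integrable ang (%t. (cmod (D (cis t)))^2)"
   by (rule ang.integrable_const_bound[of _ "(2 * \<epsilon> / 3)^2"])
   (use near in "auto simp: D intro!: power_mono measurable_ang borel_measurable_continuous_onI continuous_intros
   Dc[unfolded D]")
   show "(cmod (D (cis t)))^2 <= (2 * \<epsilon> / 3)^2" for t using near by (simp only: D power_mono norm_ge_zero)
  qed simp
  also have "(LINT t|ang. (2 * \<epsilon> / 3)^2) = (2 * \<epsilon> / 3)^2 * (2 * pi)"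
   using emeasure_ang by (simp add: measure_def)
  finally show "(LINT t|ang. (cmod (D (cis t)))^2) <= (2 * \<epsilon> / 3)^2 * (2 * pi)" .
 qed simp
 also have "... = (2 * \<epsilon> / 3)^2" by simp
 also have "... < \<epsilon>^2" using eps by (intro power_strict_mono) auto
 finally have "vdist circle_space F G < \<epsilon>" using eps by (auto intro: power2_less_imp_less)
 thus "EX G:trig_span. vdist circle_space F G < \<epsilon>" using G by blast
qed

theorem parseval_circle:
 assumes F: "continuous_on (sphere 0 1) F"
 shows "(nn_integral (count_space UNIV) (%k. ennreal ((cmod (LINT t|ang. F (cis t) * cis (of_int k * t)))^2)))
  = ennreal (2 * pi * (LINT t|ang. (cmod (F (cis t)))^2))"
proof -
 have FH: "F : vecs circle_space" using F by (simp add: circle_space_def)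
 define c where "c k = (LINT t|ang. F (cis t) * cis (of_int k * t))" for k :: int
 have "vinner circle_space (circ_char (- k)) F = c k / of_real (2 * pi)" for k
  by (simp add: circle_space_def c_def circ_char_cis cis_cnj mult.commute)
 hence ck: "(cmod (vinner circle_space (circ_char (- k)) F))\<^sup>2 = (cmod (c k))\<^sup>2 / (2 * pi)\<^sup>2" for k
  by (simp add: norm_divide power_divide norm_mult power_mult_distrib)
 have hs: "((%k. (cmod (vinner circle_space (circ_char k) F))^2) has_sum (vnorm circle_space F)^2) UNIV"
  by (rule circle.parseval[OF circ_char_mem circ_char_orthonormal trig_total FH])
 have "((%k. (cmod (vinner circle_space (circ_char k) F))^2) has_sum (vnorm circle_space F)^2) (uminus ` UNIV)"
  using hs by (simp add: surj_uminus)
 hence "((%k. (cmod (c k))^2 / (2 * pi)^2) has_sum (vnorm circle_space F)^2) UNIV"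
  by (subst (asm) has_sum_reindex) (auto simp: o_def ck inj_on_def)
 hence hs2: "((%k. (2 * pi)^2 * ((cmod (c k))^2 / (2 * pi)^2)) has_sum (2 * pi)^2 * (vnorm circle_space F)^2) UNIV"
  by (rule has_sum_cmult_right)
 have nF: "(vnorm circle_space F)^2 = (LINT t|ang. (cmod (F (cis t)))^2) / (2 * pi)"
 proof -
  have "(LINT t|ang. cnj (F (cis t)) * F (cis t)) = of_real (LINT t|ang. (cmod (F (cis t)))^2)"
   unfolding integral_complex_of_real[symmetric] complex_norm_square by (simp only: mult.commute)
  hence "vinner circle_space F F = of_real ((LINT t|ang. (cmod (F (cis t)))^2) / (2 * pi))"
   by (simp add: circle_space_def)
  thus ?thesis unfolding circle.norm_power2[OF FH] by (simp only: Re_complex_of_real)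
 qed
 have "(%k. (2 * pi)^2 * ((cmod (c k))^2 / (2 * pi)^2)) = (%k. (cmod (c k))^2)" by simp
 moreover have "(2 * pi)^2 * (vnorm circle_space F)^2 = 2 * pi * (LINT t|ang. (cmod (F (cis t)))^2)"
 proof -
  have "(2 * pi)^2 * (I / (2 * pi)) = 2 * pi * I" for I :: real by (simp add: power2_eq_square)
  thus ?thesis unfolding nF .
 qed
 ultimately have hs3: "((%k. (cmod (c k))^2) has_sum 2 * pi * (LINT t|ang. (cmod (F (cis t)))^2)) UNIV"
  using hs2 by (simp only:)
 hence int: "integrable (count_space UNIV) (%k. (cmod (c k))^2)"
  using summable_on_iff_integrable_count_space_real has_sum_imp_summable by blast
 have "(nn_integral (count_space UNIV) (%k. ennreal ((cmod (c k))^2))) = ennreal (LINT k|count_space UNIV. (cmod (c k))^2)"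
  by (rule nn_integral_eq_integral[OF int]) simp
 thus ?thesis
  using infsum_eq_integral_count_space_real[OF int] infsumI[OF hs3] by (simp add: c_def)
qed


section \<open>Plancherel's formula on the multiplicative group\<close>

definition pol :: "real \<times> real => complex" where
 "pol p = of_real (exp (fst p)) * cis (snd p)"

lemma pol_simps [simp]: "cmod (pol (r, t)) = exp r" "pol p ~= 0"
 by (auto simp: pol_def norm_mult)

lemma pol_surj: "s ~= 0 ==> EX r t. s = pol (r, t)"
 by (rule exI[of _ "ln (cmod s)"], rule exI[of _ "Arg s"])
   (simp add: pol_def rcis_cmod_Arg[of s, unfolded rcis_def])

lemma cis_ang [measurable]: "(%t. cis (c * t)) : bmeas ang"
 by (rule measurable_ang) measurable

lemma pol_measurable [measurable]: "pol : bmeas (lborel \<Otimes>\<^sub>M ang)"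
proof -
 have "(%t. cis (1 * t)) : bmeas ang" by measurable
 hence [measurable]: "cis : bmeas ang" by simp
 show ?thesis unfolding pol_def[abs_def] by measurable
qed

text \<open>The Haar measure of the multiplicative group in logarithmic polar coordinates.\<close>

definition mstar :: "complex measure" where
 "mstar = distr (lborel \<Otimes>\<^sub>M ang) borel pol"

lemma sets_mstar [simp, measurable_cong]: "sets mstar = sets borel" and space_mstar [simp]: "space mstar = UNIV"
 by (simp_all add: mstar_def)

interpretation ang: sigma_finite_measure ang
 by unfold_locales

interpretation la: pair_sigma_finite lborel ang ..

lemma integral_mstar: "f : bmeas borel ==>
  (LINT s|mstar. f s) = (LINT p|(lborel \<Otimes>\<^sub>M ang). f (pol p))"
 for f :: "complex => 'b::{banach, second_countable_topology}"
 unfolding mstar_def by (rule integral_distr) measurable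

lemma integrable_mstar: "f : bmeas borel ==>
  integrable mstar f \<longleftrightarrow> integrable (lborel \<Otimes>\<^sub>M ang) (%p. f (pol p))"
 for f :: "complex => 'b::{banach, second_countable_topology}"
 unfolding mstar_def by (rule integrable_distr_eq) measurable

lemma nn_integral_mstar: "f : bmeas borel ==>
  (nn_integral mstar (%s. f s)) = (nn_integral lborel (%r. nn_integral ang (%t. f (pol (r, t)))))"
 unfolding mstar_def by (subst nn_integral_distr) (auto simp: ang.nn_integral_fst[symmetric])

lemma emeasure_mstar_annulus:
 assumes "a <= b"
 shows "emeasure mstar {s. exp a <= cmod s & cmod s <= exp b} = ennreal ((b - a) * (2 * pi))"
proof -
 have m: "{s::complex. exp a <= cmod s & cmod s <= exp b} : sets borel" by measurable
 have "pol -` {s. exp a <= cmod s & cmod s <= exp b} \<inter> space (lborel \<Otimes>\<^sub>M ang) = {a..b} \<times> space ang"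
  by (auto simp: space_pair_measure)
 hence "emeasure mstar {s. exp a <= cmod s & cmod s <= exp b} = emeasure (lborel \<Otimes>\<^sub>M ang) ({a..b} \<times> space ang)"
  using m by (simp add: mstar_def emeasure_distr)
 also have "... = emeasure lborel {a..b} * emeasure ang (space ang)"
  by (intro ang.emeasure_pair_measure_Times) auto
 also have "... = ennreal ((b - a) * (2 * pi))"
  using assms by (simp add: emeasure_ang ennreal_mult)
 finally show ?thesis .
qed

lemma AE_mstar_nonzero: "AE s in mstar. s ~= 0"
 unfolding mstar_def by (subst AE_distr_iff) auto

lemma sigma_finite_mstar: "sigma_finite_measure mstar"
proof
 define A where "A n = {s::complex. exp (- real n) <= cmod s & cmod s <= exp (real n)}" for n :: nat
 have z: "emeasure mstar {0} = 0"
  using AE_mstar_nonzero by (subst (asm) AE_iff_null) (auto simp: null_sets_def)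
 have cov: "s : \<Union>(range A) \<union> {0}" for s
 proof (cases "s = 0")
  case False
  obtain n where "\<bar>ln (cmod s)\<bar> <= real n" using real_arch_simple by blast
  hence "exp (- real n) <= exp (ln (cmod s))" "exp (ln (cmod s)) <= exp (real n)" by auto
  hence "s : A n" using False by (simp add: A_def)
  thus ?thesis by blast
 qed simp
 have "emeasure mstar (A n) ~= \<infinity>" for n
  unfolding A_def by (subst emeasure_mstar_annulus) auto
 moreover have "A n : sets mstar" for n unfolding A_def by simp measurable
 ultimately show "EX A. countable A & A \<subseteq> sets mstar & \<Union>A = space mstar & (ALL a:A. emeasure mstar a ~= \<infinity>)"
  using z cov by (intro exI[of _ "insert {0} (range A)"]) (simp, blast)
qed

interpretation mstar: sigma_finite_measure mstar by (rule sigma_finite_mstar)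

definition chr :: "complex => int => complex => complex" where
 "chr t k s = of_real (cmod s) powr t * (s / of_real (cmod s)) powi k"

abbreviation uch :: "real => int => complex => complex" where "uch v \<equiv> chr (\<i> * of_real v)"

lemma chr_pol: "uch v k (pol (r, t)) = cis (v * r) * cis (of_int k * t)"
proof -
 have "of_real (exp r) powr (\<i> * of_real v) = cis (v * r)"
  by (simp add: powr_def cis_conv_exp mult_ac flip: exp_of_real)
 moreover have "pol (r, t) / of_real (cmod (pol (r, t))) = cis t" by (simp add: pol_def norm_mult)
 ultimately show ?thesis by (simp add: chr_def cis_power_int)
qed

lemma chr_norm: "s ~= 0 ==> cmod (uch v k s) = 1"
 using pol_surj[of s] by (auto simp: chr_pol norm_mult)

lemma chr_mult:
 assumes "s ~= 0" "s' ~= 0"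
 shows "uch v k (s * s') = uch v k s * uch v k s'"
proof -
 obtain r t r' t' where s: "s = pol (r, t)" "s' = pol (r', t')" using pol_surj assms by metis
 have "s * s' = pol (r + r', t + t')" by (simp add: s pol_def exp_add cis_mult[symmetric])
 thus ?thesis by (simp add: s chr_pol distrib_left cis_mult[symmetric])
qed

lemma chr_cnj: "s ~= 0 ==> cnj (uch v k s) = inverse (uch v k s)"
proof -
 assume "s ~= 0"
 hence "uch v k s * cnj (uch v k s) = 1"
  using chr_norm complex_norm_square[of "uch v k s"] by simp
 thus ?thesis by (rule inverse_unique[symmetric])
qed

lemma chr_add: "s ~= 0 ==>
  uch (v + w) (k + l) s = uch v k s * uch w l s"
 using pol_surj[of s] by (auto simp: chr_pol distrib_right cis_mult[symmetric] simp del: of_real_add)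

lemma chr_continuous: "continuous_on (- {0}) (uch v k)"
 unfolding chr_def[abs_def]
 by (intro continuous_intros continuous_on_power_int) (auto simp: complex_nonpos_Reals_iff)

lemma borel_measurable_continuous_nonzero:
 fixes f :: "complex => complex"
 assumes "continuous_on (- {0}) f"
 shows "f : bmeas borel"
proof -
 have "(%s. if s : - {0} then f s else f 0) : bmeas borel"
  by (rule borel_measurable_continuous_on_if) (use assms in auto)
 moreover have "(%s. if s : - {0} then f s else f 0) = f" by auto
 ultimately show ?thesis by simp
qed

lemma chr_measurable [measurable]: "uch v k : bmeas borel"
 by (rule borel_measurable_continuous_nonzero[OF chr_continuous])

definition annular :: "(complex => complex) => bool" where
 "annular A \<longleftrightarrow> continuous_on (- {0}) A & (\<exists>\<rho>>0. ALL s. A s ~= 0 --> exp (- \<rho>) <= cmod s & cmod s <= exp \<rho>)"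

lemma annular_measurable: "annular A ==> A : bmeas borel"
 by (auto simp: annular_def borel_measurable_continuous_nonzero)

lemma annular_bounds:
 assumes "annular A"
 obtains \<rho> B where "\<rho> > 0" "B > 0" "!!s. cmod (A s) <= B" "!!r t. \<rho> < \<bar>r\<bar> ==> A (pol (r, t)) = 0"
proof -
 obtain \<rho> where r: "\<rho> > 0" "!!s. A s ~= 0 ==> exp (- \<rho>) <= cmod s & cmod s <= exp \<rho>"
  using assms unfolding annular_def by blast
 define K where "K = cball 0 (exp \<rho>) - ball (0::complex) (exp (- \<rho>))"
 have "compact K" unfolding K_def by (intro compact_diff) auto
 moreover have "0 \<notin> K" by (simp add: K_def)
 hence "continuous_on K A" using assms unfolding annular_def by (auto intro: continuous_on_subset)
 ultimately have "bounded (A ` K)" using compact_continuous_image compact_imp_bounded by blast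
 then obtain B where B: "!!s. s : K ==> cmod (A s) <= B" by (meson bounded_iff imageI)
 have "cmod (A s) <= \<bar>B\<bar> + 1" for s
 proof (cases "A s = 0")
  case False
  hence "s : K" using r(2)[OF False] by (simp add: K_def)
  from B[OF this] show ?thesis by linarith
 qed simp
 moreover have "A (pol (r, t)) = 0" if "\<rho> < \<bar>r\<bar>" for r t
 proof (rule ccontr)
  assume "A (pol (r, t)) ~= 0"
  from r(2)[OF this] that show False by auto
 qed
 ultimately show thesis using that[of \<rho> "\<bar>B\<bar> + 1"] r(1) by simp
qed

definition mellin :: "(complex => complex) => int => real => complex" where
 "mellin A k v = (LINT s|mstar. A s * uch v k s)"

definition angular :: "(complex => complex) => int => real => complex" where
 "angular A k r = (LINT t|ang. A (pol (r, t)) * cis (of_int k * t))"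

lemma annular_integrable:
 assumes A: "annular A" and g: "g : bmeas borel" "!!s. s ~= 0 ==> cmod (g s) <= C"
 shows "integrable mstar (%s. A s * g s)"
proof -
 note [measurable] = annular_measurable[OF A] g(1)
 obtain \<rho> B where B: "\<rho> > 0" "B > 0" "!!s. cmod (A s) <= B" "!!r t. \<rho> < \<bar>r\<bar> ==> A (pol (r, t)) = 0"
  using annular_bounds[OF A] by blast
 have "integrable (lborel \<Otimes>\<^sub>M ang) (%p. A (pol p) * g (pol p))"
 proof (rule integrable_pair_bound[of _ _ "%r. B * \<bar>C\<bar> * indicator {-\<rho>..\<rho>} r" "%t. 1"])
  show "integrable lborel (%r. B * \<bar>C\<bar> * indicator {-\<rho>..\<rho>} r)"
   by (intro integrable_mult_right integrable_real_indicator) (auto simp: emeasure_lborel_Icc_eq)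
  fix r t
  show "norm (A (pol (r, t)) * g (pol (r, t))) <= B * \<bar>C\<bar> * indicator {-\<rho>..\<rho>} r * 1"
  proof (cases "\<rho> < \<bar>r\<bar>")
   case False
   hence "r : {-\<rho>..\<rho>}" by auto
   moreover have "cmod (A (pol (r, t))) * cmod (g (pol (r, t))) <= B * \<bar>C\<bar>"
   using B(2,3) g(2)[of "pol (r, t)"] by (intro mult_mono) auto
   ultimately show ?thesis by (simp add: norm_mult)
  qed (use B in simp)
 qed (auto intro: lborel.sigma_finite_measure_axioms ang.sigma_finite_measure_axioms)
 thus ?thesis by (subst integrable_mstar) auto
qed

lemma annular_integrable_chr: "annular A ==> integrable mstar (%s. A s * uch v k s)"
 by (rule annular_integrable[where C = 1]) (auto simp: chr_norm)

lemma annular_slice_continuous: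
 assumes "annular A"
 shows "continuous_on (sphere 0 1) (%z. A (of_real (exp r) * z))"
proof (rule continuous_on_compose2[where g = A and f = "%z. complex_of_real (exp r) * z"])
 show "continuous_on (- {0}) A" using assms by (simp add: annular_def)
 show "continuous_on (sphere 0 1) (%z. complex_of_real (exp r) * z)"
  by (intro continuous_on_mult continuous_on_const continuous_on_id)
 show "(%z. complex_of_real (exp r) * z) ` sphere 0 1 \<subseteq> - {0}" by auto
qed

lemma angular_bump:
 assumes A: "annular A" and \<rho>: "!!r t. \<rho> < \<bar>r\<bar> ==> A (pol (r, t)) = 0"
 shows "bump_line (angular A k) \<rho>"
proof
 show "angular A k x = 0" if "\<rho> < \<bar>x\<bar>" for x using \<rho>[OF that] by (simp add: angular_def)
 note [measurable] = annular_measurable[OF A]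
 obtain \<rho>' B where B: "B > 0" "!!s. cmod (A s) <= B" using annular_bounds[OF A] by metis
 have pm [measurable]: "(%t. pol (r, t)) : bmeas ang" for r
  by (rule measurable_Pair2[OF pol_measurable]) simp
 have "isCont (angular A k) r" for r
  unfolding continuous_at_sequentially
 proof (intro allI impI)
  fix X :: "nat => real" assume X: "X -->> r"
  show "(angular A k \<circ> X) -->> angular A k r"
   unfolding comp_def angular_def
  proof (rule integral_dominated_convergence[where w = "%t. B"])
   show "(%t. A (pol (r, t)) * cis (of_int k * t)) : bmeas ang" by measurable
   show "(%t. A (pol (X i, t)) * cis (of_int k * t)) : bmeas ang" for i by measurable
   show "AE t in ang. (%i. A (pol (X i, t)) * cis (of_int k * t)) -->> A (pol (r, t)) * cis (of_int k * t)"
   proof (intro AE_I2 tendsto_mult tendsto_const)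
   fix t
   have "isCont A (pol (r, t))"
   using A unfolding annular_def by (auto simp: continuous_on_eq_continuous_at open_Compl)
   moreover have "(%i. pol (X i, t)) -->> pol (r, t)"
   unfolding pol_def fst_conv snd_conv by (intro tendsto_intros X)
   ultimately show "(%i. A (pol (X i, t))) -->> A (pol (r, t))" by (rule isCont_tendsto_compose)
   qed
   show "AE t in ang. norm (A (pol (X i, t)) * cis (of_int k * t)) <= B" for i
   using B by (intro AE_I2) (simp add: norm_mult)
  qed simp
 qed
 thus "continuous_on UNIV (angular A k)" by (simp add: continuous_on_eq_continuous_at)
qed

lemma mellin_eq_fourier:
 assumes A: "annular A"
 shows "mellin A k = fourier (angular A k)"
proof
 fix v
 note [measurable] = annular_measurable[OF A]
 have "integrable (lborel \<Otimes>\<^sub>M ang) (%p. A (pol p) * uch v k (pol p))"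
  using annular_integrable_chr[OF A, of v k] by (subst (asm) integrable_mstar) auto
 from la.integral_fst'[OF this]
 have "mellin A k v = (LINT r|lborel. LINT t|ang. A (pol (r, t)) * uch v k (pol (r, t)))"
  unfolding mellin_def by (subst integral_mstar) auto
 also have "... = (LINT r|lborel. angular A k r * cis (v * r))"
  unfolding angular_def chr_pol
  by (rule b_integral_cong[OF refl], subst integral_mult_left_zero[symmetric])
   (simp only: mult_ac)
 finally show "mellin A k v = fourier (angular A k) v" by (simp only: fourier_def)
qed

definition dual_measure :: "(int \<times> real) measure" where
 "dual_measure = count_space UNIV \<Otimes>\<^sub>M lborel"

interpretation kl: pair_sigma_finite "count_space (UNIV :: int set)" "lborel :: real measure"
 by (intro pair_sigma_finite.intro sigma_finite_measure_count_space_countable lborel.sigma_finite_measure_axioms) auto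

lemma dual_measurableI:
 "(!!k. (%v. f (k, v)) : bmeas borel) ==> f : bmeas dual_measure"
 unfolding dual_measure_def by (rule measurable_pair_measure_countable1) auto

lemma mellin_measurable: "annular A ==> mellin A k : bmeas borel"
proof -
 assume A: "annular A"
 obtain \<rho> B where "!!r t. \<rho> < \<bar>r\<bar> ==> A (pol (r, t)) = 0" using annular_bounds[OF A] by metis
 then interpret bump_line "angular A k" \<rho> by (rule angular_bump[OF A])
 show ?thesis unfolding mellin_eq_fourier[OF A] by (rule fourier_measurable)
qed

lemma mellin_dual_measurable: "annular A ==> (%(k, v). mellin A k v) : bmeas dual_measure"
 by (rule dual_measurableI) (simp add: mellin_measurable)

lemma annular_norm2:
 assumes A: "annular A"
 shows "integrable mstar (%s. (cmod (A s))^2)"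
proof -
 obtain \<rho> B where B: "B > 0" "!!s. cmod (A s) <= B" using annular_bounds[OF A] by metis
 have "integrable mstar (%s. A s * cnj (A s))"
  using annular_measurable[OF A] B(2)
  by (intro annular_integrable[OF A, of _ B] measurable_compose[OF _ borel_measurable_continuous_onI[OF continuous_on_cnj[OF continuous_on_id]]]) auto
 hence "integrable mstar (%s. norm (A s * cnj (A s)))" by (rule integrable_norm)
 thus ?thesis by (simp add: norm_mult power2_eq_square)
qed

text \<open>Expanding each circle in a Fourier series and then transforming the coefficients along the
  radius.\<close>

theorem plancherel_mellin:
 assumes A: "annular A"
 shows "(nn_integral dual_measure (%(k, v). ennreal ((cmod (mellin A k v))^2)))
  = ennreal (4 * pi^2 * (LINT s|mstar. (cmod (A s))^2))"
proof -
 note [measurable] = annular_measurable[OF A]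
 obtain \<rho> B where \<rho>: "!!r t. \<rho> < \<bar>r\<bar> ==> A (pol (r, t)) = 0" using annular_bounds[OF A] by metis
 have bl: "bump_line (angular A k) \<rho>" for k by (rule angular_bump[OF A \<rho>])
 have am [measurable]: "angular A k : bmeas borel" for k using bump_line.meas[OF bl] .
 have [measurable]: "mellin A k : bmeas borel" for k using mellin_measurable[OF A] .
 have pm [measurable]: "(%t. pol (r, t)) : bmeas ang" for r
  by (rule measurable_Pair2[OF pol_measurable]) simp
 have "(nn_integral dual_measure (%(k, v). ennreal ((cmod (mellin A k v))^2)))
   = (nn_integral (count_space UNIV) (%k. nn_integral lborel (%v. ennreal ((cmod (mellin A k v))^2))))"
  unfolding dual_measure_def
  by (subst lborel.nn_integral_fst[symmetric])
   (auto intro!: measurable_pair_measure_countable1 simp: case_prod_beta)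
 also have "... = (nn_integral (count_space UNIV) (%k. ennreal (2 * pi * (LINT r|lborel. (cmod (angular A k r))^2))))"
  unfolding mellin_eq_fourier[OF A] bump_line.plancherel_line[OF bl] ..
 also have "... = (nn_integral (count_space UNIV) (%k. nn_integral lborel (%r. ennreal (2 * pi) * ennreal ((cmod (angular A k r))^2))))"
 proof (rule nn_integral_cong)
  fix k
  have "(nn_integral lborel (%r. ennreal ((cmod (angular A k r))^2))) = ennreal (LINT r|lborel. (cmod (angular A k r))^2)"
   by (rule nn_integral_eq_integral[OF bump_line.bump_power2[OF bl]]) simp
  thus "ennreal (2 * pi * (LINT r|lborel. (cmod (angular A k r))^2))
   = (nn_integral lborel (%r. ennreal (2 * pi) * ennreal ((cmod (angular A k r))^2)))"
   by (subst nn_integral_cmult) (auto simp: ennreal_mult)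
 qed
 also have "... = (nn_integral lborel (%r. nn_integral (count_space UNIV) (%k. ennreal (2 * pi) * ennreal ((cmod (angular A k r))^2))))"
  by (rule kl.Fubini'[symmetric, where f = "%k r. ennreal (2 * pi) * ennreal ((cmod (angular A k r))^2)"])
   (auto intro!: measurable_pair_measure_countable1)
 also have "... = (nn_integral lborel (%r. nn_integral ang (%t. ennreal (4 * pi^2) * ennreal ((cmod (A (pol (r, t))))^2))))"
 proof (rule nn_integral_cong)
  fix r
  let ?F = "%z. A (of_real (exp r) * z)"
  have F: "?F (cis t) = A (pol (r, t))" for t by (simp add: pol_def)
  have i: "integrable ang (%t. (cmod (A (pol (r, t))))^2)"
  proof -
   obtain \<rho>' B where B: "B > 0" "!!s. cmod (A s) <= B" using annular_bounds[OF A] by metis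
   show ?thesis
   by (rule ang.integrable_const_bound[of _ "B^2"]) (use B in "auto intro!: power_mono")
  qed
  have "(nn_integral (count_space UNIV) (%k. ennreal (2 * pi) * ennreal ((cmod (angular A k r))^2)))
   = ennreal (2 * pi) * (nn_integral (count_space UNIV) (%k. ennreal ((cmod (angular A k r))^2)))"
   by (rule nn_integral_cmult) simp
  also have "(nn_integral (count_space UNIV) (%k. ennreal ((cmod (angular A k r))^2)))
   = ennreal (2 * pi * (LINT t|ang. (cmod (A (pol (r, t))))^2))"
   using parseval_circle[OF annular_slice_continuous[OF A, of r]] unfolding F angular_def .
  also have "ennreal (2 * pi) * ... = ennreal (4 * pi^2) * ennreal (LINT t|ang. (cmod (A (pol (r, t))))^2)"
   by (simp add: ennreal_mult[symmetric] power2_eq_square)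
  also have "... = ennreal (4 * pi^2) * (nn_integral ang (%t. ennreal ((cmod (A (pol (r, t))))^2)))"
   by (subst nn_integral_eq_integral[OF i]) auto
  also have "... = (nn_integral ang (%t. ennreal (4 * pi^2) * ennreal ((cmod (A (pol (r, t))))^2)))"
   by (rule nn_integral_cmult[symmetric]) measurable
  finally show "(nn_integral (count_space UNIV) (%k. ennreal (2 * pi) * ennreal ((cmod (angular A k r))^2)))
   = (nn_integral ang (%t. ennreal (4 * pi^2) * ennreal ((cmod (A (pol (r, t))))^2)))" .
 qed
 also have "... = (nn_integral mstar (%s. ennreal (4 * pi^2) * ennreal ((cmod (A s))^2)))"
  by (rule nn_integral_mstar[symmetric]) measurable
 also have "... = ennreal (4 * pi^2) * (nn_integral mstar (%s. ennreal ((cmod (A s))^2)))"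
  by (rule nn_integral_cmult) measurable
 also have "(nn_integral mstar (%s. ennreal ((cmod (A s))^2))) = ennreal (LINT s|mstar. (cmod (A s))^2)"
  by (rule nn_integral_eq_integral[OF annular_norm2[OF A]]) simp
 also have "ennreal (4 * pi^2) * ... = ennreal (4 * pi^2 * (LINT s|mstar. (cmod (A s))^2))"
  by (rule ennreal_mult[symmetric]) auto
 finally show ?thesis .
qed


lemma annular_add:
 assumes A: "annular A" and C: "annular C"
 shows "annular (%s. C s + w * A s)"
proof -
 obtain a where a: "a > 0" "!!s. A s ~= 0 ==> exp (- a) <= cmod s & cmod s <= exp a"
  using A unfolding annular_def by blast
 obtain c where c: "c > 0" "!!s. C s ~= 0 ==> exp (- c) <= cmod s & cmod s <= exp c"
  using C unfolding annular_def by blast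
 have "exp (- (a + c)) <= cmod s & cmod s <= exp (a + c)" if "C s + w * A s ~= 0" for s
 proof -
  have "exp (- (a + c)) <= exp (- a)" "exp (- (a + c)) <= exp (- c)" "exp a <= exp (a + c)" "exp c <= exp (a + c)"
   using a(1) c(1) by simp_all
  moreover have "A s ~= 0 \<or> C s ~= 0" using that by auto
  ultimately show ?thesis using a(2)[of s] c(2)[of s] by (elim disjE) (meson order_trans)+
 qed
 moreover have "continuous_on (- {0}) (%s. C s + w * A s)"
  using A C unfolding annular_def by (intro continuous_intros) auto
 ultimately show ?thesis using a(1) c(1) unfolding annular_def by (intro conjI exI[of _ "a + c"]) auto
qed

lemma mellin_add:
 assumes A: "annular A" and C: "annular C"
 shows "mellin (%s. C s + w * A s) k v = mellin C k v + w * mellin A k v"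
proof -
 have "mellin (%s. C s + w * A s) k v
   = (LINT s|mstar. C s * uch v k s + w * (A s * uch v k s))"
  unfolding mellin_def by (simp only: distrib_right mult.assoc)
 also have "... = mellin C k v + w * mellin A k v"
  unfolding mellin_def
  by (subst b_integral_add)
   (use annular_integrable_chr[OF A] annular_integrable_chr[OF C] in auto)
 finally show ?thesis .
qed

lemma polarization_complex:
 fixes a c :: complex
 shows "cnj c * a = (1/4) * (of_real ((cmod (c + 1 * a))^2) - of_real ((cmod (c + (-1) * a))^2))
  + (\<i>/4) * (of_real ((cmod (c + (-\<i>) * a))^2) - of_real ((cmod (c + \<i> * a))^2))"
 unfolding cmod_power2 by (simp add: complex_eq_iff power2_eq_square algebra_simps)

text \<open>Polarization of the Plancherel formula.\<close>

theorem mellin_parseval: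
 assumes A: "annular A" and C: "annular C"
 shows "has_bochner_integral dual_measure (%(k, v). cnj (mellin C k v) * mellin A k v)
  (of_real (4 * pi^2) * (LINT s|mstar. cnj (C s) * A s))"
proof -
 define I where "I w = (LINT s|mstar. (cmod (C s + w * A s))^2)" for w
 have 1: "has_bochner_integral mstar (%s. complex_of_real ((cmod (C s + w * A s))^2)) (of_real (I w))" for w
  using annular_norm2[OF annular_add[OF A C]]
  unfolding I_def by (intro has_bochner_integral_of_real has_bochner_integral_integrable)
 have "has_bochner_integral mstar (%s. cnj (C s) * A s)
  ((1/4) * (of_real (I 1) - of_real (I (-1))) + (\<i>/4) * (of_real (I (-\<i>)) - of_real (I \<i>)))"
  unfolding polarization_complex
  by (intro has_bochner_integral_add has_bochner_integral_diff has_bochner_integral_mult_right 1)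
 hence eq: "(LINT s|mstar. cnj (C s) * A s)
  = (1/4) * (of_real (I 1) - of_real (I (-1))) + (\<i>/4) * (of_real (I (-\<i>)) - of_real (I \<i>))"
  by (rule has_bochner_integral_integral_eq)
 have 2: "has_bochner_integral dual_measure
   (%(k, v). complex_of_real ((cmod (mellin C k v + w * mellin A k v))^2)) (of_real (4 * pi^2 * I w))" for w
 proof -
  let ?D = "%s. C s + w * A s"
  note D = annular_add[OF A C, of w]
  have "has_bochner_integral dual_measure (%(k, v). (cmod (mellin ?D k v))^2) (4 * pi^2 * I w)"
  proof (rule has_bochner_integral_nn_integral)
   have "(%p. (cmod ((%(k, v). mellin ?D k v) p))^2) : bmeas dual_measure"
   using mellin_dual_measurable[OF D] by measurable
   thus "(%(k, v). (cmod (mellin ?D k v))^2) : bmeas dual_measure"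
   by (simp add: case_prod_beta)
   show "(nn_integral dual_measure (%x. ennreal (case x of (k, v) => (cmod (mellin ?D k v))^2))) = ennreal (4 * pi^2 * I w)"
   unfolding I_def using plancherel_mellin[OF D] by (simp only: case_prod_beta')
  qed (auto simp: I_def)
  from has_bochner_integral_of_real[OF this, where 'a = complex] show ?thesis
   by (simp add: mellin_add[OF A C] case_prod_beta')
 qed
 have "has_bochner_integral dual_measure
   (%p. (1/4) * ((%(k, v). complex_of_real ((cmod (mellin C k v + 1 * mellin A k v))^2)) p
   - (%(k, v). complex_of_real ((cmod (mellin C k v + (-1) * mellin A k v))^2)) p)
   + (\<i>/4) * ((%(k, v). complex_of_real ((cmod (mellin C k v + (-\<i>) * mellin A k v))^2)) p
   - (%(k, v). complex_of_real ((cmod (mellin C k v + \<i> * mellin A k v))^2)) p))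
   ((1/4) * (of_real (4 * pi^2 * I 1) - of_real (4 * pi^2 * I (-1)))
   + (\<i>/4) * (of_real (4 * pi^2 * I (-\<i>)) - of_real (4 * pi^2 * I \<i>)))"
  by (intro has_bochner_integral_add has_bochner_integral_diff has_bochner_integral_mult_right 2)
 moreover have "(%p. (1/4) * ((%(k, v). complex_of_real ((cmod (mellin C k v + 1 * mellin A k v))^2)) p
   - (%(k, v). complex_of_real ((cmod (mellin C k v + (-1) * mellin A k v))^2)) p)
   + (\<i>/4) * ((%(k, v). complex_of_real ((cmod (mellin C k v + (-\<i>) * mellin A k v))^2)) p
   - (%(k, v). complex_of_real ((cmod (mellin C k v + \<i> * mellin A k v))^2)) p))
   = (%(k, v). cnj (mellin C k v) * mellin A k v)"
  by (rule ext) (simp only: case_prod_beta polarization_complex)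
 moreover have "(1/4) * (complex_of_real (4 * pi^2 * I 1) - of_real (4 * pi^2 * I (-1)))
   + (\<i>/4) * (of_real (4 * pi^2 * I (-\<i>)) - of_real (4 * pi^2 * I \<i>))
   = of_real (4 * pi^2) * (LINT s|mstar. cnj (C s) * A s)"
  unfolding eq by (simp add: algebra_simps)
 ultimately show ?thesis by (simp only:)
qed

section \<open>Uniqueness of Fourier transforms of integrable functions\<close>

text \<open>The positive and the negative part of \<open>h\<close> have the same total mass; normalized, they are probability
  densities with equal characteristic functions.\<close>

lemma fourier_unique_real:
 fixes h :: "real => real"
 assumes h: "integrable lborel h" and 0: "!!r. (LINT v|lborel. cis (v * r) * of_real (h v)) = 0"
 shows "AE v in lborel. h v = 0"
proof -
 define p q where "p v = max (h v) 0" and "q v = max (- h v) 0" for v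
 have p: "integrable lborel p" and q: "integrable lborel q" using h by (auto simp: p_def[abs_def] q_def[abs_def] intro!: integrable_max)
 note [measurable] = borel_measurable_integrable[OF p] borel_measurable_integrable[OF q]
 have pq: "h v = p v - q v" "p v >= 0" "q v >= 0" for v by (auto simp: p_def q_def max_def)
 have int: "integrable lborel (%v. cis (v * r) * of_real (f v))" if "integrable lborel f" for f :: "real => real" and r
  by (rule b_integrable_bound[OF that])
   (use borel_measurable_integrable[OF that] in "auto simp: norm_mult")
 have eq: "(LINT v|lborel. cis (v * r) * of_real (p v)) = (LINT v|lborel. cis (v * r) * of_real (q v))" for r
 proof -
  have "(LINT v|lborel. cis (v * r) * of_real (h v))
   = (LINT v|lborel. cis (v * r) * of_real (p v)) - (LINT v|lborel. cis (v * r) * of_real (q v))"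
   unfolding pq(1) of_real_diff right_diff_distrib
   by (rule b_integral_diff[OF int[OF p] int[OF q]])
  thus ?thesis using 0 by simp
 qed
 define c where "c = (LINT v|lborel. p v)"
 have cq: "(LINT v|lborel. q v) = c"
 proof -
  have "complex_of_real (LINT v|lborel. p v) = of_real (LINT v|lborel. q v)"
   using eq[of 0] by simp
  thus ?thesis unfolding c_def of_real_eq_iff by simp
 qed
 have c0: "c >= 0" unfolding c_def using pq by simp
 show ?thesis
 proof (cases "c = 0")
  case True
  have "AE v in lborel. p v = 0" using integral_nonneg_eq_0_iff_AE[OF p] pq True by (simp add: c_def)
  moreover have "AE v in lborel. q v = 0" using integral_nonneg_eq_0_iff_AE[OF q] pq True cq by simp
  ultimately show ?thesis by eventually_elim (simp add: pq(1))
 next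
  case False
  hence c: "c > 0" using c0 by simp
  have rd: "real_distribution (density lborel (%v. ennreal (f v / c)))"
   if f: "integrable lborel f" "!!v. f v >= 0" "(LINT v|lborel. f v) = c" for f
  proof -
   note [measurable] = borel_measurable_integrable[OF f(1)]
   have "emeasure (density lborel (%v. ennreal (f v / c))) (space (density lborel (%v. ennreal (f v / c))))
   = (nn_integral lborel (%v. ennreal (f v / c)))" by (simp add: emeasure_density)
   also have "... = ennreal (LINT v|lborel. f v / c)"
   using f c by (intro nn_integral_eq_integral) auto
   also have "... = 1" using f c by simp
   finally show ?thesis by (intro real_distribution.intro prob_spaceI real_distribution_axioms.intro) auto
  qed
  have ch: "char (density lborel (%v. ennreal (f v / c))) r = (LINT v|lborel. cis (v * r) * of_real (f v)) / of_real c"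
   if f: "integrable lborel f" "!!v. f v >= 0" for f r
  proof -
   note [measurable] = borel_measurable_integrable[OF f(1)]
   have "char (density lborel (%v. ennreal (f v / c))) r = (LINT v|lborel. (f v / c) *\<^sub>R iexp (r * v))"
   unfolding char_def by (rule integral_density) (use f c in auto)
   also have "... = (LINT v|lborel. cis (v * r) * of_real (f v) / of_real c)"
   by (simp add: scaleR_conv_of_real cis_conv_exp mult_ac)
   also have "... = (LINT v|lborel. cis (v * r) * of_real (f v)) / of_real c" by simp
   finally show ?thesis .
  qed
  have "density lborel (%v. ennreal (p v / c)) = density lborel (%v. ennreal (q v / c))"
   by (rule Levy_uniqueness[OF rd rd]) (use p q pq cq eq ch in "auto simp: c_def")
  hence "AE v in lborel. ennreal (p v / c) = ennreal (q v / c)"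
   by (subst (asm) sigma_finite_measure.density_unique_iff[OF lborel.sigma_finite_measure_axioms]) auto
  thus ?thesis by eventually_elim (use c pq in "auto simp: divide_right_mono")
 qed
qed

lemma fourier_unique:
 fixes f :: "real => complex"
 assumes f: "integrable lborel f" and 0: "!!r. (LINT v|lborel. cis (v * r) * f v) = 0"
 shows "AE v in lborel. f v = 0"
proof -
 note [measurable] = borel_measurable_integrable[OF f]
 have int: "integrable lborel (%v. cis (v * r) * f v)" for r
  by (rule b_integrable_bound[OF f]) (auto simp: norm_mult)
 have intc: "integrable lborel (%v. cnj (cis (v * (- r)) * f v))" for r
  using int[of "- r"] by (rule integrable_cnj)
 have c0: "(LINT v|lborel. cnj (cis (v * (- r)) * f v)) = 0" for r
  using 0[of "- r"] by (subst b_integral_cnj) simp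
 have re: "cis (v * r) * of_real (Re (f v)) = (1/2) * (cis (v * r) * f v + cnj (cis (v * (- r)) * f v))" for v r
  by (simp add: cis_cnj distrib_left[symmetric] complex_add_cnj)
 have im: "cis (v * r) * of_real (Im (f v)) = (1/(2*\<i>)) * (cis (v * r) * f v - cnj (cis (v * (- r)) * f v))" for v r
 proof -
  have "(1/(2*\<i>)) * (cis (v * r) * f v - cnj (cis (v * (- r)) * f v)) = cis (v * r) * ((f v - cnj (f v)) / (2*\<i>))"
   by (simp add: cis_cnj field_simps)
  also have "(f v - cnj (f v)) / (2*\<i>) = of_real (Im (f v))" by (simp add: complex_diff_cnj mult_ac)
  finally show ?thesis by simp
 qed
 have "AE v in lborel. Re (f v) = 0"
 proof (rule fourier_unique_real)
  show "integrable lborel (%v. Re (f v))" using f by simp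
  show "(LINT v|lborel. cis (v * r) * of_real (Re (f v))) = 0" for r
   unfolding re by (subst integral_mult_right_zero, subst b_integral_add[OF int intc])
   (simp only: 0 c0, simp)
 qed
 moreover have "AE v in lborel. Im (f v) = 0"
 proof (rule fourier_unique_real)
  show "integrable lborel (%v. Im (f v))" using f by simp
  show "(LINT v|lborel. cis (v * r) * of_real (Im (f v))) = 0" for r
   unfolding im by (subst integral_mult_right_zero, subst b_integral_diff[OF int intc])
   (simp only: 0 c0, simp)
 qed
 ultimately show ?thesis by eventually_elim (simp add: complex_eq_iff)
qed

lemma integral_dual_slice:
 fixes h :: "real => complex"
 assumes "integrable dual_measure (%(k, v). (if k = l then 1 else 0) * h v)"
 shows "(LINT (k, v)|dual_measure. (if k = l then 1 else 0) * h v) = (LINT v|lborel. h v)"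
proof -
 have "(LINT (k, v)|dual_measure. (if k = l then 1 else 0) * h v)
   = (LINT k|count_space UNIV. (LINT v|lborel. (if k = l then 1 else 0) * h v))"
  using kl.integral_fst'[OF assms[unfolded dual_measure_def]] unfolding dual_measure_def by simp
 also have "... = (\<Sum>k\<in>{k. k : UNIV & (LINT v|lborel. (if k = l then 1 else 0) * h v) ~= 0}. (LINT v|lborel. (if k = l then 1 else 0) * h v))"
  by (rule lebesgue_integral_count_space_finite_support)
   (rule finite_subset[of _ "{l}"], auto split: if_splits)
 also have "... = (\<Sum>k\<in>{l}. (LINT v|lborel. (if k = l then 1 else 0) * h v))"
  by (rule sum.mono_neutral_left) (auto split: if_splits)
 also have "... = (LINT v|lborel. h v)" by simp
 finally show ?thesis .
qed

text \<open>The orthogonality of the circle characters isolates one integer, and there the line uniqueness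
  applies.\<close>

theorem dual_unique:
 fixes F :: "int \<times> real => complex"
 assumes F: "integrable dual_measure F"
  and 0: "!!s. s ~= 0 ==> (LINT (k, v)|dual_measure. uch v k s * F (k, v)) = 0"
 shows "AE v in lborel. F (l, v) = 0"
proof -
 have sfd: "sigma_finite_measure dual_measure" unfolding dual_measure_def
  by (intro sigma_finite_pair_measure sigma_finite_measure_count_space_countable
   lborel.sigma_finite_measure_axioms) auto
 interpret ad: pair_sigma_finite ang dual_measure
  by (intro pair_sigma_finite.intro sfd ang.sigma_finite_measure_axioms)
 note [measurable] = borel_measurable_integrable[OF F]
 have Fl [measurable]: "(%v. F (k, v)) : bmeas borel" for k
  using measurable_Pair2[of F "count_space UNIV" lborel borel k] borel_measurable_integrable[OF F]
  by (simp add: dual_measure_def)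
 have Fi: "integrable lborel (%v. F (k, v))" for k
  using kl.AE_integrable_fst'[OF F[unfolded dual_measure_def]] by (simp add: AE_count_space)
 show ?thesis
 proof (rule fourier_unique[OF Fi])
  fix r
  define h where "h v = cis (v * r) * F (l, v)" for v
  define g where "g = (%(t, p). cis (of_int (fst p - l) * t) * (cis (snd p * r) * F p))"
  have gm: "g : bmeas (ang \<Otimes>\<^sub>M dual_measure)"
  proof -
   have k1: "(%p. cis (of_int (fst (snd p) - l) * fst p)) : bmeas (ang \<Otimes>\<^sub>M dual_measure)"
   proof (rule measurable_compose_countable'[where f = "%k p. cis (of_int (k - l) * fst p)" and g = "%p. fst (snd p)" and I = UNIV])
   show "(%p. cis (real_of_int (k - l) * fst p)) : bmeas (ang \<Otimes>\<^sub>M dual_measure)" for k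
   by (rule measurable_compose[OF measurable_fst cis_ang])
   show "(%p. fst (snd p)) : measurable (ang \<Otimes>\<^sub>M dual_measure) (count_space UNIV)"
   unfolding dual_measure_def by measurable
   qed simp
   have k2: "(%p. cis (snd p * r) * F p) : bmeas dual_measure"
   proof (intro borel_measurable_times)
   show "(%p. cis (snd p * r)) : bmeas dual_measure" unfolding dual_measure_def by measurable
   qed measurable
   show ?thesis unfolding g_def case_prod_beta
   by (intro borel_measurable_times k1 measurable_compose[OF measurable_snd k2])
  qed
  have gi: "integrable (ang \<Otimes>\<^sub>M dual_measure) g"
   by (rule integrable_pair_bound[of _ _ "%_. 1" "%p. cmod (F p)"])
   (use F gm sfd in "auto simp: g_def norm_mult intro: ang.sigma_finite_measure_axioms")
  have one: "(LINT p|dual_measure. g (t, p)) = 0" for t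
  proof -
   have "g (t, p) = cis (- of_int l * t) * ((%(k, v). uch v k (pol (r, t)) * F (k, v)) p)" for p
   proof -
   have "cis (of_int (fst p - l) * t) = cis (- of_int l * t) * cis (of_int (fst p) * t)"
   by (simp add: cis_mult algebra_simps)
   thus ?thesis by (cases p) (simp only: g_def chr_pol case_prod_conv fst_conv snd_conv mult_ac)
   qed
   hence "(LINT p|dual_measure. g (t, p))
   = cis (- of_int l * t) * (LINT (k, v)|dual_measure. uch v k (pol (r, t)) * F (k, v))"
   by (simp only: integral_mult_right_zero)
   thus ?thesis using 0[of "pol (r, t)"] by simp
  qed
  have two: "(LINT t|ang. g (t, p)) = of_real (2 * pi) * ((%(k, v). (if k = l then 1 else 0) * h v) p)" for p
  proof -
   have "(LINT t|ang. g (t, p)) = (LINT t|ang. cis (of_int (fst p - l) * t)) * (cis (snd p * r) * F p)"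
   unfolding g_def case_prod_conv by (rule integral_mult_left_zero)
   thus ?thesis unfolding integral_ang_cis by (cases p) (auto simp: h_def)
  qed
  have "(LINT p|dual_measure. (LINT t|ang. g (t, p))) = (LINT t|ang. (LINT p|dual_measure. g (t, p)))"
   using ad.Fubini_integral[of "%t p. g (t, p)"] gi by simp
  hence z: "of_real (2 * pi) * (LINT (k, v)|dual_measure. (if k = l then 1 else 0) * h v) = 0"
   unfolding one two by simp
  have "integrable dual_measure (%(k, v). (if k = l then 1 else 0) * h v)"
  proof (rule b_integrable_bound[OF F])
   show "(%(k, v). (if k = l then 1 else 0) * h v) : bmeas dual_measure"
   by (rule dual_measurableI) (simp add: h_def)
   show "AE p in dual_measure. norm ((%(k, v). (if k = l then 1 else 0) * h v) p) <= norm (F p)"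
   by (intro AE_I2) (auto simp: h_def norm_mult)
  qed
  from integral_dual_slice[OF this] z show "(LINT v|lborel. cis (v * r) * F (l, v)) = 0"
   by (simp add: h_def)
 qed
qed


section \<open>Lebesgue measure on the complex plane\<close>

lemma Complex_measurable [measurable]: "(%p. Complex (fst p) (snd p)) : bmeas (lborel \<Otimes>\<^sub>M lborel)"
 unfolding Complex_eq by measurable

lemma lborel_complex: "(lborel :: complex measure) = distr (lborel \<Otimes>\<^sub>M lborel) borel (%p. Complex (fst p) (snd p))"
proof (rule lborel_eqI)
 fix l u :: complex assume le: "!!b. b : Basis ==> l \<bullet> b <= u \<bullet> b"
 have lu: "Re l <= Re u" "Im l <= Im u" using le[of 1] le[of \<i>] by (auto simp: Basis_complex_def)
 have "(%p. Complex (fst p) (snd p)) -` box l u \<inter> space (lborel \<Otimes>\<^sub>M lborel)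
   = {Re l<..<Re u} \<times> {Im l<..<Im u}"
  by (auto simp: box_def Basis_complex_def space_pair_measure)
 hence "emeasure (distr (lborel \<Otimes>\<^sub>M lborel) borel (%p. Complex (fst p) (snd p))) (box l u)
   = emeasure (lborel \<Otimes>\<^sub>M lborel) ({Re l<..<Re u} \<times> {Im l<..<Im u})"
  by (subst emeasure_distr) auto
 also have "... = ennreal (Re u - Re l) * ennreal (Im u - Im l)"
  using lu by (subst lborel.emeasure_pair_measure_Times) auto
 also have "... = ennreal (\<Prod>b\<in>Basis. (u - l) \<bullet> b)"
  using lu by (simp add: Basis_complex_def ennreal_mult)
 finally show "emeasure (distr (lborel \<Otimes>\<^sub>M lborel) borel (%p. Complex (fst p) (snd p))) (box l u)
   = ennreal (\<Prod>b\<in>Basis. (u - l) \<bullet> b)" .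
qed simp

lemma nn_integral_complex:
 assumes [measurable]: "F : bmeas borel"
 shows "(nn_integral lborel (%z. F z)) = (nn_integral lborel (%x. nn_integral lborel (%y. F (Complex x y))))"
 by (subst lborel_complex, subst nn_integral_distr)
   (auto simp: lborel.nn_integral_fst[symmetric])

lemma nn_integral_swap_real:
 fixes f :: "real => real => ennreal"
 assumes "(%p. f (fst p) (snd p)) : bmeas (borel \<Otimes>\<^sub>M borel)"
 shows "(nn_integral lborel (%x. nn_integral lborel (%y. f x y))) = (nn_integral lborel (%y. nn_integral lborel (%x. f x y)))"
proof (rule lborel_pair.Fubini'[symmetric])
 show "(%(x, y). f x y) : bmeas (lborel \<Otimes>\<^sub>M lborel)"
  using assms unfolding case_prod_beta'
  by (subst measurable_cong_sets[OF sets_pair_measure_cong[OF sets_lborel sets_lborel] refl])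
qed

lemma nn_integral_affine_inv:
 fixes c :: real
 assumes "f : bmeas borel" "c ~= 0"
 shows "(nn_integral lborel (%x. f (t + c * x))) = ennreal (1 / \<bar>c\<bar>) * (nn_integral lborel (%x. f x))"
proof -
 have "ennreal (1 / \<bar>c\<bar>) * (nn_integral lborel (%x. f x)) = ennreal (1 / \<bar>c\<bar>) * (ennreal \<bar>c\<bar> * (nn_integral lborel (%x. f (t + c * x))))"
  using nn_integral_real_affine[OF assms, of t] by simp
 also have "... = (nn_integral lborel (%x. f (t + c * x)))"
  using assms(2) by (simp add: mult.assoc[symmetric] ennreal_mult[symmetric] del: ennreal_1)
   (simp add: ennreal_1)
 finally show ?thesis by simp
qed

text \<open>A multiplication by \<open>a + i b\<close> is a composition of two maps which each change one real
  coordinate by an affine substitution.\<close>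

lemma nn_integral_complex_scale:
 assumes F [measurable]: "F : bmeas borel" and c: "c ~= (0::complex)"
 shows "(nn_integral lborel (%z. F (c * z))) = ennreal (1 / (cmod c)^2) * (nn_integral lborel (%z. F z))"
proof -
 define a b where "a = Re c" and "b = Im c"
 have cz: "c * Complex x y = Complex (a * x - b * y) (b * x + a * y)" for x y
  by (simp add: complex_eq_iff a_def b_def algebra_simps)
 have nc: "(cmod c)^2 = a^2 + b^2" by (simp add: cmod_power2 a_def b_def)
 have [measurable]: "(%x. F (Complex (f x) (g x))) : bmeas M"
  if "f : bmeas M" "g : bmeas M" for f g and M :: "'m measure"
  unfolding Complex_eq using that by measurable
 have L: "(nn_integral lborel (%z. F (c * z))) = (nn_integral lborel (%x. nn_integral lborel (%y. F (Complex (a * x - b * y) (b * x + a * y)))))"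
  by (subst nn_integral_complex) (auto simp: cz)
 have R: "(nn_integral lborel (%z. F z)) = (nn_integral lborel (%x. nn_integral lborel (%y. F (Complex x y))))"
  by (rule nn_integral_complex) measurable
 show ?thesis
 proof (cases "a = 0")
  case True
  have b: "b ~= 0" using True c by (auto simp: a_def b_def complex_eq_iff)
  have "(nn_integral lborel (%x. nn_integral lborel (%y. F (Complex (a * x - b * y) (b * x + a * y)))))
   = (nn_integral lborel (%x. nn_integral lborel (%y. F (Complex (0 + (- b) * y) (b * x)))))" using True by simp
  also have "... = (nn_integral lborel (%x. ennreal (1 / \<bar>b\<bar>) * (nn_integral lborel (%y. F (Complex y (b * x))))))"
   using b by (subst nn_integral_affine_inv[where f = "%y. F (Complex y (b * _))"]) auto
  also have "... = ennreal (1 / \<bar>b\<bar>) * (nn_integral lborel (%x. (nn_integral lborel (%y. F (Complex y (b * x))))))"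
   by (rule nn_integral_cmult) measurable
  also have "(nn_integral lborel (%x. (nn_integral lborel (%y. F (Complex y (b * x))))))
   = (nn_integral lborel (%y. (nn_integral lborel (%x. F (Complex y (0 + b * x))))))"
   by (subst nn_integral_swap_real) auto
  also have "... = (nn_integral lborel (%y. ennreal (1 / \<bar>b\<bar>) * (nn_integral lborel (%x. F (Complex y x)))))"
   using b by (subst nn_integral_affine_inv[where f = "%x. F (Complex _ x)"]) auto
  also have "... = ennreal (1 / \<bar>b\<bar>) * (nn_integral lborel (%y. (nn_integral lborel (%x. F (Complex y x)))))"
   by (rule nn_integral_cmult) measurable
  finally show ?thesis
   unfolding L R nc using True
   by (simp add: mult.assoc[symmetric] ennreal_mult[symmetric] power2_eq_square)
 next
  case False
  define e where "e = (a^2 + b^2) / a"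
  have e: "e ~= 0" using False by (simp add: e_def sum_power2_eq_zero_iff)
  have m1: "(%p. F (Complex (a * fst p - b * snd p) (b * fst p + a * snd p))) : bmeas (borel \<Otimes>\<^sub>M borel)"
   by measurable
  have "(nn_integral lborel (%x. nn_integral lborel (%y. F (Complex (a * x - b * y) (b * x + a * y)))))
   = (nn_integral lborel (%y. nn_integral lborel (%x. F (Complex (a * x - b * y) (b * x + a * y)))))"
   by (rule nn_integral_swap_real[OF m1])
  also have "... = (nn_integral lborel (%y. ennreal (1 / \<bar>a\<bar>) * (nn_integral lborel (%x. F (Complex x (b * x / a + e * y))))))"
  proof (rule nn_integral_cong)
   fix y
   have "(nn_integral lborel (%x. F (Complex (a * x - b * y) (b * x + a * y))))
   = (nn_integral lborel (%x. (%x. F (Complex x (b * x / a + e * y))) (- b * y + a * x)))"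
   using False by (intro nn_integral_cong arg_cong[of _ _ F]) (simp add: e_def field_simps power2_eq_square)
   also have "... = ennreal (1 / \<bar>a\<bar>) * (nn_integral lborel (%x. F (Complex x (b * x / a + e * y))))"
   by (rule nn_integral_affine_inv) (use False in auto)
   finally show "(nn_integral lborel (%x. F (Complex (a * x - b * y) (b * x + a * y))))
   = ennreal (1 / \<bar>a\<bar>) * (nn_integral lborel (%x. F (Complex x (b * x / a + e * y))))" .
  qed
  also have "... = ennreal (1 / \<bar>a\<bar>) * (nn_integral lborel (%y. (nn_integral lborel (%x. F (Complex x (b * x / a + e * y))))))"
   by (rule nn_integral_cmult) measurable
  also have "(nn_integral lborel (%y. (nn_integral lborel (%x. F (Complex x (b * x / a + e * y))))))
   = (nn_integral lborel (%x. (nn_integral lborel (%y. F (Complex x (b * x / a + e * y))))))"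
   by (subst nn_integral_swap_real) auto
  also have "... = (nn_integral lborel (%x. ennreal (1 / \<bar>e\<bar>) * (nn_integral lborel (%y. F (Complex x y)))))"
  proof (rule nn_integral_cong)
   fix x
   show "(nn_integral lborel (%y. F (Complex x (b * x / a + e * y)))) = ennreal (1 / \<bar>e\<bar>) * (nn_integral lborel (%y. F (Complex x y)))"
   by (rule nn_integral_affine_inv[where f = "%y. F (Complex x y)"]) (use e in auto)
  qed
  also have "... = ennreal (1 / \<bar>e\<bar>) * (nn_integral lborel (%x. (nn_integral lborel (%y. F (Complex x y)))))"
   by (rule nn_integral_cmult) measurable
  finally have fin: "(nn_integral lborel (%z. F (c * z)))
   = ennreal (1 / \<bar>a\<bar>) * (ennreal (1 / \<bar>e\<bar>) * (nn_integral lborel (%z. F z)))" unfolding L R .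
  have "(1 / \<bar>a\<bar>) * (1 / \<bar>e\<bar>) = 1 / (cmod c)^2"
   unfolding nc e_def using False by (simp add: abs_divide)
  thus ?thesis unfolding fin by (simp add: mult.assoc[symmetric] ennreal_mult[symmetric])
 qed
qed

lemma AE_lborel_complex_nonzero: "AE z::complex in lborel. z ~= 0"
 by (rule AE_lborel_singleton)

section \<open>Polar coordinates\<close>

lemma nn_integral_substitution_exhaust:
 fixes F :: "real => ennreal" and g g' :: "real => real" and a b :: "nat => real"
 assumes F [measurable]: "F : bmeas borel"
  and g [measurable]: "(%x. F (g x) * ennreal (g' x)) : bmeas borel"
  and ab: "!!n. a n < b n" and dec: "!!n. a (Suc n) <= a n" and inc: "!!n. b n <= b (Suc n)"
  and der: "!!n x. x : {a n..b n} ==> (g has_real_derivative g' x) (at x)"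
  and cont: "!!n. continuous_on {a n..b n} g'" and pos: "!!n x. x : {a n..b n} ==> 0 <= g' x"
  and dec': "!!n. g (a (Suc n)) <= g (a n)" and inc': "!!n. g (b n) <= g (b (Suc n))"
 shows "(nn_integral lborel (%x. F x * indicator (\<Union>n. {g (a n)..g (b n)}) x))
  = (nn_integral lborel (%x. F (g x) * ennreal (g' x) * indicator (\<Union>n. {a n..b n}) x))"
proof -
 have A: "incseq (%n. {g (a n)..g (b n)})" using dec' inc' by (intro incseq_SucI) auto
 have B: "incseq (%n. {a n..b n})" using dec inc by (intro incseq_SucI) auto
 have "(nn_integral lborel (%x. F x * indicator (\<Union>n. {g (a n)..g (b n)}) x))
   = emeasure (density lborel F) (\<Union>n. {g (a n)..g (b n)})"
  by (subst emeasure_density) auto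
 also have "... = (SUP n. emeasure (density lborel F) {g (a n)..g (b n)})"
  using A by (intro SUP_emeasure_incseq[symmetric]) auto
 also have "... = (SUP n. emeasure (density lborel (%x. F (g x) * ennreal (g' x))) {a n..b n})"
 proof (rule SUP_cong[OF refl])
  fix n
  show "emeasure (density lborel F) {g (a n)..g (b n)} = emeasure (density lborel (%x. F (g x) * ennreal (g' x))) {a n..b n}"
   using nn_integral_substitution_aux[OF F _ der cont pos ab, of n]
   by (subst (1 2) emeasure_density) (auto)
 qed
 also have "... = emeasure (density lborel (%x. F (g x) * ennreal (g' x))) (\<Union>n. {a n..b n})"
  using B by (intro SUP_emeasure_incseq) auto
 also have "... = (nn_integral lborel (%x. F (g x) * ennreal (g' x) * indicator (\<Union>n. {a n..b n}) x))"
  by (subst emeasure_density) auto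
 finally show ?thesis .
qed

lemma nn_integral_tan:
 assumes F [measurable]: "F : bmeas borel" and x: "x > 0"
 shows "(nn_integral lborel (%y. F y))
  = (nn_integral lborel (%t. F (x * tan t) * ennreal (x / (cos t)^2) * indicator {-(pi/2)<..<pi/2} t))"
proof -
 define a where "a n = arctan (real (Suc n))" for n
 have an: "0 < a n" "a n < pi/2" "tan (a n) = real (Suc n)" for n
  using arctan_ubound[of "real (Suc n)"] by (auto simp: a_def tan_arctan)
 have cover: "(\<Union>n. {x * tan (- a n)..x * tan (a n)}) = UNIV"
 proof -
  have "EX n. y : {x * tan (- a n)..x * tan (a n)}" for y
  proof -
   obtain n where n: "\<bar>y / x\<bar> <= real n" using real_arch_simple by blast
   hence "\<bar>y\<bar> <= real (Suc n) * x" using x by (simp add: abs_divide field_simps)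
   thus ?thesis by (intro exI[of _ n]) (auto simp: an abs_le_iff algebra_simps)
  qed
  thus ?thesis by blast
 qed
 have cover2: "(\<Union>n. {- a n..a n}) = {-(pi/2)<..<pi/2}"
 proof (rule set_eqI, rule iffI)
  fix t assume "t : (\<Union>n. {- a n..a n})"
  then obtain n where "- a n <= t" "t <= a n" by auto
  thus "t : {-(pi/2)<..<pi/2}" using an(2)[of n] by simp
 next
  fix t assume t: "t : {-(pi/2)<..<pi/2}"
  obtain n where n: "\<bar>tan t\<bar> <= real n" using real_arch_simple by blast
  have "arctan (tan t) = t" using t by (intro arctan_tan) auto
  moreover have "arctan (tan t) <= arctan (real (Suc n))" "arctan (- real (Suc n)) <= arctan (tan t)"
   using n by (auto simp: arctan_le_iff)
  ultimately have "t : {- a n..a n}" by (simp add: a_def arctan_minus del: of_nat_Suc)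
  thus "t : (\<Union>n. {- a n..a n})" by blast
 qed
 have mono: "a n <= a (Suc n)" for n by (simp add: a_def arctan_le_iff)
 have cosp: "cos t > 0" if "t : {- a n..a n}" for t n
  using that an[of n] by (intro cos_gt_zero_pi) auto
 have "(nn_integral lborel (%y. F y * indicator (\<Union>n. {(%t. x * tan t) (- a n)..(%t. x * tan t) (a n)}) y))
  = (nn_integral lborel (%t. F (x * tan t) * ennreal (x / (cos t)^2) * indicator (\<Union>n. {- a n..a n}) t))"
 proof (rule nn_integral_substitution_exhaust[OF F])
  show "(%t. F (x * tan t) * ennreal (x / (cos t)^2)) : bmeas borel"
   unfolding tan_def by measurable
  show "- a n < a n" for n using an(1)[of n] by simp
  show "- a (Suc n) <= - a n" "a n <= a (Suc n)" for n using mono by auto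
  show "((%t. x * tan t) has_real_derivative x / (cos t)^2) (at t)" if "t : {- a n..a n}" for n t
   using cosp[OF that] by (auto intro!: derivative_eq_intros simp: field_simps)
  show "continuous_on {- a n..a n} (%t. x / (cos t)^2)" for n
   by (intro continuous_intros) (use cosp in force)
  show "0 <= x / (cos t)^2" for t using x by simp
  show "x * tan (- a (Suc n)) <= x * tan (- a n)" "x * tan (a n) <= x * tan (a (Suc n))" for n
   using x by (auto simp: an)
 qed
 thus ?thesis unfolding cover cover2 by simp
qed

lemma nn_integral_exp:
 assumes F [measurable]: "F : bmeas borel" and c: "c > 0"
 shows "(nn_integral lborel (%x. F x * indicator {0<..} x)) = (nn_integral lborel (%r. F (c * exp r) * ennreal (c * exp r)))"
proof -
 have "(nn_integral lborel (%x. F x * indicator (\<Union>n. {(%r. c * exp r) (- real (Suc n))..(%r. c * exp r) (real (Suc n))}) x))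
  = (nn_integral lborel (%r. F (c * exp r) * ennreal (c * exp r) * indicator (\<Union>n. {- real (Suc n)..real (Suc n)}) r))"
  by (rule nn_integral_substitution_exhaust[OF F])
   (use c in "auto intro!: derivative_eq_intros continuous_intros")
 moreover have "(\<Union>n. {- real (Suc n)..real (Suc n)}) = UNIV"
 proof -
  have "EX n. r : {- real (Suc n)..real (Suc n)}" for r
  proof -
   obtain n where "\<bar>r\<bar> <= real n" using real_arch_simple by blast
   thus ?thesis by (intro exI[of _ n]) auto
  qed
  thus ?thesis by blast
 qed
 moreover have "(\<Union>n. {c * exp (- real (Suc n))..c * exp (real (Suc n))}) = {0<..}"
 proof (rule set_eqI, rule iffI)
  fix x assume "x : (\<Union>n. {c * exp (- real (Suc n))..c * exp (real (Suc n))})"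
  then obtain n where "c * exp (- real (Suc n)) <= x" by auto
  moreover have "0 < c * exp (- real (Suc n))" using c by simp
  ultimately show "x : {0<..}" by (simp only: greaterThan_iff)
 next
  fix x :: real assume "x : {0<..}"
  hence x: "x / c > 0" using c by simp
  obtain n where "\<bar>ln (x / c)\<bar> <= real n" using real_arch_simple by blast
  hence "- real (Suc n) <= ln (x / c)" "ln (x / c) <= real (Suc n)" by auto
  hence "exp (- real (Suc n)) <= exp (ln (x / c))" "exp (ln (x / c)) <= exp (real (Suc n))"
   by (simp_all only: exp_le_cancel_iff)
  hence "exp (- real (Suc n)) <= x / c" "x / c <= exp (real (Suc n))" using x by simp_all
  hence "x : {c * exp (- real (Suc n))..c * exp (real (Suc n))}"
   using c by (simp add: field_simps del: of_nat_Suc)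
  thus "x : (\<Union>n. {c * exp (- real (Suc n))..c * exp (real (Suc n))})" by blast
 qed
 ultimately show ?thesis by simp
qed

text \<open>Each half-plane is parametrized by the slope \<open>tan t\<close> of the ray and then by the logarithm of
  the radius.\<close>

lemma nn_integral_half_plane:
 assumes F [measurable]: "F : bmeas borel"
 shows "(nn_integral lborel (%x. (nn_integral lborel (%y. F (Complex x y))) * indicator {0<..} x))
  = (nn_integral lborel (%t. (nn_integral lborel (%r. F (pol (r, t)) * ennreal (exp (2 * r)))) * indicator {-(pi/2)<..<pi/2} t))"
proof -
 have C [measurable]: "(%x. F (Complex (f x) (g x))) : bmeas M"
  if "f : bmeas M" "g : bmeas M" for f g and M :: "'m measure"
  unfolding Complex_eq using that by measurable
 let ?J = "{-(pi/2)<..<pi/2}"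
 have tm [measurable]: "(tan :: real => real) : bmeas borel" unfolding tan_def[abs_def] by measurable
 have "(nn_integral lborel (%x. (nn_integral lborel (%y. F (Complex x y))) * indicator {0<..} x))
  = (nn_integral lborel (%x. (nn_integral lborel (%t. F (Complex x (x * tan t)) * ennreal (x / (cos t)^2) * indicator ?J t * indicator {0<..} x))))"
 proof (rule nn_integral_cong)
  fix x :: real
  show "(nn_integral lborel (%y. F (Complex x y))) * indicator {0<..} x
   = (nn_integral lborel (%t. F (Complex x (x * tan t)) * ennreal (x / (cos t)^2) * indicator ?J t * indicator {0<..} x))"
  proof (cases "x > 0")
   case True thus ?thesis using nn_integral_tan[of "%y. F (Complex x y)" x] by simp
  qed simp
 qed
 also have "... = (nn_integral lborel (%t. (nn_integral lborel (%x. F (Complex x (x * tan t)) * ennreal (x / (cos t)^2) * indicator ?J t * indicator {0<..} x))))"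
  by (rule nn_integral_swap_real) measurable
 also have "... = (nn_integral lborel (%t. (nn_integral lborel (%r. F (pol (r, t)) * ennreal (exp (2 * r)))) * indicator ?J t))"
 proof (rule nn_integral_cong)
  fix t :: real
  show "(nn_integral lborel (%x. F (Complex x (x * tan t)) * ennreal (x / (cos t)^2) * indicator ?J t * indicator {0<..} x))
   = (nn_integral lborel (%r. F (pol (r, t)) * ennreal (exp (2 * r)))) * indicator ?J t"
  proof (cases "t : ?J")
   case True
   hence ct: "cos t > 0" by (intro cos_gt_zero_pi) auto
   have "(nn_integral lborel (%x. F (Complex x (x * tan t)) * ennreal (x / (cos t)^2) * indicator {0<..} x))
   = (nn_integral lborel (%r. F (Complex (cos t * exp r) (cos t * exp r * tan t)) * ennreal (cos t * exp r / (cos t)^2) * ennreal (cos t * exp r)))"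
   by (rule nn_integral_exp[where F = "%x. F (Complex x (x * tan t)) * ennreal (x / (cos t)^2)", OF _ ct]) measurable
   also have "... = (nn_integral lborel (%r. F (pol (r, t)) * ennreal (exp (2 * r))))"
   proof (rule nn_integral_cong)
   fix r
   have "Complex (cos t * exp r) (cos t * exp r * tan t) = pol (r, t)"
   using ct by (simp add: pol_def complex_eq_iff tan_def)
   moreover have "ennreal (cos t * exp r / (cos t)^2) * ennreal (cos t * exp r) = ennreal (exp (2 * r))"
   proof -
   have "cos t * exp r / (cos t)^2 * (cos t * exp r) = exp r * exp r"
   using ct by (simp add: power2_eq_square)
   also have "... = exp (2 * r)" by (simp add: mult_exp_exp)
   finally show ?thesis using ct by (simp add: ennreal_mult[symmetric])
   qed
   ultimately show "F (Complex (cos t * exp r) (cos t * exp r * tan t)) * ennreal (cos t * exp r / (cos t)^2) * ennreal (cos t * exp r)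
   = F (pol (r, t)) * ennreal (exp (2 * r))" by (simp only: mult.assoc)
   qed
   finally show ?thesis using True by simp
  qed simp
 qed
 finally show ?thesis .
qed

theorem nn_integral_polar:
 assumes F [measurable]: "F : bmeas borel"
 shows "(nn_integral lborel (%z. F z)) = (nn_integral mstar (%s. F s * ennreal ((cmod s)^2)))"
proof -
 have C [measurable]: "(%x. F (Complex (f x) (g x))) : bmeas M"
  if "f : bmeas M" "g : bmeas M" for f g and M :: "'m measure"
  unfolding Complex_eq using that by measurable
 have polm [measurable]: "(%p. F (pol (f p, g p))) : bmeas M"
  if "f : bmeas M" "g : bmeas M" for f g and M :: "'m measure"
  unfolding pol_def fst_conv snd_conv using that by measurable
 define H where "H t = (nn_integral lborel (%r. F (pol (r, t)) * ennreal (exp (2 * r))))" for t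
 have [measurable]: "H : bmeas borel" unfolding H_def by measurable
 let ?G = "%x. nn_integral lborel (%y. F (Complex x y))"
 have "(nn_integral lborel (%z. F z)) = (nn_integral lborel (%x. ?G x))" by (rule nn_integral_complex[OF F])
 also have "... = (nn_integral lborel (%x. ?G x * indicator {0<..} x + ?G x * indicator {..<0} x))"
  by (rule nn_integral_cong_AE, use AE_lborel_singleton[of "0::real"] in eventually_elim)
   (auto simp: indicator_def)
 also have "... = (nn_integral lborel (%x. ?G x * indicator {0<..} x)) + (nn_integral lborel (%x. ?G x * indicator {..<0} x))"
  by (rule nn_integral_add) measurable
 also have "(nn_integral lborel (%x. ?G x * indicator {0<..} x)) = (nn_integral lborel (%t. H t * indicator {-(pi/2)<..<pi/2} t))"
  unfolding H_def by (rule nn_integral_half_plane[OF F])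
 also have "(nn_integral lborel (%x. ?G x * indicator {..<0} x)) = (nn_integral lborel (%t. H t * indicator {pi/2<..<3*pi/2} t))"
 proof -
  have "(nn_integral lborel (%x. ?G x * indicator {..<0} x))
   = (nn_integral lborel (%x. (nn_integral lborel (%y. F (- Complex x y))) * indicator {0<..} x))"
  proof -
   have "(nn_integral lborel (%y. F (- Complex x y))) = ?G (- x)" for x
   proof -
   have "- Complex x y = Complex (- x) (0 + (-1) * y)" for y by (simp add: complex_eq_iff)
   thus ?thesis using nn_integral_affine_inv[of "%y. F (Complex (- x) y)" "-1" 0] by simp
   qed
   moreover have "(nn_integral lborel (%x. ?G (0 + (-1) * x) * indicator {..<0} (0 + (-1) * x)))
   = (nn_integral lborel (%x. ?G x * indicator {..<0} x))"
   using nn_integral_affine_inv[of "%x. ?G x * indicator {..<0} x" "-1" 0] by simp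
   ultimately show ?thesis by (simp add: indicator_def)
  qed
  also have "... = (nn_integral lborel (%t. (nn_integral lborel (%r. F (- pol (r, t)) * ennreal (exp (2 * r)))) * indicator {-(pi/2)<..<pi/2} t))"
   by (rule nn_integral_half_plane[where F = "%z. F (- z)"]) measurable
  also have "... = (nn_integral lborel (%t. H (t + pi) * indicator {pi/2<..<3*pi/2} (t + pi)))"
  proof (rule nn_integral_cong)
   fix t
   have "- pol (r, t) = pol (r, t + pi)" for r
   by (simp add: pol_def complex_eq_iff)
   moreover have "indicator {-(pi/2)<..<pi/2} t = (indicator {pi/2<..<3*pi/2} (t + pi) :: ennreal)"
   by (auto simp: indicator_def field_simps)
   ultimately show "(nn_integral lborel (%r. F (- pol (r, t)) * ennreal (exp (2 * r)))) * indicator {-(pi/2)<..<pi/2} t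
   = H (t + pi) * indicator {pi/2<..<3*pi/2} (t + pi)" by (simp only: H_def)
  qed
  also have "... = (nn_integral lborel (%t. H t * indicator {pi/2<..<3*pi/2} t))"
   using nn_integral_affine_inv[of "%t. H t * indicator {pi/2<..<3*pi/2} t" 1 pi] by (simp add: add.commute)
  finally show ?thesis .
 qed
 also have "(nn_integral lborel (%t. H t * indicator {-(pi/2)<..<pi/2} t)) + (nn_integral lborel (%t. H t * indicator {pi/2<..<3*pi/2} t))
   = (nn_integral lborel (%t. H t * indicator {-(pi/2)<..<pi/2} t + H t * indicator {pi/2<..<3*pi/2} t))"
  by (rule nn_integral_add[symmetric]) measurable
 also have "... = (nn_integral lborel (%t. H t * indicator {-(pi/2)..3*pi/2} t))"
 proof (rule nn_integral_cong_AE, use AE_lborel_singleton[of "-(pi/2)"] AE_lborel_singleton[of "pi/2"] AE_lborel_singleton[of "3*pi/2"] in eventually_elim)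
  fix t :: real assume "t ~= -(pi/2)" "t ~= pi/2" "t ~= 3*pi/2"
  thus "H t * indicator {-(pi/2)<..<pi/2} t + H t * indicator {pi/2<..<3*pi/2} t = H t * indicator {-(pi/2)..3*pi/2} t"
   using pi_gt_zero by (auto simp: indicator_def)
 qed
 also have "... = (nn_integral ang (%t. H t))"
  unfolding ang_def by (subst nn_integral_restrict_space) auto
 also have "... = (nn_integral ang (%t. nn_integral lborel (%r. F (pol (r, t)) * ennreal ((cmod (pol (r, t)))^2))))"
  unfolding H_def by (simp add: exp_double)
 also have "... = (nn_integral lborel (%r. nn_integral ang (%t. F (pol (r, t)) * ennreal ((cmod (pol (r, t)))^2))))"
 proof (rule la.Fubini'[where f = "%r t. F (pol (r, t)) * ennreal ((cmod (pol (r, t)))^2)"])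
  have "(%p. F (pol p) * ennreal ((cmod (pol p))^2)) : bmeas (lborel \<Otimes>\<^sub>M ang)" by measurable
  thus "(%(r, t). F (pol (r, t)) * ennreal ((cmod (pol (r, t)))^2)) : bmeas (lborel \<Otimes>\<^sub>M ang)"
   by (simp add: case_prod_beta')
 qed
 also have "... = (nn_integral mstar (%s. F s * ennreal ((cmod s)^2)))"
  by (rule nn_integral_mstar[symmetric]) measurable
 finally show ?thesis .
qed

lemma nn_integral_mstar_scale:
 assumes F [measurable]: "F : bmeas borel" and c: "c ~= 0"
 shows "(nn_integral mstar (%s. F (c * s))) = (nn_integral mstar (%s. F s))"
proof -
 have G: "(nn_integral mstar (%s. F s)) = (nn_integral lborel (%z. F z * ennreal (1 / (cmod z)^2)))"
  if [measurable]: "F : bmeas borel" for F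
 proof -
  have "(nn_integral lborel (%z. F z * ennreal (1 / (cmod z)^2)))
   = (nn_integral mstar (%s. F s * ennreal (1 / (cmod s)^2) * ennreal ((cmod s)^2)))"
   by (rule nn_integral_polar) measurable
  also have "... = (nn_integral mstar (%s. F s))"
   by (rule nn_integral_cong_AE, use AE_mstar_nonzero in eventually_elim)
   (simp add: mult.assoc ennreal_mult[symmetric])
  finally show ?thesis by simp
 qed
 have "(nn_integral mstar (%s. F (c * s))) = (nn_integral lborel (%z. F (c * z) * ennreal (1 / (cmod z)^2)))" by (rule G) measurable
 also have "... = (nn_integral lborel (%z. (%z. F z * ennreal ((cmod c)^2 / (cmod z)^2)) (c * z)))"
  using c by (simp add: norm_mult power_mult_distrib)
 also have "... = ennreal (1 / (cmod c)^2) * (nn_integral lborel (%z. F z * ennreal ((cmod c)^2 / (cmod z)^2)))"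
  by (rule nn_integral_complex_scale[OF _ c]) measurable
 also have "... = (nn_integral lborel (%z. ennreal (1 / (cmod c)^2) * (F z * ennreal ((cmod c)^2 / (cmod z)^2))))"
  by (rule nn_integral_cmult[symmetric]) measurable
 also have "... = (nn_integral lborel (%z. F z * ennreal (1 / (cmod z)^2)))"
 proof (rule nn_integral_cong)
  fix z
  have "ennreal (1 / (cmod c)^2) * ennreal ((cmod c)^2 / (cmod z)^2) = ennreal (1 / (cmod z)^2)"
   using c by (simp add: ennreal_mult[symmetric])
  thus "ennreal (1 / (cmod c)^2) * (F z * ennreal ((cmod c)^2 / (cmod z)^2)) = F z * ennreal (1 / (cmod z)^2)"
   by (simp only: mult.left_commute)
 qed
 also have "... = (nn_integral mstar (%s. F s))" by (rule G[symmetric]) measurable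
 finally show ?thesis .
qed

lemma distr_mstar_scale: "c ~= 0 ==> distr mstar borel ((*) c) = mstar"
proof (rule measure_eqI)
 fix A assume c: "c ~= 0" and "A : sets (distr mstar borel ((*) c))"
 hence A [measurable]: "A : sets borel" by simp
 have "emeasure (distr mstar borel ((*) c)) A = (nn_integral mstar (%s. indicator A (c * s)))"
  by (subst nn_integral_indicator[symmetric], simp, subst nn_integral_distr) auto
 also have "... = (nn_integral mstar (%s. indicator A s))" by (rule nn_integral_mstar_scale[OF _ c]) measurable
 finally show "emeasure (distr mstar borel ((*) c)) A = emeasure mstar A" by simp
qed simp

lemma integral_mstar_scale:
 fixes f :: "complex => 'b::{banach, second_countable_topology}"
 assumes f: "f : bmeas borel" and c: "c ~= 0"
 shows "(LINT s|mstar. f (c * s)) = (LINT s|mstar. f s)"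
proof -
 have "(LINT s|distr mstar borel ((*) c). f s) = (LINT s|mstar. f (c * s))"
  by (rule integral_distr) (use f in auto)
 thus ?thesis by (simp add: distr_mstar_scale[OF c])
qed


section \<open>Lebesgue measure on complex coordinate space\<close>

definition cvol :: "('n::finite => complex) measure" where
 "cvol = PiM UNIV (%_. lborel)"

text \<open>The scaling action of the multiplicative group on coordinate vectors.\<close>

definition csc :: "complex => ('n => complex) => 'n => complex" where
 "csc s x = (%a. s * x a)"

interpretation cprod: product_sigma_finite "%_. lborel :: complex measure"
 by unfold_locales

lemma space_cvol [simp]: "space cvol = UNIV"
 by (simp add: cvol_def space_PiM)

lemma sigma_finite_cvol: "sigma_finite_measure cvol"
 unfolding cvol_def by (rule cprod.sigma_finite) simp

lemma sigma_finite_opp: "sigma_finite_measure (opp_measure (i :: 'n::finite))"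
 unfolding opp_measure_def by (rule cprod.sigma_finite) simp

interpretation cvol: sigma_finite_measure cvol by (rule sigma_finite_cvol)
interpretation opp: sigma_finite_measure "opp_measure (i :: 'n::finite)" for i by (rule sigma_finite_opp)

lemma measurable_cvolI:
 assumes "!!a. (%p. f p a) : bmeas M"
 shows "f : measurable M cvol"
 unfolding cvol_def by (rule measurable_PiM_single') (use assms in auto)

lemma cvol_component: "(%x. x a) : bmeas cvol"
proof -
 have "(%x. x a) : measurable (PiM UNIV (%_. lborel :: complex measure)) lborel"
  by (rule measurable_component_singleton) simp
 thus ?thesis by (simp add: cvol_def)
qed

lemma opp_component:
 fixes i :: "'n::finite"
 assumes "a ~= i" shows "(%y. y a) : bmeas (opp_measure i)"
proof -
 have "(%x. x a) : measurable (PiM (UNIV - {i}) (%_. lborel :: complex measure)) lborel"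
  by (rule measurable_component_singleton) (use assms in simp)
 thus ?thesis by (simp add: opp_measure_def)
qed

lemma opp_upd [measurable]: "(%y. y(i := c)) : measurable (opp_measure (i :: 'n::finite)) cvol"
proof (rule measurable_cvolI)
 fix a show "(%y. (y(i := c)) a) : bmeas (opp_measure i)"
  using opp_component[of a i] by (cases "a = i") auto
qed

lemma csc_measurable [measurable]:
 assumes "f : bmeas M" "g : measurable M cvol"
 shows "(%p. csc (f p) (g p)) : measurable M cvol"
 unfolding csc_def
proof (rule measurable_cvolI)
 fix a
 have "(%p. g p a) : bmeas M" by (rule measurable_compose[OF assms(2) cvol_component])
 thus "(%p. f p * g p a) : bmeas M" using assms(1) by measurable
qed

lemma emeasure_complex_affine:
 assumes A [measurable]: "A : sets borel" and c: "c ~= (0::complex)"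
 shows "emeasure lborel ((%z. t + c * z) -` A) = ennreal (1 / (cmod c)^2) * emeasure lborel A"
proof -
 have S: "(%z. t + c * z) -` A : sets borel"
  using measurable_sets[OF _ A, of "%z. t + c * z" borel] by simp
 have "emeasure lborel ((%z. t + c * z) -` A) = (nn_integral lborel (%z. indicator A (t + c * z)))"
  by (subst nn_integral_indicator[symmetric], simp add: S, rule nn_integral_cong)
   (simp split: split_indicator)
 also have "... = ennreal (1 / (cmod c)^2) * (nn_integral lborel (%z. indicator A (t + z)))"
  by (rule nn_integral_complex_scale[where F = "%z. indicator A (t + z)", OF _ c]) measurable
 also have "(nn_integral lborel (%z. indicator A (t + z))) = (nn_integral (distr lborel borel ((+) t)) (%z. indicator A z))"
  by (subst nn_integral_distr) auto
 also have "... = emeasure lborel A" by (simp add: lborel_distr_plus)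
 finally show ?thesis .
qed

lemma PiM_affine:
 fixes F :: "('n => complex) => ennreal"
 assumes I: "finite I" and c: "c ~= 0" and F: "F : bmeas (PiM I (%_. lborel))"
 shows "(nn_integral (PiM I (%_. lborel)) (%y. F y))
  = ennreal (cmod c ^ (2 * card I)) * (nn_integral (PiM I (%_. lborel)) (%y. F (\<lambda>a\<in>I. t a + c * y a)))"
proof -
 let ?P = "PiM I (%_. lborel :: complex measure)"
 define S where "S y = (\<lambda>a\<in>I. t a + c * y a)" for y :: "'n => complex"
 have Sm: "S : measurable ?P ?P"
  unfolding S_def
 proof (rule measurable_restrict)
  fix a assume "a : I"
  hence "(%y. y a) : measurable ?P lborel" by (rule measurable_component_singleton)
  hence "(%y. y a) : bmeas ?P" by simp
  hence "(%y. t a + c * y a) : bmeas ?P"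
   by (intro borel_measurable_add borel_measurable_times borel_measurable_const)
  thus "(%y. t a + c * y a) : measurable ?P lborel" by simp
 qed
 let ?k = "ennreal (cmod c ^ (2 * card I))"
 have "scale_measure ?k (distr ?P ?P S) = ?P"
 proof (rule cprod.PiM_eqI[OF I])
  fix A :: "'n => complex set" assume A: "!!a. a : I ==> A a : sets lborel"
  have pre: "S -` (Pi\<^sub>E I A) \<inter> space ?P = Pi\<^sub>E I (%a. (%z. t a + c * z) -` A a)"
   by (auto simp: S_def space_PiM PiE_def Pi_def extensional_def restrict_def split: if_splits)
  have vm: "(%z. t a + c * z) -` A a : sets borel" if "a : I" for a
   using measurable_sets[of "%z. t a + c * z" borel borel "A a"] A[OF that] by simp
  have "emeasure (scale_measure ?k (distr ?P ?P S)) (Pi\<^sub>E I A) = ?k * emeasure ?P (Pi\<^sub>E I (%a. (%z. t a + c * z) -` A a))"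
   using A I Sm by (simp add: emeasure_distr pre sets_PiM_I_finite)
  also have "emeasure ?P (Pi\<^sub>E I (%a. (%z. t a + c * z) -` A a)) = (\<Prod>a\<in>I. emeasure lborel ((%z. t a + c * z) -` A a))"
   using vm by (intro cprod.emeasure_PiM I) auto
  also have "... = (\<Prod>a\<in>I. ennreal (1 / (cmod c)^2) * emeasure lborel (A a))"
   using A c by (intro prod.cong refl emeasure_complex_affine) auto
  also have "... = ennreal (1 / (cmod c)^2) ^ card I * (\<Prod>a\<in>I. emeasure lborel (A a))"
   by (simp add: prod.distrib)
  also have "?k * ... = (\<Prod>a\<in>I. emeasure lborel (A a))"
  proof -
   have "?k * ennreal (1 / (cmod c)^2) ^ card I = ennreal (cmod c ^ (2 * card I) * (1 / (cmod c)^2) ^ card I)"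
   by (simp add: ennreal_mult ennreal_power)
   also have "... = 1" using c by (simp add: power_one_over power_mult)
   finally show ?thesis by (simp add: mult.assoc[symmetric])
  qed
  finally show "emeasure (scale_measure ?k (distr ?P ?P S)) (Pi\<^sub>E I A) = (\<Prod>a\<in>I. emeasure lborel (A a))" .
 qed simp
 hence "(nn_integral (?P) (%y. F y)) = (nn_integral (scale_measure ?k (distr ?P ?P S)) (%y. F y))" by simp
 also have "... = ?k * (nn_integral (distr ?P ?P S) (%y. F y))" by (rule nn_integral_scale_measure) (use F in simp)
 also have "(nn_integral (distr ?P ?P S) (%y. F y)) = (nn_integral (?P) (%y. F (S y)))"
  by (rule nn_integral_distr[OF Sm]) (use F in simp)
 finally show ?thesis by (simp add: S_def)
qed

lemma nn_integral_cvol_insert: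
 fixes i :: "'n::finite"
 assumes "F : bmeas cvol"
 shows "(nn_integral cvol (%x. F x)) = (nn_integral lborel (%w. nn_integral (opp_measure i) (%y. F (y(i := w)))))"
proof -
 have U: "insert i (UNIV - {i}) = UNIV" by auto
 show ?thesis
  using cprod.product_nn_integral_insert_rev[of "UNIV - {i}" i F] assms
  unfolding U cvol_def opp_measure_def by simp
qed

text \<open>Every vector with nonzero coordinate \<open>i\<close> is a multiple of a unique vector with coordinate
  \<open>1\<close> there, which separates the radial variable from the affine chart.\<close>

theorem nn_integral_unfold:
 assumes F [measurable]: "F : bmeas cvol"
 shows "(nn_integral cvol (%x. F x)) = (nn_integral (opp_measure (i::'n::finite)) (%y. nn_integral mstar (%s. F (csc s (y(i := 1))) * ennreal (cmod s ^ (2 * CARD('n))))))"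
proof -
 have c: "Suc (card (UNIV - {i})) = CARD('n)" by (simp add: card_Diff_singleton)
 have m: "(%p. F (csc (snd p) ((fst p)(i := 1)))) : bmeas (opp_measure i \<Otimes>\<^sub>M mstar)"
  by measurable
 have m2: "(%y. F (csc w (y(i := 1)))) : bmeas (opp_measure i)" for w by measurable
 define G where "G w = (nn_integral (opp_measure i) (%y. F (csc w (y(i := 1)))))" for w
 have Gm [measurable]: "G : bmeas borel"
 proof -
  have "(%p. F (csc (fst p) ((snd p)(i := 1)))) : bmeas (borel \<Otimes>\<^sub>M opp_measure i)" by measurable
  thus ?thesis unfolding G_def by (intro opp.borel_measurable_nn_integral) (simp add: case_prod_beta')
 qed
 have "(nn_integral cvol (%x. F x)) = (nn_integral lborel (%w. nn_integral (opp_measure i) (%y. F (y(i := w)))))"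
  by (rule nn_integral_cvol_insert[OF F])
 also have "... = (nn_integral lborel (%w. ennreal (cmod w ^ (2 * card (UNIV - {i}))) * G w))"
 proof (rule nn_integral_cong_AE, use AE_lborel_complex_nonzero in eventually_elim)
  fix w :: complex assume w: "w ~= 0"
  have "(nn_integral (opp_measure i) (%y. F (y(i := w))))
   = ennreal (cmod w ^ (2 * card (UNIV - {i}))) * (nn_integral (opp_measure i) (%y. F ((\<lambda>a\<in>UNIV - {i}. 0 + w * y a)(i := w))))"
   unfolding opp_measure_def
   by (rule PiM_affine[where F = "%y. F (y(i := w))" and t = "%_. 0", OF _ w])
   (use measurable_compose[OF opp_upd F] in "auto simp: opp_measure_def")
  moreover have "(\<lambda>a\<in>UNIV - {i}. 0 + w * y a)(i := w) = csc w (y(i := 1))" for y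
   by (auto simp: csc_def)
  ultimately show "(nn_integral (opp_measure i) (%y. F (y(i := w)))) = ennreal (cmod w ^ (2 * card (UNIV - {i}))) * G w"
   by (simp only: G_def)
 qed
 also have "... = (nn_integral mstar (%s. ennreal (cmod s ^ (2 * card (UNIV - {i}))) * G s * ennreal ((cmod s)^2)))"
  by (rule nn_integral_polar) measurable
 also have "... = (nn_integral mstar (%s. nn_integral (opp_measure i) (%y. F (csc s (y(i := 1))) * ennreal (cmod s ^ (2 * CARD('n))))))"
 proof (rule nn_integral_cong)
  fix s
  have "ennreal (cmod s ^ (2 * card (UNIV - {i}))) * ennreal ((cmod s)^2) = ennreal (cmod s ^ (2 * CARD('n)))"
  proof -
   have c2: "2 * CARD('n) = 2 * card (UNIV - {i}) + 2" using c by linarith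
   show ?thesis unfolding c2 power_add by (rule ennreal_mult[symmetric]) auto
  qed
  moreover have "ennreal (cmod s ^ (2 * card (UNIV - {i}))) * G s * ennreal ((cmod s)^2)
   = G s * (ennreal (cmod s ^ (2 * card (UNIV - {i}))) * ennreal ((cmod s)^2))" by (simp only: mult_ac)
  ultimately have "ennreal (cmod s ^ (2 * card (UNIV - {i}))) * G s * ennreal ((cmod s)^2) = G s * ennreal (cmod s ^ (2 * CARD('n)))"
   by (simp only:)
  also have "... = (nn_integral (opp_measure i) (%y. F (csc s (y(i := 1))) * ennreal (cmod s ^ (2 * CARD('n)))))"
   unfolding G_def by (rule nn_integral_multc[symmetric]) (rule m2)
  finally show "ennreal (cmod s ^ (2 * card (UNIV - {i}))) * G s * ennreal ((cmod s)^2)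
   = (nn_integral (opp_measure i) (%y. F (csc s (y(i := 1))) * ennreal (cmod s ^ (2 * CARD('n)))))" .
 qed
 also have "... = (nn_integral (opp_measure i) (%y. nn_integral mstar (%s. F (csc s (y(i := 1))) * ennreal (cmod s ^ (2 * CARD('n))))))"
 proof (rule pair_sigma_finite.Fubini'[where f = "%y s. F (csc s (y(i := 1))) * ennreal (cmod s ^ (2 * CARD('n)))"])
  show "pair_sigma_finite (opp_measure i) mstar"
   by (intro pair_sigma_finite.intro sigma_finite_opp sigma_finite_mstar)
  show "(%(y, s). F (csc s (y(i := 1))) * ennreal (cmod s ^ (2 * CARD('n)))) : bmeas (opp_measure i \<Otimes>\<^sub>M mstar)"
   unfolding case_prod_beta' using m by measurable
 qed
 finally show ?thesis .
qed

section \<open>Linear changes of variables\<close>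

definition mvec :: "complex^'n^'n => ('n => complex) => 'n::finite => complex" where
 "mvec h x = (%a. \<Sum>b\<in>UNIV. h $ a $ b * x b)"

definition colmat :: "'n => ('n => complex) => complex^'n^'n::finite" where
 "colmat b v = (\<chi> a c. if c = b then v a else if a = c then 1 else 0)"

lemma mvec_measurable [measurable]: "mvec h : measurable cvol cvol"
 unfolding mvec_def
 by (intro measurable_cvolI borel_measurable_sum borel_measurable_times borel_measurable_const cvol_component)

lemma mvec_mult: "mvec (A ** B) x = mvec A (mvec B x)"
proof
 fix a
 have "mvec (A ** B) x a = (\<Sum>b\<in>UNIV. \<Sum>k\<in>UNIV. A $ a $ k * (B $ k $ b * x b))"
  by (simp add: mvec_def matrix_matrix_mult_def sum_distrib_right mult.assoc)
 also have "... = (\<Sum>k\<in>UNIV. \<Sum>b\<in>UNIV. A $ a $ k * (B $ k $ b * x b))" by (rule sum.swap)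
 also have "... = mvec A (mvec B x) a" by (simp add: mvec_def sum_distrib_left)
 finally show "mvec (A ** B) x a = mvec A (mvec B x) a" .
qed

lemma mvec_one [simp]: "mvec (mat 1) x = x"
proof
 fix a
 have "mvec (mat 1) x a = (\<Sum>b\<in>UNIV. if a = b then x b else 0)"
  unfolding mvec_def mat_def by (intro sum.cong) auto
 thus "mvec (mat 1) x a = x a" by simp
qed

lemma mvec_csc: "mvec h (csc s x) = csc s (mvec h x)"
 by (auto simp: mvec_def csc_def sum_distrib_left mult.left_commute)

lemma mvec_colmat: "mvec (colmat b v) x = (%a. if a = b then v b * x b else x a + v a * x b)"
proof
 fix a
 have "mvec (colmat b v) x a = (\<Sum>c\<in>UNIV. (if c = b then v a * x c else 0) + (if c = a & a ~= b then x c else 0))"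
  unfolding mvec_def colmat_def by (intro sum.cong) auto
 also have "... = v a * x b + (if a ~= b then x a else 0)"
  by (simp add: sum.distrib)
 finally show "mvec (colmat b v) x a = (if a = b then v b * x b else x a + v a * x b)" by auto
qed

lemma det_colmat: "det (colmat b v) = v b"
proof -
 have "colmat b v = (\<chi> i j. if j = b then (mat 1 *v (\<chi> a. v a)) $ i else mat 1 $ i $ j)"
  unfolding matrix_vector_mul_lid by (simp add: colmat_def vec_eq_iff mat_def)
 thus ?thesis using cramer_lemma[of b "mat 1" "\<chi> a. v a"] by simp
qed

lemma colmat_mult_entry:
 "(colmat b v ** A) $ a $ c = (if a = b then v b * A $ b $ c else A $ a $ c + v a * A $ b $ c)"
 using fun_cong[OF mvec_colmat[of b v "%k. A $ k $ c"], of a]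
 by (simp add: mvec_def matrix_matrix_mult_def)

text \<open>Gaussian elimination: multiplying from the left by matrices that differ from the identity in
  a single column turns one column after the other into a unit vector.\<close>

lemma GL_induct [consumes 1, case_names one colmat]:
 fixes A :: "complex^'n^'n::finite"
 assumes A: "invertible A" and one: "P (mat 1)"
  and mult: "!!b v A. v b ~= 0 ==> P A ==> P (colmat b v ** A)"
 shows "P A"
proof -
 define T where "T A = {c. EX a. (A :: complex^'n^'n) $ a $ c ~= (if a = c then 1 else 0)}" for A
 have inv: "colmat b (%a. if a = b then 1 / v b else - v a / v b) ** colmat b v = mat 1"
  "colmat b v ** colmat b (%a. if a = b then 1 / v b else - v a / v b) = mat 1" if "v b ~= 0" for b and v :: "'n => complex"
  using that by (auto simp: vec_eq_iff colmat_mult_entry mat_def) (auto simp: colmat_def)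
 have inv': "invertible (colmat b v ** B)" if "v b ~= 0" "invertible B" for b v and B :: "complex^'n^'n"
  using that by (simp add: invertible_det_nz det_mul det_colmat)
 show ?thesis using A
 proof (induction "card (T A)" arbitrary: A rule: less_induct)
  case less
  have pivot: "P B" if B: "invertible B" "T B \<subseteq> T A" "b : T A" "B $ b $ b ~= 0" for B b
  proof -
   define v where "v a = B $ a $ b" for a
   have vb: "v b ~= 0" using B(4) by (simp add: v_def)
   define v' where "v' a = (if a = b then 1 / v b else - v a / v b)" for a
   define B' where "B' = colmat b v' ** B"
   have v'b: "v' b ~= 0" using vb by (simp add: v'_def)
   have "T B' \<subseteq> T A - {b}"
   proof
   fix c assume c: "c : T B'"
   then obtain a where a: "B' $ a $ c ~= (if a = c then 1 else 0)" by (auto simp: T_def)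
   have "c ~= b"
   proof
   assume "c = b"
   thus False using a vb by (auto simp: B'_def colmat_mult_entry v'_def v_def split: if_splits)
   qed
   moreover have "c : T B"
   proof (rule ccontr)
   assume "c \<notin> T B"
   hence "!!a. B $ a $ c = (if a = c then 1 else 0)" by (auto simp: T_def)
   thus False using a \<open>c ~= b\<close> by (auto simp: B'_def colmat_mult_entry split: if_splits)
   qed
   ultimately show "c : T A - {b}" using B(2) by auto
   qed
   hence "card (T B') < card (T A)" using B(3) by (intro psubset_card_mono) auto
   moreover have "invertible B'" unfolding B'_def by (rule inv'[where v = v' and b = b, OF v'b B(1)])
   ultimately have "P B'" using less.hyps by blast
   hence "P (colmat b v ** B')" by (rule mult[where v = v and b = b, OF vb])
   moreover have "colmat b v ** B' = B"
   unfolding B'_def matrix_mul_assoc v'_def using inv(2)[where v = v and b = b, OF vb] by (simp add: matrix_mul_lid)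
   ultimately show ?thesis by simp
  qed
  show ?case
  proof (cases "T A = {}")
   case True
   hence "A = mat 1" by (auto simp: T_def vec_eq_iff mat_def)
   thus ?thesis using one by simp
  next
   case False
   then obtain b where b: "b : T A" by auto
   have "EX r:T A. A $ r $ b ~= 0"
   proof (rule ccontr)
   assume "~ (EX r:T A. A $ r $ b ~= 0)"
   hence z: "A $ r $ b = 0" if "r : T A" for r using that by blast
   define x where "x c = (if c = b then 1 else if c : T A then 0 else - A $ c $ b)" for c
   have "mvec A x a = 0" for a
   proof -
   have "mvec A x a = (\<Sum>c\<in>UNIV. (if c = b then A $ a $ b else 0) + (if c = a & a \<notin> T A then - A $ a $ b else 0))"
   unfolding mvec_def
   proof (rule sum.cong[OF refl])
   fix c
   show "A $ a $ c * x c = (if c = b then A $ a $ b else 0) + (if c = a & a \<notin> T A then - A $ a $ b else 0)"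
   using b by (auto simp: x_def T_def)
   qed
   also have "... = A $ a $ b + (if a \<notin> T A then - A $ a $ b else 0)" by (simp add: sum.distrib)
   finally show ?thesis using z[of a] by auto
   qed
   hence "mvec A x = (%_. 0)" by auto
   moreover obtain A' where "A' ** A = mat 1" using less.prems by (auto simp: invertible_def)
   ultimately have "x = mvec A' (%_. 0)" using mvec_mult[of A' A x] by simp
   hence "x b = 0" by (simp add: mvec_def)
   thus False by (simp add: x_def)
   qed
   then obtain r where r: "r : T A" "A $ r $ b ~= 0" by blast
   show ?thesis
   proof (cases "A $ b $ b = 0")
   case False
   thus ?thesis using pivot[OF less.prems subset_refl b] by simp
   next
   case True
   have rb: "r ~= b" using True r by auto
   define u where "u a = (if a = r then 1 else if a = b then 1 else 0 :: complex)" for a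
   define u' where "u' a = (if a = r then 1 / u r else - u a / u r)" for a
   have ur: "u r ~= 0" "u' r ~= 0" by (auto simp: u_def u'_def)
   define B where "B = colmat r u ** A"
   have "P B"
   proof (rule pivot[OF _ _ b])
   show "invertible B" unfolding B_def by (rule inv'[where v = u and b = r, OF ur(1) less.prems])
   show "B $ b $ b ~= 0" using rb r True by (simp add: B_def colmat_mult_entry u_def)
   show "T B \<subseteq> T A"
   proof
   fix c assume "c : T B"
   then obtain a where a: "B $ a $ c ~= (if a = c then 1 else 0)" by (auto simp: T_def)
   show "c : T A"
   proof (rule ccontr)
   assume nc: "c \<notin> T A"
   hence "!!a. A $ a $ c = (if a = c then 1 else 0)" by (auto simp: T_def)
   moreover have "r ~= c" using r nc by auto
   ultimately show False using a ur by (auto simp: B_def colmat_mult_entry u_def split: if_splits)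
   qed
   qed
   qed
   hence "P (colmat r u' ** B)" by (rule mult[where v = u' and b = r, OF ur(2)])
   moreover have "colmat r u' ** B = A"
   unfolding B_def matrix_mul_assoc u'_def using inv(1)[where v = u and b = r, OF ur(1)] by (simp add: matrix_mul_lid)
   ultimately show ?thesis by simp
   qed
  qed
 qed
qed

text \<open>It suffices to treat a matrix that differs from the identity in one column, where only one
  coordinate is scaled and the others are translated.\<close>

theorem nn_integral_matrix:
 fixes h :: "complex^'n^'n::finite"
 assumes h: "invertible h" and F: "F : bmeas cvol"
 shows "(nn_integral cvol (%x. F (mvec h x))) = ennreal (1 / (cmod (det h))^2) * (nn_integral cvol (%x. F x))"
 using h F
proof (induction h arbitrary: F rule: GL_induct)
 case one thus ?case by (simp add: det_I)
next
 case (colmat b v A)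
 note [measurable] = \<open>F : bmeas cvol\<close>
 let ?E = "colmat b v" and ?I = "UNIV - {b}"
 define G where "G w = (nn_integral (opp_measure b) (%y. F (y(b := w))))" for w
 have um: "(%p. (snd p)(b := fst p)) : measurable (borel \<Otimes>\<^sub>M opp_measure b) cvol"
 proof (rule measurable_cvolI)
  fix a show "(%p. ((snd p)(b := fst p)) a) : bmeas (borel \<Otimes>\<^sub>M opp_measure b)"
   using measurable_compose[OF measurable_snd opp_component[of a b]] by (cases "a = b") auto
 qed
 have Gm [measurable]: "G : bmeas borel"
 proof -
  have "(%p. F ((snd p)(b := fst p))) : bmeas (borel \<Otimes>\<^sub>M opp_measure b)"
   using um by measurable
  thus ?thesis unfolding G_def by (intro opp.borel_measurable_nn_integral) (simp add: case_prod_beta')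
 qed
 have E: "(nn_integral cvol (%x. F (mvec ?E x))) = ennreal (1 / (cmod (v b))^2) * (nn_integral cvol (%x. F x))"
 proof -
  have "(nn_integral cvol (%x. F (mvec ?E x))) = (nn_integral lborel (%w. nn_integral (opp_measure b) (%y. F (mvec ?E (y(b := w))))))"
   by (rule nn_integral_cvol_insert) measurable
  also have "... = (nn_integral lborel (%w. G (v b * w)))"
  proof (rule nn_integral_cong)
   fix w
   have "mvec ?E (y(b := w)) = (\<lambda>a\<in>?I. v a * w + 1 * y a)(b := v b * w)" for y
   by (auto simp: mvec_colmat)
   hence "(nn_integral (opp_measure b) (%y. F (mvec ?E (y(b := w)))))
   = (nn_integral (opp_measure b) (%y. F ((\<lambda>a\<in>?I. v a * w + 1 * y a)(b := v b * w))))" by simp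
   also have "... = G (v b * w)"
   using PiM_affine[where I = ?I and c = 1 and t = "%a. v a * w" and F = "%y. F (y(b := v b * w))"]
   measurable_compose[OF opp_upd \<open>F : bmeas cvol\<close>, of b "v b * w"]
   by (simp add: G_def opp_measure_def)
   finally show "(nn_integral (opp_measure b) (%y. F (mvec ?E (y(b := w))))) = G (v b * w)" .
  qed
  also have "... = ennreal (1 / (cmod (v b))^2) * (nn_integral lborel (%w. G w))"
   by (rule nn_integral_complex_scale[OF Gm colmat.hyps(1)])
  also have "(nn_integral lborel (%w. G w)) = (nn_integral cvol (%x. F x))"
   unfolding G_def by (rule nn_integral_cvol_insert[symmetric]) measurable
  finally show ?thesis .
 qed
 have "(nn_integral cvol (%x. F (mvec (?E ** A) x))) = (nn_integral cvol (%x. F (mvec ?E (mvec A x))))" by (simp only: mvec_mult)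
 also have "... = ennreal (1 / (cmod (det A))^2) * (nn_integral cvol (%x. F (mvec ?E x)))"
  by (rule colmat.IH[where F = "%x. F (mvec ?E x)"]) measurable
 also have "... = ennreal (1 / (cmod (det (?E ** A)))^2) * (nn_integral cvol (%x. F x))"
 proof -
  have "ennreal (1 / (cmod (det A))^2) * ennreal (1 / (cmod (v b))^2) = ennreal (1 / (cmod (det (?E ** A)))^2)"
   by (subst ennreal_mult[symmetric]) (auto simp: det_mul det_colmat norm_mult power_mult_distrib mult.commute)
  thus ?thesis unfolding E by (simp only: mult.assoc[symmetric])
 qed
 finally show ?case .
qed

lemma distr_case_sum:
 "distr (cvol \<Otimes>\<^sub>M cvol) cvol (%p. case_sum (fst p) (snd p)) = (cvol :: ('p::finite + 'q::finite => complex) measure)"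
proof -
 let ?f = "%p. case_sum (fst p) (snd p) :: 'p + 'q => complex"
 have fm: "?f : measurable (cvol \<Otimes>\<^sub>M cvol) cvol"
 proof (rule measurable_cvolI)
  fix a show "(%p. ?f p a) : bmeas (cvol \<Otimes>\<^sub>M cvol)"
   by (cases a) (auto intro: measurable_compose[OF measurable_fst cvol_component] measurable_compose[OF measurable_snd cvol_component])
 qed
 have "distr (cvol \<Otimes>\<^sub>M cvol) cvol ?f = PiM UNIV (%_. lborel)"
 proof (rule cprod.PiM_eqI)
  fix A :: "'p + 'q => complex set" assume "!!a. a : UNIV ==> A a : sets lborel"
  hence A: "A a : sets borel" for a by simp
  have S: "Pi\<^sub>E UNIV A : sets cvol" unfolding cvol_def using A by (intro sets_PiM_I_finite) auto
  have A1: "Pi\<^sub>E UNIV (%a. A (Inl a)) : sets cvol" "Pi\<^sub>E UNIV (%a. A (Inr a)) : sets cvol"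
   unfolding cvol_def using A by (auto intro!: sets_PiM_I_finite)
  have pre: "?f -` (Pi\<^sub>E UNIV A) \<inter> space (cvol \<Otimes>\<^sub>M cvol) = Pi\<^sub>E UNIV (%a. A (Inl a)) \<times> Pi\<^sub>E UNIV (%a. A (Inr a))"
  proof (rule set_eqI)
   fix p :: "('p => complex) \<times> ('q => complex)"
   show "p : ?f -` (Pi\<^sub>E UNIV A) \<inter> space (cvol \<Otimes>\<^sub>M cvol) \<longleftrightarrow> p : Pi\<^sub>E UNIV (%a. A (Inl a)) \<times> Pi\<^sub>E UNIV (%a. A (Inr a))"
   by (cases p) (simp add: PiE_UNIV_domain Pi_iff space_pair_measure split_sum_all)
  qed
  have "emeasure (distr (cvol \<Otimes>\<^sub>M cvol) cvol ?f) (Pi\<^sub>E UNIV A)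
   = emeasure cvol (Pi\<^sub>E UNIV (%a. A (Inl a))) * emeasure cvol (Pi\<^sub>E UNIV (%a. A (Inr a)))"
   by (subst emeasure_distr[OF fm S], subst pre) (rule cvol.emeasure_pair_measure_Times[OF A1])
  also have "... = (\<Prod>a\<in>UNIV. emeasure lborel (A (Inl a))) * (\<Prod>a\<in>UNIV. emeasure lborel (A (Inr a)))"
   unfolding cvol_def using A by (subst (1 2) cprod.emeasure_PiM) auto
  also have "... = (\<Prod>a\<in>UNIV. emeasure lborel (A a))"
   unfolding UNIV_Plus_UNIV[symmetric] by (subst prod.Plus) auto
  finally show "emeasure (distr (cvol \<Otimes>\<^sub>M cvol) cvol ?f) (Pi\<^sub>E UNIV A) = (\<Prod>a\<in>UNIV. emeasure lborel (A a))" .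
 qed (auto simp: cvol_def)
 thus ?thesis by (simp add: cvol_def)
qed


section \<open>Functions on the group as functions on coordinate space\<close>

definition col :: "'n => complex^'n^'n => 'n => complex" where
 "col i g = (%a. g $ a $ i)"

lemma col_mult: "col i (h ** g) = mvec h (col i g)"
 by (auto simp: col_def mvec_def matrix_matrix_mult_def)

lemma col_parabolic:
 assumes "p : parabolic i" shows "col i (g ** p) = csc (p $ i $ i) (col i g)"
proof
 fix a
 have "col i (g ** p) a = (\<Sum>b\<in>UNIV. if b = i then g $ a $ i * p $ i $ i else 0)"
  unfolding col_def matrix_matrix_mult_def vec_lambda_beta
  by (rule sum.cong) (use assms in "auto simp: parabolic_def")
 thus "col i (g ** p) a = csc (p $ i $ i) (col i g) a" by (simp add: csc_def col_def mult.commute)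
qed

lemma matrix_inv_mult:
 fixes A :: "complex^'n^'n::finite"
 assumes "invertible A" shows "A ** matrix_inv A = mat 1" "matrix_inv A ** A = mat 1"
proof -
 obtain B where "A ** B = mat 1 & B ** A = mat 1" using assms by (auto simp: invertible_def)
 hence "A ** matrix_inv A = mat 1 & matrix_inv A ** A = mat 1"
  unfolding matrix_inv_def by (rule someI)
 thus "A ** matrix_inv A = mat 1" "matrix_inv A ** A = mat 1" by auto
qed

lemma matrix_inv_unique:
 fixes A :: "complex^'n^'n::finite"
 assumes "A ** B = mat 1" "B ** A = mat 1" shows "matrix_inv A = B"
proof -
 have "invertible A" using assms by (auto simp: invertible_def)
 hence "matrix_inv A = matrix_inv A ** (A ** B)" "matrix_inv A ** A = mat 1"
  using assms by (auto simp: matrix_mul_rid matrix_inv_mult)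
 thus ?thesis by (metis matrix_mul_assoc matrix_mul_lid)
qed

lemma GL_matrix_inv: "A : GL ==> matrix_inv A : GL" for A :: "complex^'n^'n::finite"
 using matrix_inv_mult[of A] by (auto simp: GL_def invertible_def)

lemma GL_mult: "A : GL ==> B : GL ==> A ** B : GL" for A :: "complex^'n^'n::finite"
 by (simp add: GL_def invertible_det_nz det_mul)

lemma det_matrix_inv: "A : GL ==> det (matrix_inv A) = 1 / det A" for A :: "complex^'n^'n::finite"
proof -
 assume "A : GL"
 hence "det A * det (matrix_inv A) = 1" "det A ~= 0"
  using matrix_inv_mult(1)[of A] by (auto simp: GL_def det_mul[symmetric] invertible_det_nz det_I)
 thus ?thesis by (simp add: field_simps)
qed

lemma matrix_measurable:
 fixes M :: "'a => 'm::finite => 'n::finite => complex"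
 assumes "!!a b. (%p. M p a b) : bmeas N"
 shows "(%p. \<chi> a b. M p a b) : bmeas N"
proof -
 have eq: "(%p. \<chi> a b. M p a b) = (%p. \<Sum>r\<in>UNIV. \<Sum>c\<in>UNIV. (\<chi> a b. if a = r & b = c then M p r c else 0))"
 proof
  fix p
  have "(\<Sum>r\<in>UNIV. \<Sum>c\<in>UNIV. if a = r & b = c then M p r c else 0) = M p a b" for a b
  proof -
   have "(\<Sum>r\<in>UNIV. \<Sum>c\<in>UNIV. if a = r & b = c then M p r c else 0)
   = (\<Sum>r\<in>UNIV. if r = a then (\<Sum>c\<in>UNIV. if c = b then M p a b else 0) else 0)"
   by (intro sum.cong) auto
   thus ?thesis by simp
  qed
  thus "(\<chi> a b. M p a b) = (\<Sum>r\<in>UNIV. \<Sum>c\<in>UNIV. (\<chi> a b. if a = r & b = c then M p r c else 0))"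
   by (simp add: vec_eq_iff)
 qed
 have c: "continuous_on UNIV (%z::complex. (\<chi> a b. if a = r & b = c then z else 0) :: complex^'n^'m)" for r c
 proof (intro continuous_on_vec_lambda)
  fix a b show "continuous_on UNIV (%z::complex. if a = r & b = c then z else 0)"
   by (cases "a = r & b = c") (auto simp: continuous_on_const)
 qed
 show ?thesis unfolding eq
  by (intro borel_measurable_sum) (rule borel_measurable_continuous_on[OF c assms])
qed

lemma opp_unipotent_eq: "opp_unipotent i y = colmat i (y(i := 1))"
 by (simp add: opp_unipotent_def colmat_def vec_eq_iff)

lemma opp_unipotent_simps [simp]:
 fixes i :: "'n::finite"
 shows "det (opp_unipotent i y) = 1" "opp_unipotent i y : GL" "col i (opp_unipotent i y) = y(i := 1)"
  "opp_unipotent i y $ i $ i = 1"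
proof -
 show "det (opp_unipotent i y) = 1" by (simp add: opp_unipotent_eq det_colmat)
 thus "opp_unipotent i y : GL" by (simp add: GL_def invertible_det_nz)
 show "col i (opp_unipotent i y) = y(i := 1)" by (auto simp: col_def opp_unipotent_def)
 show "opp_unipotent i y $ i $ i = 1" by (simp add: opp_unipotent_def)
qed

lemma opp_unipotent_measurable:
 fixes i :: "'n::finite"
 assumes "!!a. a ~= i ==> (%p. y p a) : bmeas N"
 shows "(%p. opp_unipotent i (y p)) : measurable N (borelGL)"
proof (rule measurable_restrict_space2)
 show "(%p. opp_unipotent i (y p)) : bmeas N"
  unfolding opp_unipotent_def
 proof (rule matrix_measurable)
  fix a b show "(%p. if a = b then 1 else if b = i then y p a else 0) : bmeas N"
   using assms[of a] by (cases "a = b"; cases "b = i") auto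
 qed
qed auto

lemma opp_unipotent_opp [measurable]: "opp_unipotent (i :: 'n::finite) : measurable (opp_measure i) (borelGL)"
 by (rule opp_unipotent_measurable) (rule opp_component)

lemma col_measurable [measurable]: "col (i :: 'n::finite) : measurable (borelGL) cvol"
proof (rule measurable_cvolI)
 fix a
 have "continuous_on UNIV (%g :: complex^'n^'n. col i g a)" unfolding col_def by (intro continuous_intros)
 thus "(%g. col i g a) : bmeas (borelGL)"
  by (intro measurable_restrict_space1 borel_measurable_continuous_onI)
qed

lemma det_measurable [measurable]: "(det :: complex^'n^'n::finite => complex) : bmeas (borelGL)"
proof -
 have "continuous_on UNIV (det :: complex^'n^'n => complex)"
  unfolding det_def by (intro continuous_intros)
 thus ?thesis by (intro measurable_restrict_space1 borel_measurable_continuous_onI)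
qed

lemma matrix_mult_measurable:
 fixes h :: "complex^'n^'n::finite"
 assumes "h : GL"
 shows "(%g. h ** g) : measurable (borelGL) (borelGL)"
proof (rule measurable_restrict_space2)
 show "(%g. h ** g) : space (borelGL) \<rightarrow> GL" using assms GL_mult by (auto simp: space_restrict_space)
 have "continuous_on UNIV (%g. h ** g)" unfolding matrix_matrix_mult_def
  by (intro continuous_intros continuous_on_vec_lambda)
 thus "(%g. h ** g) : bmeas (borelGL)"
  by (intro measurable_restrict_space1 borel_measurable_continuous_onI)
qed

lemma parabolic_diag: "p : parabolic (i :: 'n::finite) ==> p $ i $ i ~= 0"
proof
 assume p: "p : parabolic i" and 0: "p $ i $ i = 0"
 have "col i (matrix_inv p ** p) = (%_. 0)"
  unfolding col_parabolic[OF p] 0 by (simp add: csc_def)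
 moreover have "matrix_inv p ** p = mat 1" using p by (intro matrix_inv_mult) (auto simp: parabolic_def GL_def)
 ultimately have "col i (mat 1 :: complex^'n^'n) i = 0" by simp
 thus False by (simp add: col_def mat_def)
qed

text \<open>On the nilradical, spanned by the entries of row \<open>i\<close>, the group element \<open>p\<close> acts from the left
  by the scalar \<open>p $ i $ i\<close> and from the right by the inverse of its lower right block, whose
  determinant is \<open>det p / p $ i $ i\<close>.\<close>

lemma para_delta_parabolic:
 fixes i :: "'n::finite"
 assumes p: "p : parabolic i"
 shows "para_delta i p powr (-1/2) = cmod (det p) / cmod (p $ i $ i) ^ CARD('n)"
proof -
 define c where "c = p $ i $ i"
 define B where "B = matrix_inv p"
 have c0: "c ~= 0" using parabolic_diag[OF p] by (simp add: c_def)
 have inv: "invertible p" using p by (auto simp: parabolic_def GL_def)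
 hence d0: "det p ~= 0" by (simp add: invertible_det_nz)
 have colB: "c * B $ a $ i = (if a = i then 1 else 0)" for a
 proof -
  have "col i (B ** p) a = (if a = i then 1 else 0)"
   using matrix_inv_mult(2)[OF inv] by (simp add: B_def col_def mat_def)
  thus ?thesis unfolding col_parabolic[OF p] by (simp add: csc_def col_def c_def)
 qed
 have ent: "(p ** unit_mat i b ** B) $ i $ a = c * B $ b $ a" for a b
 proof -
  have "(p ** unit_mat i b) $ i $ r = (if r = b then c else 0)" for r
  proof -
   have "(p ** unit_mat i b) $ i $ r = (\<Sum>k\<in>UNIV. if k = i then (if r = b then p $ i $ i else 0) else 0)"
   unfolding matrix_matrix_mult_def unit_mat_def vec_lambda_beta by (rule sum.cong) auto
   thus ?thesis by (simp add: c_def)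
  qed
  hence "(p ** unit_mat i b ** B) $ i $ a = (\<Sum>r\<in>UNIV. if r = b then c * B $ b $ a else 0)"
   unfolding matrix_matrix_mult_def[of "p ** unit_mat i b"] vec_lambda_beta by (intro sum.cong) auto
  thus ?thesis by simp
 qed
 define T where "T = transpose (\<chi> r. c *s B $ r)"
 define v where "v a = (if a = i then 1 else - (c * B $ i $ a))" for a
 have Te: "T $ a $ b = c * B $ b $ a" for a b by (simp add: T_def transpose_def)
 have "(\<chi> a b. if a = i \<or> b = i then (if a = b then 1 else 0)
   else (p ** unit_mat i b ** B) $ i $ a) = colmat i v ** T"
  unfolding vec_eq_iff colmat_mult_entry Te ent by (auto simp: v_def colB)
 moreover have "det (colmat i v ** T) = c ^ CARD('n) / det p"
 proof -
  have "det T = c ^ CARD('n) * det B"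
   unfolding T_def det_transpose using det_rows_mul[of "%_. c" "%r. B $ r"] by simp
  moreover have "det B = 1 / det p" unfolding B_def using inv by (intro det_matrix_inv) (simp add: GL_def)
  ultimately show ?thesis by (simp add: det_mul det_colmat v_def)
 qed
 ultimately have "para_delta i p = (cmod (c ^ CARD('n) / det p))^2"
  unfolding para_delta_def B_def[symmetric] by (simp only:)
 hence pd: "para_delta i p = (cmod c ^ CARD('n) / cmod (det p))^2" by (simp add: norm_divide norm_power)
 have pos: "cmod c ^ CARD('n) / cmod (det p) > 0" using c0 d0 by simp
 have half: "(-1/2 :: real) = - (1/2)" by simp
 have "para_delta i p powr (-1/2) = inverse (sqrt (para_delta i p))"
  unfolding half powr_minus by (subst powr_half_sqrt) (simp_all add: pd)
 also have "sqrt (para_delta i p) = cmod c ^ CARD('n) / cmod (det p)" unfolding pd using pos by simp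
 finally show ?thesis by (simp add: c_def)
qed

lemma para_char_chr: "para_char i t k p = chr t k (p $ i $ i)"
 by (simp add: para_char_def chr_def)

lemma chr_nonzero: "s ~= 0 ==> uch v k s ~= 0"
 using chr_norm[of s v k] by auto

lemma chr_one [simp]: "chr t k 1 = 1"
 by (simp add: chr_def)

text \<open>The homogeneous function on coordinate space whose value at the first column of \<open>g\<close>, times
  \<open>\<bar>det g\<bar>\<close>, is \<open>f g\<close>.\<close>

definition cfun :: "'n::finite => real => int => (complex^'n^'n => complex) => ('n => complex) => complex" where
 "cfun i v k f x = inverse (uch v k (x i)) * of_real (1 / cmod (x i) ^ CARD('n))
   * f (opp_unipotent i (%a. x a / x i))"

lemma ps_space_simps:
 "vzero (ps_space i t k) = (%_. 0)"
 "vadd (ps_space i t k) = (%f f' g. f g + f' g)"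
 "vscale (ps_space i t k) = (%c f g. c * f g)"
 "vinner (ps_space i t k) f f' = (LINT y|opp_measure i. cnj (f (opp_unipotent i y)) * f' (opp_unipotent i y))"
 by (auto simp: ps_space_def)

lemma ps_vecs:
 fixes i :: "'n::finite"
 shows "f : vecs (ps_space i (\<i> * of_real v) k) \<longleftrightarrow>
  f : bmeas (borelGL) &
  (ALL g:GL. ALL p:parabolic i. f (g ** p) = of_real (cmod (det p) / cmod (p $ i $ i) ^ CARD('n))
   * inverse (uch v k (p $ i $ i)) * f g) &
  integrable (opp_measure i) (%y. (cmod (f (opp_unipotent i y)))^2)"
proof -
 have "(of_real (para_delta i p powr (-1/2)) :: complex) = of_real (cmod (det p) / cmod (p $ i $ i) ^ CARD('n))" if "p : parabolic i" for p
  using para_delta_parabolic[OF that] by (rule arg_cong)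
 thus ?thesis unfolding ps_space_def para_char_chr by auto
qed

text \<open>The stabilizer of the first basis vector up to unit determinant acts trivially, so such a
  function is determined by the first column of its argument.\<close>

lemma cfun_col:
 fixes i :: "'n::finite"
 assumes f: "f : vecs (ps_space i (\<i> * of_real v) k)" and g: "g : GL" and gi: "g $ i $ i ~= 0"
 shows "f g = of_real (cmod (det g)) * cfun i v k f (col i g)"
proof -
 define y where "y = (%a. col i g a / col i g i)"
 define u where "u = opp_unipotent i y"
 define w where "w = colmat i (%a. if a = i then 1 else - y a)"
 define p where "p = w ** g"
 have uw: "u ** w = mat 1" by (auto simp: u_def w_def opp_unipotent_eq vec_eq_iff colmat_mult_entry mat_def) (auto simp: colmat_def)
 have "det p = det g" by (simp add: p_def w_def det_mul det_colmat)
 hence pG: "p : GL" using g by (simp add: GL_def invertible_det_nz)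
 have "p $ a $ i = (if a = i then g $ i $ i else 0)" for a
  using gi by (simp add: p_def w_def colmat_mult_entry y_def col_def)
 hence p: "p : parabolic i" "p $ i $ i = g $ i $ i" using pG by (auto simp: parabolic_def)
 have "u ** p = g" unfolding p_def matrix_mul_assoc uw by (simp add: matrix_mul_lid)
 hence "f g = f (u ** p)" by simp
 also have "... = of_real (cmod (det p) / cmod (p $ i $ i) ^ CARD('n)) * inverse (uch v k (p $ i $ i)) * f u"
  using f p u_def unfolding ps_vecs by simp
 finally show ?thesis by (simp add: cfun_def p \<open>det p = det g\<close> u_def y_def col_def)
qed

lemma cfun_opp:
 fixes i :: "'n::finite"
 assumes "s ~= 0"
 shows "cfun i v k f (csc s (y(i := 1))) = inverse (uch v k s) * of_real (1 / cmod s ^ CARD('n)) * f (opp_unipotent i y)"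
proof -
 have "opp_unipotent i (%a. csc s (y(i := 1)) a / csc s (y(i := 1)) i) = opp_unipotent i y"
  using assms by (auto simp: opp_unipotent_def csc_def vec_eq_iff)
 thus ?thesis by (simp add: cfun_def csc_def)
qed

lemma cfun_norm_csc:
 fixes i :: "'n::finite"
 assumes "s ~= 0" "x i ~= 0"
 shows "cmod (cfun i v k f (csc s x)) = cmod (cfun i v k f x) / cmod s ^ CARD('n)"
proof -
 have "(%a. csc s x a / csc s x i) = (%a. x a / x i)" using assms by (auto simp: csc_def)
 moreover have "csc s x i ~= 0" "cmod (csc s x i) = cmod s * cmod (x i)" using assms by (auto simp: csc_def norm_mult)
 ultimately show ?thesis using assms
  by (simp add: cfun_def norm_mult norm_inverse chr_norm norm_divide norm_power power_mult_distrib)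
qed

lemma cfun_measurable:
 fixes i :: "'n::finite"
 assumes f: "f : bmeas (borelGL)"
 shows "cfun i v k f : bmeas cvol"
proof -
 note c = cvol_component
 have "(%x. f (opp_unipotent i (%a. x a / x i))) : bmeas cvol"
  by (rule measurable_compose[OF opp_unipotent_measurable f]) (intro borel_measurable_divide c)
 moreover have "(%x. inverse (uch v k (x i))) : bmeas cvol"
  by (intro borel_measurable_inverse measurable_compose[OF c chr_measurable])
 moreover have "(%x. complex_of_real (1 / cmod (x i) ^ CARD('n))) : bmeas cvol"
  using c[of i] by measurable
 ultimately show ?thesis unfolding cfun_def by (intro borel_measurable_times)
qed

section \<open>Integration in homogeneous coordinates\<close>

interpretation om: pair_sigma_finite "opp_measure (i :: 'n::finite)" mstar for i ..
interpretation cm: pair_sigma_finite "cvol :: ('n::finite => complex) measure" mstar ..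

lemma homog_measurable: "(%p. csc (snd p) ((fst p)(i := 1))) : measurable (opp_measure (i :: 'n::finite) \<Otimes>\<^sub>M mstar) cvol"
 using measurable_compose[OF measurable_fst opp_upd] by (intro csc_measurable) auto

lemma cvol_eq_distr:
 fixes i :: "'n::finite"
 shows "cvol = distr (density (opp_measure i \<Otimes>\<^sub>M mstar) (%p. ennreal (cmod (snd p) ^ (2 * CARD('n)))))
  cvol (%p. csc (snd p) ((fst p)(i := 1)))" (is "_ = distr ?D _ ?T")
proof (rule measure_eqI)
 fix A assume A: "A : sets (cvol :: ('n => complex) measure)"
 have T: "?T : measurable ?D cvol" using homog_measurable by simp
 have I: "(indicator A :: _ => ennreal) : bmeas cvol" using A by measurable
 have w: "(%p. ennreal (cmod (snd p) ^ (2 * CARD('n)))) : bmeas (opp_measure i \<Otimes>\<^sub>M mstar)" by measurable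
 have IT: "(%p. indicator A (?T p) :: ennreal) : bmeas (opp_measure i \<Otimes>\<^sub>M mstar)"
  by (rule measurable_compose[OF homog_measurable I])
 have "emeasure (distr ?D cvol ?T) A = (nn_integral (distr ?D cvol ?T) (%x. indicator A x))" using A by simp
 also have "... = (nn_integral (?D) (%p. indicator A (?T p)))" by (rule nn_integral_distr[OF T]) (use I in simp)
 also have "... = (nn_integral (opp_measure i \<Otimes>\<^sub>M mstar) (%p. ennreal (cmod (snd p) ^ (2 * CARD('n))) * indicator A (?T p)))"
  by (rule nn_integral_density[OF w IT])
 also have "... = (nn_integral (opp_measure i) (%y. nn_integral mstar (%s. ennreal (cmod (snd (y, s)) ^ (2 * CARD('n))) * indicator A (?T (y, s)))))"
  by (rule mstar.nn_integral_fst[symmetric, where f = "%p. ennreal (cmod (snd p) ^ (2 * CARD('n))) * indicator A (?T p)"])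
   (intro borel_measurable_times_ennreal w IT)
 also have "... = (nn_integral cvol (%x. indicator A x))"
  by (subst nn_integral_unfold[OF I, of i]) (simp add: mult.commute)
 finally show "emeasure cvol A = emeasure (distr ?D cvol ?T) A" using A by simp
qed simp

lemma integral_unfold:
 fixes i :: "'n::finite" and G :: "('n => complex) => complex"
 assumes G: "integrable cvol G"
 shows "(LINT x|cvol. G x) = (LINT y|opp_measure i. LINT s|mstar. cmod s ^ (2 * CARD('n)) *\<^sub>R G (csc s (y(i := 1))))"
proof -
 let ?T = "%p :: ('n => complex) \<times> complex. csc (snd p) ((fst p)(i := 1))"
 let ?D = "density (opp_measure i \<Otimes>\<^sub>M mstar) (%p. ennreal (cmod (snd p) ^ (2 * CARD('n))))"
 have Gm: "G : bmeas cvol" using G by simp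
 have T: "?T : measurable ?D cvol" using homog_measurable by simp
 have GT: "(%p. G (?T p)) : bmeas (opp_measure i \<Otimes>\<^sub>M mstar)"
  by (rule measurable_compose[OF homog_measurable Gm])
 have "integrable (distr ?D cvol ?T) G" using G by (simp only: cvol_eq_distr[of i, symmetric])
 hence "integrable ?D (%p. G (?T p))" by (simp add: integrable_distr_eq[OF T Gm])
 hence int: "integrable (opp_measure i \<Otimes>\<^sub>M mstar) (%p. cmod (snd p) ^ (2 * CARD('n)) *\<^sub>R G (?T p))"
  by (subst (asm) integrable_density[OF GT]) auto
 have "(LINT x|cvol. G x) = (LINT x|distr ?D cvol ?T. G x)" by (simp only: cvol_eq_distr[of i, symmetric])
 also have "... = (LINT p|?D. G (?T p))" by (rule integral_distr[OF T Gm])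
 also have "... = (LINT p|(opp_measure i \<Otimes>\<^sub>M mstar). cmod (snd p) ^ (2 * CARD('n)) *\<^sub>R G (?T p))"
  by (rule integral_density[OF GT]) auto
 also have "... = (LINT y|opp_measure i. LINT s|mstar. cmod s ^ (2 * CARD('n)) *\<^sub>R G (csc s (y(i := 1))))"
  using om.integral_fst'[OF int] by simp
 finally show ?thesis .
qed

definition nrm :: "('n::finite => complex) => real" where
 "nrm x = (\<Sum>a\<in>UNIV. cmod (x a))"

lemma nrm_csc: "nrm (csc s x) = cmod s * nrm x"
 by (simp add: nrm_def csc_def norm_mult sum_distrib_left)

lemma nrm_nonneg [simp]: "0 <= nrm x"
 by (simp add: nrm_def sum_nonneg)

lemma nrm_pos: "x a ~= 0 ==> 0 < nrm x"
 unfolding nrm_def by (rule sum_pos2[of _ a]) auto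

lemma nrm_ge: "cmod (x a) <= nrm x"
 unfolding nrm_def by (rule member_le_sum) auto

lemma nrm_measurable [measurable]: "nrm : bmeas cvol"
 unfolding nrm_def by (rule borel_measurable_sum, rule measurable_compose[OF cvol_component], simp)

lemma nrm_mvec: "\<exists>C>0. ALL x. nrm (mvec A x) <= C * nrm x"
proof -
 define C where "C = (\<Sum>a\<in>UNIV. \<Sum>b\<in>UNIV. cmod (A $ a $ b)) + 1"
 have "nrm (mvec A x) <= C * nrm x" for x
 proof -
  have "nrm (mvec A x) <= (\<Sum>a\<in>UNIV. \<Sum>b\<in>UNIV. cmod (A $ a $ b) * nrm x)"
   unfolding nrm_def[of "mvec A x"] unfolding mvec_def
  proof (intro sum_mono)
   fix a
   have "cmod (\<Sum>b\<in>UNIV. A $ a $ b * x b) <= (\<Sum>b\<in>UNIV. cmod (A $ a $ b * x b))" by (rule norm_sum)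
   also have "... <= (\<Sum>b\<in>UNIV. cmod (A $ a $ b) * nrm x)"
   by (intro sum_mono) (simp add: norm_mult mult_left_mono nrm_ge)
   finally show "cmod (\<Sum>b\<in>UNIV. A $ a $ b * x b) <= (\<Sum>b\<in>UNIV. cmod (A $ a $ b) * nrm x)" .
  qed
  also have "... <= C * nrm x" by (simp add: C_def sum_distrib_right distrib_right)
  finally show ?thesis .
 qed
 moreover have "C > 0" unfolding C_def by (intro add_nonneg_pos sum_nonneg) auto
 ultimately show ?thesis by blast
qed

lemma emeasure_shell:
 fixes x :: "'n::finite => complex"
 assumes x: "nrm x > 0" and \<rho>: "0 < \<rho>1" "\<rho>1 <= \<rho>2"
 shows "(nn_integral mstar (%s. indicator {\<rho>1..\<rho>2} (nrm (csc s x)))) = ennreal (ln (\<rho>2 / \<rho>1) * (2 * pi))"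
proof -
 let ?S = "{s. exp (ln (\<rho>1 / nrm x)) <= cmod s & cmod s <= exp (ln (\<rho>2 / nrm x))}"
 have eq: "(%s. indicator {\<rho>1..\<rho>2} (nrm (csc s x)) :: ennreal) = indicator ?S"
  using x \<rho> by (auto simp: fun_eq_iff nrm_csc indicator_def field_simps)
 have S: "?S : sets mstar" by measurable
 have "ln (\<rho>1 / nrm x) <= ln (\<rho>2 / nrm x)" using x \<rho> by (subst ln_le_cancel_iff) (auto intro: divide_right_mono)
 hence "emeasure mstar ?S = ennreal ((ln (\<rho>2 / nrm x) - ln (\<rho>1 / nrm x)) * (2 * pi))"
  by (rule emeasure_mstar_annulus)
 moreover have "ln (\<rho>2 / nrm x) - ln (\<rho>1 / nrm x) = ln (\<rho>2 / \<rho>1)" using x \<rho> by (simp add: ln_div)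
 ultimately show ?thesis unfolding eq using S by simp
qed

lemma mvec_nonzero:
 fixes A :: "complex^'n^'n::finite"
 assumes A: "invertible A" and x: "x a ~= 0" shows "nrm (mvec A x) > 0"
proof -
 have "EX b. mvec A x b ~= 0"
 proof (rule ccontr)
  assume "~ (EX b. mvec A x b ~= 0)"
  hence "mvec A x = (%_. 0)" by auto
  moreover have "mvec (matrix_inv A) (mvec A x) = x"
   by (simp add: mvec_mult[symmetric] matrix_inv_mult[OF A])
  ultimately have "x = mvec (matrix_inv A) (%_. 0)" by simp
  hence "x a = 0" by (simp add: mvec_def)
  thus False using x by simp
 qed
 thus ?thesis using nrm_pos by blast
qed

text \<open>The invariance of the inner product rests on this formula: the square norm can be computed over
  any linear image of a shell, because every complex line meets all of these in the same measure.\<close>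

lemma nn_integral_shell:
 fixes i :: "'n::finite" and A :: "complex^'n^'n"
 assumes A: "invertible A" and f: "f : bmeas (borelGL)" and \<rho>: "0 < \<rho>1" "\<rho>1 <= \<rho>2"
 shows "(nn_integral cvol (%x. indicator {\<rho>1..\<rho>2} (nrm (mvec A x)) * ennreal ((cmod (cfun i v k f x))^2)))
  = ennreal (ln (\<rho>2 / \<rho>1) * (2 * pi)) * (nn_integral (opp_measure i) (%y. ennreal ((cmod (f (opp_unipotent i y)))^2)))"
proof -
 let ?F = "%x. indicator {\<rho>1..\<rho>2} (nrm (mvec A x)) * ennreal ((cmod (cfun i v k f x))^2)"
 note [measurable] = cfun_measurable[OF f, of i v k]
 have fo: "(%y. f (opp_unipotent i y)) : bmeas (opp_measure i)"
  by (rule measurable_compose[OF opp_unipotent_opp f])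
 have "(nn_integral cvol (%x. ?F x)) = (nn_integral (opp_measure i) (%y. nn_integral mstar (%s. ?F (csc s (y(i := 1))) * ennreal (cmod s ^ (2 * CARD('n))))))"
  by (rule nn_integral_unfold) measurable
 also have "... = (nn_integral (opp_measure i) (%y. ennreal (ln (\<rho>2 / \<rho>1) * (2 * pi)) * ennreal ((cmod (f (opp_unipotent i y)))^2)))"
 proof (rule nn_integral_cong)
  fix y :: "'n => complex"
  let ?x = "y(i := 1)"
  have pos: "nrm (mvec A ?x) > 0" by (rule mvec_nonzero[OF A, of _ i]) simp
  have "(nn_integral mstar (%s. ?F (csc s ?x) * ennreal (cmod s ^ (2 * CARD('n)))))
   = (nn_integral mstar (%s. indicator {\<rho>1..\<rho>2} (nrm (csc s (mvec A ?x))) * ennreal ((cmod (f (opp_unipotent i y)))^2)))"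
  proof (rule nn_integral_cong_AE, use AE_mstar_nonzero in eventually_elim)
   fix s :: complex assume s: "s ~= 0"
   have "(cmod (cfun i v k f (csc s ?x)))^2 * cmod s ^ (2 * CARD('n)) = (cmod (f (opp_unipotent i y)))^2"
   unfolding cfun_opp[OF s] using s
   by (simp add: norm_mult norm_inverse chr_norm norm_divide norm_power power_mult_distrib power_divide power_mult[symmetric] mult.commute)
   hence "ennreal ((cmod (cfun i v k f (csc s ?x)))^2) * ennreal (cmod s ^ (2 * CARD('n))) = ennreal ((cmod (f (opp_unipotent i y)))^2)"
   by (subst ennreal_mult[symmetric]) auto
   thus "?F (csc s ?x) * ennreal (cmod s ^ (2 * CARD('n)))
   = indicator {\<rho>1..\<rho>2} (nrm (csc s (mvec A ?x))) * ennreal ((cmod (f (opp_unipotent i y)))^2)"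
   by (simp only: mvec_csc mult.assoc)
  qed
  also have "... = (nn_integral mstar (%s. indicator {\<rho>1..\<rho>2} (nrm (csc s (mvec A ?x))))) * ennreal ((cmod (f (opp_unipotent i y)))^2)"
   by (rule nn_integral_multc) (simp add: nrm_csc)
  finally show "(nn_integral mstar (%s. ?F (csc s ?x) * ennreal (cmod s ^ (2 * CARD('n)))))
   = ennreal (ln (\<rho>2 / \<rho>1) * (2 * pi)) * ennreal ((cmod (f (opp_unipotent i y)))^2)"
   by (simp only: emeasure_shell[OF pos \<rho>])
 qed
 also have "... = ennreal (ln (\<rho>2 / \<rho>1) * (2 * pi)) * (nn_integral (opp_measure i) (%y. ennreal ((cmod (f (opp_unipotent i y)))^2)))"
  using fo by (intro nn_integral_cmult) measurable
 finally show ?thesis .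
qed

lemma AE_cvol_component_nonzero: "AE x in cvol. x (a :: 'n::finite) ~= 0"
proof -
 let ?F = "%x. indicator {0} (x a) :: ennreal"
 have m: "?F : bmeas (cvol :: ('n => complex) measure)"
  by (rule measurable_compose[OF cvol_component]) simp
 have "(nn_integral cvol (%x. ?F x)) = (nn_integral lborel (%w. nn_integral (opp_measure a) (%y. ?F (y(a := w)))))"
  by (rule nn_integral_cvol_insert[OF m])
 also have "... = (nn_integral (lborel :: complex measure) (%w. 0))"
  using AE_lborel_complex_nonzero by (intro nn_integral_cong_AE) (auto elim!: eventually_mono)
 finally have "AE x in cvol. ?F x = 0" using m by (simp add: nn_integral_0_iff_AE)
 thus ?thesis by eventually_elim (auto split: split_indicator_asm)
qed

lemma AE_mvec_component_nonzero:
 fixes A :: "complex^'n^'n::finite"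
 assumes A: "invertible A" shows "AE x in cvol. mvec A x a ~= 0"
proof -
 let ?F = "%x. indicator {0} (x a) :: ennreal"
 have m: "?F : bmeas (cvol :: ('n => complex) measure)"
  by (rule measurable_compose[OF cvol_component]) simp
 have m': "(%x. ?F (mvec A x)) : bmeas cvol" by (rule measurable_compose[OF mvec_measurable m])
 have "(nn_integral cvol (%x. ?F x)) = 0"
  using AE_cvol_component_nonzero[of a] m by (subst nn_integral_0_iff_AE) (auto elim!: eventually_mono)
 hence "(nn_integral cvol (%x. ?F (mvec A x))) = 0" by (simp only: nn_integral_matrix[OF A m] mult_zero_right)
 hence "AE x in cvol. ?F (mvec A x) = 0" using m' by (simp add: nn_integral_0_iff_AE)
 thus ?thesis by eventually_elim (auto split: split_indicator_asm)
qed


section \<open>The principal series as unitary representations\<close>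

definition cplx_space :: "complex ip_space" where
 "cplx_space = \<lparr>vecs = UNIV, vzero = 0, vadd = (+), vscale = (*), vinner = (%a b. cnj a * b)\<rparr>"

lemma cplx_space_simps [simp]:
 "vecs cplx_space = UNIV" "vzero cplx_space = 0" "vadd cplx_space = (+)" "vscale cplx_space = (*)"
 "vinner cplx_space = (%a b. cnj a * b)"
 by (auto simp: cplx_space_def)

lemma cplx_norm [simp]: "vnorm cplx_space a = cmod a"
proof -
 have "Re (cnj a * a) = (cmod a)^2" unfolding cmod_power2 by (simp add: power2_eq_square)
 thus ?thesis by (simp add: vnorm_def)
qed

text \<open>The principal series is modelled on the square-integrable functions on the open cell, that is, on a
  direct integral of lines; its completeness follows from that of direct integrals.\<close>

lemma hilbert_cplx: "hilbert cplx_space"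
proof
 fix X :: "nat => complex" assume X: "hcauchy cplx_space X"
 have d: "vdist cplx_space a b = dist a b" for a b by (simp add: vdist_def dist_norm)
 have "Cauchy X" using X by (simp add: hcauchy_def d Cauchy_def)
 from Cauchy_convergent[OF this] obtain x where "X -->> x" unfolding convergent_def by blast
 hence "(%n. vdist cplx_space (X n) x) -->> 0" unfolding d by (subst (asm) tendsto_dist_iff)
 thus "EX x:vecs cplx_space. (%n. vdist cplx_space (X n) x) -->> 0"
  by (intro bexI[of _ x]) simp_all
qed (auto simp: algebra_simps)

lemma hilbert_field_cplx: "hilbert_field M (%_. cplx_space) {%_. 1}"
proof (rule hilbert_field.intro)
 have "vtotal cplx_space {1}"
  unfolding vtotal_def
 proof (intro conjI ballI allI impI)
  fix x :: complex and \<epsilon> :: real assume "\<epsilon> > 0"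
  have "vadd cplx_space (vscale cplx_space x 1) (vzero cplx_space) : vspan cplx_space {1}"
   by (intro vspan.step vspan.zero) simp
  thus "EX y:vspan cplx_space {1}. vdist cplx_space x y < \<epsilon>"
   using \<open>\<epsilon> > 0\<close> by (intro bexI[of _ x]) (auto simp: vdist_def)
 qed simp
 thus "measurable_field M (%_. cplx_space) {%_. 1}"
  unfolding measurable_field_def by (auto intro!: exI[of _ "{%_. 1}"])
qed (rule hilbert_cplx)

definition L2 :: "'a measure => ('a => complex) ip_space" where
 "L2 M = direct_integral M (%_. cplx_space) {%_. 1}"

lemma L2_simps:
 "vecs (L2 M) = {s : bmeas M. integrable M (%z. (cmod (s z))^2)}"
 "vzero (L2 M) = (%_. 0)" "vadd (L2 M) = (%s t z. s z + t z)" "vscale (L2 M) = (%c s z. c * s z)"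
 "vinner (L2 M) = (%s t. LINT z|M. cnj (s z) * t z)"
 by (auto simp: L2_def direct_integral_def)

lemma hilbert_L2: "hilbert (L2 M)"
proof -
 interpret hilbert_field M "%_. cplx_space" "{%_. 1}" by (rule hilbert_field_cplx)
 show ?thesis unfolding L2_def by (rule D.hilbert_L)
qed

lemma L2_norm: "s : vecs (L2 M) ==> (vnorm (L2 M) s)^2 = (LINT z|M. (cmod (s z))^2)"
proof -
 interpret hilbert_field M "%_. cplx_space" "{%_. 1}" by (rule hilbert_field_cplx)
 show "s : vecs (L2 M) ==> ?thesis" using D.L_norm unfolding L2_def by simp
qed

abbreviation psr :: "'n::finite => real => int => (complex^'n^'n => complex) ip_space" where
 "psr i v k \<equiv> ps_space i (\<i> * of_real v) k"

definition cell :: "'n::finite => (complex^'n^'n => complex) => ('n => complex) => complex" where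
 "cell i f y = f (opp_unipotent i y)"

lemma cell_mem: "f : vecs (psr i v k) ==> cell i f : vecs (L2 (opp_measure i))" for i :: "'n::finite"
 unfolding L2_simps ps_vecs cell_def using measurable_compose[OF opp_unipotent_opp] by auto

lemma cell_simps:
 "vinner (ps_space i t k) f f' = vinner (L2 (opp_measure i)) (cell i f) (cell i f')"
 "cell i (vadd (ps_space i t k) f f') = vadd (L2 (opp_measure i)) (cell i f) (cell i f')"
 "cell i (vscale (ps_space i t k) c f) = vscale (L2 (opp_measure i)) c (cell i f)"
 "cell i (vzero (ps_space i t k)) = vzero (L2 (opp_measure i))"
 by (auto simp: ps_space_simps L2_simps cell_def)

lemma cell_norm: "vnorm (ps_space i t k) f = vnorm (L2 (opp_measure i)) (cell i f)"
 by (simp add: vnorm_def cell_simps)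

lemma cell_dist: "vdist (ps_space i t k) f f' = vdist (L2 (opp_measure i)) (cell i f) (cell i f')"
 by (simp add: vdist_def cell_norm cell_simps)

lemma ps_norm: "f : vecs (psr i v k) ==> (vnorm (psr i v k) f)^2 = (LINT y|opp_measure i. (cmod (f (opp_unipotent i y)))^2)"
 for i :: "'n::finite"
 unfolding cell_norm by (simp add: L2_norm cell_mem) (simp add: cell_def)

text \<open>A function on the open cell extends to the group, by zero off the set where the cell
  coordinates are defined.\<close>

definition cell_ext :: "'n::finite => real => int => (('n => complex) => complex) => complex^'n^'n => complex" where
 "cell_ext i v k \<phi> g = (if col i g i = 0 then 0 else
   of_real (cmod (det g) / cmod (col i g i) ^ CARD('n)) * inverse (uch v k (col i g i))
   * \<phi> (\<lambda>a\<in>UNIV - {i}. col i g a / col i g i))"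

lemma col_comp_measurable: "(%g. col i g a) : bmeas (borelGL)" for i :: "'n::finite"
 by (rule measurable_compose[OF col_measurable cvol_component])

lemma cell_ext_mem:
 fixes i :: "'n::finite"
 assumes \<phi>: "\<phi> : vecs (L2 (opp_measure i))"
 shows "cell_ext i v k \<phi> : vecs (psr i v k)"
  and "y : space (opp_measure i) ==> cell i (cell_ext i v k \<phi>) y = \<phi> y"
proof -
 have cell: "cell i (cell_ext i v k \<phi>) y = \<phi> y" if "y : space (opp_measure i)" for y
 proof -
  have "(\<lambda>a\<in>UNIV - {i}. (y(i := 1)) a / 1) = y"
  proof
   fix a show "(\<lambda>a\<in>UNIV - {i}. (y(i := 1)) a / 1) a = y a"
   using that by (cases "a = i") (auto simp: opp_measure_def space_PiM PiE_def extensional_def)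
  qed
  thus ?thesis by (simp add: cell_def cell_ext_def)
 qed
 thus "y : space (opp_measure i) ==> cell i (cell_ext i v k \<phi>) y = \<phi> y" .
 have \<phi>m: "\<phi> : bmeas (opp_measure i)" and \<phi>i: "integrable (opp_measure i) (%y. (cmod (\<phi> y))^2)"
  using \<phi> by (auto simp: L2_simps)
 note c = col_comp_measurable[of i]
 have rm: "(%g. \<lambda>a\<in>UNIV - {i}. col i g a / col i g i) : measurable (borelGL) (opp_measure i)"
  unfolding opp_measure_def
  by (rule measurable_restrict) (use c in "auto intro!: borel_measurable_divide")
 have "cell_ext i v k \<phi> : bmeas (borelGL)"
  unfolding cell_ext_def
 proof (rule measurable_If)
  show "(%g. of_real (cmod (det g) / cmod (col i g i) ^ CARD('n)) * inverse (uch v k (col i g i))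
   * \<phi> (\<lambda>a\<in>UNIV - {i}. col i g a / col i g i)) : bmeas (borelGL)"
  proof (intro borel_measurable_times)
   show "(%g. complex_of_real (cmod (det g) / cmod (col i g i) ^ CARD('n))) : bmeas (borelGL)"
   using c[of i] by measurable
   show "(%g. inverse (uch v k (col i g i))) : bmeas (borelGL)"
   by (intro borel_measurable_inverse measurable_compose[OF c chr_measurable])
   show "(%g. \<phi> (\<lambda>a\<in>UNIV - {i}. col i g a / col i g i)) : bmeas (borelGL)"
   by (rule measurable_compose[OF rm \<phi>m])
  qed
  have "(%g. col i g i) -` {0} \<inter> space (borelGL) : sets (borelGL)"
   by (rule measurable_sets[OF c]) simp
  moreover have "{g : space (borelGL). col i g i = 0} = (%g. col i g i) -` {0} \<inter> space (borelGL)" by auto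
  ultimately show "{g : space (borelGL). col i g i = 0} : sets (borelGL)" by simp
 qed simp
 moreover have "cell_ext i v k \<phi> (g ** p) = of_real (cmod (det p) / cmod (p $ i $ i) ^ CARD('n))
   * inverse (uch v k (p $ i $ i)) * cell_ext i v k \<phi> g" if p: "p : parabolic i" for g p
 proof (cases "col i g i = 0")
  case True thus ?thesis by (simp add: cell_ext_def col_parabolic[OF p] csc_def)
 next
  case False
  note p0 = parabolic_diag[OF p]
  have "(\<lambda>a\<in>UNIV - {i}. csc (p $ i $ i) (col i g) a / csc (p $ i $ i) (col i g) i) = (\<lambda>a\<in>UNIV - {i}. col i g a / col i g i)"
   using p0 by (auto simp: csc_def)
  moreover have "csc (p $ i $ i) (col i g) i = p $ i $ i * col i g i" by (simp add: csc_def)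
  ultimately show ?thesis using False p0
   by (simp add: cell_ext_def col_parabolic[OF p] det_mul norm_mult power_mult_distrib chr_mult)
 qed
 moreover have "integrable (opp_measure i) (%y. (cmod (cell_ext i v k \<phi> (opp_unipotent i y)))^2)"
  using \<phi>i by (rule b_integrable_cong[THEN iffD1, rotated -1]) (use cell in "auto simp: cell_def")
 ultimately show "cell_ext i v k \<phi> : vecs (psr i v k)" unfolding ps_vecs by blast
qed

lemma ps_add: "f : vecs (psr i v k) ==> f' : vecs (psr i v k) ==> vadd (psr i v k) f f' : vecs (psr i v k)"
 for i :: "'n::finite"
proof -
 assume f: "f : vecs (psr i v k)" "f' : vecs (psr i v k)"
 interpret L: hilbert "L2 (opp_measure i)" by (rule hilbert_L2)
 have "cell i (vadd (psr i v k) f f') : vecs (L2 (opp_measure i))"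
  unfolding cell_simps by (intro L.add_mem cell_mem[OF f(1)] cell_mem[OF f(2)])
 hence "integrable (opp_measure i) (%y. (cmod (f (opp_unipotent i y) + f' (opp_unipotent i y)))^2)"
  by (simp add: L2_simps cell_def ps_space_simps)
 thus ?thesis using f unfolding ps_vecs ps_space_simps by (auto simp: distrib_left add_divide_distrib)
qed

lemma ps_scale: "f : vecs (psr i v k) ==> vscale (psr i v k) c f : vecs (psr i v k)"
 for i :: "'n::finite"
 unfolding ps_vecs ps_space_simps by (auto simp: norm_mult power_mult_distrib algebra_simps)

lemma hilbert_ps: "hilbert (psr i v k)" for i :: "'n::finite"
proof -
 interpret L: hilbert "L2 (opp_measure i)" by (rule hilbert_L2)
 note cm = cell_mem[of _ i v k]
 have z: "vzero (psr i v k) : vecs (psr i v k)" unfolding ps_vecs ps_space_simps by simp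
 show ?thesis
 proof (unfold_locales, goal_cases)
  case 1 show ?case by (rule z)
 next
  case (2 x y) thus ?case by (rule ps_add)
 next
  case (3 x c) thus ?case by (rule ps_scale)
 next
  case (4 x) thus ?case by (simp add: cell_simps cm)
 next
  case (5 x y z) thus ?case by (simp add: cell_simps cm)
 next
  case (6 x y c) thus ?case by (simp add: cell_simps cm)
 next
  case (7 x y) thus ?case unfolding cell_simps by (intro L.inner_commute cm)
 next
  case (8 x) thus ?case unfolding cell_simps by (intro L.inner_nonneg cm)
 next
  case (9 X)
  have Xm: "X n : vecs (psr i v k)" for n using 9 by (simp add: hcauchy_def)
  have "hcauchy (L2 (opp_measure i)) (%n. cell i (X n))"
   using 9 cm unfolding hcauchy_def cell_dist by auto
  then obtain \<phi> where \<phi>: "\<phi> : vecs (L2 (opp_measure i))" "(%n. vdist (L2 (opp_measure i)) (cell i (X n)) \<phi>) -->> 0"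
   using L.complete by blast
  have "vdist (psr i v k) (X n) (cell_ext i v k \<phi>) = vdist (L2 (opp_measure i)) (cell i (X n)) \<phi>" for n
   unfolding cell_dist unfolding vdist_def vnorm_def L2_simps
   by (intro arg_cong[where f = "%z. sqrt (Re z)"] b_integral_cong refl) (simp add: cell_ext_mem(2)[OF \<phi>(1)])
  thus ?case using \<phi>(2) cell_ext_mem(1)[OF \<phi>(1)] by (intro bexI[of _ "cell_ext i v k \<phi>"]) auto
 qed
qed

lemma (in pre_hilbert) isometry_onI:
 assumes U: "!!x. x : vecs H ==> U x : vecs H"
  and add: "!!x y. x : vecs H ==> y : vecs H ==> U (vadd H x y) = vadd H (U x) (U y)"
  and scale: "!!x c. x : vecs H ==> U (vscale H c x) = vscale H c (U x)"
  and norm: "!!x. x : vecs H ==> vnorm H (U x) = vnorm H x"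
 shows "isometry_on H U"
 unfolding isometry_on_def
proof (intro conjI ballI)
 fix x y assume xy: "x : vecs H" "y : vecs H"
 have Re: "Re (vinner H (U x) (U y)) = Re (vinner H x y)" if "x : vecs H" for x
 proof -
  have "vdist H (U x) (U y) = vdist H x y"
   using that xy(2) norm[of "vsub x y"] by (simp add: vdist_def add scale)
  thus ?thesis using dist_power2[of x y] dist_power2[of "U x" "U y"] that xy(2) by (simp add: U norm)
 qed
 have "Re (vinner H (U (vscale H \<i> x)) (U y)) = Re (vinner H (vscale H \<i> x) y)" using xy by (intro Re) simp
 hence "Im (vinner H (U x) (U y)) = Im (vinner H x y)" using xy by (simp add: scale U)
 thus "vinner H (U x) (U y) = vinner H x y" using Re[OF xy(1)] by (simp add: complex_eq_iff)
qed (rule U)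

lemma ps_act: "act (principal_series i t k) h f = (%g. f (matrix_inv h ** g))"
 and ps_hspace: "hspace (principal_series i t k) = ps_space i t k"
 by (auto simp: principal_series_def)

text \<open>Translation by \<open>h\<close> moves the shell over which the norm is computed and contributes the square of
  \<open>\<bar>det h\<bar>\<close>, which is the Jacobian of the linear substitution that moves it back.\<close>

lemma nn_integral_act:
 fixes i :: "'n::finite"
 assumes h: "h : GL" and f: "f : vecs (psr i v k)"
 shows "(nn_integral (opp_measure i) (%y. ennreal ((cmod (f (h ** opp_unipotent i y)))^2)))
  = (nn_integral (opp_measure i) (%y. ennreal ((cmod (f (opp_unipotent i y)))^2)))"
proof -
 let ?h = "matrix_inv h"
 have hi: "invertible h" "invertible ?h" using h GL_matrix_inv[OF h] by (auto simp: GL_def)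
 have d0: "det h ~= 0" using hi by (simp add: invertible_det_nz)
 define fh where "fh g = f (h ** g)" for g
 have fm: "f : bmeas (borelGL)" using f by (simp add: ps_vecs)
 have fhm: "fh : bmeas (borelGL)"
  unfolding fh_def by (rule measurable_compose[OF matrix_mult_measurable[OF h] fm])
 let ?I = "%x. indicator {1..exp 1} (nrm x) :: ennreal"
 let ?F = "%z. ?I (mvec ?h z) * ennreal ((cmod (cfun i v k f z))^2)"
 have Fm: "?F : bmeas cvol" using cfun_measurable[OF fm, of i v k] by measurable
 have c: "ennreal (ln (exp 1 / 1) * (2 * pi)) = ennreal (2 * pi)" by simp
 have "ennreal (2 * pi) * (nn_integral (opp_measure i) (%y. ennreal ((cmod (fh (opp_unipotent i y)))^2)))
  = (nn_integral cvol (%x. ?I (mvec (mat 1) x) * ennreal ((cmod (cfun i v k fh x))^2)))"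
  unfolding c[symmetric] by (rule nn_integral_shell[symmetric]) (use fhm in \<open>auto simp: invertible_def intro: exI[of _ "mat 1"]\<close>)
 also have "... = (nn_integral cvol (%x. ennreal ((cmod (det h))^2) * ?F (mvec h x)))"
 proof (rule nn_integral_cong_AE, use AE_cvol_component_nonzero[of i] AE_mvec_component_nonzero[OF hi(1), of i] in eventually_elim)
  fix x assume x: "x i ~= 0" "mvec h x i ~= 0"
  let ?u = "opp_unipotent i (%a. x a / x i)"
  have colu: "col i ?u = csc (1 / x i) x" using x by (auto simp: csc_def)
  have colhu: "col i (h ** ?u) = csc (1 / x i) (mvec h x)" by (simp only: col_mult colu mvec_csc)
  have "(h ** ?u) $ i $ i = csc (1 / x i) (mvec h x) i" using fun_cong[OF colhu, of i] by (simp add: col_def)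
  hence nz: "(h ** ?u) $ i $ i ~= 0" using x by (simp add: csc_def)
  have hu: "h ** ?u : GL" by (rule GL_mult[OF h]) simp
  have fu: "fh ?u = of_real (cmod (det h)) * cfun i v k f (csc (1 / x i) (mvec h x))"
   unfolding fh_def cfun_col[OF f hu nz] by (simp add: det_mul colhu)
  have "cmod (cfun i v k f (csc (1 / x i) (mvec h x))) = cmod (cfun i v k f (mvec h x)) / cmod (1 / x i) ^ CARD('n)"
   using x by (intro cfun_norm_csc) auto
  hence "cmod (cfun i v k fh x) = cmod (det h) * cmod (cfun i v k f (mvec h x))"
   using x by (simp add: cfun_def[of i v k fh] fu norm_mult norm_inverse chr_norm norm_divide norm_power power_divide)
  hence "ennreal ((cmod (cfun i v k fh x))^2) = ennreal ((cmod (det h))^2) * ennreal ((cmod (cfun i v k f (mvec h x)))^2)"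
   by (simp add: power_mult_distrib ennreal_mult)
  moreover have "mvec ?h (mvec h x) = x" by (simp add: mvec_mult[symmetric] matrix_inv_mult[OF hi(1)])
  ultimately show "?I (mvec (mat 1) x) * ennreal ((cmod (cfun i v k fh x))^2) = ennreal ((cmod (det h))^2) * ?F (mvec h x)"
   by (simp add: ac_simps)
 qed
 also have "... = ennreal ((cmod (det h))^2) * (nn_integral cvol (%x. ?F (mvec h x)))"
  by (rule nn_integral_cmult) (rule measurable_compose[OF mvec_measurable Fm])
 also have "... = ennreal ((cmod (det h))^2) * (ennreal (1 / (cmod (det h))^2) * (nn_integral cvol (%x. ?F x)))"
  by (simp only: nn_integral_matrix[OF hi(1) Fm])
 also have "... = (ennreal ((cmod (det h))^2) * ennreal (1 / (cmod (det h))^2)) * (nn_integral cvol (%x. ?F x))" by (simp only: mult.assoc)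
 also have "ennreal ((cmod (det h))^2) * ennreal (1 / (cmod (det h))^2) = 1"
  using d0 by (subst ennreal_mult[symmetric]) auto
 also have "1 * (nn_integral cvol (%x. ?F x)) = ennreal (2 * pi) * (nn_integral (opp_measure i) (%y. ennreal ((cmod (f (opp_unipotent i y)))^2)))"
  unfolding c[symmetric] mult_1 by (rule nn_integral_shell) (use hi fm in auto)
 finally show ?thesis unfolding fh_def by (subst (asm) ennreal_mult_cancel_left) auto
qed

theorem ps_unitary:
 fixes i :: "'n::finite"
 assumes h: "h : GL"
 shows "isometry_on (psr i v k) (act (principal_series i (\<i> * of_real v) k) h)"
proof -
 interpret hilbert "psr i v k" by (rule hilbert_ps)
 let ?h = "matrix_inv h"
 have h': "?h : GL" by (rule GL_matrix_inv[OF h])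
 have int: "integrable (opp_measure i) (%y. (cmod (f (?h ** opp_unipotent i y)))^2) &
  (LINT y|opp_measure i. (cmod (f (?h ** opp_unipotent i y)))^2) = (LINT y|opp_measure i. (cmod (f (opp_unipotent i y)))^2)"
  if f: "f : vecs (psr i v k)" for f
 proof -
  have fm: "f : bmeas (borelGL)"
   and fi: "integrable (opp_measure i) (%y. (cmod (f (opp_unipotent i y)))^2)" using f by (auto simp: ps_vecs)
  have "(%y. f (?h ** opp_unipotent i y)) : bmeas (opp_measure i)"
   by (rule measurable_compose[OF measurable_compose[OF opp_unipotent_opp matrix_mult_measurable[OF h']] fm])
  hence m: "(%y. (cmod (f (?h ** opp_unipotent i y)))^2) : bmeas (opp_measure i)" by measurable
  have "(nn_integral (opp_measure i) (%y. ennreal ((cmod (f (?h ** opp_unipotent i y)))^2)))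
   = ennreal (LINT y|opp_measure i. (cmod (f (opp_unipotent i y)))^2)"
   unfolding nn_integral_act[OF h' f] by (rule nn_integral_eq_integral[OF fi]) simp
  thus ?thesis using m by (subst (asm) nn_integral_eq_integrable) auto
 qed
 have mem: "(%g. f (?h ** g)) : vecs (psr i v k)" if f: "f : vecs (psr i v k)" for f
 proof -
  have "(%g. f (?h ** g)) : bmeas (borelGL)"
   using f unfolding ps_vecs by (intro measurable_compose[OF matrix_mult_measurable[OF h']]) auto
  thus ?thesis using f int[OF f] GL_mult[OF h'] unfolding ps_vecs by (auto simp: matrix_mul_assoc)
 qed
 show ?thesis unfolding ps_act
 proof (rule isometry_onI)
  fix f assume f: "f : vecs (psr i v k)"
  have "(vnorm (psr i v k) (%g. f (?h ** g)))^2 = (vnorm (psr i v k) f)^2"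
   unfolding ps_norm[OF f] ps_norm[OF mem[OF f]] using int[OF f] by simp
  thus "vnorm (psr i v k) (%g. f (?h ** g)) = vnorm (psr i v k) f" using f mem[OF f] by simp
 qed (auto simp: ps_space_simps mem)
qed


section \<open>Vectors obtained by averaging over lines\<close>

text \<open>Continuity is only required along complex lines, which is all that the Mellin transform sees.\<close>

definition bump :: "(('n::finite => complex) => complex) => bool" where
 "bump \<Phi> \<longleftrightarrow> \<Phi> : bmeas cvol & (EX B. ALL x. cmod (\<Phi> x) <= B) &
   (\<exists>\<rho>1>0. \<exists>\<rho>2\<ge>\<rho>1. ALL x. \<Phi> x ~= 0 --> \<rho>1 <= nrm x & nrm x <= \<rho>2) &
   (ALL x. continuous_on UNIV (%s. \<Phi> (csc s x)))"

lemma bumpE: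
 assumes "bump \<Phi>"
 obtains B \<rho>1 \<rho>2 where "B > 0" "!!x. cmod (\<Phi> x) <= B" "0 < \<rho>1" "\<rho>1 <= \<rho>2"
  "!!x. \<Phi> x ~= 0 ==> \<rho>1 <= nrm x & nrm x <= \<rho>2"
proof -
 from assms obtain B \<rho>1 \<rho>2 where B: "!!x. cmod (\<Phi> x) <= B" and \<rho>: "0 < \<rho>1" "\<rho>1 <= \<rho>2"
  "!!x. \<Phi> x ~= 0 ==> \<rho>1 <= nrm x & nrm x <= \<rho>2"
  unfolding bump_def by blast
 have "!!x. cmod (\<Phi> x) <= max B 1" using B by (simp add: le_max_iff_disj)
 thus ?thesis using that[of "max B 1" \<rho>1 \<rho>2] \<rho> by simp
qed

lemma bump_measurable: "bump \<Phi> ==> \<Phi> : bmeas cvol"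
 by (simp add: bump_def)

lemma bump_mvec:
 fixes A :: "complex^'n^'n::finite"
 assumes \<Phi>: "bump \<Phi>" and A: "invertible A" shows "bump (%x. c * \<Phi> (mvec A x))"
proof -
 from \<Phi> obtain B \<rho>1 \<rho>2 where B: "B > 0" "!!x. cmod (\<Phi> x) <= B" and \<rho>: "0 < \<rho>1" "\<rho>1 <= \<rho>2"
  "!!x. \<Phi> x ~= 0 ==> \<rho>1 <= nrm x & nrm x <= \<rho>2" by (rule bumpE) blast
 obtain C where C: "C > 0" "!!x. nrm (mvec A x) <= C * nrm x" using nrm_mvec[of A] by blast
 obtain D where D: "D > 0" "!!x. nrm (mvec (matrix_inv A) x) <= D * nrm x" using nrm_mvec[of "matrix_inv A"] by blast
 have D': "nrm x <= D * nrm (mvec A x)" for x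
  using D(2)[of "mvec A x"] by (simp add: mvec_mult[symmetric] matrix_inv_mult[OF A])
 have supp: "\<rho>1 / C <= nrm x & nrm x <= max (\<rho>1 / C) (D * \<rho>2)" if "c * \<Phi> (mvec A x) ~= 0" for x
 proof -
  have r: "\<rho>1 <= nrm (mvec A x)" "nrm (mvec A x) <= \<rho>2" using that \<rho>(3) by auto
  have "\<rho>1 <= C * nrm x" using r(1) C(2)[of x] by linarith
  moreover have "nrm x <= D * \<rho>2" using D'[of x] r(2) D(1) by (meson mult_left_mono order.strict_implies_order order_trans)
  ultimately show ?thesis using C(1) by (simp add: divide_le_eq mult.commute le_max_iff_disj)
 qed
 show ?thesis unfolding bump_def
 proof (intro conjI allI)
  show "(%x. c * \<Phi> (mvec A x)) : bmeas cvol"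
   using measurable_compose[OF mvec_measurable bump_measurable[OF \<Phi>]] by measurable
  show "EX B. ALL x. cmod (c * \<Phi> (mvec A x)) <= B"
   using B by (intro exI[of _ "cmod c * B"]) (auto simp: norm_mult intro: mult_left_mono)
  show "\<exists>\<rho>1>0. \<exists>\<rho>2\<ge>\<rho>1. ALL x. c * \<Phi> (mvec A x) ~= 0 --> \<rho>1 <= nrm x & nrm x <= \<rho>2"
   using supp \<rho>(1) C(1) by (intro exI[of _ "\<rho>1 / C"] conjI exI[of _ "max (\<rho>1 / C) (D * \<rho>2)"]) auto
  fix x show "continuous_on UNIV (%s. c * \<Phi> (mvec A (csc s x)))"
   using \<Phi> unfolding mvec_csc bump_def by (intro continuous_intros) blast
 qed
qed

definition scal_mat :: "complex => complex^'n^'n::finite" where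
 "scal_mat c = (\<chi> a b. if a = b then c else 0)"

lemma mvec_scal_mat: "mvec (scal_mat c) x = csc c x"
proof
 fix a
 have "mvec (scal_mat c) x a = (\<Sum>b\<in>UNIV. if b = a then c * x a else 0)"
  unfolding mvec_def scal_mat_def by (intro sum.cong) auto
 thus "mvec (scal_mat c) x a = csc c x a" by (simp add: csc_def)
qed

lemma bump_csc:
 fixes \<Phi> :: "('n::finite => complex) => complex"
 assumes "bump \<Phi>" "c ~= 0" shows "bump (%x. \<Phi> (csc c x))"
proof -
 have "scal_mat c ** scal_mat (1 / c) = (mat 1 :: complex^'n^'n)" "scal_mat (1 / c) ** scal_mat c = (mat 1 :: complex^'n^'n)"
 proof -
  have "(scal_mat a ** scal_mat b :: complex^'n^'n) = scal_mat (a * b)" for a b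
  proof -
   have "(scal_mat a ** scal_mat b :: complex^'n^'n) $ r $ s = scal_mat (a * b) $ r $ s" for r s
   proof -
   have "(scal_mat a ** scal_mat b :: complex^'n^'n) $ r $ s = (\<Sum>k\<in>UNIV. if k = r then (if r = s then a * b else 0) else 0)"
   unfolding matrix_matrix_mult_def scal_mat_def vec_lambda_beta by (intro sum.cong) auto
   thus ?thesis by (simp add: scal_mat_def)
   qed
   thus ?thesis by (simp add: vec_eq_iff)
  qed
  thus "scal_mat c ** scal_mat (1 / c) = (mat 1 :: complex^'n^'n)" "scal_mat (1 / c) ** scal_mat c = (mat 1 :: complex^'n^'n)"
   using assms(2) by (auto simp: scal_mat_def mat_def vec_eq_iff)
 qed
 hence "invertible (scal_mat c :: complex^'n^'n)" by (auto simp: invertible_def)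
 from bump_mvec[OF assms(1) this, of 1] show ?thesis by (simp add: mvec_scal_mat)
qed

lemma nrm_ball_sets: "{x. nrm x <= R} : sets cvol"
 using measurable_sets[OF nrm_measurable, of "{..R}"] by (simp add: vimage_def)

lemma emeasure_ball_cvol: "emeasure cvol {x. nrm x <= R} < \<infinity>"
proof -
 have "{x :: 'a => complex. nrm x <= R} \<subseteq> Pi\<^sub>E UNIV (%_. cball 0 R)"
  using nrm_ge order_trans by (fastforce simp: PiE_UNIV_domain)
 moreover have S: "Pi\<^sub>E UNIV (%_. cball 0 R) : sets (cvol :: ('a => complex) measure)"
  unfolding cvol_def by (intro sets_PiM_I_finite) auto
 ultimately have "emeasure cvol {x :: 'a => complex. nrm x <= R} <= emeasure cvol (Pi\<^sub>E UNIV (%_. cball 0 R) :: ('a => complex) set)"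
  by (rule emeasure_mono)
 also have "... = (\<Prod>a\<in>(UNIV :: 'a set). emeasure lborel (cball (0 :: complex) R))"
  unfolding cvol_def by (rule cprod.emeasure_PiM) auto
 also have "... < \<infinity>" using emeasure_bounded_finite[of "cball (0 :: complex) R"] by (simp add: power_less_top_ennreal)
 finally show ?thesis .
qed

lemma bump_integrable:
 assumes \<Phi>: "bump \<Phi>" shows "integrable cvol \<Phi>"
proof -
 from \<Phi> obtain B \<rho>1 \<rho>2 where B: "B > 0" "!!x. cmod (\<Phi> x) <= B"
  and \<rho>: "!!x. \<Phi> x ~= 0 ==> \<rho>1 <= nrm x & nrm x <= \<rho>2" by (rule bumpE) blast
 have "integrable cvol (%x. B * indicator {x. nrm x <= \<rho>2} x)"
  using nrm_ball_sets[of \<rho>2] emeasure_ball_cvol[of \<rho>2] by (intro integrable_mult_right integrable_real_indicator) auto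
 thus ?thesis
 proof (rule b_integrable_bound[OF _ bump_measurable[OF \<Phi>]], intro AE_I2)
  fix x show "norm (\<Phi> x) <= norm (B * indicator {x. nrm x <= \<rho>2} x :: real)"
   using B \<rho>[of x] by (cases "\<Phi> x = 0") auto
 qed
qed

definition mel :: "real => int => (('n::finite => complex) => complex) => ('n => complex) => complex" where
 "mel v k \<Phi> x = (LINT s|mstar. \<Phi> (csc s x) * uch v k s * of_real (cmod s ^ CARD('n)))"

text \<open>The factor \<open>cmod s ^ CARD('n)\<close> in \<open>mel\<close> and the determinant here produce the homogeneity that the
  normalized induction prescribes.\<close>

definition psf :: "'n::finite => real => int => (('n => complex) => complex) => complex^'n^'n => complex" where
 "psf i v k \<Phi> g = of_real (cmod (det g)) * mel v k \<Phi> (col i g)"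

lemma chr_joint_measurable [measurable]: "(%p. uch (fst p) k (snd p)) : bmeas (borel \<Otimes>\<^sub>M borel)"
proof -
 have "(%p :: real \<times> complex. (of_real (cmod (snd p)) powr (\<i> * of_real (fst p)) :: complex)) : bmeas (borel \<Otimes>\<^sub>M borel)"
 proof -
  have "(of_real (cmod s) powr (\<i> * of_real v) :: complex) = (if s = 0 then 0 else cis (v * ln (cmod s)))" for s :: complex and v :: real
   by (simp add: powr_def Ln_of_real cis_conv_exp mult.assoc)
  thus ?thesis by simp
 qed
 moreover have "(%p :: real \<times> complex. (snd p / of_real (cmod (snd p))) powi k) : bmeas (borel \<Otimes>\<^sub>M borel)"
  unfolding power_int_def by measurable
 ultimately show ?thesis unfolding chr_def by (rule borel_measurable_times)
qed

lemma mel_measurable: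
 fixes \<Phi> :: "('n::finite => complex) => complex"
 assumes \<Phi>: "bump \<Phi>" and v: "v : bmeas M" and x: "x : measurable M cvol"
 shows "(%z. mel (v z) k \<Phi> (x z)) : bmeas M"
 unfolding mel_def
proof (rule mstar.borel_measurable_lebesgue_integral)
 have 1: "(%p. \<Phi> (csc (snd p) (x (fst p)))) : bmeas (M \<Otimes>\<^sub>M mstar)"
  by (rule measurable_compose[OF csc_measurable bump_measurable[OF \<Phi>]]) (use x in measurable)
 have 2: "(%p. uch (v (fst p)) k (snd p)) : bmeas (M \<Otimes>\<^sub>M mstar)"
  using measurable_compose[OF measurable_Pair[OF measurable_compose[OF measurable_fst v] measurable_snd[of M mstar, unfolded measurable_cong_sets[OF refl sets_mstar]]] chr_joint_measurable[of k]] by simp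
 show "(%(z, s). \<Phi> (csc s (x z)) * uch (v z) k s * of_real (cmod s ^ CARD('n))) : bmeas (M \<Otimes>\<^sub>M mstar)"
  using 1 2 unfolding case_prod_beta' by measurable
qed

lemma mel_line_measurable:
 fixes \<Phi> :: "('n::finite => complex) => complex"
 assumes "bump \<Phi>"
 shows "(%s. \<Phi> (csc s x) * uch v k s * of_real (cmod s ^ CARD('n))) : bmeas borel"
proof -
 have "(%s. \<Phi> (csc s x)) : bmeas borel"
  using assms unfolding bump_def by (intro borel_measurable_continuous_onI) auto
 thus ?thesis by measurable
qed

lemma mel_csc:
 fixes \<Phi> :: "('n::finite => complex) => complex"
 assumes \<Phi>: "bump \<Phi>" and c: "c ~= 0"
 shows "mel v k \<Phi> (csc c x) = inverse (uch v k c) * of_real (1 / cmod c ^ CARD('n)) * mel v k \<Phi> x"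
proof -
 let ?f = "%s. \<Phi> (csc s x) * uch v k s * of_real (cmod s ^ CARD('n))"
 have "mel v k \<Phi> (csc c x) = (LINT s|mstar. (inverse (uch v k c) * of_real (1 / cmod c ^ CARD('n))) * ?f (c * s))"
  unfolding mel_def
 proof (rule integral_cong_AE)
  show "AE s in mstar. \<Phi> (csc s (csc c x)) * uch v k s * of_real (cmod s ^ CARD('n))
   = (inverse (uch v k c) * of_real (1 / cmod c ^ CARD('n))) * ?f (c * s)"
   using AE_mstar_nonzero
  proof eventually_elim
   fix s :: complex assume s: "s ~= 0"
   have "csc s (csc c x) = csc (c * s) x" by (auto simp: csc_def)
   thus "\<Phi> (csc s (csc c x)) * uch v k s * of_real (cmod s ^ CARD('n))
   = (inverse (uch v k c) * of_real (1 / cmod c ^ CARD('n))) * ?f (c * s)"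
   using chr_nonzero[OF c, of v k] c s by (simp add: chr_mult norm_mult power_mult_distrib)
  qed
  show "(%s. \<Phi> (csc s (csc c x)) * uch v k s * of_real (cmod s ^ CARD('n))) : bmeas mstar"
   using mel_line_measurable[OF \<Phi>, of "csc c x" v k] by simp
  have "(%s. ?f (c * s)) : bmeas borel"
   by (rule measurable_compose[OF _ mel_line_measurable[OF \<Phi>]]) simp
  thus "(%s. (inverse (uch v k c) * of_real (1 / cmod c ^ CARD('n))) * ?f (c * s)) : bmeas mstar"
   by measurable
 qed
 also have "... = (inverse (uch v k c) * of_real (1 / cmod c ^ CARD('n))) * (LINT s|mstar. ?f (c * s))" by simp
 also have "(LINT s|mstar. ?f (c * s)) = (LINT s|mstar. ?f s)"
  by (rule integral_mstar_scale[OF mel_line_measurable[OF \<Phi>] c])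
 finally show ?thesis unfolding mel_def .
qed

lemma mel_bound:
 fixes \<Phi> :: "('n::finite => complex) => complex"
 assumes \<Phi>: "bump \<Phi>"
 shows "\<exists>K>0. ALL v k x. nrm x > 0 --> cmod (mel v k \<Phi> x) * nrm x ^ CARD('n) <= K"
proof -
 from \<Phi> obtain B \<rho>1 \<rho>2 where B: "B > 0" "!!x. cmod (\<Phi> x) <= B" and \<rho>: "0 < \<rho>1" "\<rho>1 <= \<rho>2"
  "!!x. \<Phi> x ~= 0 ==> \<rho>1 <= nrm x & nrm x <= \<rho>2" by (rule bumpE) blast
 define K where "K = B * \<rho>2 ^ CARD('n) * (ln (\<rho>2 / \<rho>1) * (2 * pi)) + 1"
 have ln0: "0 <= ln (\<rho>2 / \<rho>1)" using \<rho> by (intro ln_ge_zero) simp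
 have "cmod (mel v k \<Phi> x) * nrm x ^ CARD('n) <= K" if x: "nrm x > 0" for v k x
 proof -
  let ?I = "%s. indicator {\<rho>1..\<rho>2} (nrm (csc s x)) :: real"
  have Im: "?I : bmeas mstar" unfolding nrm_csc by measurable
  have nI: "(nn_integral mstar (%s. ennreal (?I s))) = ennreal (ln (\<rho>2 / \<rho>1) * (2 * pi))"
   using emeasure_shell[OF x \<rho>(1,2)] by (simp add: ennreal_indicator)
  hence I: "integrable mstar ?I" "(LINT s|mstar. ?I s) = ln (\<rho>2 / \<rho>1) * (2 * pi)"
   using Im ln0 by (subst (asm) nn_integral_eq_integrable; auto)+
  let ?C = "B * (\<rho>2 / nrm x) ^ CARD('n)"
  let ?f = "%s. \<Phi> (csc s x) * uch v k s * of_real (cmod s ^ CARD('n))"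
  have CI: "integrable mstar (%s. ?C * ?I s)" using I(1) by simp
  have ae: "AE s in mstar. cmod (?f s) <= ?C * ?I s"
   using AE_mstar_nonzero
  proof eventually_elim
   fix s :: complex assume s: "s ~= 0"
   show "cmod (?f s) <= ?C * ?I s"
   proof (cases "\<Phi> (csc s x) = 0")
   case True thus ?thesis using B(1) \<rho> x by (auto intro!: mult_nonneg_nonneg)
   next
   case False
   hence r: "\<rho>1 <= nrm (csc s x)" "nrm (csc s x) <= \<rho>2" using \<rho>(3) by auto
   hence "cmod s <= \<rho>2 / nrm x" using x by (simp add: nrm_csc field_simps)
   hence "cmod s ^ CARD('n) <= (\<rho>2 / nrm x) ^ CARD('n)" by (intro power_mono) auto
   hence "cmod (\<Phi> (csc s x)) * cmod s ^ CARD('n) <= B * (\<rho>2 / nrm x) ^ CARD('n)"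
   using B by (intro mult_mono) auto
   thus ?thesis using r s by (simp add: norm_mult chr_norm norm_power)
   qed
  qed
  have fi: "integrable mstar ?f"
  proof (rule b_integrable_bound[OF CI])
   show "AE s in mstar. norm (?f s) <= norm (?C * ?I s)"
   using ae by eventually_elim (auto intro: order_trans)
  qed (use mel_line_measurable[OF \<Phi>, of x v k] in simp)
  have "cmod (mel v k \<Phi> x) <= (LINT s|mstar. cmod (?f s))" unfolding mel_def by (rule integral_norm_bound)
  also have "... <= (LINT s|mstar. ?C * ?I s)" by (rule integral_mono_AE[OF integrable_norm[OF fi] CI ae])
  also have "... = ?C * (ln (\<rho>2 / \<rho>1) * (2 * pi))" using I by simp
  finally have "cmod (mel v k \<Phi> x) * nrm x ^ CARD('n) <= ?C * (ln (\<rho>2 / \<rho>1) * (2 * pi)) * nrm x ^ CARD('n)"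
   using x by (intro mult_right_mono) auto
  thus ?thesis using x by (simp add: K_def power_divide)
 qed
 moreover have "K > 0" unfolding K_def using B \<rho> ln0 by (intro add_nonneg_pos mult_nonneg_nonneg) auto
 ultimately show ?thesis by blast
qed

lemma nrm_opp_finite:
 fixes i :: "'n::finite"
 shows "(nn_integral (opp_measure i) (%y. ennreal ((1 / nrm (y(i := 1)) ^ CARD('n))^2))) < \<infinity>"
proof -
 let ?I = "%x. indicator {1..exp 1} (nrm x) :: ennreal"
 have Im: "?I : bmeas (cvol :: ('n => complex) measure)" by measurable
 have "(nn_integral (opp_measure i) (%y. ennreal ((1 / nrm (y(i := 1)) ^ CARD('n))^2)))
  <= (nn_integral (opp_measure i) (%y. nn_integral mstar (%s. ?I (csc s (y(i := 1))) * ennreal (cmod s ^ (2 * CARD('n))))))"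
 proof (rule nn_integral_mono)
  fix y :: "'n => complex"
  let ?n = "nrm (y(i := 1))"
  have n: "?n > 0" by (rule nrm_pos[of _ i]) simp
  have "ennreal ((1 / ?n ^ CARD('n))^2) = 1 * ennreal ((1 / ?n ^ CARD('n))^2)" by simp
  also have "... <= ennreal (ln (exp 1 / 1) * (2 * pi)) * ennreal ((1 / ?n ^ CARD('n))^2)"
   by (intro mult_right_mono) (use pi_gt3 in "auto simp: ennreal_1[symmetric] simp del: ennreal_1 intro!: ennreal_leI")
  also have "... = (nn_integral mstar (%s. ?I (csc s (y(i := 1))))) * ennreal ((1 / ?n ^ CARD('n))^2)"
   by (subst emeasure_shell[OF n]) auto
  also have "... = (nn_integral mstar (%s. ?I (csc s (y(i := 1))) * ennreal ((1 / ?n ^ CARD('n))^2)))"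
   by (rule nn_integral_multc[symmetric]) (simp add: nrm_csc)
  also have "... <= (nn_integral mstar (%s. ?I (csc s (y(i := 1))) * ennreal (cmod s ^ (2 * CARD('n)))))"
  proof (rule nn_integral_mono)
   fix s
   show "?I (csc s (y(i := 1))) * ennreal ((1 / ?n ^ CARD('n))^2) <= ?I (csc s (y(i := 1))) * ennreal (cmod s ^ (2 * CARD('n)))"
   proof (cases "nrm (csc s (y(i := 1))) : {1..exp 1}")
   case True
   hence "1 / ?n <= cmod s" using n by (simp add: nrm_csc field_simps)
   hence "(1 / ?n) ^ (2 * CARD('n)) <= cmod s ^ (2 * CARD('n))" using n by (intro power_mono) auto
   moreover have "(1 / ?n) ^ (2 * CARD('n)) = (1 / ?n ^ CARD('n))^2" by (simp add: power_divide power_mult[symmetric] mult.commute)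
   ultimately show ?thesis by (intro mult_left_mono ennreal_leI) auto
   qed simp
  qed
  finally show "ennreal ((1 / ?n ^ CARD('n))^2) <= (nn_integral mstar (%s. ?I (csc s (y(i := 1))) * ennreal (cmod s ^ (2 * CARD('n)))))" .
 qed
 also have "... = (nn_integral (cvol :: ('n => complex) measure) (%x. ?I x))" by (rule nn_integral_unfold[OF Im, symmetric])
 also have "... <= (nn_integral (cvol :: ('n => complex) measure) (%x. indicator {x. nrm x <= exp 1} x))"
  by (intro nn_integral_mono) (auto split: split_indicator)
 also have "... = emeasure cvol {x :: 'n => complex. nrm x <= exp 1}"
  by (rule nn_integral_indicator[OF nrm_ball_sets])
 also have "... < \<infinity>" by (rule emeasure_ball_cvol)
 finally show ?thesis .
qed

lemma psf_opp: "psf i v k \<Phi> (opp_unipotent i y) = mel v k \<Phi> (y(i := 1))"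
 by (simp add: psf_def)

lemma psf_joint_measurable:
 fixes i :: "'n::finite"
 assumes "bump \<Phi>" and v: "v : bmeas M" and g: "g : measurable M (borelGL)"
 shows "(%z. psf i (v z) k \<Phi> (g z)) : bmeas M"
proof -
 have "(%z. mel (v z) k \<Phi> (col i (g z))) : bmeas M"
  by (rule mel_measurable[OF assms(1) v measurable_compose[OF g col_measurable]])
 moreover have "(%z. det (g z)) : bmeas M" by (rule measurable_compose[OF g det_measurable])
 ultimately show ?thesis unfolding psf_def by measurable
qed

lemma psf_mem:
 fixes i :: "'n::finite"
 assumes \<Phi>: "bump \<Phi>" shows "psf i v k \<Phi> : vecs (psr i v k)"
 unfolding ps_vecs
proof (intro conjI ballI)
 show m: "psf i v k \<Phi> : bmeas (borelGL)"
  by (rule psf_joint_measurable[OF \<Phi>]) auto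
 fix g p assume p: "p : parabolic i"
 show "psf i v k \<Phi> (g ** p) = of_real (cmod (det p) / cmod (p $ i $ i) ^ CARD('n)) * inverse (uch v k (p $ i $ i)) * psf i v k \<Phi> g"
  using parabolic_diag[OF p] by (simp add: psf_def col_parabolic[OF p] mel_csc[OF \<Phi>] det_mul norm_mult)
next
 have m: "(%y. psf i v k \<Phi> (opp_unipotent i y)) : bmeas (opp_measure i)"
  by (rule psf_joint_measurable[OF \<Phi>]) auto
 obtain K where K: "K > 0" "!!x :: 'n => complex. nrm x > 0 ==> cmod (mel v k \<Phi> x) * nrm x ^ CARD('n) <= K"
  using mel_bound[OF \<Phi>] by blast
 have "(nn_integral (opp_measure i) (%y. ennreal ((cmod (psf i v k \<Phi> (opp_unipotent i y)))^2)))
   <= (nn_integral (opp_measure i) (%y. ennreal (K^2) * ennreal ((1 / nrm (y(i := 1)) ^ CARD('n))^2)))"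
 proof (rule nn_integral_mono)
  fix y :: "'n => complex"
  have n: "nrm (y(i := 1)) > 0" by (rule nrm_pos[of _ i]) simp
  have "cmod (mel v k \<Phi> (y(i := 1))) <= K * (1 / nrm (y(i := 1)) ^ CARD('n))"
   using K(2)[OF n] n by (simp add: field_simps)
  hence "(cmod (mel v k \<Phi> (y(i := 1))))^2 <= K^2 * (1 / nrm (y(i := 1)) ^ CARD('n))^2"
   unfolding power_mult_distrib[symmetric] by (intro power_mono) auto
  thus "ennreal ((cmod (psf i v k \<Phi> (opp_unipotent i y)))^2) <= ennreal (K^2) * ennreal ((1 / nrm (y(i := 1)) ^ CARD('n))^2)"
   unfolding psf_opp by (subst ennreal_mult[symmetric]) (auto intro: ennreal_leI)
 qed
 also have "... = ennreal (K^2) * (nn_integral (opp_measure i) (%y. ennreal ((1 / nrm (y(i := 1)) ^ CARD('n))^2)))"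
  by (rule nn_integral_cmult) (use measurable_compose[OF opp_upd nrm_measurable, of i 1] in measurable)
 also have "... < \<infinity>" using nrm_opp_finite[of i] by (simp add: ennreal_mult_less_top)
 finally show "integrable (opp_measure i) (%y. (cmod (psf i v k \<Phi> (opp_unipotent i y)))^2)"
  using m by (intro integrableI_bounded) auto
qed

lemma psf_act:
 fixes i :: "'n::finite"
 assumes h: "h : GL"
 shows "act (principal_series i t k') h (psf i v k \<Phi>)
  = psf i v k (%x. of_real (cmod (det (matrix_inv h))) * \<Phi> (mvec (matrix_inv h) x))"
proof
 fix g
 show "act (principal_series i t k') h (psf i v k \<Phi>) g
  = psf i v k (%x. of_real (cmod (det (matrix_inv h))) * \<Phi> (mvec (matrix_inv h) x)) g"
  unfolding ps_act psf_def mel_def col_mult mvec_csc det_mul norm_mult of_real_mult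
  by (simp add: mult.assoc)
qed

lemma psf_csc:
 fixes \<Phi> :: "('n::finite => complex) => complex"
 assumes "bump \<Phi>" "c ~= 0"
 shows "psf i v k (%x. \<Phi> (csc c x))
  = vscale (psr i v k) (inverse (uch v k c) * of_real (1 / cmod c ^ CARD('n))) (psf i v k \<Phi>)"
proof
 fix g
 have "csc c (csc s x) = csc s (csc c x)" for s and x :: "'n => complex" by (auto simp: csc_def)
 hence "mel v k (%x. \<Phi> (csc c x)) x = mel v k \<Phi> (csc c x)" for x unfolding mel_def by simp
 thus "psf i v k (%x. \<Phi> (csc c x)) g
  = vscale (psr i v k) (inverse (uch v k c) * of_real (1 / cmod c ^ CARD('n))) (psf i v k \<Phi>) g"
  by (simp add: psf_def mel_csc[OF assms] ps_space_simps)
qed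


lemma cnj_borel [measurable]: "cnj : bmeas borel"
 by (rule borel_measurable_continuous_onI) (intro continuous_intros)

lemma cnj_bump_measurable: "bump \<Phi> ==> (%x. cnj (\<Phi> x)) : bmeas cvol"
 by (rule measurable_compose[OF bump_measurable cnj_borel])

text \<open>The integral over the multiplicative group and the integral over the open cell combine to one over
  the whole coordinate space.\<close>

lemma psf_inner:
 fixes i :: "'n::finite"
 assumes \<Phi>: "bump \<Phi>" and f: "f : vecs (psr i v k)"
 shows "integrable cvol (%x. cnj (\<Phi> x) * cfun i v k f x)"
  and "vinner (psr i v k) (psf i v k \<Phi>) f = (LINT x|cvol. cnj (\<Phi> x) * cfun i v k f x)"
proof -
 let ?F = "cfun i v k f"
 have fm: "f : bmeas (borelGL)" and fi: "integrable (opp_measure i) (%y. (cmod (f (opp_unipotent i y)))^2)"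
  using f by (auto simp: ps_vecs)
 note [measurable] = cfun_measurable[OF fm, of i v k] bump_measurable[OF \<Phi>]
 from \<Phi> obtain B \<rho>1 \<rho>2 where B: "B > 0" "!!x. cmod (\<Phi> x) <= B" and \<rho>: "0 < \<rho>1" "\<rho>1 <= \<rho>2"
  "!!x. \<Phi> x ~= 0 ==> \<rho>1 <= nrm x & nrm x <= \<rho>2" by (rule bumpE) blast
 let ?W = "%x. indicator {\<rho>1..\<rho>2} (nrm x) :: real"
 have WF: "integrable cvol (%x. ?W x * (cmod (?F x))^2)"
 proof (rule integrableI_bounded)
  have "(nn_integral cvol (%x. ennreal (norm (?W x * (cmod (?F x))^2))))
   = (nn_integral cvol (%x. indicator {\<rho>1..\<rho>2} (nrm (mvec (mat 1) x)) * ennreal ((cmod (?F x))^2)))"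
   by (intro nn_integral_cong) (simp split: split_indicator)
  also have "... = ennreal (ln (\<rho>2 / \<rho>1) * (2 * pi)) * (nn_integral (opp_measure i) (%y. ennreal ((cmod (f (opp_unipotent i y)))^2)))"
   by (rule nn_integral_shell[OF _ fm \<rho>(1,2)]) (auto simp: invertible_def intro: exI[of _ "mat 1"])
  also have "(nn_integral (opp_measure i) (%y. ennreal ((cmod (f (opp_unipotent i y)))^2))) = ennreal (LINT y|opp_measure i. (cmod (f (opp_unipotent i y)))^2)"
   by (rule nn_integral_eq_integral[OF fi]) simp
  also have "ennreal (ln (\<rho>2 / \<rho>1) * (2 * pi)) * ... < \<infinity>" by (simp add: ennreal_mult_less_top)
  finally show "(nn_integral cvol (%x. ennreal (norm (?W x * (cmod (?F x))^2)))) < \<infinity>" .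
 qed measurable
 have W: "integrable cvol (%x. indicator {x. nrm x <= \<rho>2} x :: real)"
  using nrm_ball_sets[of \<rho>2] emeasure_ball_cvol[of \<rho>2] by (intro integrable_real_indicator) auto
 have "integrable cvol (%x. B * (indicator {x. nrm x <= \<rho>2} x + ?W x * (cmod (?F x))^2))"
  by (intro integrable_mult_right b_integrable_add W WF)
 thus int: "integrable cvol (%x. cnj (\<Phi> x) * ?F x)"
 proof (rule b_integrable_bound)
  show "AE x in cvol. norm (cnj (\<Phi> x) * ?F x) <= norm (B * (indicator {x. nrm x <= \<rho>2} x + ?W x * (cmod (?F x))^2))"
  proof (rule AE_I2)
   fix x
   show "norm (cnj (\<Phi> x) * ?F x) <= norm (B * (indicator {x. nrm x <= \<rho>2} x + ?W x * (cmod (?F x))^2))"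
   proof (cases "\<Phi> x = 0")
   case False
   have "cmod (?F x) <= 1 + (cmod (?F x))^2"
   using sum_power2_ge_zero[of "cmod (?F x)" "cmod (?F x) - 1"] zero_le_power2[of "cmod (?F x) - 1"]
   by (simp add: power2_eq_square algebra_simps)
   hence "cmod (\<Phi> x) * cmod (?F x) <= B * (1 + (cmod (?F x))^2)" using B by (intro mult_mono) auto
   moreover have "norm (B * (indicator {x. nrm x <= \<rho>2} x + ?W x * (cmod (?F x))^2)) = B * (1 + (cmod (?F x))^2)"
   using False \<rho>(3)[of x] B by simp
   ultimately show ?thesis by (simp add: norm_mult)
   qed simp
  qed
  have "(%x. cnj (\<Phi> x)) : bmeas cvol" by (rule cnj_bump_measurable[OF \<Phi>])
  thus "(%x. cnj (\<Phi> x) * ?F x) : bmeas cvol"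
   by (intro borel_measurable_times cfun_measurable[OF fm])
 qed
 have "(LINT x|cvol. cnj (\<Phi> x) * ?F x)
  = (LINT y|opp_measure i. LINT s|mstar. cmod s ^ (2 * CARD('n)) *\<^sub>R (cnj (\<Phi> (csc s (y(i := 1)))) * ?F (csc s (y(i := 1)))))"
  by (rule integral_unfold[OF int])
 also have "... = (LINT y|opp_measure i. cnj (mel v k \<Phi> (y(i := 1))) * f (opp_unipotent i y))"
 proof (rule b_integral_cong[OF refl])
  fix y :: "'n => complex"
  let ?x = "y(i := 1)" and ?c = "f (opp_unipotent i y)"
  let ?g = "%s. \<Phi> (csc s ?x) * uch v k s * of_real (cmod s ^ CARD('n))"
  have gm: "?g : bmeas borel" by (rule mel_line_measurable[OF \<Phi>])
  have c1: "(%s. csc s ?x) : measurable mstar cvol" by (intro csc_measurable) auto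
  have "(LINT s|mstar. cmod s ^ (2 * CARD('n)) *\<^sub>R (cnj (\<Phi> (csc s ?x)) * ?F (csc s ?x))) = (LINT s|mstar. cnj (?g s) * ?c)"
  proof (rule integral_cong_AE)
   show "(%s. cmod s ^ (2 * CARD('n)) *\<^sub>R (cnj (\<Phi> (csc s ?x)) * ?F (csc s ?x))) : bmeas mstar"
   proof (intro borel_measurable_scaleR borel_measurable_times)
   show "(%s. cnj (\<Phi> (csc s ?x))) : bmeas mstar" by (rule measurable_compose[OF c1 cnj_bump_measurable[OF \<Phi>]])
   show "(%s. ?F (csc s ?x)) : bmeas mstar" by (rule measurable_compose[OF c1 cfun_measurable[OF fm]])
   qed measurable
   have "(%s. cnj (?g s)) : bmeas borel" by (rule measurable_compose[OF gm cnj_borel])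
   thus "(%s. cnj (?g s) * ?c) : bmeas mstar" by simp
   show "AE s in mstar. cmod s ^ (2 * CARD('n)) *\<^sub>R (cnj (\<Phi> (csc s ?x)) * ?F (csc s ?x)) = cnj (?g s) * ?c"
   using AE_mstar_nonzero
   proof eventually_elim
   fix s :: complex assume s: "s ~= 0"
   have p: "cmod s ^ (2 * CARD('n)) = cmod s ^ CARD('n) * cmod s ^ CARD('n)" by (simp add: power_add[symmetric] mult_2)
   show "cmod s ^ (2 * CARD('n)) *\<^sub>R (cnj (\<Phi> (csc s ?x)) * ?F (csc s ?x)) = cnj (?g s) * ?c"
   unfolding cfun_opp[OF s] p using s by (simp add: chr_cnj[OF s] scaleR_conv_of_real)
   qed
  qed
  also have "... = (LINT s|mstar. cnj (?g s)) * ?c" by simp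
  also have "(LINT s|mstar. cnj (?g s)) = cnj (mel v k \<Phi> ?x)" unfolding mel_def by (rule b_integral_cnj)
  finally show "(LINT s|mstar. cmod s ^ (2 * CARD('n)) *\<^sub>R (cnj (\<Phi> (csc s ?x)) * ?F (csc s ?x))) = cnj (mel v k \<Phi> ?x) * ?c" .
 qed
 also have "... = vinner (psr i v k) (psf i v k \<Phi>) f" by (simp add: ps_space_simps psf_opp)
 finally show "vinner (psr i v k) (psf i v k \<Phi>) f = (LINT x|cvol. cnj (\<Phi> x) * ?F x)" ..
qed

lemma cfun_psf:
 fixes i :: "'n::finite"
 assumes \<Phi>: "bump \<Phi>" and x: "x i ~= 0" shows "cfun i v k (psf i v k \<Phi>) x = mel v k \<Phi> x"
proof -
 let ?g = "colmat i x"
 have g: "?g : GL" "?g $ i $ i ~= 0" "col i ?g = x" "det ?g ~= 0"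
  using x by (auto simp: GL_def invertible_det_nz det_colmat col_def) (auto simp: colmat_def)
 have "psf i v k \<Phi> ?g = of_real (cmod (det ?g)) * cfun i v k (psf i v k \<Phi>) x"
  using cfun_col[OF psf_mem[OF \<Phi>] g(1,2), of v k] unfolding g(3) .
 moreover have "psf i v k \<Phi> ?g = of_real (cmod (det ?g)) * mel v k \<Phi> x" unfolding psf_def g(3) ..
 ultimately have "of_real (cmod (det ?g)) * cfun i v k (psf i v k \<Phi>) x = of_real (cmod (det ?g)) * mel v k \<Phi> x"
  by (simp only:)
 thus ?thesis using g(4) by simp
qed

definition corr :: "(('n::finite => complex) => complex) => (('n => complex) => complex) => complex => complex" where
 "corr \<Phi> \<Psi> s = of_real (cmod s ^ CARD('n)) * (LINT x|cvol. cnj (\<Phi> x) * \<Psi> (csc s x))"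

lemma bump_pair_supp:
 assumes "bump \<Phi>" "bump \<Psi>"
 obtains a b where "0 < a" "a <= b" "!!x s. \<Phi> x ~= 0 ==> \<Psi> (csc s x) ~= 0 ==> a <= cmod s & cmod s <= b"
proof -
 from assms(1) obtain B \<rho>1 \<rho>2 where \<rho>: "0 < \<rho>1" "\<rho>1 <= \<rho>2"
  "!!x. \<Phi> x ~= 0 ==> \<rho>1 <= nrm x & nrm x <= \<rho>2" by (rule bumpE) blast
 from assms(2) obtain B' r1 r2 where r: "0 < r1" "r1 <= r2"
  "!!x. \<Psi> x ~= 0 ==> r1 <= nrm x & nrm x <= r2" by (rule bumpE) blast
 have "r1 / \<rho>2 <= cmod s & cmod s <= r2 / \<rho>1" if "\<Phi> x ~= 0" "\<Psi> (csc s x) ~= 0" for x s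
 proof -
  have 1: "\<rho>1 <= nrm x" "nrm x <= \<rho>2" "r1 <= cmod s * nrm x" "cmod s * nrm x <= r2"
   using \<rho>(3)[OF that(1)] r(3)[OF that(2)] by (auto simp: nrm_csc)
  have "cmod s * nrm x <= cmod s * \<rho>2" "cmod s * \<rho>1 <= cmod s * nrm x" using 1 by (auto intro: mult_left_mono)
  hence "r1 <= cmod s * \<rho>2" "cmod s * \<rho>1 <= r2" using 1 by linarith+
  thus ?thesis using \<rho> r by (simp add: divide_le_eq le_divide_eq)
 qed
 moreover have "0 < r1 / \<rho>2" "r1 / \<rho>2 <= r2 / \<rho>1" using \<rho> r by (auto intro!: frac_le)
 ultimately show ?thesis using that by blast
qed

lemma csc_line_measurable:
 assumes "bump \<Psi>" shows "(%x. \<Psi> (csc s x)) : bmeas cvol"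
 by (rule measurable_compose[OF csc_measurable bump_measurable[OF assms]]) auto

lemma corr_annular:
 fixes \<Phi> :: "('n::finite => complex) => complex"
 assumes \<Phi>: "bump \<Phi>" and \<Psi>: "bump \<Psi>" shows "annular (corr \<Phi> \<Psi>)"
proof -
 from bump_pair_supp[OF assms] obtain a b where ab: "0 < a" "a <= b"
  "!!x s. \<Phi> x ~= 0 ==> \<Psi> (csc s x) ~= 0 ==> a <= cmod s & cmod s <= b" by blast
 from \<Psi> obtain B where B: "B > 0" "!!x. cmod (\<Psi> x) <= B" by (rule bumpE) blast
 have m: "(%x. cnj (\<Phi> x) * \<Psi> (csc s x)) : bmeas cvol" for s
  by (intro borel_measurable_times cnj_bump_measurable[OF \<Phi>] csc_line_measurable[OF \<Psi>])
 have "continuous_on UNIV (%s. LINT x|cvol. cnj (\<Phi> x) * \<Psi> (csc s x))"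
 proof (rule continuous_on_sequentiallyI)
  fix u :: "nat => complex" and s assume u: "u -->> s"
  show "(%n. LINT x|cvol. cnj (\<Phi> x) * \<Psi> (csc (u n) x)) -->> (LINT x|cvol. cnj (\<Phi> x) * \<Psi> (csc s x))"
  proof (rule integral_dominated_convergence[where w = "%x. cmod (\<Phi> x) * B"])
   show "integrable cvol (%x. cmod (\<Phi> x) * B)" using bump_integrable[OF \<Phi>] by simp
   show "AE x in cvol. (%n. cnj (\<Phi> x) * \<Psi> (csc (u n) x)) -->> cnj (\<Phi> x) * \<Psi> (csc s x)"
   proof (rule AE_I2)
   fix x
   have "continuous_on UNIV (%s. \<Psi> (csc s x))" using \<Psi> by (simp add: bump_def)
   hence "isCont (%s. \<Psi> (csc s x)) s" by (simp add: continuous_on_eq_continuous_at)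
   hence "(%n. \<Psi> (csc (u n) x)) -->> \<Psi> (csc s x)" using u by (rule isCont_tendsto_compose)
   thus "(%n. cnj (\<Phi> x) * \<Psi> (csc (u n) x)) -->> cnj (\<Phi> x) * \<Psi> (csc s x)" by (rule tendsto_mult_left)
   qed
   show "AE x in cvol. norm (cnj (\<Phi> x) * \<Psi> (csc (u n) x)) <= cmod (\<Phi> x) * B" for n
   using B by (intro AE_I2) (simp add: norm_mult mult_left_mono)
  qed (rule m)+
 qed
 hence "continuous_on (- {0}) (corr \<Phi> \<Psi>)" unfolding corr_def
  by (intro continuous_intros) (rule continuous_on_subset, auto)
 moreover have "exp (- (\<bar>ln a\<bar> + \<bar>ln b\<bar> + 1)) <= cmod s & cmod s <= exp (\<bar>ln a\<bar> + \<bar>ln b\<bar> + 1)" if "corr \<Phi> \<Psi> s ~= 0" for s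
 proof -
  have "EX x. cnj (\<Phi> x) * \<Psi> (csc s x) ~= 0"
  proof (rule ccontr)
   assume "~ ?thesis"
   hence "(%x. cnj (\<Phi> x) * \<Psi> (csc s x)) = (%_. 0)" by auto
   thus False using that by (simp add: corr_def)
  qed
  then obtain x where "\<Phi> x ~= 0" "\<Psi> (csc s x) ~= 0" by auto
  hence s: "a <= cmod s" "cmod s <= b" using ab(3) by auto
  have "exp (- (\<bar>ln a\<bar> + \<bar>ln b\<bar> + 1)) <= exp (ln a)" "exp (ln b) <= exp (\<bar>ln a\<bar> + \<bar>ln b\<bar> + 1)" by simp_all
  thus ?thesis using s ab by simp
 qed
 moreover have "\<bar>ln a\<bar> + \<bar>ln b\<bar> + 1 > 0" by linarith
 ultimately show ?thesis unfolding annular_def by blast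
qed

text \<open>Inner products of averaged vectors are Mellin transforms of functions that do not depend on the
  parameters of the representation.\<close>

theorem psf_inner_psf:
 fixes i :: "'n::finite"
 assumes \<Phi>: "bump \<Phi>" and \<Psi>: "bump \<Psi>"
 shows "vinner (psr i v k) (psf i v k \<Phi>) (psf i v k \<Psi>) = mellin (corr \<Phi> \<Psi>) k v"
proof -
 from bump_pair_supp[OF assms] obtain a b where ab: "0 < a" "a <= b"
  "!!x s. \<Phi> x ~= 0 ==> \<Psi> (csc s x) ~= 0 ==> a <= cmod s & cmod s <= b" by blast
 from \<Psi> obtain B where B: "B > 0" "!!x. cmod (\<Psi> x) <= B" by (rule bumpE) blast
 let ?H = "%x s. cnj (\<Phi> x) * (\<Psi> (csc s x) * uch v k s * of_real (cmod s ^ CARD('n)))"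
 have I: "integrable mstar (indicator {s. exp (ln a) <= cmod s & cmod s <= exp (ln b)} :: complex => real)"
  using emeasure_mstar_annulus[of "ln a" "ln b"] ab by (intro integrable_real_indicator) auto
 have H: "integrable (cvol \<Otimes>\<^sub>M mstar) (%(x, s). ?H x s)"
 proof (rule integrable_pair_bound[OF cvol.sigma_finite_measure_axioms mstar.sigma_finite_measure_axioms])
  show "integrable cvol (%x. cmod (\<Phi> x))" using bump_integrable[OF \<Phi>] by simp
  show "integrable mstar (%s. B * b ^ CARD('n) * indicator {s. exp (ln a) <= cmod s & cmod s <= exp (ln b)} s)"
   using I by (intro integrable_mult_right)
  have 1: "(%p. \<Psi> (csc (snd p) (fst p))) : bmeas (cvol \<Otimes>\<^sub>M mstar)"
   by (rule measurable_compose[OF csc_measurable bump_measurable[OF \<Psi>]]) measurable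
  have "(%p. \<Phi> (fst p)) : bmeas (cvol \<Otimes>\<^sub>M mstar)"
   by (rule measurable_compose[OF measurable_fst bump_measurable[OF \<Phi>]])
  hence 2: "(%p. cnj (\<Phi> (fst p))) : bmeas (cvol \<Otimes>\<^sub>M mstar)" by (rule measurable_compose[OF _ cnj_borel])
  show "(%(x, s). ?H x s) : bmeas (cvol \<Otimes>\<^sub>M mstar)"
   using 1 2 unfolding case_prod_beta' by measurable
  fix x s
  show "norm (case (x, s) of (x, s) => ?H x s) <= cmod (\<Phi> x) * (B * b ^ CARD('n) * indicator {s. exp (ln a) <= cmod s & cmod s <= exp (ln b)} s)"
  proof (cases "\<Phi> x = 0 \<or> \<Psi> (csc s x) = 0")
   case True thus ?thesis using B ab by (auto intro!: mult_nonneg_nonneg)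
  next
   case False
   hence s: "a <= cmod s" "cmod s <= b" using ab(3)[of x s] by auto
   have "cmod s ^ CARD('n) <= b ^ CARD('n)" using s by (intro power_mono) auto
   hence "cmod (\<Psi> (csc s x)) * cmod s ^ CARD('n) <= B * b ^ CARD('n)" using B by (intro mult_mono) auto
   moreover have "s ~= 0" using s ab by auto
   ultimately show ?thesis using s ab by (simp add: norm_mult chr_norm norm_power mult_left_mono)
  qed
 qed
 have "vinner (psr i v k) (psf i v k \<Phi>) (psf i v k \<Psi>) = (LINT x|cvol. cnj (\<Phi> x) * cfun i v k (psf i v k \<Psi>) x)"
  by (rule psf_inner(2)[OF \<Phi> psf_mem[OF \<Psi>]])
 also have "... = (LINT x|cvol. cnj (\<Phi> x) * mel v k \<Psi> x)"
 proof (rule integral_cong_AE)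
  have 1: "(%x. cnj (\<Phi> x)) : bmeas cvol" by (rule cnj_bump_measurable[OF \<Phi>])
  show "(%x. cnj (\<Phi> x) * cfun i v k (psf i v k \<Psi>) x) : bmeas cvol"
   using psf_mem[OF \<Psi>, of i v k] by (intro borel_measurable_times 1 cfun_measurable) (simp add: ps_vecs)
  show "(%x. cnj (\<Phi> x) * mel v k \<Psi> x) : bmeas cvol"
   by (intro borel_measurable_times 1 mel_measurable[OF \<Psi>, where v = "%_. v" and x = "%x. x"]) auto
  show "AE x in cvol. cnj (\<Phi> x) * cfun i v k (psf i v k \<Psi>) x = cnj (\<Phi> x) * mel v k \<Psi> x"
   using AE_cvol_component_nonzero[of i] by eventually_elim (simp add: cfun_psf[OF \<Psi>])
 qed
 also have "... = (LINT x|cvol. LINT s|mstar. ?H x s)" by (simp add: mel_def)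
 also have "... = (LINT s|mstar. LINT x|cvol. ?H x s)" by (rule cm.Fubini_integral[OF H, symmetric])
 also have "... = (LINT s|mstar. corr \<Phi> \<Psi> s * uch v k s)"
 proof (rule b_integral_cong[OF refl])
  fix s
  have "(LINT x|cvol. ?H x s) = (LINT x|cvol. (cnj (\<Phi> x) * \<Psi> (csc s x)) * (uch v k s * of_real (cmod s ^ CARD('n))))"
   by (simp only: mult_ac)
  also have "... = (LINT x|cvol. cnj (\<Phi> x) * \<Psi> (csc s x)) * (uch v k s * of_real (cmod s ^ CARD('n)))"
   by (rule integral_mult_left_zero)
  finally show "(LINT x|cvol. ?H x s) = corr \<Phi> \<Psi> s * uch v k s" by (simp add: corr_def mult_ac)
 qed
 finally show ?thesis by (simp add: mellin_def)
qed

section \<open>A countable total family\<close>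

lemma countable_pi_generator:
 "\<exists>\<U> :: complex set set. countable \<U> & UNIV : \<U> & (ALL U:\<U>. open U) & (ALL U:\<U>. ALL V:\<U>. U \<inter> V : \<U>) &
   sets borel = sigma_sets UNIV \<U>"
proof -
 obtain B :: "complex set set" where B: "countable B" "topological_basis B" using ex_countable_basis by blast
 define \<U> where "\<U> = Inter ` {F. finite F & F \<subseteq> B}"
 have "countable \<U>" unfolding \<U>_def by (intro countable_image countable_Collect_finite_subset B)
 moreover have "UNIV : \<U>" unfolding \<U>_def by (rule image_eqI[of _ _ "{}"]) auto
 moreover have op: "open U" if "U : \<U>" for U
  using that B(2) unfolding \<U>_def by (auto intro!: open_Inter simp: topological_basis_def)
 moreover have "U \<inter> V : \<U>" if "U : \<U>" "V : \<U>" for U V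
 proof -
  from that(1) obtain F where F: "U = \<Inter>F" "F : {F. finite F & F \<subseteq> B}" unfolding \<U>_def by (rule imageE)
  from that(2) obtain G where G: "V = \<Inter>G" "G : {F. finite F & F \<subseteq> B}" unfolding \<U>_def by (rule imageE)
  have "U \<inter> V = \<Inter>(F \<union> G)" by (simp add: F G Inter_Un_distrib)
  moreover have "F \<union> G : {F. finite F & F \<subseteq> B}" using F G by simp
  ultimately show ?thesis unfolding \<U>_def by (rule image_eqI)
 qed
 moreover have "sets borel = sigma_sets UNIV \<U>"
 proof
  have "sigma_sets UNIV B \<subseteq> sigma_sets UNIV \<U>"
  proof (rule sigma_sets_mono')
   show "B \<subseteq> \<U>"
   proof
   fix b assume "b : B"
   thus "b : \<U>" unfolding \<U>_def by (intro image_eqI[of _ _ "{b}"]) simp_all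
   qed
  qed
  thus "sets borel \<subseteq> sigma_sets UNIV \<U>" unfolding borel_eq_countable_basis[OF B] by simp
  show "sigma_sets UNIV \<U> \<subseteq> sets borel"
  proof -
   have "\<U> \<subseteq> sets borel" using op by (intro subsetI borel_open)
   thus ?thesis using sets.sigma_sets_subset[of \<U> borel] by simp
  qed
 qed
 ultimately show ?thesis by blast
qed

definition pi_gen :: "complex set set" where
 "pi_gen = (SOME \<U>. countable \<U> & UNIV : \<U> & (ALL U:\<U>. open U) & (ALL U:\<U>. ALL V:\<U>. U \<inter> V : \<U>) &
   sets borel = sigma_sets UNIV \<U>)"

lemma pi_gen: "countable pi_gen" "UNIV : pi_gen" "U : pi_gen ==> open U"
 "U : pi_gen ==> V : pi_gen ==> U \<inter> V : pi_gen" "sets borel = sigma_sets UNIV pi_gen"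
 using someI_ex[OF countable_pi_generator] unfolding pi_gen_def[symmetric] by auto

text \<open>The functions \<open>edge U n\<close> approximate the indicator of the open set \<open>U\<close>, and \<open>cutoff m\<close> approximates
  that of the nonzero numbers; the complement of \<open>UNIV\<close> is empty and has no useful distance.\<close>

definition edge :: "complex set => nat => complex => real" where
 "edge U n z = (if U = UNIV then 1 else min 1 (real n * infdist z (- U)))"

definition cutoff :: "nat => complex => real" where
 "cutoff m z = max 0 (min 1 (real m * cmod z - 1)) * max 0 (min 1 (real m - cmod z))"

definition tbump :: "('n::finite => complex set) => nat => nat => ('n => complex) => complex" where
 "tbump U n m x = of_real (\<Prod>a\<in>UNIV. edge (U a) n (x a) * cutoff m (x a))"

lemma edge_cont: "continuous_on UNIV (edge U n)"
 by (cases "U = UNIV") (auto simp: edge_def[abs_def] intro!: continuous_intros)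

lemma cutoff_cont: "continuous_on UNIV (cutoff m)"
 unfolding cutoff_def by (intro continuous_intros)

lemma edge_bounds: "0 <= edge U n z" "edge U n z <= 1"
 by (auto simp: edge_def infdist_nonneg)

lemma cutoff_bounds: "0 <= cutoff m z" "cutoff m z <= 1"
 unfolding cutoff_def by (auto intro!: mult_le_one)

lemma cutoff_supp: "cutoff m z ~= 0 ==> 1 / (real m + 1) <= cmod z & cmod z <= real m"
proof -
 assume "cutoff m z ~= 0"
 hence 1: "real m * cmod z > 1" "cmod z < real m" by (auto simp: cutoff_def max_def min_def split: if_splits)
 have "(real m + 1) * cmod z = real m * cmod z + cmod z" by (simp add: distrib_right)
 hence "1 < (real m + 1) * cmod z" using 1(1) norm_ge_zero[of z] by linarith
 thus ?thesis using 1(2) by (simp add: divide_le_eq mult.commute)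
qed

lemma cutoff_tendsto: assumes "z ~= 0" shows "(%m. cutoff m z) -->> 1"
proof (rule tendsto_eventually)
 obtain m0 :: nat where m0: "real m0 > max (2 / cmod z) (cmod z + 1)" using reals_Archimedean2 by blast
 show "\<forall>\<^sub>F m in sequentially. cutoff m z = 1"
  using eventually_ge_at_top[of m0]
 proof eventually_elim
  fix m assume "m0 <= m"
  hence m: "real m > 2 / cmod z" "real m > cmod z + 1" using m0 by linarith+
  hence "real m * cmod z >= 2" using assms by (simp add: divide_less_eq)
  thus "cutoff m z = 1" using m(2) by (simp add: cutoff_def)
 qed
qed

lemma edge_tendsto: assumes "open U" shows "(%n. edge U n z) -->> indicator U z"
proof (cases "U = UNIV")
 case False
 show ?thesis
 proof (cases "z : U")
  case True
  hence d: "infdist z (- U) > 0" using assms False by (intro infdist_pos_not_in_closed) auto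
  obtain n0 :: nat where n0: "real n0 > 1 / infdist z (- U)" using reals_Archimedean2 by blast
  have "\<forall>\<^sub>F n in sequentially. edge U n z = 1"
   using eventually_ge_at_top[of n0]
  proof eventually_elim
   fix n assume "n0 <= n"
   hence "real n > 1 / infdist z (- U)" using n0 by linarith
   hence "real n * infdist z (- U) > 1" using d by (simp add: divide_less_eq)
   thus "edge U n z = 1" using False by (simp add: edge_def)
  qed
  thus ?thesis using True by (simp add: tendsto_eventually)
 next
  case nz: False
  hence "infdist z (- U) = 0" by simp
  thus ?thesis using nz False by (simp add: edge_def)
 qed
qed (simp add: edge_def)

lemma tbump_bump: "bump (tbump U n m :: ('n::finite => complex) => complex)"
 unfolding bump_def
proof (intro conjI allI)
 show "(tbump U n m :: ('n => complex) => complex) : bmeas cvol"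
 proof -
  have "(%x. \<Prod>a\<in>UNIV. edge (U a) n (x a) * cutoff m (x a)) : bmeas (cvol :: ('n => complex) measure)"
   by (intro borel_measurable_prod borel_measurable_times
   measurable_compose[OF cvol_component] borel_measurable_continuous_onI edge_cont cutoff_cont)
  thus ?thesis unfolding tbump_def by measurable
 qed
 have "(\<Prod>a\<in>UNIV. edge (U a) n (x a) * cutoff m (x a)) <= 1" "0 <= (\<Prod>a\<in>UNIV. edge (U a) n (x a) * cutoff m (x a))" for x
  by (auto intro!: prod_le_1 prod_nonneg mult_le_one mult_nonneg_nonneg edge_bounds cutoff_bounds)
 thus "EX B. ALL x. cmod (tbump U n m x) <= B" by (intro exI[of _ 1]) (simp add: tbump_def del: of_real_prod)
 have "1 / (real m + 1) <= nrm x & nrm x <= 1 + real CARD('n) * real m" if "tbump U n m x ~= 0" for x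
 proof -
  have "cutoff m (x a) ~= 0" for a using that by (auto simp: tbump_def simp del: of_real_prod)
  hence c: "1 / (real m + 1) <= cmod (x a)" "cmod (x a) <= real m" for a using cutoff_supp by blast+
  have "nrm x <= (\<Sum>a\<in>(UNIV :: 'n set). real m)" unfolding nrm_def by (intro sum_mono c)
  thus ?thesis using c(1)[of undefined] nrm_ge[of x undefined] by simp
 qed
 moreover have "1 / (real m + 1) <= 1 + real CARD('n) * real m"
 proof -
  have "1 / (real m + 1) <= 1" by (simp add: divide_le_eq)
  moreover have "0 <= real CARD('n) * real m" by simp
  ultimately show ?thesis by linarith
 qed
 ultimately show "\<exists>\<rho>1>0. \<exists>\<rho>2\<ge>\<rho>1. ALL x. tbump U n m x ~= 0 --> \<rho>1 <= nrm x & nrm x <= \<rho>2"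
  by (intro exI[of _ "1 / (real m + 1)"] conjI exI[of _ "1 + real CARD('n) * real m"]) auto
 fix x
 show "continuous_on UNIV (%s. tbump U n m (csc s x))"
  unfolding tbump_def csc_def
  by (intro continuous_on_of_real continuous_on_prod continuous_on_mult
   continuous_on_compose2[OF edge_cont] continuous_on_compose2[OF cutoff_cont] continuous_intros) auto
qed

lemma zero_of_rectangles:
 fixes h :: "('n::finite => complex) => complex"
 assumes h: "integrable cvol h"
  and 0: "!!U. (!!a. U a : pi_gen) ==> (LINT x|cvol. indicator (Pi\<^sub>E UNIV U) x *\<^sub>R h x) = 0"
 shows "AE x in cvol. h x = 0"
proof -
 let ?G = "{Pi\<^sub>E UNIV U | U :: 'n => complex set. ALL a. U a : pi_gen}"
 have stable: "Int_stable ?G"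
 proof (rule Int_stableI)
  fix A B assume "A : ?G" "B : ?G"
  then obtain U V where "A = Pi\<^sub>E UNIV U" "B = Pi\<^sub>E UNIV V" "ALL a. U a : pi_gen" "ALL a. V a : pi_gen" by auto
  thus "A \<inter> B : ?G" by (intro CollectI exI[of _ "%a. U a \<inter> V a"]) (auto simp: PiE_Int pi_gen(4))
 qed
 have Gs: "?G \<subseteq> sets cvol"
  unfolding cvol_def using pi_gen(3) by (auto intro!: sets_PiM_I_finite borel_open)
 have gen: "sets cvol \<subseteq> sigma_sets UNIV ?G"
 proof
  fix A assume A: "A : sets (cvol :: ('n => complex) measure)"
  have "(%x :: 'n => complex. x) : measurable (sigma UNIV ?G) cvol"
  proof (rule measurable_cvolI)
   fix a
   have "(%x :: 'n => complex. x a) : measurable (sigma UNIV ?G) (sigma UNIV pi_gen)"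
   proof (rule measurable_measure_of)
   fix V assume V: "V : pi_gen"
   have "(%x. x a) -` V \<inter> space (sigma UNIV ?G) = Pi\<^sub>E UNIV ((%_. UNIV)(a := V))"
   by (auto simp: PiE_UNIV_domain Pi_iff split: if_splits)
   moreover have "Pi\<^sub>E UNIV ((%_. UNIV)(a := V)) : ?G" using V pi_gen(2) by (intro CollectI exI[of _ "(%_. UNIV)(a := V)"]) auto
   ultimately show "(%x. x a) -` V \<inter> space (sigma UNIV ?G) : sets (sigma UNIV ?G)" by (auto intro: sigma_sets.Basic)
   qed auto
   moreover have "sets (sigma UNIV pi_gen) = sets (borel :: complex measure)" using pi_gen(5) by simp
   ultimately show "(%x :: 'n => complex. x a) : bmeas (sigma UNIV ?G)"
   by (simp only: measurable_cong_sets[OF refl, of "sigma UNIV pi_gen" borel])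
  qed
  from measurable_sets[OF this A] show "A : sigma_sets UNIV ?G" by simp
 qed
 show ?thesis
 proof (rule cvol.density_zero[OF h])
  fix A assume "A : sets (cvol :: ('n => complex) measure)"
  hence "A : sigma_sets UNIV ?G" using gen by blast
  thus "set_lebesgue_integral cvol A h = 0"
  proof (rule sigma_sets_induct_disjoint[OF stable, of UNIV A "%A. set_lebesgue_integral cvol A h = 0", rotated], goal_cases)
   case (1 A) thus ?case using 0 unfolding set_lebesgue_integral_def by auto
  next
   case 2 thus ?case by (simp add: set_lebesgue_integral_def)
  next
   case (3 A)
   have A: "A : sets cvol" using 3(1) sets.sigma_sets_subset[OF Gs] by auto
   have "(LINT x|cvol. indicator (Pi\<^sub>E UNIV (%_. UNIV)) x *\<^sub>R h x) = 0" by (rule 0) (rule pi_gen(2))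
   hence "(LINT x|cvol. h x) = 0" by (simp add: PiE_UNIV_domain)
   moreover have "(LINT x|cvol. indicator (UNIV - A) x *\<^sub>R h x) = (LINT x|cvol. h x - indicator A x *\<^sub>R h x)"
   by (intro b_integral_cong refl) (simp split: split_indicator)
   moreover have "(LINT x|cvol. h x - indicator A x *\<^sub>R h x) = (LINT x|cvol. h x) - (LINT x|cvol. indicator A x *\<^sub>R h x)"
   by (intro b_integral_diff h integrable_mult_indicator A)
   ultimately show ?case using 3(2) by (simp add: set_lebesgue_integral_def)
  next
   case (4 A)
   have A: "A n : sets cvol" for n using 4(2) sets.sigma_sets_subset[OF Gs] by auto
   have "set_integrable cvol (\<Union>n. A n) h" unfolding set_integrable_def
   using A by (intro integrable_mult_indicator h) auto
   moreover have "!!m n. m ~= n ==> A m \<inter> A n = {}" using 4(1) by (auto simp: disjoint_family_on_def)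
   ultimately have "set_lebesgue_integral cvol (\<Union>n. A n) h = suminf (%n. set_lebesgue_integral cvol (A n) h)"
   using A by (intro lebesgue_integral_countable_add) auto
   thus ?case using 4(3) by simp
  qed auto
 qed
qed

text \<open>As \<open>n\<close> grows, orthogonality to the \<open>tbump U n m\<close> gives that the homogeneous function of \<open>f\<close>, cut off
  with \<open>m\<close>, has integral zero over products of sets of a generator, hence vanishes. Then \<open>m\<close> grows.\<close>

theorem psf_tbump_separate:
 fixes i :: "'n::finite"
 assumes f: "f : vecs (psr i v k)"
  and 0: "!!U n m. (!!a. U a : pi_gen) ==> vinner (psr i v k) (psf i v k (tbump U n m)) f = 0"
 shows "vnorm (psr i v k) f = 0"
proof -
 let ?F = "cfun i v k f"
 have fm: "f : bmeas (borelGL)" and fi: "integrable (opp_measure i) (%y. (cmod (f (opp_unipotent i y)))^2)"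
  using f by (auto simp: ps_vecs)
 define h where "h m x = tbump (%_. UNIV) 0 m x * ?F x" for m and x :: "'n => complex"
 have h: "integrable cvol (h m)" for m
  using psf_inner(1)[OF tbump_bump[of "%_. UNIV" 0 m] f] by (simp add: h_def[abs_def] tbump_def)
 have "AE x in cvol. h m x = 0" for m
 proof (rule zero_of_rectangles[OF h])
  fix U :: "'n => complex set" assume U: "!!a. U a : pi_gen"
  let ?e = "%n x. \<Prod>a\<in>UNIV. edge (U a) n (x a)"
  have eq: "?e n x *\<^sub>R h m x = cnj (tbump U n m x) * ?F x" for n x
   by (simp add: h_def tbump_def scaleR_conv_of_real prod.distrib edge_def[of UNIV])
  have z: "(LINT x|cvol. ?e n x *\<^sub>R h m x) = 0" for n
   unfolding eq using psf_inner(2)[OF tbump_bump[of U n m] f] 0[of U n m, OF U] by simp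
  have em: "(%x. ?e n x) : bmeas cvol" for n
   by (intro borel_measurable_prod measurable_compose[OF cvol_component] borel_measurable_continuous_onI edge_cont)
  have "(%n. LINT x|cvol. ?e n x *\<^sub>R h m x) -->> (LINT x|cvol. indicator (Pi\<^sub>E UNIV U) x *\<^sub>R h m x)"
  proof (rule integral_dominated_convergence[where w = "%x. cmod (h m x)"])
   have "Pi\<^sub>E UNIV U : sets cvol" unfolding cvol_def using U pi_gen(3) by (intro sets_PiM_I_finite) auto
   thus "(%x. indicator (Pi\<^sub>E UNIV U) x *\<^sub>R h m x) : bmeas cvol"
   using h[of m] by (intro borel_measurable_scaleR borel_measurable_indicator) auto
   show "(%x. ?e n x *\<^sub>R h m x) : bmeas cvol" for n
   using h[of m] by (intro borel_measurable_scaleR em) auto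
   show "integrable cvol (%x. cmod (h m x))" using h by simp
   show "AE x in cvol. (%n. ?e n x *\<^sub>R h m x) -->> indicator (Pi\<^sub>E UNIV U) x *\<^sub>R h m x"
   proof (intro AE_I2 tendsto_scaleR tendsto_const)
   fix x
   have "(%n. ?e n x) -->> (\<Prod>a\<in>UNIV. indicator (U a) (x a))"
   by (intro tendsto_prod edge_tendsto pi_gen(3) U)
   moreover have "(\<Prod>a\<in>UNIV. indicator (U a) (x a) :: real) = indicator (Pi\<^sub>E UNIV U) x"
   proof (cases "ALL a. x a : U a")
   case True thus ?thesis by (simp add: PiE_UNIV_domain Pi_iff)
   next
   case False thus ?thesis by (auto simp: PiE_UNIV_domain Pi_iff indicator_def)
   qed
   ultimately show "(%n. ?e n x) -->> indicator (Pi\<^sub>E UNIV U) x" by simp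
   qed
   fix n
   have "0 <= ?e n x" "?e n x <= 1" for x by (auto intro!: prod_nonneg prod_le_1 edge_bounds)
   thus "AE x in cvol. norm (?e n x *\<^sub>R h m x) <= cmod (h m x)"
   by (intro AE_I2) (simp add: mult_left_le_one_le)
  qed
  thus "(LINT x|cvol. indicator (Pi\<^sub>E UNIV U) x *\<^sub>R h m x) = 0" unfolding z by (simp add: LIMSEQ_const_iff)
 qed
 hence "AE x in cvol. ALL m. h m x = 0" by (simp add: AE_all_countable)
 moreover have "AE x in cvol. ALL a. x (a :: 'n) ~= 0"
 proof -
  have "AE x in cvol. ALL a:UNIV. x (a :: 'n) ~= 0"
   by (rule AE_finite_allI) (auto intro: AE_cvol_component_nonzero)
  thus ?thesis by simp
 qed
 ultimately have F0: "AE x in cvol. ?F x = 0"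
 proof eventually_elim
  fix x assume x: "ALL m. h m x = 0" "ALL a. x a ~= 0"
  have "(%m. h m x) -->> of_real (\<Prod>a\<in>(UNIV :: 'n set). 1 * 1) * ?F x"
   unfolding h_def tbump_def using x(2)
   by (intro tendsto_mult tendsto_of_real tendsto_prod cutoff_tendsto tendsto_const) (auto simp: edge_def)
  thus "?F x = 0" using x(1) by (simp add: LIMSEQ_const_iff)
 qed
 have "ennreal (ln (exp 1 / 1) * (2 * pi)) * (nn_integral (opp_measure i) (%y. ennreal ((cmod (f (opp_unipotent i y)))^2)))
  = (nn_integral cvol (%x. indicator {1..exp 1} (nrm (mvec (mat 1) x)) * ennreal ((cmod (?F x))^2)))"
  by (rule nn_integral_shell[symmetric]) (use fm in \<open>auto simp: invertible_def intro: exI[of _ "mat 1"]\<close>)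
 also have "... = (nn_integral (cvol :: ('n => complex) measure) (%x. 0))"
  using F0 by (intro nn_integral_cong_AE) (auto elim!: eventually_mono)
 finally have "(nn_integral (opp_measure i) (%y. ennreal ((cmod (f (opp_unipotent i y)))^2))) = 0" by simp
 moreover have "(nn_integral (opp_measure i) (%y. ennreal ((cmod (f (opp_unipotent i y)))^2))) = ennreal ((vnorm (psr i v k) f)^2)"
  unfolding ps_norm[OF f] by (rule nn_integral_eq_integral[OF fi]) simp
 ultimately show ?thesis by (simp add: ennreal_eq_0_iff)
qed

definition tbumps :: "(('n::finite => complex) => complex) set" where
 "tbumps = {tbump U n m | U n m. ALL a. U a : pi_gen}"

lemma countable_tbumps: "countable (tbumps :: (('n::finite => complex) => complex) set)"
proof -
 have "countable (Pi\<^sub>E (UNIV :: 'n set) (%_. pi_gen))" by (rule countable_PiE) (auto intro: pi_gen(1))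
 hence "countable ((%(U, n, m). tbump U n m) ` (Pi\<^sub>E (UNIV :: 'n set) (%_. pi_gen) \<times> UNIV \<times> UNIV))" by (intro countable_image countable_SIGMA) auto
 moreover have "tbumps \<subseteq> (%(U, n, m). tbump U n m) ` (Pi\<^sub>E (UNIV :: 'n set) (%_. pi_gen) \<times> UNIV \<times> UNIV)"
 proof
  fix \<Phi> :: "('n => complex) => complex" assume "\<Phi> : tbumps"
  then obtain U n m where "\<Phi> = tbump U n m" "ALL a. U a : pi_gen" unfolding tbumps_def by blast
  thus "\<Phi> : (%(U, n, m). tbump U n m) ` (Pi\<^sub>E (UNIV :: 'n set) (%_. pi_gen) \<times> UNIV \<times> UNIV)"
   by (intro image_eqI[of _ _ "(U, n, m)"]) (auto simp: PiE_UNIV_domain)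
 qed
 ultimately show ?thesis by (rule countable_subset[rotated])
qed

lemma tbumps_bump: "\<Phi> : tbumps ==> bump \<Phi>"
 by (auto simp: tbumps_def tbump_bump)

lemma psf_tbumps_vtotal: "vtotal (psr i v k) (psf i v k ` tbumps)" for i :: "'n::finite"
proof (rule hilbert.vtotal_of_orth_total[OF hilbert_ps])
 show "orth_total (psr i v k) (psf i v k ` tbumps)"
  unfolding orth_total_def
 proof (intro conjI ballI impI)
  show "psf i v k ` tbumps \<subseteq> vecs (psr i v k)" by (auto intro: psf_mem tbumps_bump)
  fix f assume f: "f : vecs (psr i v k)" and 0: "ALL s:psf i v k ` tbumps. vinner (psr i v k) s f = 0"
  show "vnorm (psr i v k) f = 0"
  proof (rule psf_tbump_separate[OF f])
   fix U :: "'n => complex set" and n m assume "!!a. U a : pi_gen"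
   hence "psf i v k (tbump U n m) : psf i v k ` tbumps" unfolding tbumps_def by blast
   thus "vinner (psr i v k) (psf i v k (tbump U n m)) f = 0" using 0 by blast
  qed
 qed
qed


section \<open>Block diagonal matrices\<close>

lemma block_diag_simps [simp]:
 "block_diag (A, B) $ Inl a $ Inl b = A $ a $ b" "block_diag (A, B) $ Inl a $ Inr d = 0"
 "block_diag (A, B) $ Inr c $ Inl b = 0" "block_diag (A, B) $ Inr c $ Inr d = B $ c $ d"
 by (auto simp: block_diag_def)

lemma sum_UNIV_Plus:
 "(\<Sum>x\<in>(UNIV :: ('p::finite + 'q::finite) set). f x) = (\<Sum>a\<in>UNIV. f (Inl a)) + (\<Sum>b\<in>UNIV. f (Inr b))"
 unfolding UNIV_Plus_UNIV[symmetric] by (subst sum.Plus) auto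

lemma block_diag_mult:
 fixes A C :: "complex^'p^'p::finite" and B D :: "complex^'q^'q::finite"
 shows "block_diag (A, B) ** block_diag (C, D) = block_diag (A ** C, B ** D)"
 by (simp add: vec_eq_iff split_sum_all matrix_matrix_mult_def sum_UNIV_Plus)

lemma block_diag_one: "block_diag (mat 1 :: complex^'p^'p::finite, mat 1 :: complex^'q^'q::finite) = mat 1"
 by (simp add: vec_eq_iff split_sum_all mat_def)

lemma mvec_block_diag:
 fixes A :: "complex^'p^'p::finite" and B :: "complex^'q^'q::finite"
 shows "(%a. mvec (block_diag (A, B)) x (Inl a)) = mvec A (%a. x (Inl a))"
  "(%b. mvec (block_diag (A, B)) x (Inr b)) = mvec B (%b. x (Inr b))"
 by (auto simp: mvec_def sum_UNIV_Plus)

text \<open>Both blocks are built up column by column.\<close>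

lemma det_block_diag:
 fixes A :: "complex^'p^'p::finite" and B :: "complex^'q^'q::finite"
 assumes "invertible A" "invertible B"
 shows "det (block_diag (A, B)) = det A * det B"
proof -
 have e: "block_diag (mat 1 :: complex^'p^'p, colmat b v) = colmat (Inr b) (case_sum (%_. 0) v)" for b and v :: "'q => complex"
  by (auto simp: vec_eq_iff split_sum_all mat_def colmat_def)
 have e': "block_diag (colmat b v, mat 1 :: complex^'q^'q) = colmat (Inl b) (case_sum v (%_. 0))" for b and v :: "'p => complex"
  by (auto simp: vec_eq_iff split_sum_all mat_def colmat_def)
 have 1: "det (block_diag (mat 1 :: complex^'p^'p, B)) = det B"
  using assms(2)
 proof (induction B rule: GL_induct)
  case one show ?case by (simp add: block_diag_one)
 next
  case (colmat b v B)
  have "block_diag (mat 1 :: complex^'p^'p, colmat b v ** B) = block_diag (mat 1, colmat b v) ** block_diag (mat 1, B)"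
   by (simp add: block_diag_mult matrix_mul_lid)
  thus ?case using colmat by (simp add: e det_mul det_colmat)
 qed
 show ?thesis
  using assms(1)
 proof (induction A rule: GL_induct)
  case one show ?case by (simp add: 1)
 next
  case (colmat b v A)
  have "block_diag (colmat b v ** A, B) = block_diag (colmat b v, mat 1) ** block_diag (A, B)"
   by (simp add: block_diag_mult matrix_mul_lid)
  thus ?case using colmat by (simp add: e' det_mul det_colmat)
 qed
qed

lemma block_diag_GL:
 fixes A :: "complex^'p^'p::finite" and B :: "complex^'q^'q::finite"
 assumes "A : GL" "B : GL"
 shows "block_diag (A, B) : GL" "matrix_inv (block_diag (A, B)) = block_diag (matrix_inv A, matrix_inv B)"
proof -
 have i: "invertible A" "invertible B" using assms by (auto simp: GL_def)
 show "block_diag (A, B) : GL" using i by (simp add: GL_def invertible_det_nz det_block_diag)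
 show "matrix_inv (block_diag (A, B)) = block_diag (matrix_inv A, matrix_inv B)"
  by (rule matrix_inv_unique) (simp_all add: block_diag_mult matrix_inv_mult i block_diag_one)
qed

section \<open>Products of averaged vectors\<close>

text \<open>The constant \<open>2 * pi\<close> absorbs the one in the Parseval formula.\<close>

definition ext :: "(('p::finite => complex) => complex) => (('q::finite => complex) => complex) => ('p + 'q => complex) => complex" where
 "ext \<Phi> \<Psi> x = of_real (2 * pi) * (\<Phi> (%a. x (Inl a)) * \<Psi> (%b. x (Inr b)))"

lemma csc_parts: "(%a. csc s x (Inl a)) = csc s (%a. x (Inl a))" "(%b. csc s x (Inr b)) = csc s (%b. x (Inr b))"
 by (auto simp: csc_def)

lemma nrm_parts: "nrm (x :: 'p::finite + 'q::finite => complex) = nrm (%a. x (Inl a)) + nrm (%b. x (Inr b))"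
 by (simp add: nrm_def sum_UNIV_Plus)

lemma bump_ext:
 fixes \<Phi> :: "('p::finite => complex) => complex" and \<Psi> :: "('q::finite => complex) => complex"
 assumes \<Phi>: "bump \<Phi>" and \<Psi>: "bump \<Psi>" shows "bump (ext \<Phi> \<Psi>)"
proof -
 from \<Phi> obtain B \<rho>1 \<rho>2 where B: "B > 0" "!!x. cmod (\<Phi> x) <= B" and \<rho>: "0 < \<rho>1" "\<rho>1 <= \<rho>2"
  "!!x. \<Phi> x ~= 0 ==> \<rho>1 <= nrm x & nrm x <= \<rho>2" by (rule bumpE) blast
 from \<Psi> obtain C r1 r2 where C: "C > 0" "!!x. cmod (\<Psi> x) <= C" and r: "0 < r1" "r1 <= r2"
  "!!x. \<Psi> x ~= 0 ==> r1 <= nrm x & nrm x <= r2" by (rule bumpE) blast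
 show ?thesis unfolding bump_def
 proof (intro conjI allI)
  have "(%x :: 'p + 'q => complex. %a. x (Inl a)) : measurable cvol cvol" "(%x :: 'p + 'q => complex. %a. x (Inr a)) : measurable cvol cvol"
   by (intro measurable_cvolI cvol_component)+
  from measurable_compose[OF this(1) bump_measurable[OF \<Phi>]] measurable_compose[OF this(2) bump_measurable[OF \<Psi>]]
  show "ext \<Phi> \<Psi> : bmeas cvol" unfolding ext_def[abs_def] by (intro borel_measurable_times borel_measurable_const)
  have "cmod (ext \<Phi> \<Psi> x) <= 2 * pi * (B * C)" for x
   unfolding ext_def norm_mult using B C by (intro mult_mono) auto
  thus "EX B. ALL x. cmod (ext \<Phi> \<Psi> x) <= B" by blast
  have "\<rho>1 + r1 <= nrm x & nrm x <= \<rho>2 + r2" if "ext \<Phi> \<Psi> x ~= 0" for x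
   using that \<rho>(3)[of "%a. x (Inl a)"] r(3)[of "%b. x (Inr b)"] by (auto simp: ext_def nrm_parts)
  thus "\<exists>\<rho>1>0. \<exists>\<rho>2\<ge>\<rho>1. ALL x. ext \<Phi> \<Psi> x ~= 0 --> \<rho>1 <= nrm x & nrm x <= \<rho>2"
   using \<rho> r by (intro exI[of _ "\<rho>1 + r1"] conjI exI[of _ "\<rho>2 + r2"]) auto
  fix x :: "'p + 'q => complex"
  show "continuous_on UNIV (%s. ext \<Phi> \<Psi> (csc s x))"
   unfolding ext_def csc_parts using \<Phi> \<Psi> unfolding bump_def by (intro continuous_on_mult continuous_on_const) blast+
 qed
qed

interpretation cc: pair_sigma_finite "cvol :: ('p::finite => complex) measure" "cvol :: ('q::finite => complex) measure" ..

lemma CARD_sum: "CARD('p::finite + 'q::finite) = CARD('p) + CARD('q)"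
 unfolding UNIV_Plus_UNIV[symmetric] by (rule card_Plus) auto

lemma corr_ext:
 fixes \<Phi> \<Phi>' :: "('p::finite => complex) => complex" and \<Psi> \<Psi>' :: "('q::finite => complex) => complex"
 assumes b: "bump \<Phi>" "bump \<Psi>" "bump \<Phi>'" "bump \<Psi>'"
 shows "corr (ext \<Phi> \<Psi>) (ext \<Phi>' \<Psi>') s = of_real (4 * pi^2) * (corr \<Phi> \<Phi>' s * corr \<Psi> \<Psi>' s)"
proof -
 let ?f = "%p. case_sum (fst p) (snd p) :: 'p + 'q => complex"
 let ?G = "%x. cnj (ext \<Phi> \<Psi> x) * ext \<Phi>' \<Psi>' (csc s x)"
 let ?g = "%x. cnj (\<Phi> x) * \<Phi>' (csc s x)" and ?h = "%y. cnj (\<Psi> y) * \<Psi>' (csc s y)"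
 have fm: "?f : measurable (cvol \<Otimes>\<^sub>M cvol) cvol"
 proof (rule measurable_cvolI)
  fix a show "(%p. ?f p a) : bmeas (cvol \<Otimes>\<^sub>M cvol)"
   by (cases a) (auto intro: measurable_compose[OF measurable_fst cvol_component] measurable_compose[OF measurable_snd cvol_component])
 qed
 have Gm: "?G : bmeas cvol"
  by (intro borel_measurable_times cnj_bump_measurable csc_line_measurable bump_ext b)
 have gm: "?g : bmeas cvol" "?h : bmeas cvol"
  by (intro borel_measurable_times cnj_bump_measurable csc_line_measurable b)+
 have gi: "integrable cvol ?g" "integrable cvol ?h"
 proof -
  from b(3) obtain B where B: "!!x. cmod (\<Phi>' x) <= B" by (rule bumpE) blast
  from b(4) obtain C where C: "!!x. cmod (\<Psi>' x) <= C" by (rule bumpE) blast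
  show "integrable cvol ?g"
   by (rule b_integrable_bound[OF integrable_mult_left[OF integrable_norm[OF bump_integrable[OF b(1)]], of B] gm(1)])
   (intro AE_I2, use B in "auto simp: norm_mult intro!: mult_left_mono intro: order_trans[OF _ abs_ge_self]")
  show "integrable cvol ?h"
   by (rule b_integrable_bound[OF integrable_mult_left[OF integrable_norm[OF bump_integrable[OF b(2)]], of C] gm(2)])
   (intro AE_I2, use C in "auto simp: norm_mult intro!: mult_left_mono intro: order_trans[OF _ abs_ge_self]")
 qed
 have "(LINT x|cvol. ?G x) = (LINT x|distr (cvol \<Otimes>\<^sub>M cvol) cvol ?f. ?G x)" by (simp only: distr_case_sum)
 also have "... = (LINT p|(cvol \<Otimes>\<^sub>M cvol). ?G (?f p))" by (rule integral_distr[OF fm Gm])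
 also have "... = (LINT p|(cvol \<Otimes>\<^sub>M cvol). of_real (4 * pi^2) * (?g (fst p) * ?h (snd p)))"
  by (intro b_integral_cong refl) (simp add: ext_def csc_parts power2_eq_square)
 also have "... = of_real (4 * pi^2) * (LINT p|(cvol \<Otimes>\<^sub>M cvol). ?g (fst p) * ?h (snd p))" by (rule integral_mult_right_zero)
 also have "(LINT p|(cvol \<Otimes>\<^sub>M cvol). ?g (fst p) * ?h (snd p)) = (LINT x|cvol. LINT y|cvol. ?g x * ?h y)"
 proof -
  have "integrable (cvol \<Otimes>\<^sub>M cvol) (%p. ?g (fst p) * ?h (snd p))"
  proof (rule integrable_pair_bound[OF cvol.sigma_finite_measure_axioms cvol.sigma_finite_measure_axioms])
   show "integrable cvol (%x. cmod (?g x))" "integrable cvol (%x. cmod (?h x))" using gi by auto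
   show "(%p. ?g (fst p) * ?h (snd p)) : bmeas (cvol \<Otimes>\<^sub>M cvol)"
   by (intro borel_measurable_times[OF measurable_compose[OF measurable_fst gm(1)] measurable_compose[OF measurable_snd gm(2)]])
  qed (simp add: norm_mult)
  from cc.integral_fst'[OF this] show ?thesis by simp
 qed
 also have "... = (LINT x|cvol. ?g x) * (LINT y|cvol. ?h y)" by simp
 finally show ?thesis by (simp add: corr_def CARD_sum power_add mult_ac)
qed

lemma tbump_ext:
 fixes U :: "'p::finite + 'q::finite => complex set"
 shows "ext (tbump (%a. U (Inl a)) n m) (tbump (%b. U (Inr b)) n m) = (%x. of_real (2 * pi) * tbump U n m x)"
proof -
 have "(\<Prod>x\<in>(UNIV :: ('p + 'q) set). f x) = (\<Prod>a\<in>UNIV. f (Inl a)) * (\<Prod>b\<in>UNIV. f (Inr b))" for f :: "'p + 'q => real"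
  unfolding UNIV_Plus_UNIV[symmetric] by (subst prod.Plus) auto
 thus ?thesis unfolding ext_def tbump_def by (simp del: of_real_prod)
qed

lemma psf_scale: "psf i v k (%x. c * \<Phi> x) = vscale (psr i v k) c (psf i v k \<Phi>)" for i :: "'n::finite"
 by (simp add: psf_def mel_def ps_space_simps mult.assoc fun_eq_iff)

text \<open>The averaged vectors of products span the restricted representation.\<close>

lemma psf_ext_orth_total:
 fixes i :: "'p::finite + 'q::finite"
 shows "orth_total (psr i v k) {psf i v k (ext \<Phi> \<Psi>) | \<Phi> \<Psi>. bump \<Phi> & bump \<Psi>}"
 unfolding orth_total_def
proof (intro conjI ballI impI)
 show "{psf i v k (ext \<Phi> \<Psi>) | \<Phi> \<Psi>. bump \<Phi> & bump \<Psi>} \<subseteq> vecs (psr i v k)" by (auto intro: psf_mem bump_ext)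
 fix f assume f: "f : vecs (psr i v k)" and 0: "ALL s:{psf i v k (ext \<Phi> \<Psi>) | \<Phi> \<Psi>. bump \<Phi> & bump \<Psi>}. vinner (psr i v k) s f = 0"
 interpret hilbert "psr i v k" by (rule hilbert_ps)
 show "vnorm (psr i v k) f = 0"
 proof (rule psf_tbump_separate[OF f])
  fix U :: "'p + 'q => complex set" and n m
  have "vinner (psr i v k) (psf i v k (ext (tbump (%a. U (Inl a)) n m) (tbump (%b. U (Inr b)) n m))) f = 0"
  proof (rule bspec[OF 0])
   show "psf i v k (ext (tbump (%a. U (Inl a)) n m) (tbump (%b. U (Inr b)) n m)) : {psf i v k (ext \<Phi> \<Psi>) | \<Phi> \<Psi>. bump \<Phi> & bump \<Psi>}"
   using tbump_bump[of "%a. U (Inl a)" n m] tbump_bump[of "%b. U (Inr b)" n m] by blast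
  qed
  hence "cnj (of_real (2 * pi)) * vinner (psr i v k) (psf i v k (tbump U n m)) f = 0"
   unfolding tbump_ext psf_scale by (subst (asm) inner_scale_left[OF f psf_mem[OF tbump_bump]])
  thus "vinner (psr i v k) (psf i v k (tbump U n m)) f = 0" by simp
 qed
qed

lemma psf_ext_act:
 fixes A :: "complex^'p^'p::finite" and B :: "complex^'q^'q::finite"
 assumes "A : GL" "B : GL"
 shows "act (principal_series i t k') (block_diag (A, B)) (psf i v k (ext \<Phi> \<Psi>))
  = psf i v k (ext (%x. of_real (cmod (det (matrix_inv A))) * \<Phi> (mvec (matrix_inv A) x))
   (%y. of_real (cmod (det (matrix_inv B))) * \<Psi> (mvec (matrix_inv B) y)))"
proof -
 have "invertible (matrix_inv A)" "invertible (matrix_inv B)" using GL_matrix_inv[OF assms(1)] GL_matrix_inv[OF assms(2)] by (auto simp: GL_def)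
 hence d: "det (matrix_inv (block_diag (A, B))) = det (matrix_inv A) * det (matrix_inv B)"
  unfolding block_diag_GL(2)[OF assms] by (rule det_block_diag)
 show ?thesis
  unfolding psf_act[OF block_diag_GL(1)[OF assms]] d unfolding block_diag_GL(2)[OF assms] ext_def mvec_block_diag
  by (simp add: norm_mult mult_ac)
qed


section \<open>The direct integral\<close>

lemma psf_section:
 fixes i :: "'n::finite"
 assumes \<Phi>: "bump \<Phi>" and u: "u : bmeas borel"
 shows "(%z. psf i (u z) k \<Phi>) : ps_sections i (%z. \<i> * of_real (u z)) k"
proof -
 have "(%p. psf i (u (fst p)) k \<Phi> (snd p)) : bmeas (lborel \<Otimes>\<^sub>M borelGL)"
  by (rule psf_joint_measurable[OF \<Phi> measurable_compose[OF measurable_fst] measurable_snd]) (use u in simp)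
 thus ?thesis by (simp add: ps_sections_def psf_mem[OF \<Phi>] case_prod_beta')
qed

lemma section_inner_measurable:
 fixes i :: "'n::finite"
 assumes d: "d : ps_sections i t k" and e: "e : ps_sections i t k"
 shows "(%z. vinner (ps_space i (t z) k) (d z) (e z)) : bmeas borel"
proof -
 have m: "(%p. (fst p, opp_unipotent i (snd p))) : measurable (lborel \<Otimes>\<^sub>M opp_measure i) (lborel \<Otimes>\<^sub>M borelGL)"
  by (intro measurable_Pair measurable_fst measurable_compose[OF measurable_snd opp_unipotent_opp])
 have c: "(%p. f (fst p) (opp_unipotent i (snd p))) : bmeas (lborel \<Otimes>\<^sub>M opp_measure i)"
  if f: "f : ps_sections i t k" for f
 proof -
  have "(%(z, g). f z g) : bmeas (lborel \<Otimes>\<^sub>M borelGL)" using f by (simp add: ps_sections_def)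
  from measurable_compose[OF m this] show ?thesis by simp
 qed
 have "(%z. vinner (ps_space i (t z) k) (d z) (e z)) : bmeas lborel"
  unfolding ps_space_simps
 proof (rule opp.borel_measurable_lebesgue_integral)
  show "(%(z, y). cnj (d z (opp_unipotent i y)) * e z (opp_unipotent i y)) : bmeas (lborel \<Otimes>\<^sub>M opp_measure i)"
   unfolding case_prod_beta' by (intro borel_measurable_times measurable_compose[OF c[OF d] cnj_borel] c e)
 qed
 thus ?thesis by simp
qed

lemma section_act:
 fixes i :: "'n::finite"
 assumes h: "h : GL" and d: "d : ps_sections i (%z. \<i> * of_real (u z)) k"
 shows "(%z. act (principal_series i (\<i> * of_real (u z)) k) h (d z)) : ps_sections i (%z. \<i> * of_real (u z)) k"
 unfolding ps_sections_def
proof (intro CollectI conjI allI)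
 show "act (principal_series i (\<i> * of_real (u z)) k) h (d z) : vecs (psr i (u z) k)" for z
  using ps_unitary[OF h, of i "u z" k] d by (auto simp: isometry_on_def ps_sections_def)
 have m: "(%p. (fst p, matrix_inv h ** snd p)) : measurable (lborel \<Otimes>\<^sub>M borelGL) (lborel \<Otimes>\<^sub>M borelGL)"
  by (intro measurable_Pair measurable_fst measurable_compose[OF measurable_snd matrix_mult_measurable[OF GL_matrix_inv[OF h]]])
 have "(%(z, g). d z g) : bmeas (lborel \<Otimes>\<^sub>M borelGL)" using d by (simp add: ps_sections_def)
 from measurable_compose[OF m this]
 show "(%(z, g). act (principal_series i (\<i> * of_real (u z)) k) h (d z) g) : bmeas (lborel \<Otimes>\<^sub>M borelGL)"
  by (simp add: ps_act case_prod_beta')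
qed

lemma ps_act_inverse:
 fixes i :: "'n::finite"
 assumes "h : GL"
 shows "act (principal_series i t k) h (act (principal_series i t k) (matrix_inv h) f) = f"
proof -
 have h: "invertible h" using assms by (simp add: GL_def)
 have "matrix_inv (matrix_inv h) = h" by (rule matrix_inv_unique) (simp_all add: matrix_inv_mult h)
 thus ?thesis by (simp add: ps_act matrix_mul_assoc matrix_inv_mult h matrix_mul_lid)
qed

lemma mellin_twist:
 assumes A: "annular A"
 shows "annular (%s. cnj (A s * uch \<nu> k s))"
  and "mellin A (k - l) (\<nu> - v) = cnj (mellin (%s. cnj (A s * uch \<nu> k s)) l v)"
proof -
 show "annular (%s. cnj (A s * uch \<nu> k s))"
  using A unfolding annular_def by (auto intro!: continuous_on_cnj continuous_on_mult chr_continuous)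
 have "cnj (mellin (%s. cnj (A s * uch \<nu> k s)) l v)
  = (LINT s|mstar. cnj (cnj (A s * uch \<nu> k s) * uch v l s))"
  unfolding mellin_def by (rule b_integral_cnj[symmetric])
 also have "... = mellin A (k - l) (\<nu> - v)"
  unfolding mellin_def
 proof (rule integral_cong_AE)
  note [measurable] = annular_measurable[OF A]
  have "(%s. cnj (uch v l s)) : bmeas borel" by (rule measurable_compose[OF chr_measurable cnj_borel])
  thus "(%s. cnj (cnj (A s * uch \<nu> k s) * uch v l s)) : bmeas mstar" by simp
  show "(%s. A s * uch (\<nu> - v) (k - l) s) : bmeas mstar" by measurable
  show "AE s in mstar. cnj (cnj (A s * uch \<nu> k s) * uch v l s) = A s * uch (\<nu> - v) (k - l) s"
   using AE_mstar_nonzero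
  proof eventually_elim
   fix s :: complex assume s: "s ~= 0"
   have "uch \<nu> k s = uch v l s * uch (\<nu> - v) (k - l) s"
   using chr_add[OF s, of v "\<nu> - v" l "k - l"] by simp
   thus "cnj (cnj (A s * uch \<nu> k s) * uch v l s) = A s * uch (\<nu> - v) (k - l) s"
   using chr_nonzero[OF s, of v l] by (simp add: chr_cnj[OF s])
  qed
 qed
 finally show "mellin A (k - l) (\<nu> - v) = cnj (mellin (%s. cnj (A s * uch \<nu> k s)) l v)" ..
qed

lemma pure_tensor_scale:
 assumes H: "pre_hilbert H" and K: "pre_hilbert K" and a: "a : vecs H" and b: "b : vecs K"
  and y: "y : vecs (hilbert_tensor H K)"
 shows "vinner (hilbert_tensor H K) (pure_tensor (vscale H c a) b) y = cnj c * vinner (hilbert_tensor H K) (pure_tensor a b) y"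
proof -
 interpret H: pre_hilbert H by (rule H)
 interpret K: pre_hilbert K by (rule K)
 interpret T: hilbert "hilbert_tensor H K" by (rule hilbert_hilbert_tensor[OF H K])
 let ?x = "pure_tensor (vscale H c a) b" and ?y = "pure_tensor a b"
 have m: "?x : vecs (hilbert_tensor H K)" "?y : vecs (hilbert_tensor H K)" "vscale (hilbert_tensor H K) c ?y : vecs (hilbert_tensor H K)"
  using a b H K by (auto intro!: pure_tensor_mem)
 have xx: "vinner (hilbert_tensor H K) ?x ?x = cnj c * (c * (vinner H a a * vinner K b b))"
  using a b by (simp add: pure_tensor_inner[OF H K])
 have xy: "vinner (hilbert_tensor H K) ?x ?y = cnj c * (vinner H a a * vinner K b b)"
  using a b by (simp add: pure_tensor_inner[OF H K])
 have yy: "vinner (hilbert_tensor H K) ?y ?y = vinner H a a * vinner K b b"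
  using a b by (simp add: pure_tensor_inner[OF H K])
 have "(vdist (hilbert_tensor H K) ?x (vscale (hilbert_tensor H K) c ?y))^2 = 0"
  unfolding T.dist_power2[OF m(1,3)] T.norm_power2[OF m(1)] T.norm_power2[OF m(3)] xx
   T.inner_scale[OF m(1,2)] xy T.inner_scale[OF m(3,2)] T.inner_scale_left[OF m(2,2)] yy
  by (simp add: algebra_simps)
 hence "veq (hilbert_tensor H K) ?x (vscale (hilbert_tensor H K) c ?y)" by (simp add: veq_def)
 hence "vinner (hilbert_tensor H K) y ?x = vinner (hilbert_tensor H K) y (vscale (hilbert_tensor H K) c ?y)"
  by (rule T.inner_veq) (use m y in auto)
 hence "vinner (hilbert_tensor H K) y ?x = c * vinner (hilbert_tensor H K) y ?y" using m y by simp
 thus ?thesis using T.inner_commute[OF y m(1)] T.inner_commute[OF y m(2)] by simp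
qed

context
 fixes i :: "'p::finite" and j :: "'q::finite" and \<nu> :: real and k :: int
begin

definition ten where
 "ten k' z = outer_tensor (principal_series i (\<i> * of_real z) k') (principal_series j (\<i> * of_real (\<nu> - z)) (k - k'))"

definition fib where
 "fib k' z = hilbert_tensor (psr i z k') (psr j (\<nu> - z) (k - k'))"

definition secs where
 "secs k' = tensor_sections (ps_sections i (%z. \<i> * of_real z) k') (ps_sections j (%z. \<i> * of_real (\<nu> - z)) (k - k'))"

definition bv where
 "bv \<Phi> \<Psi> k' z = pure_tensor (psf i z k' \<Phi>) (psf j (\<nu> - z) (k - k') \<Psi>)"

definition dint where
 "dint k' = direct_integral lborel (fib k') (secs k')"

definition dsum where
 "dsum = hilbert_sum UNIV dint"

lemma hspace_ten: "hspace (ten k' z) = fib k' z"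
 by (simp add: ten_def fib_def outer_tensor_def ps_hspace)

lemma ph: "pre_hilbert (psr i v l)" "pre_hilbert (psr j v l)"
 by (auto intro: hilbert.axioms(1)[OF hilbert_ps])

lemma fib_hilbert: "hilbert (fib k' z)"
 unfolding fib_def by (intro hilbert_hilbert_tensor ph)

lemma bv_secs: "bump \<Phi> ==> bump \<Psi> ==> bv \<Phi> \<Psi> k' : secs k'"
proof -
 assume b: "bump \<Phi>" "bump \<Psi>"
 have s1: "(%z. psf i z k' \<Phi>) : ps_sections i (%z. \<i> * of_real z) k'"
  using psf_section[OF b(1), of "%z. z" i k'] by simp
 have s2: "(%z. psf j (\<nu> - z) (k - k') \<Psi>) : ps_sections j (%z. \<i> * of_real (\<nu> - z)) (k - k')"
  by (rule psf_section[OF b(2)]) simp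
 show ?thesis unfolding secs_def tensor_sections_def bv_def[abs_def]
  by (rule CollectI, intro exI conjI, rule refl, rule s1, rule s2)
qed

lemma bv_mem: "bump \<Phi> ==> bump \<Psi> ==> bv \<Phi> \<Psi> k' z : vecs (fib k' z)"
 unfolding bv_def fib_def by (intro pure_tensor_mem ph psf_mem)

lemma secs_field: "measurable_field lborel (fib k') (secs k')"
 unfolding measurable_field_def
proof (intro conjI ballI)
 fix e z assume "e : secs k'"
 then obtain d d' where e: "e = (%z. pure_tensor (d z) (d' z))" "d : ps_sections i (%z. \<i> * of_real z) k'"
  "d' : ps_sections j (%z. \<i> * of_real (\<nu> - z)) (k - k')" unfolding secs_def tensor_sections_def by blast
 hence d: "d z : vecs (psr i z k')" "d' z : vecs (psr j (\<nu> - z) (k - k'))" by (auto simp: ps_sections_def)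
 show "e z : vecs (fib k' z)" unfolding fib_def e(1) by (intro pure_tensor_mem ph d)
next
 fix e f assume "e : secs k'" "f : secs k'"
 then obtain d d' c c' where e: "e = (%z. pure_tensor (d z) (d' z))" "f = (%z. pure_tensor (c z) (c' z))"
  and dc: "d : ps_sections i (%z. \<i> * of_real z) k'" "c : ps_sections i (%z. \<i> * of_real z) k'"
  "d' : ps_sections j (%z. \<i> * of_real (\<nu> - z)) (k - k')" "c' : ps_sections j (%z. \<i> * of_real (\<nu> - z)) (k - k')"
  unfolding secs_def tensor_sections_def by blast
 have "vinner (fib k' z) (e z) (f z) = vinner (psr i z k') (d z) (c z) * vinner (psr j (\<nu> - z) (k - k')) (d' z) (c' z)" for z
  unfolding e fib_def using dc by (intro pure_tensor_inner ph) (auto simp: ps_sections_def)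
 moreover have "(%z. vinner (psr i z k') (d z) (c z) * vinner (psr j (\<nu> - z) (k - k')) (d' z) (c' z)) : bmeas borel"
  by (intro borel_measurable_times section_inner_measurable dc)
 ultimately show "(%z. vinner (fib k' z) (e z) (f z)) : bmeas lborel" by simp
next
 let ?D = "(%(\<Phi>, \<Psi>). bv \<Phi> \<Psi> k') ` (tbumps \<times> tbumps)"
 show "\<exists>D\<subseteq>secs k'. countable D & (ALL z:space lborel. vtotal (fib k' z) ((%e. e z) ` D))"
 proof (intro exI[of _ ?D] conjI ballI)
  show "?D \<subseteq> secs k'" by (auto intro!: bv_secs tbumps_bump)
  show "countable ?D" by (intro countable_image countable_SIGMA countable_tbumps)
  fix z
  have eq: "(%e. e z) ` ?D = {pure_tensor a b | a b. a : psf i z k' ` tbumps & b : psf j (\<nu> - z) (k - k') ` tbumps}"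
  proof (intro equalityI subsetI)
   fix x assume "x : (%e. e z) ` ?D"
   then obtain \<Phi> \<Psi> where x: "x = bv \<Phi> \<Psi> k' z" "\<Phi> : tbumps" "\<Psi> : tbumps" by auto
   show "x : {pure_tensor a b | a b. a : psf i z k' ` tbumps & b : psf j (\<nu> - z) (k - k') ` tbumps}"
   unfolding x(1) bv_def by (rule CollectI, intro exI conjI, rule refl) (use x in auto)
  next
   fix x assume "x : {pure_tensor a b | a b. a : psf i z k' ` tbumps & b : psf j (\<nu> - z) (k - k') ` tbumps}"
   then obtain \<Phi> \<Psi> where x: "x = bv \<Phi> \<Psi> k' z" "\<Phi> : tbumps" "\<Psi> : tbumps" by (auto simp: bv_def)
   have D: "bv \<Phi> \<Psi> k' : ?D" using x by (intro image_eqI[of _ _ "(\<Phi>, \<Psi>)"]) auto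
   show "x : (%e. e z) ` ?D" unfolding x(1) by (rule imageI[OF D, of "%e. e z"])
  qed
  show "vtotal (fib k' z) ((%e. e z) ` ?D)"
   unfolding eq by (rule hilbert.vtotal_of_orth_total[OF fib_hilbert], unfold fib_def,
   intro pure_tensors_orth_total ph psf_tbumps_vtotal)
 qed
qed

lemma hilbert_field_fib: "hilbert_field lborel (fib k') (secs k')"
 by (rule hilbert_field.intro[OF secs_field fib_hilbert])

lemma section_space_dint:
 "section_space lborel (fib k') (hilbert_field.msections lborel (fib k') (secs k')) (dint k')"
 unfolding dint_def by (rule hilbert_field.section_space_direct_integral[OF hilbert_field_fib])

lemma hilbert_dint: "hilbert (dint k')"
 by (rule section_space.hilbert_L[OF section_space_dint])

lemma hilbert_dsum: "hilbert dsum"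
 unfolding dsum_def by (rule section_space.hilbert_L[OF section_space_hilbert_sum]) (rule hilbert_dint)

lemma dint_vecs: "s : vecs (dint k') \<longleftrightarrow> (ALL z. s z : vecs (fib k' z)) &
  (ALL e:secs k'. (%z. vinner (fib k' z) (e z) (s z)) : bmeas borel) &
  integrable lborel (%z. (vnorm (fib k' z) (s z))^2)"
 by (simp add: dint_def direct_integral_def)

lemma dint_inner: "vinner (dint k') s t = (LINT z|lborel. vinner (fib k' z) (s z) (t z))"
 by (simp add: dint_def direct_integral_def)

lemma dsum_vecs: "x : vecs dsum \<longleftrightarrow> (ALL k'. x k' : vecs (dint k')) &
  integrable (count_space UNIV) (%k'. (vnorm (dint k') (x k'))^2)"
 unfolding dsum_def hilbert_sum_simps by simp

lemma dsum_inner: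
 assumes x: "x : vecs dsum" and y: "y : vecs dsum"
 shows "integrable dual_measure (%(k', z). vinner (fib k' z) (x k' z) (y k' z))"
  and "vinner dsum x y = (LINT (k', z)|dual_measure. vinner (fib k' z) (x k' z) (y k' z))"
proof -
 let ?F = "%(k', z). vinner (fib k' z) (x k' z) (y k' z)"
 have xy: "x k' : vecs (dint k')" "y k' : vecs (dint k')" for k' using x y by (auto simp: dsum_vecs)
 have xyz: "x k' z : vecs (fib k' z)" "y k' z : vecs (fib k' z)" for k' z using xy by (auto simp: dint_vecs)
 have li: "integrable lborel (%z. vinner (fib k' z) (x k' z) (y k' z))" for k'
  by (rule section_space.inner_integrable[OF section_space_dint xy])
 have n: "(vnorm (dint k') s)^2 = (LINT z|lborel. (vnorm (fib k' z) (s z))^2)" if "s : vecs (dint k')" for s k'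
  by (rule section_space.L_norm[OF section_space_dint that])
 have Fm: "?F : bmeas dual_measure"
  using li by (intro dual_measurableI) (auto dest: borel_measurable_integrable)
 have "integrable (count_space UNIV \<Otimes>\<^sub>M lborel) ?F"
 proof (rule kl.Fubini_integrable)
  show "?F : bmeas (count_space UNIV \<Otimes>\<^sub>M lborel)" using Fm by (simp add: dual_measure_def)
  show "AE k' in count_space UNIV. integrable lborel (%z. ?F (k', z))" using li by simp
  show "integrable (count_space UNIV) (%k'. LINT z|lborel. norm (?F (k', z)))"
  proof (rule b_integrable_bound)
   show "integrable (count_space UNIV) (%k'. (vnorm (dint k') (x k'))^2 + (vnorm (dint k') (y k'))^2)"
   using x y by (simp add: dsum_vecs)
   show "AE k' in count_space UNIV. norm (LINT z|lborel. norm (?F (k', z))) <= norm ((vnorm (dint k') (x k'))^2 + (vnorm (dint k') (y k'))^2)"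
   proof (rule AE_I2)
   fix k'
   have "(LINT z|lborel. norm (?F (k', z))) <= (LINT z|lborel. (vnorm (fib k' z) (x k' z))^2 + (vnorm (fib k' z) (y k' z))^2)"
   proof (rule integral_mono)
   show "integrable lborel (%z. norm (?F (k', z)))" using li by simp
   show "integrable lborel (%z. (vnorm (fib k' z) (x k' z))^2 + (vnorm (fib k' z) (y k' z))^2)"
   using xy[of k'] by (simp add: dint_vecs)
   fix z
   show "norm (?F (k', z)) <= (vnorm (fib k' z) (x k' z))^2 + (vnorm (fib k' z) (y k' z))^2"
   using pre_hilbert.inner_le_power2[OF hilbert.axioms(1)[OF fib_hilbert] xyz] by simp
   qed
   also have "... = (vnorm (dint k') (x k'))^2 + (vnorm (dint k') (y k'))^2"
   unfolding n[OF xy(1)] n[OF xy(2)] by (rule b_integral_add) (use xy[of k'] in "simp_all add: dint_vecs")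
   finally show "norm (LINT z|lborel. norm (?F (k', z))) <= norm ((vnorm (dint k') (x k'))^2 + (vnorm (dint k') (y k'))^2)"
   by simp
   qed
  qed simp
 qed
 note int = this
 thus "integrable dual_measure ?F" by (simp add: dual_measure_def)
 have "integrable (count_space UNIV) (%k'. LINT z|lborel. ?F (k', z))" by (rule kl.integrable_fst'[OF int])
 hence "vinner dsum x y = (LINT k'|count_space UNIV. LINT z|lborel. ?F (k', z))"
  unfolding dsum_def hilbert_sum_inner dint_inner by (subst infsum_eq_integral_count_space) auto
 also have "... = (LINT p|dual_measure. ?F p)" unfolding dual_measure_def by (rule kl.integral_fst'[OF int])
 finally show "vinner dsum x y = (LINT p|dual_measure. ?F p)" .
qed

text \<open>The second factor contributes the complex conjugate of a Mellin transform at the same parameters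
  as the first, so the Parseval formula integrates the product.\<close>

lemma bv_parseval:
 assumes b: "bump \<Phi>" "bump \<Psi>" "bump \<Phi>'" "bump \<Psi>'"
 shows "has_bochner_integral dual_measure (%(k', z). vinner (fib k' z) (bv \<Phi> \<Psi> k' z) (bv \<Phi>' \<Psi>' k' z))
  (of_real (4 * pi^2) * (LINT s|mstar. corr \<Psi> \<Psi>' s * uch \<nu> k s * corr \<Phi> \<Phi>' s))"
proof -
 let ?C = "%s. cnj (corr \<Psi> \<Psi>' s * uch \<nu> k s)"
 have "vinner (fib k' z) (bv \<Phi> \<Psi> k' z) (bv \<Phi>' \<Psi>' k' z) = cnj (mellin ?C k' z) * mellin (corr \<Phi> \<Phi>') k' z" for k' z
 proof -
  have "vinner (fib k' z) (bv \<Phi> \<Psi> k' z) (bv \<Phi>' \<Psi>' k' z)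
   = vinner (psr i z k') (psf i z k' \<Phi>) (psf i z k' \<Phi>')
   * vinner (psr j (\<nu> - z) (k - k')) (psf j (\<nu> - z) (k - k') \<Psi>) (psf j (\<nu> - z) (k - k') \<Psi>')"
   unfolding bv_def fib_def by (intro pure_tensor_inner ph psf_mem b)
  thus ?thesis
   unfolding psf_inner_psf[OF b(1,3)] psf_inner_psf[OF b(2,4)] mellin_twist(2)[OF corr_annular[OF b(2,4)]]
   by (simp only: mult.commute)
 qed
 thus ?thesis
  using mellin_parseval[OF corr_annular[OF b(1,3)] mellin_twist(1)[OF corr_annular[OF b(2,4)], of \<nu> k]] by simp
qed

lemma bv_dsum:
 assumes b: "bump \<Phi>" "bump \<Psi>" shows "bv \<Phi> \<Psi> : vecs dsum"
proof -
 let ?F = "%(k', z). (vnorm (fib k' z) (bv \<Phi> \<Psi> k' z))^2"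
 have "integrable dual_measure (%p. Re ((%(k', z). vinner (fib k' z) (bv \<Phi> \<Psi> k' z) (bv \<Phi> \<Psi> k' z)) p))"
  by (rule integrable_Re) (use bv_parseval[OF b b] in "simp add: has_bochner_integral_iff")
 moreover have "(%p. Re ((%(k', z). vinner (fib k' z) (bv \<Phi> \<Psi> k' z) (bv \<Phi> \<Psi> k' z)) p)) = ?F"
  by (auto simp: fun_eq_iff pre_hilbert.norm_power2[OF hilbert.axioms(1)[OF fib_hilbert] bv_mem[OF b]])
 ultimately have int: "integrable (count_space UNIV \<Otimes>\<^sub>M lborel) ?F" by (simp add: dual_measure_def)
 have "ALL k'. integrable lborel (%z. ?F (k', z))"
  using kl.AE_integrable_fst'[OF int] by (simp add: AE_count_space)
 hence mem: "bv \<Phi> \<Psi> k' : vecs (dint k')" for k'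
  unfolding dint_vecs using bv_mem[OF b] secs_field[of k'] bv_secs[OF b, of k'] by (auto simp: measurable_field_def)
 have "integrable (count_space UNIV) (%k'. LINT z|lborel. ?F (k', z))" by (rule kl.integrable_fst'[OF int])
 moreover have "(LINT z|lborel. ?F (k', z)) = (vnorm (dint k') (bv \<Phi> \<Psi> k'))^2" for k'
  using section_space.L_norm[OF section_space_dint mem] by simp
 ultimately show ?thesis unfolding dsum_vecs using mem by simp
qed

text \<open>A vector orthogonal to all \<open>bv \<Phi> \<Psi>\<close> is orthogonal to the dilates of \<open>bv \<Phi> \<Psi>\<close> in the first
  factor. Dilation acts by a character on each fibre, so Fourier uniqueness on the dual of the
  multiplicative group shows orthogonality in almost every fibre.\<close>

lemma bv_orth_total: "orth_total dsum {bv \<Phi> \<Psi> | \<Phi> \<Psi>. bump \<Phi> & bump \<Psi>}"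
 unfolding orth_total_def
proof (intro conjI ballI impI)
 show "{bv \<Phi> \<Psi> | \<Phi> \<Psi>. bump \<Phi> & bump \<Psi>} \<subseteq> vecs dsum" using bv_dsum by blast
 fix y assume y: "y : vecs dsum" and 0: "ALL s:{bv \<Phi> \<Psi> | \<Phi> \<Psi>. bump \<Phi> & bump \<Psi>}. vinner dsum s y = 0"
 have yd: "y k' : vecs (dint k')" for k' using y by (simp add: dsum_vecs)
 have yz: "y k' z : vecs (fib k' z)" for k' z using yd by (auto simp: dint_vecs)
 have fibre: "AE z in lborel. vinner (fib l z) (bv \<Phi> \<Psi> l z) (y l z) = 0" if b: "bump \<Phi>" "bump \<Psi>" for \<Phi> \<Psi> l
 proof -
  let ?F = "%(k', z). vinner (fib k' z) (bv \<Phi> \<Psi> k' z) (y k' z)"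
  have int: "integrable dual_measure ?F" by (rule dsum_inner(1)[OF bv_dsum[OF b] y])
  have "(LINT (k', v)|dual_measure. uch v k' s * ?F (k', v)) = 0" if s: "s ~= 0" for s
  proof -
   let ?c = "of_real (1 / cmod s ^ CARD('p)) :: complex"
   have bs: "bump (%x. \<Phi> (csc s x))" by (rule bump_csc[OF b(1) s])
   have eq: "vinner (fib k' z) (bv (%x. \<Phi> (csc s x)) \<Psi> k' z) (y k' z) = ?c * (uch z k' s * ?F (k', z))" for k' z
   proof -
   have "vinner (fib k' z) (bv (%x. \<Phi> (csc s x)) \<Psi> k' z) (y k' z)
   = cnj (inverse (uch z k' s) * ?c) * vinner (fib k' z) (bv \<Phi> \<Psi> k' z) (y k' z)"
   unfolding bv_def psf_csc[OF b(1) s] fib_def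
   by (rule pure_tensor_scale[OF ph(1) ph(2) psf_mem[OF b(1)] psf_mem[OF b(2)]]) (use yz[of k' z] in "simp add: fib_def")
   thus ?thesis by (simp add: chr_cnj[OF s])
   qed
   have "0 = vinner dsum (bv (%x. \<Phi> (csc s x)) \<Psi>) y" using 0 bs b(2) by force
   also have "... = (LINT (k', z)|dual_measure. vinner (fib k' z) (bv (%x. \<Phi> (csc s x)) \<Psi> k' z) (y k' z))"
   by (rule dsum_inner(2)[OF bv_dsum[OF bs b(2)] y])
   also have "... = (LINT p|dual_measure. ?c * (%(k', z). uch z k' s * ?F (k', z)) p)"
   unfolding eq by (simp only: case_prod_beta')
   also have "... = ?c * (LINT (k', v)|dual_measure. uch v k' s * ?F (k', v))" by (rule integral_mult_right_zero)
   finally show ?thesis using s by simp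
  qed
  from dual_unique[OF int this, of l] show ?thesis by simp
 qed
 have zero: "AE z in lborel. vnorm (fib l z) (y l z) = 0" for l
 proof -
  have "AE z in lborel. ALL p:tbumps \<times> tbumps. vinner (fib l z) (bv (fst p) (snd p) l z) (y l z) = 0"
  proof (subst AE_ball_countable)
   show "countable (tbumps \<times> tbumps)" by (intro countable_SIGMA countable_tbumps)
   show "ALL p:tbumps \<times> tbumps. AE z in lborel. vinner (fib l z) (bv (fst p) (snd p) l z) (y l z) = 0"
   by (intro ballI fibre tbumps_bump) auto
  qed
  thus ?thesis
  proof eventually_elim
   fix z assume 0: "ALL p:tbumps \<times> tbumps. vinner (fib l z) (bv (fst p) (snd p) l z) (y l z) = 0"
   have "orth_total (fib l z) {pure_tensor a b | a b. a : psf i z l ` tbumps & b : psf j (\<nu> - z) (k - l) ` tbumps}"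
   unfolding fib_def by (intro pure_tensors_orth_total ph psf_tbumps_vtotal)
   thus "vnorm (fib l z) (y l z) = 0"
   using yz[of l z] 0 unfolding orth_total_def by (force simp: bv_def)
  qed
 qed
 have "(vnorm (dint l) (y l))^2 = 0" for l
 proof -
  have "(vnorm (dint l) (y l))^2 = (LINT z|lborel. (vnorm (fib l z) (y l z))^2)"
   by (rule section_space.L_norm[OF section_space_dint yd])
  also have "... = 0" using zero[of l] by (intro integral_eq_zero_AE) (auto elim!: eventually_mono)
  finally show ?thesis .
 qed
 hence "vinner (dint l) (y l) (y l) = 0" for l
  using pre_hilbert.inner_self[OF hilbert.axioms(1)[OF hilbert_dint] yd[of l]] by simp
 hence "vinner dsum y y = 0" unfolding dsum_def hilbert_sum_inner by simp
 thus "vnorm dsum y = 0" by (simp add: vnorm_def)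
qed

lemma act_dsum:
 assumes A: "A : GL" and B: "B : GL"
 shows "isometry_on dsum (%x k' z. act (ten k' z) (A, B) (x k' z))"
 unfolding dsum_def
proof (rule hilbert_sum_isometry)
 fix k'
 interpret hilbert_field lborel "fib k'" "secs k'" by (rule hilbert_field_fib)
 show "isometry_on (dint k') (%s z. act (ten k' z) (A, B) (s z))"
  unfolding dint_def
 proof (rule direct_integral_isometry)
  fix z
  have "isometry_on (hspace (ten k' z)) (act (ten k' z) (A, B))"
   unfolding ten_def by (rule outer_tensor_isometry; unfold ps_hspace; intro ph ps_unitary A B)
  thus "isometry_on (fib k' z) (act (ten k' z) (A, B))" by (simp only: hspace_ten)
 next
  fix e assume "e : secs k'"
  then obtain d d' where e: "e = (%z. pure_tensor (d z) (d' z))" and d: "d : ps_sections i (%z. \<i> * of_real z) k'"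
   "d' : ps_sections j (%z. \<i> * of_real (\<nu> - z)) (k - k')" unfolding secs_def tensor_sections_def by blast
  let ?e = "%z. pure_tensor (act (principal_series i (\<i> * of_real z) k') (matrix_inv A) (d z))
   (act (principal_series j (\<i> * of_real (\<nu> - z)) (k - k')) (matrix_inv B) (d' z))"
  have m1: "?e : secs k'" unfolding secs_def tensor_sections_def
   by (rule CollectI, intro exI conjI, rule refl, rule section_act[OF GL_matrix_inv[OF A] d(1)],
   rule section_act[OF GL_matrix_inv[OF B] d(2)])
  have m2: "e z = act (ten k' z) (A, B) (?e z)" for z
   unfolding e ten_def outer_tensor_act_pure ps_act_inverse[OF A] ps_act_inverse[OF B] ..
  show "EX e':secs k'. ALL z:space lborel. e z = act (ten k' z) (A, B) (e' z)"
   by (rule bexI[OF _ m1], intro ballI, rule m2)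
 qed
qed

lemma bv_act:
 assumes A: "A : GL" and B: "B : GL"
 shows "act (ten k' z) (A, B) (bv \<Phi> \<Psi> k' z)
  = bv (%x. of_real (cmod (det (matrix_inv A))) * \<Phi> (mvec (matrix_inv A) x))
   (%y. of_real (cmod (det (matrix_inv B))) * \<Psi> (mvec (matrix_inv B) y)) k' z"
 unfolding ten_def bv_def outer_tensor_act_pure psf_act[OF A] psf_act[OF B] ..

lemma bv_inner_ext:
 assumes b: "bump \<Phi>" "bump \<Psi>" "bump \<Phi>'" "bump \<Psi>'"
 shows "vinner (psr (Inl i :: 'p + 'q) \<nu> k) (psf (Inl i) \<nu> k (ext \<Phi> \<Psi>)) (psf (Inl i) \<nu> k (ext \<Phi>' \<Psi>'))
  = vinner dsum (bv \<Phi> \<Psi>) (bv \<Phi>' \<Psi>')"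
proof -
 have "vinner (psr (Inl i :: 'p + 'q) \<nu> k) (psf (Inl i) \<nu> k (ext \<Phi> \<Psi>)) (psf (Inl i) \<nu> k (ext \<Phi>' \<Psi>'))
  = (LINT s|mstar. of_real (4 * pi^2) * (corr \<Psi> \<Psi>' s * uch \<nu> k s * corr \<Phi> \<Phi>' s))"
  unfolding psf_inner_psf[OF bump_ext[OF b(1,2)] bump_ext[OF b(3,4)]] mellin_def corr_ext[OF b]
  by (simp only: mult_ac)
 also have "... = of_real (4 * pi^2) * (LINT s|mstar. corr \<Psi> \<Psi>' s * uch \<nu> k s * corr \<Phi> \<Phi>' s)"
  by (rule integral_mult_right_zero)
 also have "... = vinner dsum (bv \<Phi> \<Psi>) (bv \<Phi>' \<Psi>')"
  unfolding dsum_inner(2)[OF bv_dsum[OF b(1,2)] bv_dsum[OF b(3,4)]]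
  by (rule has_bochner_integral_integral_eq[OF bv_parseval[OF b], symmetric])
 finally show ?thesis .
qed

lemma equivalence:
 "unitarily_equivalent (GL \<times> GL)
  (restrict_rep block_diag (principal_series (Inl i :: 'p + 'q) (\<i> * of_real \<nu>) k))
  (sum_rep UNIV (%k'. integral_rep lborel (ten k') (secs k')))"
proof -
 let ?R = "restrict_rep block_diag (principal_series (Inl i :: 'p + 'q) (\<i> * of_real \<nu>) k)"
 let ?S = "sum_rep UNIV (%k'. integral_rep lborel (ten k') (secs k'))"
 let ?I = "{(\<Phi> :: ('p => complex) => complex, \<Psi> :: ('q => complex) => complex). bump \<Phi> & bump \<Psi>}"
 let ?a = "%(\<Phi>, \<Psi>). psf (Inl i :: 'p + 'q) \<nu> k (ext \<Phi> \<Psi>)" and ?b = "%(\<Phi>, \<Psi>). bv \<Phi> \<Psi>"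
 have hR: "hspace ?R = psr (Inl i) \<nu> k" by (simp add: restrict_rep_def ps_hspace)
 have aR: "act ?R = (%h. act (principal_series (Inl i) (\<i> * of_real \<nu>) k) (block_diag h))" by (simp add: restrict_rep_def)
 have hS: "hspace ?S = dsum"
  by (simp add: sum_rep_def integral_rep_def hspace_ten dsum_def dint_def[abs_def])
 have aS: "act ?S = (%g x k' z. act (ten k' z) g (x k' z))" by (simp add: sum_rep_def integral_rep_def)
 have psi: "\<Phi> = (%x. of_real (cmod (det (matrix_inv A))) * (of_real (cmod (det A)) * \<Phi> (mvec A (mvec (matrix_inv A) x))))"
  if "A : GL" for \<Phi> :: "('n::finite => complex) => complex" and A
 proof -
  have A: "invertible A" "det A ~= 0" using that by (auto simp: GL_def invertible_det_nz)
  thus ?thesis by (simp add: fun_eq_iff mvec_mult[symmetric] matrix_inv_mult det_matrix_inv[OF that] norm_divide)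
 qed
 show ?thesis
 proof (rule unitarily_equivalentI_families[where I = ?I and a = ?a and b = ?b])
  show "hilbert (hspace ?R)" unfolding hR by (rule hilbert_ps)
  show "hilbert (hspace ?S)" unfolding hS by (rule hilbert_dsum)
  show "?a p : vecs (hspace ?R)" "?b p : vecs (hspace ?S)" if "p : ?I" for p
   unfolding hR hS using that by (auto intro: psf_mem bump_ext bv_dsum)
  show "vinner (hspace ?R) (?a p) (?a q) = vinner (hspace ?S) (?b p) (?b q)" if "p : ?I" "q : ?I" for p q
   unfolding hR hS using that bv_inner_ext by auto
  have "?a ` ?I = {psf (Inl i) \<nu> k (ext \<Phi> \<Psi>) | \<Phi> \<Psi>. bump \<Phi> & bump \<Psi>}" by auto
  thus "orth_total (hspace ?R) (?a ` ?I)" unfolding hR using psf_ext_orth_total[of "Inl i" \<nu> k] by simp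
  have "?b ` ?I = {bv \<Phi> \<Psi> | \<Phi> \<Psi>. bump \<Phi> & bump \<Psi>}" by auto
  thus "orth_total (hspace ?S) (?b ` ?I)" unfolding hS using bv_orth_total by simp
  fix g :: "(complex^'p^'p) \<times> (complex^'q^'q)" assume "g : GL \<times> GL"
  then obtain A B where AB: "g = (A, B)" "A : GL" "B : GL" by auto
  show "isometry_on (hspace ?R) (act ?R g)" unfolding hR aR AB(1) by (intro ps_unitary block_diag_GL AB)
  show "isometry_on (hspace ?S) (act ?S g)" unfolding hS aS AB(1) by (rule act_dsum[OF AB(2,3)])
  fix p assume "p : ?I"
  then obtain \<Phi> \<Psi> where p: "p = (\<Phi>, \<Psi>)" "bump \<Phi>" "bump \<Psi>" by auto
  let ?\<Phi> = "%x. of_real (cmod (det A)) * \<Phi> (mvec A x)" and ?\<Psi> = "%y. of_real (cmod (det B)) * \<Psi> (mvec B y)"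
  have "bump ?\<Phi>" "bump ?\<Psi>" using p AB by (auto intro!: bump_mvec simp: GL_def)
  moreover have "act ?R g (?a (?\<Phi>, ?\<Psi>)) = ?a p"
   unfolding aR AB(1) p(1) prod.case psf_ext_act[OF AB(2,3)] psi[OF AB(2), symmetric] psi[OF AB(3), symmetric] ..
  moreover have "act ?S g (?b (?\<Phi>, ?\<Psi>)) = ?b p"
   unfolding aS AB(1) p(1) prod.case bv_act[OF AB(2,3)] psi[OF AB(2), symmetric] psi[OF AB(3), symmetric] ..
  ultimately show "EX q:?I. act ?R g (?a q) = ?a p & act ?S g (?b q) = ?b p"
   by (intro bexI[of _ "(?\<Phi>, ?\<Psi>)"]) auto
 qed
qed

end

theorem theorem2:
  fixes i :: "'p::finite" and j :: "'q::finite" and \<nu> :: real and k :: int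
  shows
    "let \<tau> = (\<lambda>k' \<nu>'. outer_tensor
               (principal_series i (\<i> * of_real \<nu>') k')
               (principal_series j (\<i> * of_real (\<nu> - \<nu>')) (k - k')));
         E = (\<lambda>k'. tensor_sections
               (ps_sections i (\<lambda>\<nu>'. \<i> * of_real \<nu>') k')
               (ps_sections j (\<lambda>\<nu>'. \<i> * of_real (\<nu> - \<nu>')) (k - k')))
     in (\<forall>k'. measurable_field lborel (\<lambda>\<nu>'. hspace (\<tau> k' \<nu>')) (E k')) \<and>
        unitarily_equivalent (GL \<times> GL)
          (restrict_rep block_diag (principal_series (Inl i :: 'p + 'q) (\<i> * of_real \<nu>) k))
          (sum_rep UNIV (\<lambda>k'. integral_rep lborel (\<tau> k') (E k')))"
proof -
 have "measurable_field lborel (%z. hspace (ten i j \<nu> k k' z)) (secs i j \<nu> k k')" for k'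
  unfolding hspace_ten by (rule secs_field)
 thus ?thesis using equivalence[where i = i and j = j and \<nu> = \<nu> and k = k] unfolding Let_def ten_def[abs_def] secs_def[abs_def] by simp
qed

end
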